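(* Let $k$ be an algebraically closed field, $G$ a connected affine algebraic group over $k$, $N$ a closed, normal $k$-subgroup scheme of $G$, $Q$ a finite dimensional rational $N$-module, and $V$ a $G$-submodule of $Q$ with $\operatorname{soc}^NQ\subseteq V$. Assume that $(Q,V)$ is a strongly $G$-stable pair, afforded by a morphism $\alpha:G\to GL_k(Q)$. Let $J_V$ be the annihilator of $V$ in $\operatorname{End}_N(Q)$, $U:=1_Q+J_V$, let $G^\diamond=G^\diamond(Q,V,\alpha)$ be the associated extension of $G$ by $U$, and let $\rho^\diamond:G^\diamond\to GL_k(Q)$ be the homomorphism given by $(u,g)q=u\alpha(g)q$ for $u\in U$, $g\in G$, $q\in Q$. Then: The image $G^*=U\alpha(G)$ of $\rho^\diamond$ is independent of the choice of the morphism $\alpha$ affording the strong $G$-stability of $(Q,V)$. Also, the induced homomorphism $G\to G^*/U$ of algebraic groups, sending $g\in G$ to the image of $\alpha(g)$ in $G^*/U$, is independent of $\alpha$. Finally, the algebraic group $G^\diamond$ is itself independent of the choice of $\alpha$, up to an isomorphism preserving the action $G^\diamond\times Q\to Q$ of $G^\diamond$ on $Q$. In fact, there is a pull-back diagram $$\begin{array}{ccc} G^\diamond & \longrightarrow & G\\ \downarrow & & \downarrow\\ G^* & \longrightarrow & G^*/U\end{array}$$ in the category of affine algebraic groups, where $G^\diamond\to G$ is the projection $(u,g)\mapsto g$, $G^\diamond\to G^*$ is induced by $\rho^\diamond$, $G\to G^*/U$ is the homomorphism above, and $G^*\to G^*/U$ is the quotient map.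
   Context: The characteristic of $k$ is arbitrary. Algebraic group means reduced algebraic $k$-group scheme. Let $\rho:N\to GL_k(Q)$ define the $N$-action; $\operatorname{soc}^NQ$ is the $N$-socle. A "$G$-submodule $V$ of $Q$" is a rational $G$-module $V$ whose restriction $V|_N$ is an $N$-submodule of $Q$. The pair $(Q,V)$ is strongly $G$-stable, afforded by $\alpha$, if $\alpha:G\to GL_k(Q)$ is a morphism of $k$-schemes such that, for all commutative $k$-algebras $S$ and all $g\in G(S)$, $n\in N(S)$, $v\in V\otimes_kS$: (i) $\alpha(g)\rho(n)=\rho(gng^{-1})\alpha(g)$ and $\alpha(1)=1$; (ii) $\alpha(gn)=\alpha(g)\rho(n)$; (iii) $\alpha(g)v=gv$. Since $\operatorname{soc}^NQ\subseteq V$, the ideal $J_V$ is nilpotent and $U=1_Q+J_V$ is a closed unipotent subgroup of $GL_k(Q)$; it is stable under conjugation by all $\alpha(g)$ and contains all $\gamma(g,h):=\alpha(g)\alpha(h)\alpha(gh)^{-1}$. The group $G^\diamond(Q,V,\alpha)$ is the affine algebraic group with underlying $k$-scheme $U\times G$, identity $(1,1)$, and multiplication $(x,g)(y,h)=(x\cdot\alpha(g)y\alpha(g)^{-1}\cdot\gamma(g,h),\,gh)$ for $x,y\in U$, $g,h\in G$. *)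

theory Defs
  imports
    "HOL-Algebra.Coset"
    "HOL-Algebra.Ideal"
    "HOL-Analysis.Abstract_Topology"
    "Jordan_Normal_Form.Determinant"
    "Jordan_Normal_Form.VS_Connect"
begin

section \<open>Affine algebraic groups\<close>

text \<open>
  Over an algebraically closed field \<open>k\<close> a reduced affine algebraic \<open>k\<close>-group scheme is the same
  thing as an abstract group together with a finitely generated algebra of \<open>k\<close>-valued functions on
  it, closed under comultiplication and antipode, such that every \<open>k\<close>-algebra homomorphism from
  this algebra to \<open>k\<close> is the evaluation at exactly one group element. Regular functions are
  extensional, i.e. undefined off the carrier.
\<close>

record ('a, 'k) alg_group = "'a monoid" +
  regular :: "('a \<Rightarrow> 'k) set"

inductive_set fun_alg :: "'a set \<Rightarrow> ('a \<Rightarrow> 'k::field) set \<Rightarrow> ('a \<Rightarrow> 'k) set"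
  for X :: "'a set" and F :: "('a \<Rightarrow> 'k) set"
where
  const: "(\<lambda>x\<in>X. c) \<in> fun_alg X F"
| gen: "f \<in> F \<Longrightarrow> restrict f X \<in> fun_alg X F"
| add: "f \<in> fun_alg X F \<Longrightarrow> h \<in> fun_alg X F \<Longrightarrow> (\<lambda>x\<in>X. f x + h x) \<in> fun_alg X F"
| mult: "f \<in> fun_alg X F \<Longrightarrow> h \<in> fun_alg X F \<Longrightarrow> (\<lambda>x\<in>X. f x * h x) \<in> fun_alg X F"

text \<open>The image of \<open>A \<otimes> B\<close> in the functions on \<open>X \<times> Y\<close>; this is \<open>A \<otimes> B\<close> itself, since the
  canonical map is injective. A list represents a sum of elementary tensors.\<close>

definition tensor_funs ::
  "'a set \<Rightarrow> ('a \<Rightarrow> 'k) set \<Rightarrow> 'b set \<Rightarrow> ('b \<Rightarrow> 'k) set \<Rightarrow> ('a \<times> 'b \<Rightarrow> 'k::field) set" where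
  "tensor_funs X A Y B =
     {(\<lambda>(x, y)\<in>X \<times> Y. \<Sum>(a, b)\<leftarrow>cs. a x * b y) | cs. set cs \<subseteq> A \<times> B}"

definition coord_ring :: "('a, 'k::field) alg_group \<Rightarrow> ('k, 'a \<Rightarrow> 'k) module" where
  "coord_ring G =
     \<lparr>carrier = regular G,
      monoid.mult = (\<lambda>f h. \<lambda>x\<in>carrier G. f x * h x),
      one = (\<lambda>x\<in>carrier G. 1),
      zero = (\<lambda>x\<in>carrier G. 0),
      add = (\<lambda>f h. \<lambda>x\<in>carrier G. f x + h x),
      smult = (\<lambda>c f. \<lambda>x\<in>carrier G. c * f x)\<rparr>"

definition base_alg :: "('k::field, 'k) module" where
  "base_alg = \<lparr>carrier = UNIV, monoid.mult = (*), one = 1, zero = 0, add = (+), smult = (*)\<rparr>"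

text \<open>The set \<open>G(S)\<close> of \<open>S\<close>-valued points, that is of \<open>k\<close>-algebra homomorphisms \<open>k[G] \<rightarrow> S\<close>.\<close>

definition points ::
  "('a, 'k::field) alg_group \<Rightarrow> ('k, 's) module \<Rightarrow> (('a \<Rightarrow> 'k) \<Rightarrow> 's) set" where
  "points G S =
     {x \<in> Ring.ring_hom (coord_ring G) S \<inter> extensional (regular G).
        \<forall>c. \<forall>f\<in>regular G. x (c \<odot>\<^bsub>coord_ring G\<^esub> f) = c \<odot>\<^bsub>S\<^esub> x f}"

definition affine_alg_group :: "('a, 'k::field) alg_group \<Rightarrow> bool" where
  "affine_alg_group G \<longleftrightarrow>
     group G \<and>
     (\<exists>F. finite F \<and> regular G = fun_alg (carrier G) F) \<and>
     bij_betw (\<lambda>x. \<lambda>f\<in>regular G. f x) (carrier G) (points G base_alg) \<and>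
     (\<forall>f\<in>regular G. (\<lambda>x\<in>carrier G. f (inv\<^bsub>G\<^esub> x)) \<in> regular G) \<and>
     (\<forall>f\<in>regular G. (\<lambda>(x, y)\<in>carrier G \<times> carrier G. f (x \<otimes>\<^bsub>G\<^esub> y))
        \<in> tensor_funs (carrier G) (regular G) (carrier G) (regular G))"

definition zariski :: "('a, 'k::field) alg_group \<Rightarrow> 'a topology" where
  "zariski G =
     topology (\<lambda>W. \<exists>F\<subseteq>regular G. W = {x \<in> carrier G. \<exists>f\<in>F. f x \<noteq> 0})"

definition variety_morphism ::
  "('a, 'k::field) alg_group \<Rightarrow> ('b, 'k) alg_group \<Rightarrow> ('a \<Rightarrow> 'b) \<Rightarrow> bool" where
  "variety_morphism G H \<phi> \<longleftrightarrow>
     \<phi> \<in> carrier G \<rightarrow> carrier H \<and>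
     (\<forall>f\<in>regular H. (\<lambda>x\<in>carrier G. f (\<phi> x)) \<in> regular G)"

definition alg_group_hom ::
  "('a, 'k::field) alg_group \<Rightarrow> ('b, 'k) alg_group \<Rightarrow> ('a \<Rightarrow> 'b) \<Rightarrow> bool" where
  "alg_group_hom G H \<phi> \<longleftrightarrow> \<phi> \<in> hom G H \<and> variety_morphism G H \<phi>"

definition alg_group_iso ::
  "('a, 'k::field) alg_group \<Rightarrow> ('b, 'k) alg_group \<Rightarrow> ('a \<Rightarrow> 'b) \<Rightarrow> bool" where
  "alg_group_iso G H \<phi> \<longleftrightarrow>
     bij_betw \<phi> (carrier G) (carrier H) \<and> alg_group_hom G H \<phi> \<and>
     alg_group_hom H G (inv_into (carrier G) \<phi>)"

text \<open>The general linear group; its regular functions are the polynomials in the matrix entries and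
  the inverse of the determinant.\<close>

definition GL :: "nat \<Rightarrow> ('k::field mat, 'k) alg_group" where
  "GL n =
     \<lparr>carrier = {X \<in> carrier_mat n n. invertible_mat X},
      monoid.mult = (*),
      one = 1\<^sub>m n,
      regular = fun_alg {X \<in> carrier_mat n n. invertible_mat X}
        ({(\<lambda>X. X $$ (i, j)) | i j. i < n \<and> j < n} \<union> {\<lambda>X. 1 / det X})\<rparr>"

definition sub_alg_group ::
  "('a, 'k::field) alg_group \<Rightarrow> 'a set \<Rightarrow> ('a, 'k) alg_group" where
  "sub_alg_group G K =
     \<lparr>carrier = K, monoid.mult = monoid.mult G, one = one G,
      regular = (\<lambda>f. restrict f K) ` regular G\<rparr>"

text \<open>The quotient \<open>G/K\<close>: its regular functions are the regular functions on \<open>G\<close> that are constant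
  on the cosets of \<open>K\<close>.\<close>

definition quot_alg_group ::
  "('a, 'k::field) alg_group \<Rightarrow> 'a set \<Rightarrow> ('a set, 'k) alg_group" where
  "quot_alg_group G K =
     \<lparr>carrier = carrier (G Mod K), monoid.mult = monoid.mult (G Mod K), one = one (G Mod K),
      regular = {f \<in> extensional (carrier (G Mod K)).
                   (\<lambda>x\<in>carrier G. f (K #>\<^bsub>G\<^esub> x)) \<in> regular G}\<rparr>"

text \<open>Pull-back squares
  \<open>P \<rightarrow> A\<close> (by \<open>p\<close>), \<open>P \<rightarrow> B\<close> (by \<open>q\<close>), \<open>A \<rightarrow> C\<close> (by \<open>f\<close>), \<open>B \<rightarrow> C\<close> (by \<open>g\<close>)
  in the category of affine algebraic groups. The test objects have their elements in a type that is
  a parameter, so that the full universal property is the statement for all types \<open>'t\<close>.\<close>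

definition is_pullback ::
  "'t itself \<Rightarrow> ('p, 'k::field) alg_group \<Rightarrow> ('a, 'k) alg_group \<Rightarrow> ('b, 'k) alg_group \<Rightarrow>
   ('c, 'k) alg_group \<Rightarrow> ('p \<Rightarrow> 'a) \<Rightarrow> ('p \<Rightarrow> 'b) \<Rightarrow> ('a \<Rightarrow> 'c) \<Rightarrow> ('b \<Rightarrow> 'c) \<Rightarrow> bool" where
  "is_pullback ty P A B C p q f g \<longleftrightarrow>
     affine_alg_group P \<and> affine_alg_group A \<and> affine_alg_group B \<and> affine_alg_group C \<and>
     alg_group_hom P A p \<and> alg_group_hom P B q \<and> alg_group_hom A C f \<and> alg_group_hom B C g \<and>
     (\<forall>z\<in>carrier P. f (p z) = g (q z)) \<and>
     (\<forall>(T :: ('t, 'k) alg_group) a b.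
        affine_alg_group T \<and> alg_group_hom T A a \<and> alg_group_hom T B b \<and>
        (\<forall>t\<in>carrier T. f (a t) = g (b t)) \<longrightarrow>
        (\<exists>!c. c \<in> extensional (carrier T) \<and> alg_group_hom T P c \<and>
           (\<forall>t\<in>carrier T. p (c t) = a t \<and> q (c t) = b t)))"

section \<open>Functors of points and subgroup schemes\<close>

text \<open>Comultiplication, as some representing sum of elementary tensors; what is built from it below
  does not depend on the choice.\<close>

definition comult ::
  "('a, 'k::field) alg_group \<Rightarrow> ('a \<Rightarrow> 'k) \<Rightarrow> (('a \<Rightarrow> 'k) \<times> ('a \<Rightarrow> 'k)) list" where
  "comult G f = (SOME cs. set cs \<subseteq> regular G \<times> regular G \<and>
     (\<forall>x\<in>carrier G. \<forall>y\<in>carrier G. f (x \<otimes>\<^bsub>G\<^esub> y) = (\<Sum>(a, b)\<leftarrow>cs. a x * b y)))"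

definition points_group ::
  "('a, 'k::field) alg_group \<Rightarrow> ('k, 's) module \<Rightarrow> (('a \<Rightarrow> 'k) \<Rightarrow> 's) monoid" where
  "points_group G S =
     \<lparr>carrier = points G S,
      monoid.mult = (\<lambda>x y. \<lambda>f\<in>regular G. \<Oplus>\<^bsub>S\<^esub>i\<in>{..<length (comult G f)}.
         x (fst (comult G f ! i)) \<otimes>\<^bsub>S\<^esub> y (snd (comult G f ! i))),
      one = (\<lambda>f\<in>regular G. f \<one>\<^bsub>G\<^esub> \<odot>\<^bsub>S\<^esub> \<one>\<^bsub>S\<^esub>)\<rparr>"

text \<open>
  The phrase ``for all commutative \<open>k\<close>-algebras \<open>S\<close>'' is rendered by letting \<open>S\<close> range over all
  algebras whose elements lie in the type below. As \<open>k\<close> is infinite, a finitely generated \<open>k\<close>-algebra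
  has at most as many elements as \<open>k\<close>, so each of them, in particular \<open>k[G]\<close>, \<open>k[N]\<close> and
  \<open>k[G] \<otimes> k[N]\<close>, has an isomorphic copy in this type. All schemes in play are of finite type, hence
  the conditions below hold for all commutative \<open>k\<close>-algebras as soon as they hold for these.
\<close>

type_synonym ('a, 'k) test_alg = "('k, ('a \<Rightarrow> 'k) set) module"

text \<open>A closed subscheme \<open>N\<close> of \<open>G\<close>, possibly not reduced, is given by its ideal \<open>I\<close>, so that
  \<open>k[N] = k[G]/I\<close> and \<open>N(S)\<close> is the following subset of \<open>G(S)\<close>.\<close>

definition sub_points ::
  "('a, 'k::field) alg_group \<Rightarrow> ('a \<Rightarrow> 'k) set \<Rightarrow> ('k, 's) module \<Rightarrow> (('a \<Rightarrow> 'k) \<Rightarrow> 's) set" where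
  "sub_points G I S = {x \<in> points G S. \<forall>f\<in>I. x f = \<zero>\<^bsub>S\<^esub>}"

definition normal_subgroup_scheme ::
  "('a, 'k::field) alg_group \<Rightarrow> ('a \<Rightarrow> 'k) set \<Rightarrow> bool" where
  "normal_subgroup_scheme G I \<longleftrightarrow>
     ideal I (coord_ring G) \<and>
     (\<forall>S :: ('a, 'k) test_alg. algebra class_ring S \<longrightarrow>
        sub_points G I S \<lhd> points_group G S)"

section \<open>Matrices and vectors over a commutative \<open>k\<close>-algebra\<close>

definition mult_mat_alg :: "('k, 's) module \<Rightarrow> nat \<Rightarrow> 's mat \<Rightarrow> 's mat \<Rightarrow> 's mat" where
  "mult_mat_alg S n X Y =
     mat n n (\<lambda>(i, j). \<Oplus>\<^bsub>S\<^esub>l\<in>{..<n}. X $$ (i, l) \<otimes>\<^bsub>S\<^esub> Y $$ (l, j))"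

definition one_mat_alg :: "('k, 's) module \<Rightarrow> nat \<Rightarrow> 's mat" where
  "one_mat_alg S n = mat n n (\<lambda>(i, j). if i = j then \<one>\<^bsub>S\<^esub> else \<zero>\<^bsub>S\<^esub>)"

definition mult_vec_alg :: "('k, 's) module \<Rightarrow> nat \<Rightarrow> 's mat \<Rightarrow> 's vec \<Rightarrow> 's vec" where
  "mult_vec_alg S n X w = vec n (\<lambda>i. \<Oplus>\<^bsub>S\<^esub>j\<in>{..<n}. X $$ (i, j) \<otimes>\<^bsub>S\<^esub> w $ j)"

definition base_change_mat :: "('k, 's) module \<Rightarrow> 'k mat \<Rightarrow> 's mat" where
  "base_change_mat S X = map_mat (\<lambda>c. c \<odot>\<^bsub>S\<^esub> \<one>\<^bsub>S\<^esub>) X"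

text \<open>The list of the pairs \<open>(s\<^sub>j, v\<^sub>j)\<close> stands for the element \<open>\<Sum>\<^sub>j v\<^sub>j \<otimes> s\<^sub>j\<close> of
  \<open>k\<^sup>n \<otimes> S = S\<^sup>n\<close>.\<close>

definition tensor_vec :: "('k, 's) module \<Rightarrow> nat \<Rightarrow> ('s \<times> 'k vec) list \<Rightarrow> 's vec" where
  "tensor_vec S n cs =
     vec n (\<lambda>i. \<Oplus>\<^bsub>S\<^esub>j\<in>{..<length cs}. (snd (cs ! j) $ i) \<odot>\<^bsub>S\<^esub> fst (cs ! j))"

definition base_change_space :: "('k, 's) module \<Rightarrow> nat \<Rightarrow> 'k vec set \<Rightarrow> 's vec set" where
  "base_change_space S n W = tensor_vec S n ` {cs. set cs \<subseteq> carrier S \<times> W}"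

text \<open>The value at an \<open>S\<close>-valued point \<open>x\<close> of a matrix of regular functions on \<open>G\<close>.\<close>

definition mat_at ::
  "('a, 'k) alg_group \<Rightarrow> nat \<Rightarrow> ('a \<Rightarrow> 'k mat) \<Rightarrow> (('a \<Rightarrow> 'k) \<Rightarrow> 's) \<Rightarrow> 's mat" where
  "mat_at G n \<rho> x = mat n n (\<lambda>(i, j). x (\<lambda>g\<in>carrier G. \<rho> g $$ (i, j)))"

section \<open>Rational \<open>N\<close>-modules\<close>

text \<open>
  Throughout, \<open>Q = k\<^sup>n\<close>, and the \<open>N\<close>-module structure is given by a matrix with entries in
  \<open>k[N] = k[G]/I\<close>. It is represented by a matrix \<open>\<rho>\<close> of regular functions on \<open>G\<close> lifting these
  entries; only the values of \<open>\<rho>\<close> at points of \<open>N\<close> are ever used.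
\<close>

definition rational_module ::
  "('a, 'k::field) alg_group \<Rightarrow> ('a \<Rightarrow> 'k) set \<Rightarrow> nat \<Rightarrow> ('a \<Rightarrow> 'k mat) \<Rightarrow> bool" where
  "rational_module G I n \<rho> \<longleftrightarrow>
     (\<forall>g\<in>carrier G. \<rho> g \<in> carrier_mat n n) \<and>
     (\<forall>i<n. \<forall>j<n. (\<lambda>g\<in>carrier G. \<rho> g $$ (i, j)) \<in> regular G) \<and>
     (\<forall>S :: ('a, 'k) test_alg. algebra class_ring S \<longrightarrow>
        mat_at G n \<rho> \<one>\<^bsub>points_group G S\<^esub> = one_mat_alg S n \<and>
        (\<forall>x\<in>sub_points G I S. \<forall>y\<in>sub_points G I S.
           mat_at G n \<rho> (x \<otimes>\<^bsub>points_group G S\<^esub> y) =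
           mult_mat_alg S n (mat_at G n \<rho> x) (mat_at G n \<rho> y)))"

definition N_submodule ::
  "('a, 'k::field) alg_group \<Rightarrow> ('a \<Rightarrow> 'k) set \<Rightarrow> nat \<Rightarrow> ('a \<Rightarrow> 'k mat) \<Rightarrow> 'k vec set \<Rightarrow> bool" where
  "N_submodule G I n \<rho> W \<longleftrightarrow>
     subspace class_ring W (module_vec TYPE('k) n) \<and>
     (\<forall>S :: ('a, 'k) test_alg. algebra class_ring S \<longrightarrow>
        (\<forall>x\<in>sub_points G I S. \<forall>w\<in>base_change_space S n W.
           mult_vec_alg S n (mat_at G n \<rho> x) w \<in> base_change_space S n W))"

definition simple_N_submodule ::
  "('a, 'k::field) alg_group \<Rightarrow> ('a \<Rightarrow> 'k) set \<Rightarrow> nat \<Rightarrow> ('a \<Rightarrow> 'k mat) \<Rightarrow> 'k vec set \<Rightarrow> bool" where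
  "simple_N_submodule G I n \<rho> W \<longleftrightarrow>
     N_submodule G I n \<rho> W \<and> W \<noteq> {0\<^sub>v n} \<and>
     (\<forall>W'. N_submodule G I n \<rho> W' \<and> W' \<subseteq> W \<longrightarrow> W' = {0\<^sub>v n} \<or> W' = W)"

definition socle ::
  "('a, 'k::field) alg_group \<Rightarrow> ('a \<Rightarrow> 'k) set \<Rightarrow> nat \<Rightarrow> ('a \<Rightarrow> 'k mat) \<Rightarrow> 'k vec set" where
  "socle G I n \<rho> =
     LinearCombinations.module.span class_ring (module_vec TYPE('k) n)
       (\<Union>{W. simple_N_submodule G I n \<rho> W})"

definition End_N ::
  "('a, 'k::field) alg_group \<Rightarrow> ('a \<Rightarrow> 'k) set \<Rightarrow> nat \<Rightarrow> ('a \<Rightarrow> 'k mat) \<Rightarrow> 'k mat set" where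
  "End_N G I n \<rho> =
     {X \<in> carrier_mat n n. \<forall>S :: ('a, 'k) test_alg. algebra class_ring S \<longrightarrow>
        (\<forall>x\<in>sub_points G I S.
           mult_mat_alg S n (base_change_mat S X) (mat_at G n \<rho> x) =
           mult_mat_alg S n (mat_at G n \<rho> x) (base_change_mat S X))}"

section \<open>\<open>G\<close>-submodules of \<open>Q\<close> and strong stability\<close>

text \<open>The action on \<open>V \<otimes> S\<close> of an \<open>S\<close>-valued point \<open>x\<close> of \<open>G\<close>, for a rational \<open>G\<close>-module
  structure \<open>act\<close> on \<open>V\<close>.\<close>

definition act_at ::
  "('a, 'k) alg_group \<Rightarrow> nat \<Rightarrow> ('a \<Rightarrow> 'k vec \<Rightarrow> 'k vec) \<Rightarrow> ('k, 's) module \<Rightarrow>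
   (('a \<Rightarrow> 'k) \<Rightarrow> 's) \<Rightarrow> ('s \<times> 'k vec) list \<Rightarrow> 's vec" where
  "act_at G n act S x cs =
     vec n (\<lambda>i. \<Oplus>\<^bsub>S\<^esub>j\<in>{..<length cs}.
       x (\<lambda>g\<in>carrier G. act g (snd (cs ! j)) $ i) \<otimes>\<^bsub>S\<^esub> fst (cs ! j))"

definition G_submodule ::
  "('a, 'k::field) alg_group \<Rightarrow> ('a \<Rightarrow> 'k) set \<Rightarrow> nat \<Rightarrow> ('a \<Rightarrow> 'k mat) \<Rightarrow> 'k vec set \<Rightarrow>
   ('a \<Rightarrow> 'k vec \<Rightarrow> 'k vec) \<Rightarrow> bool" where
  "G_submodule G I n \<rho> V act \<longleftrightarrow>
     subspace class_ring V (module_vec TYPE('k) n) \<and>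
     (\<forall>g\<in>carrier G. act g \<in> V \<rightarrow> V) \<and>
     (\<forall>g\<in>carrier G. \<forall>u\<in>V. \<forall>v\<in>V. act g (u + v) = act g u + act g v) \<and>
     (\<forall>g\<in>carrier G. \<forall>c. \<forall>v\<in>V. act g (c \<cdot>\<^sub>v v) = c \<cdot>\<^sub>v act g v) \<and>
     (\<forall>v\<in>V. act \<one>\<^bsub>G\<^esub> v = v) \<and>
     (\<forall>g\<in>carrier G. \<forall>h\<in>carrier G. \<forall>v\<in>V. act (g \<otimes>\<^bsub>G\<^esub> h) v = act g (act h v)) \<and>
     (\<forall>v\<in>V. \<forall>i<n. (\<lambda>g\<in>carrier G. act g v $ i) \<in> regular G) \<and>
     N_submodule G I n \<rho> V \<and>
     (\<forall>S :: ('a, 'k) test_alg. algebra class_ring S \<longrightarrow>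
        (\<forall>x\<in>sub_points G I S. \<forall>cs. set cs \<subseteq> carrier S \<times> V \<longrightarrow>
           mult_vec_alg S n (mat_at G n \<rho> x) (tensor_vec S n cs) = act_at G n act S x cs))"

definition strongly_stable ::
  "('a, 'k::field) alg_group \<Rightarrow> ('a \<Rightarrow> 'k) set \<Rightarrow> nat \<Rightarrow> ('a \<Rightarrow> 'k mat) \<Rightarrow> 'k vec set \<Rightarrow>
   ('a \<Rightarrow> 'k vec \<Rightarrow> 'k vec) \<Rightarrow> ('a \<Rightarrow> 'k mat) \<Rightarrow> bool" where
  "strongly_stable G I n \<rho> V act \<alpha> \<longleftrightarrow>
     variety_morphism G (GL n) \<alpha> \<and>
     (\<forall>S :: ('a, 'k) test_alg. algebra class_ring S \<longrightarrow>
        mat_at G n \<alpha> \<one>\<^bsub>points_group G S\<^esub> = one_mat_alg S n \<and>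
        (\<forall>x\<in>points G S. \<forall>y\<in>sub_points G I S.
           mult_mat_alg S n (mat_at G n \<alpha> x) (mat_at G n \<rho> y) =
           mult_mat_alg S n
             (mat_at G n \<rho>
                (x \<otimes>\<^bsub>points_group G S\<^esub> y \<otimes>\<^bsub>points_group G S\<^esub> inv\<^bsub>points_group G S\<^esub> x))
             (mat_at G n \<alpha> x)) \<and>
        (\<forall>x\<in>points G S. \<forall>y\<in>sub_points G I S.
           mat_at G n \<alpha> (x \<otimes>\<^bsub>points_group G S\<^esub> y) =
           mult_mat_alg S n (mat_at G n \<alpha> x) (mat_at G n \<rho> y)) \<and>
        (\<forall>x\<in>points G S. \<forall>cs. set cs \<subseteq> carrier S \<times> V \<longrightarrow>
           mult_vec_alg S n (mat_at G n \<alpha> x) (tensor_vec S n cs) = act_at G n act S x cs))"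

section \<open>The extension \<open>G\<^sup>\<diamond>\<close> and its image\<close>

definition J_ideal ::
  "('a, 'k::field) alg_group \<Rightarrow> ('a \<Rightarrow> 'k) set \<Rightarrow> nat \<Rightarrow> ('a \<Rightarrow> 'k mat) \<Rightarrow> 'k vec set \<Rightarrow>
   'k mat set" where
  "J_ideal G I n \<rho> V = {X \<in> End_N G I n \<rho>. \<forall>v\<in>V. X *\<^sub>v v = 0\<^sub>v n}"

definition U_group ::
  "('a, 'k::field) alg_group \<Rightarrow> ('a \<Rightarrow> 'k) set \<Rightarrow> nat \<Rightarrow> ('a \<Rightarrow> 'k mat) \<Rightarrow> 'k vec set \<Rightarrow>
   'k mat set" where
  "U_group G I n \<rho> V = (\<lambda>X. 1\<^sub>m n + X) ` J_ideal G I n \<rho> V"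

definition gamma ::
  "('a, 'k::field) alg_group \<Rightarrow> nat \<Rightarrow> ('a \<Rightarrow> 'k mat) \<Rightarrow> 'a \<Rightarrow> 'a \<Rightarrow> 'k mat" where
  "gamma G n \<alpha> g h = \<alpha> g * \<alpha> h * inv\<^bsub>GL n\<^esub> (\<alpha> (g \<otimes>\<^bsub>G\<^esub> h))"

definition G_diamond ::
  "('a, 'k::field) alg_group \<Rightarrow> ('a \<Rightarrow> 'k) set \<Rightarrow> nat \<Rightarrow> ('a \<Rightarrow> 'k mat) \<Rightarrow> 'k vec set \<Rightarrow>
   ('a \<Rightarrow> 'k mat) \<Rightarrow> ('k mat \<times> 'a, 'k) alg_group" where
  "G_diamond G I n \<rho> V \<alpha> =
     \<lparr>carrier = U_group G I n \<rho> V \<times> carrier G,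
      monoid.mult = (\<lambda>(x, g) (y, h).
        (x * (\<alpha> g * y * inv\<^bsub>GL n\<^esub> (\<alpha> g)) * gamma G n \<alpha> g h, g \<otimes>\<^bsub>G\<^esub> h)),
      one = (1\<^sub>m n, \<one>\<^bsub>G\<^esub>),
      regular = tensor_funs
        (U_group G I n \<rho> V) (regular (sub_alg_group (GL n) (U_group G I n \<rho> V)))
        (carrier G) (regular G)\<rparr>"

definition rho_diamond :: "('a \<Rightarrow> 'k::field mat) \<Rightarrow> 'k mat \<times> 'a \<Rightarrow> 'k mat" where
  "rho_diamond \<alpha> = (\<lambda>(u, g). u * \<alpha> g)"

definition G_star ::
  "('a, 'k::field) alg_group \<Rightarrow> ('a \<Rightarrow> 'k) set \<Rightarrow> nat \<Rightarrow> ('a \<Rightarrow> 'k mat) \<Rightarrow> 'k vec set \<Rightarrow>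
   ('a \<Rightarrow> 'k mat) \<Rightarrow> ('k mat, 'k) alg_group" where
  "G_star G I n \<rho> V \<alpha> =
     sub_alg_group (GL n) (rho_diamond \<alpha> ` carrier (G_diamond G I n \<rho> V \<alpha>))"

definition G_star_mod_U ::
  "('a, 'k::field) alg_group \<Rightarrow> ('a \<Rightarrow> 'k) set \<Rightarrow> nat \<Rightarrow> ('a \<Rightarrow> 'k mat) \<Rightarrow> 'k vec set \<Rightarrow>
   ('a \<Rightarrow> 'k mat) \<Rightarrow> ('k mat set, 'k) alg_group" where
  "G_star_mod_U G I n \<rho> V \<alpha> = quot_alg_group (G_star G I n \<rho> V \<alpha>) (U_group G I n \<rho> V)"

definition quot_map ::
  "('a, 'k::field) alg_group \<Rightarrow> ('a \<Rightarrow> 'k) set \<Rightarrow> nat \<Rightarrow> ('a \<Rightarrow> 'k mat) \<Rightarrow> 'k vec set \<Rightarrow>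
   ('a \<Rightarrow> 'k mat) \<Rightarrow> 'k mat \<Rightarrow> 'k mat set" where
  "quot_map G I n \<rho> V \<alpha> X = U_group G I n \<rho> V #>\<^bsub>G_star G I n \<rho> V \<alpha>\<^esub> X"

definition induced_map ::
  "('a, 'k::field) alg_group \<Rightarrow> ('a \<Rightarrow> 'k) set \<Rightarrow> nat \<Rightarrow> ('a \<Rightarrow> 'k mat) \<Rightarrow> 'k vec set \<Rightarrow>
   ('a \<Rightarrow> 'k mat) \<Rightarrow> 'a \<Rightarrow> 'k mat set" where
  "induced_map G I n \<rho> V \<alpha> g = quot_map G I n \<rho> V \<alpha> (\<alpha> g)"

end

theory Submission imports Defs "HOL-Library.Function_Algebras"
begin

text \<open>
  Let \<open>\<alpha>\<close> and \<open>\<beta>\<close> afford the strong stability. Both intertwine the action of \<open>N\<close> with its conjugate by \<open>g\<close>, and both agree with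
  the given action on \<open>V\<close>. So \<open>\<beta>(g) \<alpha>(g)\<^sup>-\<^sup>1\<close> is an \<open>N\<close>-endomorphism that is the identity on \<open>V\<close>, that is, an element of \<open>U\<close>
  (\<open>affording_differ_by_U\<close>). Hence \<open>U \<alpha>(G) = U \<beta>(G)\<close>, the cosets of \<open>\<alpha>(g)\<close> and \<open>\<beta>(g)\<close> agree, and
  \<open>(u, g) \<mapsto> (u \<beta>(g) \<alpha>(g)\<^sup>-\<^sup>1, g)\<close> is the isomorphism between the two extensions (\<open>comparison\<close>). In the same way
  \<open>\<alpha>(g) \<alpha>(h) \<alpha>(gh)\<^sup>-\<^sup>1\<close> lies in \<open>U\<close>, so \<open>\<alpha>\<close> is a homomorphism modulo \<open>U\<close>. The maps \<open>\<rho>\<^sup>\<diamond>\<close> and \<open>snd\<close> together embed the extension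
  into the product of \<open>GL n\<close> and \<open>G\<close>, with image the pairs in \<open>G\<^sup>*\<close> and \<open>G\<close> that have the same class in \<open>G\<^sup>* / U\<close>. This gives the group axioms
  and the pull-back property (\<open>pullback\<close>).

  The larger part of the work is to see that the four corners of the square are affine algebraic groups.

  First, \<open>J\<close> is nilpotent (\<open>nil_algebra_J\<close>): the image of a nonzero \<open>N\<close>-endomorphism is a nonzero submodule, so it meets the
  socle and hence \<open>V\<close>, and multiplication by one more element of \<open>J\<close> makes the kernel strictly larger. So \<open>U\<close> consists of
  invertible matrices, and it is closed in \<open>GL n\<close>; this makes the extension affine (\<open>affine_D\<close>).

  Second, \<open>G\<^sup>*\<close> is closed in \<open>GL n\<close>, being a subgroup that is the image of an affine variety (\<open>gl_closed_image\<close>). As for every theorem on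
  images of morphisms, the core is that points of the target outside a proper closed set lift to the source. In terms of
  characters of coordinate algebras: a character extends to a finitely generated extension algebra as soon as it does not vanish
  at a certain nonzero element (\<open>char_extends_generically\<close>). One adjoins one generator at a time. For domains this is
  elementary, and the components of a reduced algebra are treated like domains by multiplying with an element that has a
  prime annihilator.

  Third, \<open>G\<^sup>* / U\<close> is affine. Here \<open>U\<close> is unipotent of the special form \<open>1 + J\<close>, which allows an explicit argument: there is a
  regular map \<open>R\<close> from \<open>G\<^sup>*\<close> to itself that picks one element of each coset \<open>U X\<close> (\<open>unipotent_retraction\<close>), so that the
  functions on the quotient are the functions on \<open>G\<^sup>*\<close> composed with \<open>R\<close> (\<open>affine_quotient\<close>). The map \<open>R\<close> is built along the flag of
  the subspaces killed by the powers of \<open>J\<close>, which \<open>G\<^sup>*\<close> preserves: if \<open>E\<close> projects onto one layer of the flag, then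
  \<open>X E X\<^sup>-\<^sup>1 E\<close> shows by how much \<open>X\<close> has to be corrected in that layer (\<open>layer_shift\<close>).
\<close>

section \<open>Adjoining elements to a subring\<close>

definition unital_subring :: "'r::comm_ring_1 set \<Rightarrow> bool" where
  "unital_subring A \<longleftrightarrow> 1 \<in> A \<and> (\<forall>x\<in>A. - x \<in> A) \<and> (\<forall>x\<in>A. \<forall>y\<in>A. x + y \<in> A \<and> x * y \<in> A)"

definition polys_over :: "'r::comm_ring_1 set \<Rightarrow> 'r poly set" where
  "polys_over A = {p. \<forall>i. coeff p i \<in> A}"

definition adjoin :: "'r::comm_ring_1 set \<Rightarrow> 'r \<Rightarrow> 'r set" where
  "adjoin A b = (\<lambda>p. poly p b) ` polys_over A"

fun adjoin_list :: "'r::comm_ring_1 set \<Rightarrow> 'r list \<Rightarrow> 'r set" where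
  "adjoin_list A [] = A"
| "adjoin_list A (b # bs) = adjoin_list (adjoin A b) bs"

lemma unital_subringD:
  assumes "unital_subring A"
  shows "1 \<in> A" "0 \<in> A" "x \<in> A \<Longrightarrow> - x \<in> A" "x \<in> A \<Longrightarrow> y \<in> A \<Longrightarrow> x + y \<in> A"
    "x \<in> A \<Longrightarrow> y \<in> A \<Longrightarrow> x * y \<in> A" "x \<in> A \<Longrightarrow> y \<in> A \<Longrightarrow> x - y \<in> A" "x \<in> A \<Longrightarrow> x ^ N \<in> A"
proof -
  show one: "1 \<in> A" and neg: "x \<in> A \<Longrightarrow> - x \<in> A" and add: "x \<in> A \<Longrightarrow> y \<in> A \<Longrightarrow> x + y \<in> A"
    and mult: "x \<in> A \<Longrightarrow> y \<in> A \<Longrightarrow> x * y \<in> A" for x y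
    using assms by (auto simp: unital_subring_def)
  show "0 \<in> A" using add[OF one neg[OF one]] by simp
  show "x \<in> A \<Longrightarrow> y \<in> A \<Longrightarrow> x - y \<in> A" using add[of x "- y"] neg[of y] by simp
  show "x \<in> A \<Longrightarrow> x ^ N \<in> A" by (induction N) (auto intro: one mult)
qed

lemma unital_subring_sum:
  assumes "unital_subring A" "\<And>i. i \<in> S \<Longrightarrow> f i \<in> A"
  shows "sum f S \<in> A"
  using assms(2) by (induction S rule: infinite_finite_induct) (auto intro: unital_subringD[OF assms(1)])

lemma polys_overD: "p \<in> polys_over A \<Longrightarrow> coeff p i \<in> A"
  by (simp add: polys_over_def)

lemma polys_over_closed:
  assumes A: "unital_subring A"
  shows "0 \<in> polys_over A" "1 \<in> polys_over A" "c \<in> A \<Longrightarrow> monom c m \<in> polys_over A"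
    "p \<in> polys_over A \<Longrightarrow> q \<in> polys_over A \<Longrightarrow> p + q \<in> polys_over A"
    "p \<in> polys_over A \<Longrightarrow> q \<in> polys_over A \<Longrightarrow> p - q \<in> polys_over A"
    "p \<in> polys_over A \<Longrightarrow> - p \<in> polys_over A"
    "p \<in> polys_over A \<Longrightarrow> q \<in> polys_over A \<Longrightarrow> p * q \<in> polys_over A"
    "c \<in> A \<Longrightarrow> p \<in> polys_over A \<Longrightarrow> Polynomial.smult c p \<in> polys_over A"
    "p \<in> polys_over A \<Longrightarrow> poly_cutoff m p \<in> polys_over A"
  using unital_subringD[OF A]
  by (auto simp: polys_over_def coeff_mult coeff_poly_cutoff coeff_1 coeff_monom intro!: unital_subring_sum[OF A])

lemma adjoin_poly: "p \<in> polys_over A \<Longrightarrow> poly p b \<in> adjoin A b"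
  by (simp add: adjoin_def)

lemma unital_subring_adjoin:
  assumes A: "unital_subring A"
  shows "unital_subring (adjoin A b)"
  unfolding unital_subring_def
proof (intro conjI ballI)
  show "1 \<in> adjoin A b" using adjoin_poly[OF polys_over_closed(2)[OF A], of b] by simp
next
  fix x assume "x \<in> adjoin A b"
  then obtain p where p: "p \<in> polys_over A" "x = poly p b" by (auto simp: adjoin_def)
  show "- x \<in> adjoin A b" using adjoin_poly[OF polys_over_closed(6)[OF A p(1)], of b] p by simp
  fix y assume "y \<in> adjoin A b"
  then obtain q where q: "q \<in> polys_over A" "y = poly q b" by (auto simp: adjoin_def)
  show "x + y \<in> adjoin A b" using adjoin_poly[OF polys_over_closed(4)[OF A p(1) q(1)], of b] p q by simp
  show "x * y \<in> adjoin A b" using adjoin_poly[OF polys_over_closed(7)[OF A p(1) q(1)], of b] p q by simp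
qed

lemma subset_adjoin:
  assumes "unital_subring A"
  shows "A \<subseteq> adjoin A b"
proof
  fix a assume "a \<in> A"
  then show "a \<in> adjoin A b"
    using adjoin_poly[OF polys_over_closed(3)[OF assms, of a 0], of b] by (simp add: poly_monom)
qed

lemma generator_in_adjoin:
  assumes "unital_subring A"
  shows "b \<in> adjoin A b"
  using adjoin_poly[OF polys_over_closed(3)[OF assms unital_subringD(1)[OF assms], of 1], of b]
  by (simp add: poly_monom)

lemma unital_subring_adjoin_list: "unital_subring A \<Longrightarrow> unital_subring (adjoin_list A bs)"
  by (induction bs arbitrary: A) (auto intro: unital_subring_adjoin)

lemma subset_adjoin_list: "unital_subring A \<Longrightarrow> A \<subseteq> adjoin_list A bs"
  by (induction bs arbitrary: A) (use subset_adjoin unital_subring_adjoin in fastforce)+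

lemma generators_in_adjoin_list: "unital_subring A \<Longrightarrow> set bs \<subseteq> adjoin_list A bs"
proof (induction bs arbitrary: A)
  case (Cons b bs)
  note sub = unital_subring_adjoin[OF Cons.prems, of b]
  show ?case
    using Cons.IH[OF sub] subset_adjoin_list[OF sub, of bs] generator_in_adjoin[OF Cons.prems, of b]
    by auto
qed simp

lemma adjoin_least:
  assumes "unital_subring C" "A \<subseteq> C" "b \<in> C"
  shows "adjoin A b \<subseteq> C"
proof
  fix x assume "x \<in> adjoin A b"
  then obtain p where p: "p \<in> polys_over A" "x = poly p b" by (auto simp: adjoin_def)
  have "(\<Sum>i\<le>degree p. coeff p i * b ^ i) \<in> C"
    using p(1) assms by (intro unital_subring_sum[OF assms(1)] unital_subringD[OF assms(1)])
      (auto simp: polys_over_def)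
  then show "x \<in> C" using p(2) by (simp add: poly_altdef)
qed

lemma adjoin_list_least:
  "unital_subring C \<Longrightarrow> A \<subseteq> C \<Longrightarrow> set bs \<subseteq> C \<Longrightarrow> adjoin_list A bs \<subseteq> C"
proof (induction bs arbitrary: A)
  case (Cons b bs)
  then show ?case using adjoin_least[of C A b] by auto
qed simp

text \<open>Division with remainder over a ring: the leading coefficient need not be invertible, so one multiplies
  by a power of it. The remainder is bounded by the vanishing of its coefficients instead of by its degree, so
  that \<open>d = 0\<close> forces it to be zero.\<close>

lemma pseudo_division:
  assumes A: "unital_subring A" and r: "r \<in> polys_over A" "degree r \<le> d"
    and p: "p \<in> polys_over A"
  shows "\<exists>N h p'. h \<in> polys_over A \<and> p' \<in> polys_over A \<and> Polynomial.smult (coeff r d ^ N) p = r * h + p' \<and>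
    (\<forall>i\<ge>d. coeff p' i = 0)"
proof -
  let ?c = "coeff r d"
  have "\<exists>N h p'. h \<in> polys_over A \<and> p' \<in> polys_over A \<and> Polynomial.smult (?c ^ N) p = r * h + p' \<and>
    (\<forall>i\<ge>d. coeff p' i = 0)" if "\<forall>i\<ge>m. coeff p i = 0" "p \<in> polys_over A" for m
    using that
  proof (induction m arbitrary: p)
    case 0
    then show ?case
      by (intro exI[of _ 0] exI[of _ 0] exI[of _ p]) (auto simp: polys_over_closed[OF A])
  next
    case (Suc m)
    show ?case
    proof (cases "Suc m \<le> d")
      case True
      then show ?thesis using Suc.prems
        by (intro exI[of _ 0] exI[of _ 0] exI[of _ p]) (auto simp: polys_over_closed[OF A])
    next
      case False
      let ?u = "monom (coeff p m) (m - d)"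
      let ?p = "Polynomial.smult ?c p - ?u * r"
      have u: "?u \<in> polys_over A" using Suc.prems(2) polys_over_closed(3)[OF A] by (simp add: polys_over_def)
      have c: "?c \<in> A" using r(1) by (simp add: polys_over_def)
      have "\<forall>i\<ge>m. coeff ?p i = 0"
      proof (intro allI impI)
        fix i assume i: "m \<le> i"
        show "coeff ?p i = 0"
        proof (cases "i = m")
          case True
          then show ?thesis using False by (simp add: coeff_monom_mult)
        next
          case False
          then have "coeff p i = 0" "coeff r (i - (m - d)) = 0"
            using i Suc.prems(1) r(2) \<open>\<not> Suc m \<le> d\<close> by (auto intro!: coeff_eq_0)
          then show ?thesis by (simp add: coeff_monom_mult)
        qed
      qed
      moreover have "?p \<in> polys_over A"
        using u c Suc.prems(2) r(1) by (intro polys_over_closed(5,7,8)[OF A])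
      ultimately obtain N h p' where IH: "h \<in> polys_over A" "p' \<in> polys_over A"
        "Polynomial.smult (?c ^ N) ?p = r * h + p'" "\<forall>i\<ge>d. coeff p' i = 0"
        using Suc.IH by blast
      have "Polynomial.smult (?c ^ Suc N) p = Polynomial.smult (?c ^ N) ?p + Polynomial.smult (?c ^ N) (?u * r)"
        by (simp add: smult_diff_right mult.commute)
      also have "\<dots> = r * (h + Polynomial.smult (?c ^ N) ?u) + p'"
        using IH(3) by (simp add: algebra_simps)
      finally have "Polynomial.smult (?c ^ Suc N) p = r * (h + Polynomial.smult (?c ^ N) ?u) + p'" .
      moreover have "h + Polynomial.smult (?c ^ N) ?u \<in> polys_over A"
        using IH(1) u c by (intro polys_over_closed(4,8)[OF A] unital_subringD(7)[OF A])
      ultimately show ?thesis using IH(2,4) by blast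
    qed
  qed
  moreover have "\<forall>i\<ge>Suc (degree p). coeff p i = 0" by (auto intro: coeff_eq_0)
  ultimately show ?thesis using p by blast
qed

lemma poly_killed:
  fixes e :: "'r::comm_ring_1"
  assumes "\<And>i. e * coeff p i = 0"
  shows "e * poly p b = 0"
proof -
  have "Polynomial.smult e p = 0" by (rule poly_eqI) (use assms in simp)
  then show ?thesis by (metis poly_smult poly_0)
qed

text \<open>Modulo the annihilator of \<open>s\<close> in \<open>A\<close>, a polynomial may lose its top coefficients. Cutting them off gives a
  polynomial with the same value, up to that annihilator, whose top coefficient survives.\<close>

lemma trim_polynomial:
  fixes s :: "'r::comm_ring_1"
  assumes A: "unital_subring A" and p: "p \<in> polys_over A" and nz: "s * coeff p i \<noteq> 0"
  obtains p' m where "p' \<in> polys_over A" "degree p' \<le> m" "s * coeff p' m \<noteq> 0" "coeff p m \<noteq> 0" "s * coeff p m \<noteq> 0"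
    "\<And>j. m < j \<Longrightarrow> s * coeff p j = 0"
    "\<And>e b. (\<And>a. a \<in> A \<Longrightarrow> s * a = 0 \<Longrightarrow> e * a = 0) \<Longrightarrow> e * poly p' b = e * poly p b"
proof -
  define M where "M = {j. s * coeff p j \<noteq> 0}"
  have sub: "M \<subseteq> {..degree p}" by (auto simp: M_def intro!: le_degree)
  then have fin: "finite M" by (rule finite_subset) simp
  have ne: "M \<noteq> {}" using nz by (auto simp: M_def)
  define m where "m = Max M"
  have mM: "m \<in> M" unfolding m_def by (rule Max_in[OF fin ne])
  have gt: "s * coeff p j = 0" if "m < j" for j
    using Max_ge[OF fin, of j] that unfolding m_def by (force simp: M_def)
  let ?p = "poly_cutoff (Suc m) p"
  have "degree ?p \<le> m" by (rule degree_le) (auto simp: coeff_poly_cutoff)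
  moreover have "e * poly ?p b = e * poly p b"
    if "\<And>a. a \<in> A \<Longrightarrow> s * a = 0 \<Longrightarrow> e * a = 0" for e b
  proof -
    have "e * poly (p - ?p) b = 0"
    proof (rule poly_killed)
      fix j show "e * coeff (p - ?p) j = 0"
        using that[OF polys_overD[OF p]] gt[of j] by (cases "m < j") (auto simp: coeff_poly_cutoff)
    qed
    then show ?thesis by (simp add: algebra_simps)
  qed
  ultimately show thesis
    using that[of ?p m] mM gt polys_over_closed(9)[OF A p]
    by (force simp: M_def coeff_poly_cutoff)
qed

section \<open>Elements whose annihilator is prime\<close>

text \<open>The annihilator of \<open>e\<close> in \<open>A\<close> is a prime ideal. Such an \<open>e\<close> singles out an irreducible component: \<open>A\<close> behaves like
  an integral domain as long as equalities are tested after multiplication by \<open>e\<close>. Keeping the multiplier avoids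
  passing to quotient rings, and with them to new types.\<close>

definition prime_at :: "'r::comm_ring_1 set \<Rightarrow> 'r \<Rightarrow> bool" where
  "prime_at A e \<longleftrightarrow> e \<noteq> 0 \<and> (\<forall>x\<in>A. \<forall>y\<in>A. e * x * y = 0 \<longrightarrow> e * x = 0 \<or> e * y = 0)"

lemma prime_at_power:
  assumes "prime_at A e" "unital_subring A" "x \<in> A" "y \<in> A" "e * (x ^ N * y) = 0" "e * x \<noteq> 0"
  shows "e * y = 0"
  using assms(5)
proof (induction N)
  case (Suc N)
  have "e * x * (x ^ N * y) = 0" using Suc.prems by (simp add: mult.assoc)
  moreover have "x ^ N * y \<in> A" using assms by (intro unital_subringD[OF assms(2)])
  ultimately have "e * (x ^ N * y) = 0" using assms(1,3,6) by (auto simp: prime_at_def)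
  then show ?case by (rule Suc.IH)
qed simp

lemma reduced_power:
  fixes x y :: "'r::comm_ring_1"
  assumes red: "\<forall>z::'r. z * z = 0 \<longrightarrow> z = 0" and "x ^ N * y = 0"
  shows "x * y = 0"
  using assms(2)
proof (induction N)
  case 0 then show ?case by simp
next
  case (Suc N)
  have "(x ^ N * y) * x = 0" using Suc.prems by (simp add: mult_ac)
  then show ?case
  proof (cases N)
    case 0 then show ?thesis using Suc.prems by simp
  next
    case (Suc M)
    have "(x ^ N * y) * (x ^ N * y) = (x ^ Suc N * y) * (x ^ M * y)" using Suc by (simp add: mult_ac)
    also have "\<dots> = 0" using Suc.prems \<open>(x ^ N * y) * x = 0\<close> by (simp add: mult_ac)
    finally have "x ^ N * y = 0" using red by blast
    then show ?thesis by (rule Suc.IH)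
  qed
qed

lemma coeff_mult_top:
  assumes "degree p \<le> m" "degree q \<le> l"
  shows "coeff (p * q) (m + l) = coeff p m * coeff q l"
proof -
  have "coeff (p * q) (m + l) = (\<Sum>i\<le>m + l. coeff p i * coeff q (m + l - i))" by (simp add: coeff_mult)
  also have "\<dots> = (\<Sum>i\<in>{m}. coeff p i * coeff q (m + l - i))"
  proof (rule sum.mono_neutral_right)
    show "\<forall>i\<in>{..m + l} - {m}. coeff p i * coeff q (m + l - i) = 0"
    proof
      fix i assume "i \<in> {..m + l} - {m}"
      then have "m < i \<or> l < m + l - i" by auto
      then show "coeff p i * coeff q (m + l - i) = 0"
        using assms coeff_eq_0[of p i] coeff_eq_0[of q "m + l - i"] by auto
    qed
  qed auto
  finally show ?thesis by simp
qed

text \<open>An irreducible component of the smaller ring is dominated by one of the larger ring. Let \<open>T\<close> consist of the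
  elements of \<open>A[b]\<close> that have the same annihilator in \<open>A\<close> as \<open>s\<close>. If \<open>b\<close> satisfies no polynomial relation after
  multiplication by a member of \<open>T\<close>, then \<open>s A[b]\<close> is as good as a polynomial ring and \<open>s\<close> itself will do. Otherwise
  take such a relation of least degree, killed by \<open>e \<in> T\<close> and with leading coefficient \<open>c\<close>: division by it reduces every
  element of \<open>A[b]\<close> to lower degree, where there are no relations left, and \<open>e c\<close> has the required property.\<close>

lemma prime_at_adjoin:
  fixes s :: "'r::comm_ring_1"
  assumes red: "\<forall>z::'r. z * z = 0 \<longrightarrow> z = 0" and A: "unital_subring A"
    and s: "prime_at A s" "s \<in> A"
  shows "\<exists>e\<in>adjoin A b. prime_at (adjoin A b) e \<and> (\<forall>a\<in>A. e * a = 0 \<longleftrightarrow> s * a = 0)"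
proof -
  let ?B = "adjoin A b"
  note B = unital_subring_adjoin[OF A, of b]
  define T where "T = {e \<in> ?B. \<forall>a\<in>A. e * a = 0 \<longleftrightarrow> s * a = 0}"
  have sT: "s \<in> T" using s subset_adjoin[OF A] by (auto simp: T_def)
  have TD: "e * a = 0 \<longleftrightarrow> s * a = 0" if "e \<in> T" "a \<in> A" for e a using that by (auto simp: T_def)
  have sp: "s * x = 0 \<or> s * y = 0" if "x \<in> A" "y \<in> A" "s * (x * y) = 0" for x y
    using s that by (auto simp: prime_at_def mult.assoc)
  have T0: "e \<noteq> 0" if "e \<in> T" for e
    using TD[OF that unital_subringD(1)[OF A]] s by (auto simp: prime_at_def)
  \<comment> \<open>The condition \<open>s * coeff r d \<noteq> 0\<close> makes \<open>d\<close> the degree of \<open>r\<close> modulo the annihilator of \<open>s\<close>.\<close>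
  define rel where "rel e r d \<longleftrightarrow> e \<in> T \<and> r \<in> polys_over A \<and> degree r \<le> d \<and> s * coeff r d \<noteq> 0 \<and>
    e * poly r b = 0" for e r d
  have small: "s * coeff p i = 0"
    if p: "p \<in> polys_over A" "e \<in> T" "e * poly p b = 0"
      and min: "\<And>e r d'. rel e r d' \<Longrightarrow> coeff p d' = 0" for e p i
  proof (rule ccontr)
    assume "s * coeff p i \<noteq> 0"
    then obtain p' m where p': "p' \<in> polys_over A" "degree p' \<le> m" "s * coeff p' m \<noteq> 0" "coeff p m \<noteq> 0"
      "\<And>e b. (\<And>a. a \<in> A \<Longrightarrow> s * a = 0 \<Longrightarrow> e * a = 0) \<Longrightarrow> e * poly p' b = e * poly p b"
      using trim_polynomial[OF A p(1)] by metis
    have "e * poly p' b = e * poly p b" using TD[OF p(2)] by (intro p'(5)) auto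
    then have "rel e p' m" using p p' by (simp add: rel_def)
    then show False using min p'(4) by blast
  qed
  show ?thesis
  proof (cases "\<exists>e r d. rel e r d")
    case False
    have "prime_at ?B s"
      unfolding prime_at_def
    proof (intro conjI ballI impI)
      show "s \<noteq> 0" using T0[OF sT] .
      fix x y assume xy: "x \<in> ?B" "y \<in> ?B" and z: "s * x * y = 0"
      obtain p where p: "p \<in> polys_over A" "x = poly p b" using xy by (auto simp: adjoin_def)
      obtain q where q: "q \<in> polys_over A" "y = poly q b" using xy by (auto simp: adjoin_def)
      show "s * x = 0 \<or> s * y = 0"
      proof (rule ccontr)
        assume neg: "\<not> ?thesis"
        then obtain i j where "s * coeff p i \<noteq> 0" "s * coeff q j \<noteq> 0"
          using poly_killed[of s p b] poly_killed[of s q b] p q by blast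
        then obtain p' m q' l where
          p': "p' \<in> polys_over A" "degree p' \<le> m" "s * coeff p' m \<noteq> 0" "s * poly p' b = s * poly p b" and
          q': "q' \<in> polys_over A" "degree q' \<le> l" "s * coeff q' l \<noteq> 0" "s * poly q' b = s * poly q b"
          using trim_polynomial[OF A p(1)] trim_polynomial[OF A q(1)] by metis
        have "s * poly (p' * q') b = (s * poly p' b) * poly q' b" by (simp add: mult_ac)
        also have "\<dots> = poly p b * (s * poly q' b)" by (simp only: p'(4) mult_ac)
        also have "\<dots> = s * x * y" by (simp only: q'(4) p q mult_ac)
        finally have 0: "s * poly (p' * q') b = 0" using z by simp
        have "s * coeff (p' * q') (m + l) \<noteq> 0"
          using sp[of "coeff p' m" "coeff q' l"] p' q'
          by (auto simp: coeff_mult_top polys_overD)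
        then have "rel s (p' * q') (m + l)"
          using 0 sT p' q' degree_mult_le[of p' q'] by (auto simp: rel_def polys_over_closed[OF A])
        then show False using False by blast
      qed
    qed
    then show ?thesis using s subset_adjoin[OF A, of b] by (intro bexI[of _ s]) auto
  next
    case True
    define d where "d = (LEAST d. \<exists>e r. rel e r d)"
    have "\<exists>e r. rel e r d" unfolding d_def by (rule LeastI_ex) (use True in blast)
    then obtain e r where er: "rel e r d" by blast
    have dmin: "d \<le> d'" if "rel e r d'" for e r d'
      unfolding d_def by (rule Least_le) (use that in blast)
    have e: "e \<in> T" and r: "r \<in> polys_over A" "degree r \<le> d" and r0: "e * poly r b = 0"
      using er by (auto simp: rel_def)
    define c where "c = coeff r d"
    have c: "c \<in> A" "s * c \<noteq> 0" using er by (auto simp: c_def rel_def polys_overD)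
    have cB: "c \<in> ?B" "e \<in> ?B" using c subset_adjoin[OF A] e by (auto simp: T_def)
    \<comment> \<open>Reducing \<open>y\<close> modulo \<open>r\<close> leaves a remainder of degree below \<open>d\<close> which \<open>e'\<close> kills, so minimality
      of \<open>d\<close> applies; the powers of \<open>c\<close> introduced by the division disappear because the ring is reduced.\<close>
    have key: "e * (c * y) = 0"
      if y: "e' \<in> T" "e' * poly r b = 0" "e' * y = 0" "y \<in> ?B" for e' y
    proof -
      obtain q where q: "q \<in> polys_over A" "y = poly q b" using y by (auto simp: adjoin_def)
      obtain N h q' where h: "q' \<in> polys_over A" "Polynomial.smult (c ^ N) q = r * h + q'"
        "\<forall>i\<ge>d. coeff q' i = 0"
        using pseudo_division[OF A r q(1)] unfolding c_def by blast
      have eq: "c ^ N * y = poly r b * poly h b + poly q' b"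
        using arg_cong[OF h(2), of "\<lambda>p. poly p b"] q by simp
      have "e' * poly q' b = c ^ N * (e' * y) - (e' * poly r b) * poly h b"
        using arg_cong[OF eq, of "\<lambda>z. e' * z"] by (simp add: algebra_simps)
      then have "e' * poly q' b = 0" using that by simp
      then have "s * coeff q' i = 0" for i
        using small[OF h(1) that(1)] dmin h(3) by blast
      then have "e * coeff q' i = 0" for i using TD[OF e polys_overD[OF h(1)]] by blast
      then have "e * poly q' b = 0" by (rule poly_killed)
      then have "e * (c ^ N * y) = 0" using eq r0 by (simp add: distrib_left flip: mult.assoc)
      then have "c ^ N * (e * y) = 0" by (simp add: mult_ac)
      then have "c * (e * y) = 0" by (rule reduced_power[OF red])
      then show ?thesis by (simp add: mult_ac)
    qed
    have ecT: "e * c * x \<in> T" if x: "x \<in> ?B" "e * c * x \<noteq> 0" for x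
    proof -
      have "s * a = 0" if a: "a \<in> A" "e * c * x * a = 0" for a
      proof (rule ccontr)
        assume sa: "s * a \<noteq> 0"
        obtain p where p: "p \<in> polys_over A" "x = poly p b" using x by (auto simp: adjoin_def)
        obtain N h p' where h: "p' \<in> polys_over A" "Polynomial.smult (c ^ N) p = r * h + p'"
          "\<forall>i\<ge>d. coeff p' i = 0"
          using pseudo_division[OF A r p(1)] unfolding c_def by blast
        have eq: "c ^ N * x = poly r b * poly h b + poly p' b"
          using arg_cong[OF h(2), of "\<lambda>p. poly p b"] p by simp
        have ex: "e * c ^ N * x = e * poly p' b" using eq r0 by (simp add: distrib_left mult.assoc) (simp flip: mult.assoc)
        have ap: "Polynomial.smult (c * a) p' \<in> polys_over A"
          using a c h by (intro polys_over_closed(8)[OF A] unital_subringD[OF A])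
        have "e * poly (Polynomial.smult (c * a) p') b = c * a * (e * c ^ N * x)" using ex by (simp add: mult_ac)
        also have "\<dots> = c ^ N * (e * c * x * a)" by (simp add: mult_ac)
        finally have 0: "e * poly (Polynomial.smult (c * a) p') b = 0" using a by simp
        have k: "s * (c * a * coeff p' i) = 0" for i
          using small[OF ap e 0, of i] dmin h(3) by force
        have "s * coeff p' i = 0" for i
        proof -
          have "s * (c * (a * coeff p' i)) = 0" using k[of i] by (simp add: mult_ac)
          then have "s * (a * coeff p' i) = 0"
            using sp[of c "a * coeff p' i"] c a polys_overD[OF h(1), of i] unital_subringD(5)[OF A] by blast
          then show ?thesis using sp[of a "coeff p' i"] a sa polys_overD[OF h(1), of i] by blast
        qed
        then have "e * coeff p' i = 0" for i using TD[OF e polys_overD[OF h(1)]] by blast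
        then have "e * poly p' b = 0" by (rule poly_killed)
        then have "c ^ N * (e * x) = 0" using ex by (simp add: mult_ac)
        then have "c * (e * x) = 0" by (rule reduced_power[OF red])
        then show False using x by (simp add: mult_ac)
      qed
      moreover have "e * c * x * a = 0" if "a \<in> A" "s * a = 0" for a
      proof -
        have "e * a = 0" using TD[OF e that(1)] that by simp
        have "e * c * x * a = c * x * (e * a)" by (simp add: mult_ac)
        then show ?thesis using \<open>e * a = 0\<close> by simp
      qed
      moreover have "e * c * x \<in> ?B" using x cB by (intro unital_subringD[OF B])
      ultimately show ?thesis by (auto simp: T_def)
    qed
    have ec0: "e * c \<noteq> 0" using TD[OF e c(1)] c(2) by simp
    have "prime_at ?B (e * c)"
      unfolding prime_at_def
    proof (intro conjI ballI impI)
      show "e * c \<noteq> 0" by (rule ec0)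
      fix x y assume xy: "x \<in> ?B" "y \<in> ?B" and z: "e * c * x * y = 0"
      show "e * c * x = 0 \<or> e * c * y = 0"
      proof (cases "e * c * x = 0")
        case False
        have "e * c * x * poly r b = c * x * (e * poly r b)" by (simp add: mult_ac)
        then have "e * c * x * poly r b = 0" using r0 by simp
        then have "e * (c * y) = 0" using key[OF ecT[OF xy(1) False]] z xy(2) by blast
        then show ?thesis by (simp add: mult_ac)
      qed simp
    qed
    moreover have "e * c \<in> T" using ecT[of 1] ec0 unital_subringD(1)[OF B] by simp
    ultimately show ?thesis by (auto simp: T_def)
  qed
qed

lemma prime_at_adjoin_list:
  fixes s :: "'r::comm_ring_1"
  assumes red: "\<forall>z::'r. z * z = 0 \<longrightarrow> z = 0" and A: "unital_subring A"
    and s: "prime_at A s" "s \<in> A"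
  shows "\<exists>e\<in>adjoin_list A bs. prime_at (adjoin_list A bs) e \<and> (\<forall>a\<in>A. e * a = 0 \<longleftrightarrow> s * a = 0)"
  using A s
proof (induction bs arbitrary: A s)
  case Nil
  then show ?case by auto
next
  case (Cons b bs)
  obtain e where e: "e \<in> adjoin A b" "prime_at (adjoin A b) e" "\<forall>a\<in>A. e * a = 0 \<longleftrightarrow> s * a = 0"
    using prime_at_adjoin[OF red Cons.prems, of b] by blast
  show ?case
    using Cons.IH[OF unital_subring_adjoin[OF Cons.prems(1)] e(2,1)] e(3) subset_adjoin[OF Cons.prems(1), of b]
    by (metis adjoin_list.simps(2) subsetD)
qed

section \<open>Generic extension of characters\<close>

text \<open>A ring homomorphism from \<open>A\<close> to a field that factors through \<open>A\<close> modulo the annihilator of \<open>e\<close>.\<close>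

definition char_on :: "'r::comm_ring_1 set \<Rightarrow> 'r \<Rightarrow> ('r \<Rightarrow> 'k::field) \<Rightarrow> bool" where
  "char_on A e \<chi> \<longleftrightarrow> \<chi> 1 = 1 \<and> (\<forall>x\<in>A. \<forall>y\<in>A. \<chi> (x + y) = \<chi> x + \<chi> y \<and> \<chi> (x * y) = \<chi> x * \<chi> y) \<and>
    (\<forall>x\<in>A. e * x = 0 \<longrightarrow> \<chi> x = 0)"

lemma char_onD:
  assumes "unital_subring A" "char_on A e \<chi>"
  shows "\<chi> 1 = 1" "\<chi> 0 = 0" "x \<in> A \<Longrightarrow> y \<in> A \<Longrightarrow> \<chi> (x + y) = \<chi> x + \<chi> y"
    "x \<in> A \<Longrightarrow> y \<in> A \<Longrightarrow> \<chi> (x * y) = \<chi> x * \<chi> y" "x \<in> A \<Longrightarrow> e * x = 0 \<Longrightarrow> \<chi> x = 0"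
    "x \<in> A \<Longrightarrow> y \<in> A \<Longrightarrow> \<chi> (x - y) = \<chi> x - \<chi> y" "x \<in> A \<Longrightarrow> \<chi> (x ^ N) = \<chi> x ^ N"
proof -
  show 1: "\<chi> 1 = 1" and add: "x \<in> A \<Longrightarrow> y \<in> A \<Longrightarrow> \<chi> (x + y) = \<chi> x + \<chi> y"
    and mult: "x \<in> A \<Longrightarrow> y \<in> A \<Longrightarrow> \<chi> (x * y) = \<chi> x * \<chi> y"
    and k: "x \<in> A \<Longrightarrow> e * x = 0 \<Longrightarrow> \<chi> x = 0" for x y using assms(2) by (auto simp: char_on_def)
  show "\<chi> 0 = 0" using k[of 0] unital_subringD(2)[OF assms(1)] by simp
  show "\<chi> (x - y) = \<chi> x - \<chi> y" if "x \<in> A" "y \<in> A"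
    using add[of "x - y" y] unital_subringD(6)[OF assms(1) that] that by simp
  show "x \<in> A \<Longrightarrow> \<chi> (x ^ N) = \<chi> x ^ N"
    by (induction N) (auto simp: 1 mult unital_subringD[OF assms(1)])
qed

lemma char_on_sum:
  assumes "unital_subring A" "char_on A e \<chi>" "\<And>i. i \<in> S \<Longrightarrow> f i \<in> A"
  shows "\<chi> (sum f S) = (\<Sum>i\<in>S. \<chi> (f i))"
  using assms(3)
proof (induction S rule: infinite_finite_induct)
  case (insert x F)
  then show ?case by (simp add: char_onD(3)[OF assms(1,2)] unital_subring_sum[OF assms(1)])
qed (use char_onD[OF assms(1,2)] in auto)

lemma map_poly_char:
  assumes A: "unital_subring A" "char_on A e \<chi>" and p: "p \<in> polys_over A" "q \<in> polys_over A"
  shows "map_poly \<chi> (p + q) = map_poly \<chi> p + map_poly \<chi> q"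
    "map_poly \<chi> (p - q) = map_poly \<chi> p - map_poly \<chi> q"
    "map_poly \<chi> (p * q) = map_poly \<chi> p * map_poly \<chi> q"
    "c \<in> A \<Longrightarrow> map_poly \<chi> (Polynomial.smult c p) = Polynomial.smult (\<chi> c) (map_poly \<chi> p)"
    "coeff (map_poly \<chi> p) i = \<chi> (coeff p i)"
proof -
  note D = char_onD[OF A] and co = coeff_map_poly[where f = \<chi>, OF char_onD(2)[OF A]]
  note P = polys_overD[OF p(1)] polys_overD[OF p(2)]
  show "map_poly \<chi> (p + q) = map_poly \<chi> p + map_poly \<chi> q"
    "map_poly \<chi> (p - q) = map_poly \<chi> p - map_poly \<chi> q"
    "c \<in> A \<Longrightarrow> map_poly \<chi> (Polynomial.smult c p) = Polynomial.smult (\<chi> c) (map_poly \<chi> p)"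
    by (rule poly_eqI; simp add: co D P)+
  show "map_poly \<chi> (p * q) = map_poly \<chi> p * map_poly \<chi> q"
    by (rule poly_eqI) (simp add: co coeff_mult char_on_sum[OF A] unital_subringD(5)[OF A(1)] D P)
  show "coeff (map_poly \<chi> p) i = \<chi> (coeff p i)" by (rule co)
qed

text \<open>Sending \<open>b\<close> to \<open>\<beta>\<close> is well defined exactly because \<open>\<beta>\<close> satisfies all relations that \<open>b\<close> satisfies.\<close>

lemma char_extends_to_adjoin:
  fixes \<chi> :: "'r::comm_ring_1 \<Rightarrow> 'k::field"
  assumes A: "unital_subring A" "char_on A e \<chi>"
    and rel: "\<And>p. p \<in> polys_over A \<Longrightarrow> e * poly p b = 0 \<Longrightarrow> poly (map_poly \<chi> p) \<beta> = 0"
  shows "\<exists>\<chi>'. char_on (adjoin A b) e \<chi>' \<and> (\<forall>a\<in>A. \<chi>' a = \<chi> a) \<and>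
    (\<forall>p\<in>polys_over A. \<chi>' (poly p b) = poly (map_poly \<chi> p) \<beta>)"
proof -
  define \<chi>' where "\<chi>' y = poly (map_poly \<chi> (SOME p. p \<in> polys_over A \<and> poly p b = y)) \<beta>" for y
  note P = polys_over_closed[OF A(1)]
  have val: "\<chi>' (poly p b) = poly (map_poly \<chi> p) \<beta>" if p: "p \<in> polys_over A" for p
  proof -
    define q where "q = (SOME q. q \<in> polys_over A \<and> poly q b = poly p b)"
    have q: "q \<in> polys_over A \<and> poly q b = poly p b"
      unfolding q_def by (rule someI[of _ p]) (use p in simp)
    have "poly (map_poly \<chi> (q - p)) \<beta> = 0" using q p by (intro rel P(5)) auto
    then show ?thesis using map_poly_char(2)[OF A, of q p] q p unfolding \<chi>'_def q_def[symmetric] by simp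
  qed
  have "char_on (adjoin A b) e \<chi>'"
    unfolding char_on_def
  proof (intro conjI ballI impI)
    show "\<chi>' 1 = 1" using val[OF P(2)] char_onD(1)[OF A] by simp
    fix x assume "x \<in> adjoin A b"
    then obtain p where p: "p \<in> polys_over A" "x = poly p b" by (auto simp: adjoin_def)
    show "\<chi>' x = 0" if "e * x = 0" using rel[OF p(1)] val[OF p(1)] that p(2) by simp
    fix y assume "y \<in> adjoin A b"
    then obtain q where q: "q \<in> polys_over A" "y = poly q b" by (auto simp: adjoin_def)
    show "\<chi>' (x + y) = \<chi>' x + \<chi>' y"
      using val[OF P(4)[OF p(1) q(1)]] val[OF p(1)] val[OF q(1)] map_poly_char(1)[OF A p(1) q(1)] p q by simp
    show "\<chi>' (x * y) = \<chi>' x * \<chi>' y"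
      using val[OF P(7)[OF p(1) q(1)]] val[OF p(1)] val[OF q(1)] map_poly_char(3)[OF A p(1) q(1)] p q by simp
  qed
  moreover have "\<chi>' a = \<chi> a" if "a \<in> A" for a
    using val[OF P(3)[OF that, of 0]] char_onD(2)[OF A]
    by (simp add: poly_monom map_poly_monom)
  ultimately show ?thesis using val by blast
qed

lemma poly_degree_zero: "degree p = 0 \<Longrightarrow> poly p x = coeff p 0"
  by (auto elim!: degree_eq_zeroE)

lemma poly_nonzero_value:
  fixes p :: "'k::alg_closed_field poly"
  assumes "p \<noteq> 0"
  shows "\<exists>x. poly p x \<noteq> 0"
proof (cases "degree p = 0")
  case True
  then have "poly p 0 \<noteq> 0" using assms leading_coeff_neq_0[OF assms] by (simp add: poly_degree_zero)
  then show ?thesis by blast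
next
  case False
  have "degree (p - 1) = degree p" using False by (simp add: degree_diff_less degree_add_eq_left diff_conv_add_uminus del: add_uminus_conv_diff)
  then obtain x where "poly (p - 1) x = 0" using alg_closed_imp_poly_has_root[of "p - 1"] False by auto
  then show ?thesis by (intro exI[of _ x]) simp
qed

text \<open>Up to the multiplier \<open>e\<close> this is an extension of integral domains. If \<open>b\<close> is transcendental and \<open>v = q(b)\<close>, then a
  nonzero coefficient \<open>a\<close> of \<open>q\<close> works: whenever \<open>\<chi> a \<noteq> 0\<close>, the polynomial \<open>\<chi>(q)\<close> has a nonzero value. If \<open>b\<close> is algebraic,
  with a minimal relation \<open>r\<close> of leading coefficient \<open>c\<close>, then \<open>b\<close> can be sent to any root of \<open>\<chi>(r)\<close> provided that
  \<open>\<chi> c \<noteq> 0\<close>; the value at \<open>v\<close> is nonzero if in addition \<open>\<chi> l \<noteq> 0\<close> for a nonzero multiple \<open>l\<close> of \<open>v\<close> in \<open>A\<close>. So \<open>a = c l\<close>.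
  The element \<open>v\<close> is carried
  along for the sake of iteration: the \<open>a\<close> required by the later generators is the \<open>v\<close> of the earlier one.\<close>

lemma char_extends_generically_adjoin:
  fixes e b :: "'r::comm_ring_1"
  assumes A: "unital_subring A" and e: "prime_at (adjoin A b) e"
    and v: "v \<in> adjoin A b" "e * v \<noteq> 0"
  shows "\<exists>a\<in>A. e * a \<noteq> 0 \<and> (\<forall>\<chi> :: 'r \<Rightarrow> 'k::alg_closed_field. char_on A e \<chi> \<and> \<chi> a \<noteq> 0 \<longrightarrow>
    (\<exists>\<chi>'. char_on (adjoin A b) e \<chi>' \<and> (\<forall>x\<in>A. \<chi>' x = \<chi> x) \<and> \<chi>' v \<noteq> 0))"
proof -
  let ?B = "adjoin A b"
  note B = unital_subring_adjoin[OF A, of b] and P = polys_over_closed[OF A]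
  note BD = unital_subringD[OF B]
  have AB: "a \<in> A \<Longrightarrow> a \<in> ?B" for a using subset_adjoin[OF A] by blast
  have pr: "e * x = 0 \<or> e * y = 0" if "x \<in> ?B" "y \<in> ?B" "e * (x * y) = 0" for x y
    using e that by (auto simp: prime_at_def mult.assoc)
  have prp: "e * y = 0" if "e * x \<noteq> 0" "x \<in> ?B" "y \<in> ?B" "e * (x ^ N * y) = 0" for x y N
    using prime_at_power[OF e B that(2,3,4,1)] .
  define rel where "rel r d \<longleftrightarrow> r \<in> polys_over A \<and> degree r \<le> d \<and> e * coeff r d \<noteq> 0 \<and>
    e * poly r b = 0" for r d
  have small: "e * coeff p i = 0"
    if p: "p \<in> polys_over A" "e * poly p b = 0"
      and min: "\<And>r d'. rel r d' \<Longrightarrow> coeff p d' = 0" for p i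
  proof (rule ccontr)
    assume "e * coeff p i \<noteq> 0"
    then obtain p' m where p': "p' \<in> polys_over A" "degree p' \<le> m" "e * coeff p' m \<noteq> 0" "coeff p m \<noteq> 0"
      "e * poly p' b = e * poly p b"
      using trim_polynomial[OF A p(1)] by metis
    then have "rel p' m" using p p' by (simp add: rel_def)
    then show False using min p'(4) by blast
  qed
  obtain q where q: "q \<in> polys_over A" "v = poly q b" using v by (auto simp: adjoin_def)
  show ?thesis
  proof (cases "\<exists>r d. rel r d")
    case False
    obtain i where i: "e * coeff q i \<noteq> 0" using poly_killed[of e q b] v q by blast
    show ?thesis
    proof (intro bexI[of _ "coeff q i"] conjI allI impI)
      show "e * coeff q i \<noteq> 0" by (rule i)
      show "coeff q i \<in> A" by (rule polys_overD[OF q(1)])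
      fix \<chi> :: "'r \<Rightarrow> 'k" assume "char_on A e \<chi> \<and> \<chi> (coeff q i) \<noteq> 0"
      then have \<chi>: "char_on A e \<chi>" "\<chi> (coeff q i) \<noteq> 0" by auto
      have "map_poly \<chi> q \<noteq> 0" using map_poly_char(5)[OF A \<chi>(1) q(1) q(1), of i] \<chi>(2) by auto
      then obtain \<beta> where \<beta>: "poly (map_poly \<chi> q) \<beta> \<noteq> 0" using poly_nonzero_value by blast
      have "poly (map_poly \<chi> p) \<beta> = 0" if p: "p \<in> polys_over A" "e * poly p b = 0" for p
      proof -
        have "map_poly \<chi> p = 0"
        proof (rule poly_eqI)
          fix j
          have "e * coeff p j = 0" using small[OF p] False by blast
          then show "coeff (map_poly \<chi> p) j = coeff 0 j"
            using map_poly_char(5)[OF A \<chi>(1) p(1) p(1)] char_onD(5)[OF A \<chi>(1) polys_overD[OF p(1)]] by simp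
        qed
        then show ?thesis by simp
      qed
      from char_extends_to_adjoin[OF A \<chi>(1) this] obtain \<chi>' where
        "char_on ?B e \<chi>'" "\<forall>a\<in>A. \<chi>' a = \<chi> a" "\<forall>p\<in>polys_over A. \<chi>' (poly p b) = poly (map_poly \<chi> p) \<beta>"
        by blast
      then show "\<exists>\<chi>'. char_on ?B e \<chi>' \<and> (\<forall>x\<in>A. \<chi>' x = \<chi> x) \<and> \<chi>' v \<noteq> 0" using \<beta> q by auto
    qed
  next
    case True
    define d where "d = (LEAST d. \<exists>r. rel r d)"
    have "\<exists>r. rel r d" unfolding d_def by (rule LeastI_ex) (use True in blast)
    then obtain r where rd: "rel r d" by blast
    have dmin: "d \<le> d'" if "rel r d'" for r d' unfolding d_def by (rule Least_le) (use that in blast)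
    have small': "e * coeff p i = 0" if "p \<in> polys_over A" "e * poly p b = 0" "\<forall>i\<ge>d. coeff p i = 0" for p i
      using small[OF that(1,2)] dmin that(3) by blast
    have r: "r \<in> polys_over A" "degree r \<le> d" and r0: "e * poly r b = 0" using rd by (auto simp: rel_def)
    define c where "c = coeff r d"
    have c: "c \<in> A" "e * c \<noteq> 0" using rd by (auto simp: c_def rel_def polys_overD)
    have ev: "e * poly h b \<in> (\<lambda>w. e * (v * w)) ` ?B \<Longrightarrow> x \<in> ?B \<Longrightarrow> e * (x * poly h b) \<in> (\<lambda>w. e * (v * w)) ` ?B" for h x
    proof -
      assume "e * poly h b \<in> (\<lambda>w. e * (v * w)) ` ?B" "x \<in> ?B"
      then obtain w where "w \<in> ?B" "e * poly h b = e * (v * w)" by auto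
      then have "e * (x * poly h b) = e * (v * (x * w))" by (metis mult.left_commute)
      then show ?thesis using \<open>w \<in> ?B\<close> \<open>x \<in> ?B\<close> BD(5) by blast
    qed
    \<comment> \<open>Some multiple of \<open>v\<close> is nonzero and lies in \<open>A\<close> modulo the annihilator of \<open>e\<close>: among the polynomials whose
      value at \<open>b\<close> is a nonzero multiple of \<open>v\<close>, one of least degree \<open>m\<close> is constant.\<close>
    define good where "good h m \<longleftrightarrow> h \<in> polys_over A \<and> degree h \<le> m \<and> e * coeff h m \<noteq> 0 \<and>
      e * poly h b \<noteq> 0 \<and> e * poly h b \<in> (\<lambda>w. e * (v * w)) ` ?B" for h m
    have trim: "\<exists>h' m. good h' m \<and> coeff h m \<noteq> 0"
      if h: "h \<in> polys_over A" "e * poly h b \<noteq> 0" "e * poly h b \<in> (\<lambda>w. e * (v * w)) ` ?B" for h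
    proof -
      obtain i where "e * coeff h i \<noteq> 0" using poly_killed[of e h b] h by blast
      then obtain p' m where p': "p' \<in> polys_over A" "degree p' \<le> m" "e * coeff p' m \<noteq> 0" "coeff h m \<noteq> 0"
        "e * poly p' b = e * poly h b"
        using trim_polynomial[OF A h(1)] by metis
      then have "good p' m" using h by (simp add: good_def)
      then show ?thesis using p' by blast
    qed
    have "e * v = e * (v * 1)" by simp
    then have "e * poly q b \<in> (\<lambda>w. e * (v * w)) ` ?B" using q BD(1) by blast
    then have "\<exists>h' m. good h' m" using trim[OF q(1)] v q by blast
    define m where "m = (LEAST m. \<exists>h. good h m)"
    have "\<exists>h. good h m" unfolding m_def by (rule LeastI_ex) (use \<open>\<exists>h' m. good h' m\<close> in blast)
    then obtain h where h: "good h m" by blast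
    have mmin: "m \<le> m'" if "good h m'" for h m' unfolding m_def by (rule Least_le) (use that in blast)
    have hP: "h \<in> polys_over A" "degree h \<le> m" "e * poly h b \<noteq> 0" "e * poly h b \<in> (\<lambda>w. e * (v * w)) ` ?B"
      using h by (auto simp: good_def)
    define l where "l = coeff h m"
    have l: "l \<in> A" "e * l \<noteq> 0" using h by (auto simp: l_def good_def polys_overD)
    \<comment> \<open>If \<open>m\<close> were positive, division by \<open>r\<close> gives \<open>m < d\<close>, and division of \<open>r\<close> by \<open>h\<close> leaves a remainder that vanishes by
      the minimality of \<open>m\<close> and of \<open>d\<close>. So the quotient \<open>k\<close> is again a relation for \<open>b\<close>, of degree \<open>d - m < d\<close>.\<close>
    have "m = 0"
    proof (rule ccontr)
      assume m: "m \<noteq> 0"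
      obtain N g h' where D1: "g \<in> polys_over A" "h' \<in> polys_over A"
        "Polynomial.smult (c ^ N) h = r * g + h'" "\<forall>i\<ge>d. coeff h' i = 0"
        using pseudo_division[OF A r hP(1)] unfolding c_def by blast
      have "c ^ N * poly h b = poly r b * poly g b + poly h' b"
        using arg_cong[OF D1(3), of "\<lambda>p. poly p b"] by simp
      then have eh': "e * poly h' b = e * (c ^ N * poly h b)" using r0 by (simp add: distrib_left flip: mult.assoc)
      have "e * (c ^ N * poly h b) \<noteq> 0"
        using prp[of c "poly h b" N] c AB hP adjoin_poly[OF hP(1), of b] by blast
      then obtain h'' m' where "good h'' m'" "coeff h' m' \<noteq> 0"
        using trim[OF D1(2)] eh' ev[OF hP(4)] BD(7) AB c(1) by metis
      then have md: "m < d" using mmin D1(4) by (meson le_less_trans not_le)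
      obtain M k r' where D2: "k \<in> polys_over A" "r' \<in> polys_over A"
        "Polynomial.smult (l ^ M) r = h * k + r'" "\<forall>i\<ge>m. coeff r' i = 0"
        using pseudo_division[OF A hP(1,2) r(1)] unfolding l_def by blast
      have "l ^ M * poly r b = poly h b * poly k b + poly r' b"
        using arg_cong[OF D2(3), of "\<lambda>p. poly p b"] by simp
      then have "e * (poly h b * poly k b) + e * poly r' b = l ^ M * (e * poly r b)"
        by (simp add: mult_ac flip: distrib_left)
      then have "e * (poly h b * poly k b) + e * poly r' b = 0" using r0 by simp
      then have er': "e * poly r' b = e * ((- poly k b) * poly h b)"
        by (simp add: mult_ac add_eq_0_iff)
      have "e * poly r' b \<in> (\<lambda>w. e * (v * w)) ` ?B"
        unfolding er' by (rule ev[OF hP(4)]) (intro BD adjoin_poly[OF D2(1)])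
      then have "e * poly r' b = 0" using trim[OF D2(2)] mmin D2(4) by blast
      then have r'k: "e * coeff r' i = 0" for i using small'[OF D2(2)] D2(4) md by simp
      have "e * (poly h b * poly k b) = 0" using er' \<open>e * poly r' b = 0\<close> by (simp add: mult_ac)
      then have ek: "e * poly k b = 0" using pr[of "poly h b" "poly k b"] hP(3) adjoin_poly[OF hP(1)] adjoin_poly[OF D2(1)] by blast
      have "\<exists>i. e * coeff k i \<noteq> 0"
      proof (rule ccontr)
        assume "\<not> ?thesis"
        then have k0: "e * coeff k i = 0" for i by blast
        have "Polynomial.smult e k = 0" by (rule poly_eqI) (simp add: k0)
        have "e * (l ^ M * c) = coeff (Polynomial.smult e (h * k + r')) d"
          unfolding D2(3)[symmetric] by (simp add: c_def)
        also have "Polynomial.smult e (h * k + r') = h * Polynomial.smult e k + Polynomial.smult e r'"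
          by (simp add: smult_add_right)
        also have "coeff \<dots> d = 0" using r'k \<open>Polynomial.smult e k = 0\<close> by simp
        finally show False using prp[of l c M] l c AB by blast
      qed
      then obtain k' t where k': "k' \<in> polys_over A" "degree k' \<le> t" "e * coeff k' t \<noteq> 0"
        "\<And>j. t < j \<Longrightarrow> e * coeff k j = 0" "coeff k t \<noteq> 0" "e * poly k' b = e * poly k b"
        "e * coeff k t \<noteq> 0"
        using trim_polynomial[OF A D2(1)] by metis
      have "rel k' t" using k' ek by (simp add: rel_def)
      then have td: "d \<le> t" by (rule dmin)
      have sk: "Polynomial.smult e k = Polynomial.smult e (poly_cutoff (Suc t) k)"
        by (rule poly_eqI) (use k'(4) in \<open>auto simp: coeff_poly_cutoff\<close>)
      have "coeff (Polynomial.smult e (Polynomial.smult (l ^ M) r)) (m + t) = 0"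
        using r(2) td m coeff_eq_0[of r "m + t"] by simp
      moreover have "coeff r' (m + t) = 0" using D2(4) by simp
      ultimately have "coeff (Polynomial.smult e (h * k)) (m + t) = 0"
        unfolding D2(3) by (simp add: distrib_left)
      also have "Polynomial.smult e (h * k) = h * Polynomial.smult e (poly_cutoff (Suc t) k)"
        by (simp flip: sk)
      also have "coeff \<dots> (m + t) = l * (e * coeff k t)"
        unfolding l_def
        by (subst coeff_mult_top) (auto simp: hP coeff_poly_cutoff intro!: degree_le)
      finally have "e * (l * coeff k t) = 0" by (simp add: mult_ac)
      then show False using pr[of l "coeff k t"] l k'(7) AB polys_overD[OF D2(1)] by blast
    qed
    then have "degree h = 0" using hP(2) by simp
    then have ph: "poly h b = l" using \<open>m = 0\<close> unfolding l_def by (simp add: poly_degree_zero)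
    obtain w where w: "w \<in> ?B" "e * l = e * (v * w)" using hP(4) ph by auto
    show ?thesis
    proof (intro bexI[of _ "c * l"] conjI allI impI)
      show "e * (c * l) \<noteq> 0" using pr[of c l] c l AB by blast
      show "c * l \<in> A" using c l unital_subringD[OF A] by blast
      fix \<chi> :: "'r \<Rightarrow> 'k" assume "char_on A e \<chi> \<and> \<chi> (c * l) \<noteq> 0"
      then have \<chi>: "char_on A e \<chi>" and cl: "\<chi> (c * l) \<noteq> 0" by auto
      have nz: "\<chi> c \<noteq> 0" "\<chi> l \<noteq> 0"
        using cl char_onD(4)[OF A \<chi> c(1) l(1)] by auto
      have d0: "d \<noteq> 0"
      proof
        assume "d = 0"
        then have "poly r b = c" using r(2) unfolding c_def
          by (simp add: poly_degree_zero)
        then show False using r0 c by simp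
      qed
      have "coeff (map_poly \<chi> r) d \<noteq> 0" using nz map_poly_char(5)[OF A \<chi> r(1) r(1)] by (simp add: c_def)
      then have "degree (map_poly \<chi> r) > 0" using d0 le_degree by fastforce
      then obtain \<beta> where \<beta>: "poly (map_poly \<chi> r) \<beta> = 0" using alg_closed_imp_poly_has_root by blast
      have "poly (map_poly \<chi> p) \<beta> = 0" if p: "p \<in> polys_over A" "e * poly p b = 0" for p
      proof -
        obtain N g p' where D: "g \<in> polys_over A" "p' \<in> polys_over A"
          "Polynomial.smult (c ^ N) p = r * g + p'" "\<forall>i\<ge>d. coeff p' i = 0"
          using pseudo_division[OF A r p(1)] unfolding c_def by blast
        have "c ^ N * poly p b = poly r b * poly g b + poly p' b"
          using arg_cong[OF D(3), of "\<lambda>p. poly p b"] by simp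
        then have "e * poly p' b = c ^ N * (e * poly p b) - (e * poly r b) * poly g b"
          by (simp add: algebra_simps)
        then have "e * poly p' b = 0" using p r0 by simp
        then have k: "e * coeff p' i = 0" for i using small'[OF D(2)] D(4) by blast
        have "map_poly \<chi> p' = 0"
          by (rule poly_eqI) (simp add: map_poly_char(5)[OF A \<chi> D(2) D(2)] char_onD(5)[OF A \<chi> polys_overD[OF D(2)] k])
        moreover have "Polynomial.smult (\<chi> c ^ N) (map_poly \<chi> p) = map_poly \<chi> r * map_poly \<chi> g + map_poly \<chi> p'"
          using arg_cong[OF D(3), of "map_poly \<chi>"] P(7)[OF r(1) D(1)] D(1,2) r(1) p(1) c(1)
          by (simp add: map_poly_char[OF A \<chi>] char_onD[OF A \<chi>] unital_subringD[OF A])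
        ultimately have "\<chi> c ^ N * poly (map_poly \<chi> p) \<beta> = 0"
          using \<beta> by (metis add.right_neutral mult_zero_left poly_mult poly_smult)
        then show ?thesis using nz by simp
      qed
      from char_extends_to_adjoin[OF A \<chi> this] obtain \<chi>' where
        \<chi>': "char_on ?B e \<chi>'" "\<forall>a\<in>A. \<chi>' a = \<chi> a"
        by blast
      have "e * (l - v * w) = 0" using w(2) by (simp add: right_diff_distrib)
      moreover have "l - v * w \<in> ?B" by (intro BD(5,6) w(1) v(1) AB[OF l(1)])
      ultimately have "\<chi>' (l - v * w) = 0" by (rule char_onD(5)[OF B \<chi>'(1), rotated])
      then have "\<chi>' l = \<chi>' v * \<chi>' w"
        using char_onD(4,6)[OF B \<chi>'(1)] w v AB[OF l(1)] BD(5) by simp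
      then have "\<chi>' v \<noteq> 0" using nz \<chi>'(2) l by auto
      then show "\<exists>\<chi>'. char_on ?B e \<chi>' \<and> (\<forall>x\<in>A. \<chi>' x = \<chi> x) \<and> \<chi>' v \<noteq> 0" using \<chi>' by blast
    qed
  qed
qed

lemma char_extends_generically_adjoin_list:
  fixes e :: "'r::comm_ring_1"
  assumes A: "unital_subring A" and e: "prime_at (adjoin_list A bs) e"
    and v: "v \<in> adjoin_list A bs" "e * v \<noteq> 0"
  shows "\<exists>a\<in>A. e * a \<noteq> 0 \<and> (\<forall>\<chi> :: 'r \<Rightarrow> 'k::alg_closed_field. char_on A e \<chi> \<and> \<chi> a \<noteq> 0 \<longrightarrow>
    (\<exists>\<chi>'. char_on (adjoin_list A bs) e \<chi>' \<and> (\<forall>x\<in>A. \<chi>' x = \<chi> x) \<and> \<chi>' v \<noteq> 0))"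
  using A e v
proof (induction bs arbitrary: A)
  case Nil
  then show ?case by auto
next
  case (Cons b bs)
  let ?B = "adjoin A b" and ?C = "adjoin_list A (b # bs)"
  note A = Cons.prems(1) and B = unital_subring_adjoin[OF Cons.prems(1), of b]
  obtain v' where v': "v' \<in> ?B" "e * v' \<noteq> 0" and ext: "\<And>\<chi> :: 'r \<Rightarrow> 'k. char_on ?B e \<chi> \<Longrightarrow> \<chi> v' \<noteq> 0 \<Longrightarrow>
    \<exists>\<chi>'. char_on ?C e \<chi>' \<and> (\<forall>x\<in>?B. \<chi>' x = \<chi> x) \<and> \<chi>' v \<noteq> 0"
    using Cons.IH[OF B] Cons.prems by auto
  have sub: "?B \<subseteq> ?C" using subset_adjoin_list[OF B] by simp
  have "prime_at ?B e" using Cons.prems(2) sub by (auto simp: prime_at_def)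
  from char_extends_generically_adjoin[OF A this v'] obtain a where a: "a \<in> A" "e * a \<noteq> 0"
    and ext': "\<And>\<chi> :: 'r \<Rightarrow> 'k. char_on A e \<chi> \<Longrightarrow> \<chi> a \<noteq> 0 \<Longrightarrow>
    \<exists>\<chi>'. char_on ?B e \<chi>' \<and> (\<forall>x\<in>A. \<chi>' x = \<chi> x) \<and> \<chi>' v' \<noteq> 0"
    by blast
  show ?case
  proof (intro bexI[of _ a] conjI allI impI)
    fix \<chi> :: "'r \<Rightarrow> 'k" assume "char_on A e \<chi> \<and> \<chi> a \<noteq> 0"
    then obtain \<chi>1 where 1: "char_on ?B e \<chi>1" "\<forall>x\<in>A. \<chi>1 x = \<chi> x" "\<chi>1 v' \<noteq> 0" using ext' by blast
    then obtain \<chi>2 where 2: "char_on ?C e \<chi>2" "\<forall>x\<in>?B. \<chi>2 x = \<chi>1 x" "\<chi>2 v \<noteq> 0" using ext by blast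
    then show "\<exists>\<chi>'. char_on ?C e \<chi>' \<and> (\<forall>x\<in>A. \<chi>' x = \<chi> x) \<and> \<chi>' v \<noteq> 0"
      using 1 subset_adjoin[OF A, of b] by (intro exI[of _ \<chi>2]) auto
  qed (use a in auto)
qed

text \<open>Over an integral domain \<open>K\<close> the multiplier disappears from the statement: a multiplier \<open>s\<close> of \<open>A\<close>, dominated by \<open>e\<close> upstairs, is
  absorbed into the element \<open>a\<close>, since a character with \<open>\<chi> s \<noteq> 0\<close> kills the annihilator of \<open>s\<close>.\<close>

lemma char_extends_generically:
  fixes K :: "'r::comm_ring_1 set" and as bs :: "'r list"
  assumes red: "\<forall>z::'r. z * z = 0 \<longrightarrow> z = 0"
    and K: "unital_subring K" "prime_at K 1"
  defines "A \<equiv> adjoin_list K as"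
  shows "\<exists>a\<in>A. a \<noteq> 0 \<and> (\<forall>\<chi> :: 'r \<Rightarrow> 'k::alg_closed_field. char_on A 1 \<chi> \<and> \<chi> a \<noteq> 0 \<longrightarrow>
    (\<exists>\<chi>'. char_on (adjoin_list A bs) 1 \<chi>' \<and> (\<forall>x\<in>A. \<chi>' x = \<chi> x)))"
proof -
  have A: "unital_subring A" unfolding A_def by (rule unital_subring_adjoin_list[OF K(1)])
  have B: "unital_subring (adjoin_list A bs)" by (rule unital_subring_adjoin_list[OF A])
  obtain s where s: "s \<in> A" "prime_at A s"
    using prime_at_adjoin_list[OF red K unital_subringD(1)[OF K(1)], of as] unfolding A_def by blast
  obtain e where e: "prime_at (adjoin_list A bs) e" "\<forall>a\<in>A. e * a = 0 \<longleftrightarrow> s * a = 0"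
    using prime_at_adjoin_list[OF red A s(2,1), of bs] by blast
  have "e * 1 \<noteq> 0" using e by (simp add: prime_at_def)
  from char_extends_generically_adjoin_list[OF A e(1) unital_subringD(1)[OF B] this]
  obtain a where a: "a \<in> A" "e * a \<noteq> 0" and ext: "\<And>\<chi> :: 'r \<Rightarrow> 'k. char_on A e \<chi> \<Longrightarrow> \<chi> a \<noteq> 0 \<Longrightarrow>
    \<exists>\<chi>'. char_on (adjoin_list A bs) e \<chi>' \<and> (\<forall>x\<in>A. \<chi>' x = \<chi> x)"
    by blast
  show ?thesis
  proof (intro bexI[of _ "s * a"] conjI allI impI)
    show "s * a \<noteq> 0" using e(2) a by blast
    show "s * a \<in> A" using s a unital_subringD(5)[OF A] by blast
    fix \<chi> :: "'r \<Rightarrow> 'k" assume "char_on A 1 \<chi> \<and> \<chi> (s * a) \<noteq> 0"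
    then have \<chi>: "char_on A 1 \<chi>" and sa: "\<chi> (s * a) \<noteq> 0" by auto
    have nz: "\<chi> s \<noteq> 0" "\<chi> a \<noteq> 0"
      using sa char_onD(4)[OF A \<chi> s(1) a(1)] by auto
    have "\<chi> x = 0" if "x \<in> A" "e * x = 0" for x
    proof -
      have "s * x = 0" using e(2) that by blast
      then have "\<chi> s * \<chi> x = 0" using char_onD(2,4)[OF A \<chi>] s(1) that(1) by metis
      then show ?thesis using nz by simp
    qed
    then have "char_on A e \<chi>" using \<chi> by (simp add: char_on_def)
    then obtain \<chi>' where \<chi>': "char_on (adjoin_list A bs) e \<chi>'" "\<forall>x\<in>A. \<chi>' x = \<chi> x" using ext nz by blast
    have "char_on (adjoin_list A bs) 1 \<chi>'" using \<chi>'(1) char_onD(2)[OF B \<chi>'(1)] by (simp add: char_on_def)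
    then show "\<exists>\<chi>'. char_on (adjoin_list A bs) 1 \<chi>' \<and> (\<forall>x\<in>A. \<chi>' x = \<chi> x)" using \<chi>'(2) by blast
  qed
qed

section \<open>Algebras of functions\<close>

definition fun_algebra :: "'a set \<Rightarrow> ('a \<Rightarrow> 'k::field) set \<Rightarrow> bool" where
  "fun_algebra X A \<longleftrightarrow> A \<subseteq> extensional X \<and> (\<forall>c. (\<lambda>x\<in>X. c) \<in> A) \<and>
    (\<forall>f\<in>A. \<forall>h\<in>A. (\<lambda>x\<in>X. f x + h x) \<in> A \<and> (\<lambda>x\<in>X. f x * h x) \<in> A)"

lemma fun_algebraD:
  assumes "fun_algebra X A"
  shows "f \<in> A \<Longrightarrow> f \<in> extensional X" "(\<lambda>x\<in>X. c) \<in> A"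
    "(\<lambda>x\<in>X. f x) \<in> A \<Longrightarrow> (\<lambda>x\<in>X. h x) \<in> A \<Longrightarrow> (\<lambda>x\<in>X. f x + h x) \<in> A"
    "(\<lambda>x\<in>X. f x) \<in> A \<Longrightarrow> (\<lambda>x\<in>X. h x) \<in> A \<Longrightarrow> (\<lambda>x\<in>X. f x * h x) \<in> A"
    "(\<lambda>x\<in>X. f x) \<in> A \<Longrightarrow> (\<lambda>x\<in>X. c * f x) \<in> A"
    "f \<in> A \<Longrightarrow> (\<lambda>x\<in>X. f x) \<in> A"
proof -
  show ext: "f \<in> A \<Longrightarrow> f \<in> extensional X" and const: "(\<lambda>x\<in>X. c) \<in> A" for f c
    using assms by (auto simp: fun_algebra_def)
  show "f \<in> A \<Longrightarrow> (\<lambda>x\<in>X. f x) \<in> A" using extensional_restrict[OF ext] by simp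
  have eq: "(\<lambda>x\<in>X. (\<lambda>x\<in>X. f x) x + (\<lambda>x\<in>X. h x) x) = (\<lambda>x\<in>X. f x + h x)"
    "(\<lambda>x\<in>X. (\<lambda>x\<in>X. f x) x * (\<lambda>x\<in>X. h x) x) = (\<lambda>x\<in>X. f x * h x)" for f h :: "'a \<Rightarrow> 'b"
    by (auto simp: restrict_def)
  show "(\<lambda>x\<in>X. f x) \<in> A \<Longrightarrow> (\<lambda>x\<in>X. h x) \<in> A \<Longrightarrow> (\<lambda>x\<in>X. f x + h x) \<in> A"
    and mult: "(\<lambda>x\<in>X. f x) \<in> A \<Longrightarrow> (\<lambda>x\<in>X. h x) \<in> A \<Longrightarrow> (\<lambda>x\<in>X. f x * h x) \<in> A" for f h
    using assms eq[of f h] unfolding fun_algebra_def by metis+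
  show "(\<lambda>x\<in>X. f x) \<in> A \<Longrightarrow> (\<lambda>x\<in>X. c * f x) \<in> A" using mult[OF const] .
qed

lemma fun_algebra_sum:
  assumes A: "fun_algebra X A" and "\<And>i. i \<in> S \<Longrightarrow> (\<lambda>x\<in>X. f i x) \<in> A"
  shows "(\<lambda>x\<in>X. \<Sum>i\<in>S. f i x) \<in> A"
  using assms(2)
  by (induction S rule: infinite_finite_induct) (auto intro: fun_algebraD[OF A])

lemma fun_algebra_prod:
  assumes A: "fun_algebra X A" and "\<And>i. i \<in> S \<Longrightarrow> (\<lambda>x\<in>X. f i x) \<in> A"
  shows "(\<lambda>x\<in>X. \<Prod>i\<in>S. f i x) \<in> A"
  using assms(2)
  by (induction S rule: infinite_finite_induct) (auto intro: fun_algebraD[OF A])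

lemma fun_algebra_sum_list:
  assumes A: "fun_algebra X A" and "\<And>c. c \<in> set cs \<Longrightarrow> (\<lambda>x\<in>X. f c x) \<in> A"
  shows "(\<lambda>x\<in>X. \<Sum>c\<leftarrow>cs. f c x) \<in> A"
  using assms(2)
  by (induction cs) (auto intro: fun_algebraD[OF A])

lemma restrict_cong_mem: "(\<And>x. x \<in> X \<Longrightarrow> f x = g x) \<Longrightarrow> (\<lambda>x\<in>X. f x) \<in> A \<Longrightarrow> (\<lambda>x\<in>X. g x) \<in> A"
  by (metis restrict_ext)

lemma fun_algebra_fun_alg: "fun_algebra X (fun_alg X F)"
proof -
  have "f \<in> extensional X" if "f \<in> fun_alg X F" for f using that by cases (simp_all only: restrict_extensional)
  then show ?thesis
    unfolding fun_algebra_def by (auto intro: fun_alg.intros)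
qed

text \<open>Pulling back along \<open>\<phi>\<close> is an algebra homomorphism, so regularity of a map only has to be tested on generators.\<close>

lemma fun_alg_pullback:
  assumes A: "fun_algebra X A" and \<phi>: "\<And>x. x \<in> X \<Longrightarrow> \<phi> x \<in> Y"
    and gen: "\<And>f. f \<in> F \<Longrightarrow> (\<lambda>x\<in>X. f (\<phi> x)) \<in> A" and f: "f \<in> fun_alg Y F"
  shows "(\<lambda>x\<in>X. f (\<phi> x)) \<in> A"
  using f
proof induction
  case (const c)
  then show ?case by (rule restrict_cong_mem[OF _ fun_algebraD(2)[OF A]]) (simp add: \<phi>)
next
  case (gen f)
  show ?case by (rule restrict_cong_mem[OF _ assms(3)[OF gen]]) (simp add: \<phi>)
next
  case (add f h)
  then show ?case by (intro restrict_cong_mem[OF _ fun_algebraD(3)[OF A add.IH]]) (simp add: \<phi>)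
next
  case (mult f h)
  then show ?case by (intro restrict_cong_mem[OF _ fun_algebraD(4)[OF A mult.IH]]) (simp add: \<phi>)
qed

lemma fun_alg_least:
  assumes A: "fun_algebra X A" and gen: "\<And>f. f \<in> F \<Longrightarrow> restrict f X \<in> A"
  shows "fun_alg X F \<subseteq> A"
proof
  fix f assume f: "f \<in> fun_alg X F"
  have "(\<lambda>x\<in>X. f x) \<in> A" by (rule fun_alg_pullback[OF A _ _ f]) (use gen in auto)
  then show "f \<in> A" using extensional_restrict[OF fun_algebraD(1)[OF fun_algebra_fun_alg f]] by simp
qed

section \<open>Tensor products\<close>

lemma tensor_funs_mem:
  "set cs \<subseteq> A \<times> B \<Longrightarrow> (\<lambda>z\<in>X \<times> Y. \<Sum>(a, b)\<leftarrow>cs. a (fst z) * b (snd z)) \<in> tensor_funs X A Y B"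
  unfolding tensor_funs_def
  by (intro CollectI exI[of _ cs]) (auto simp: restrict_def fun_eq_iff)

lemma tensor_funsE:
  assumes "f \<in> tensor_funs X A Y B"
  obtains cs where "set cs \<subseteq> A \<times> B" "f = (\<lambda>z\<in>X \<times> Y. \<Sum>(a, b)\<leftarrow>cs. a (fst z) * b (snd z))"
proof -
  obtain cs where cs: "set cs \<subseteq> A \<times> B" "f = (\<lambda>(x, y)\<in>X \<times> Y. \<Sum>(a, b)\<leftarrow>cs. a x * b y)"
    using assms by (auto simp: tensor_funs_def)
  have "f = (\<lambda>z\<in>X \<times> Y. \<Sum>(a, b)\<leftarrow>cs. a (fst z) * b (snd z))"
    unfolding cs(2) by (auto simp: restrict_def fun_eq_iff)
  then show thesis using that cs(1) by blast
qed

lemma fun_algebra_tensor: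
  assumes A: "fun_algebra X A" and B: "fun_algebra Y B"
  shows "fun_algebra (X \<times> Y) (tensor_funs X A Y B)"
  unfolding fun_algebra_def
proof (intro conjI allI ballI)
  show "tensor_funs X A Y B \<subseteq> extensional (X \<times> Y)" by (auto elim!: tensor_funsE)
  show "(\<lambda>x\<in>X \<times> Y. c) \<in> tensor_funs X A Y B" for c
    by (rule restrict_cong_mem[OF _ tensor_funs_mem[of "[(\<lambda>x\<in>X. c, \<lambda>y\<in>Y. 1)]"]])
      (auto intro: fun_algebraD[OF A] fun_algebraD[OF B])
  fix f h assume f: "f \<in> tensor_funs X A Y B" and h: "h \<in> tensor_funs X A Y B"
  obtain cs where cs: "set cs \<subseteq> A \<times> B" "f = (\<lambda>z\<in>X \<times> Y. \<Sum>(a, b)\<leftarrow>cs. a (fst z) * b (snd z))"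
    using tensor_funsE[OF f] .
  obtain ds where ds: "set ds \<subseteq> A \<times> B" "h = (\<lambda>z\<in>X \<times> Y. \<Sum>(a, b)\<leftarrow>ds. a (fst z) * b (snd z))"
    using tensor_funsE[OF h] .
  show "(\<lambda>x\<in>X \<times> Y. f x + h x) \<in> tensor_funs X A Y B"
    by (rule restrict_cong_mem[OF _ tensor_funs_mem[of "cs @ ds"]]) (use cs ds in auto)
  define es where "es = concat (map (\<lambda>(a, b). map (\<lambda>(a', b'). (\<lambda>x\<in>X. a x * a' x, \<lambda>y\<in>Y. b y * b' y)) ds) cs)"
  have pA: "a \<in> A \<Longrightarrow> a' \<in> A \<Longrightarrow> (\<lambda>x\<in>X. a x * a' x) \<in> A"
    and pB: "b \<in> B \<Longrightarrow> b' \<in> B \<Longrightarrow> (\<lambda>y\<in>Y. b y * b' y) \<in> B" for a a' b b'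
    using A B by (auto simp: fun_algebra_def)
  have c1: "(a, b) \<in> set cs \<Longrightarrow> a \<in> A \<and> b \<in> B" and d1: "(a, b) \<in> set ds \<Longrightarrow> a \<in> A \<and> b \<in> B" for a b
    using cs(1) ds(1) by auto
  have es: "set es \<subseteq> A \<times> B"
    unfolding es_def by (auto simp del: restrict_apply intro!: pA pB dest: c1 d1)
  have "(\<Sum>(a, b)\<leftarrow>es. a x * b y) = (\<Sum>(a, b)\<leftarrow>cs. a x * b y) * (\<Sum>(a, b)\<leftarrow>ds. a x * b y)"
    if xy: "x \<in> X" "y \<in> Y" for x y
  proof -
    have "(\<Sum>(a, b)\<leftarrow>map (\<lambda>(a', b'). (\<lambda>x\<in>X. c x * a' x, \<lambda>y\<in>Y. d y * b' y)) ds. a x * b y) =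
      c x * d y * (\<Sum>(a, b)\<leftarrow>ds. a x * b y)" for c d
      by (induction ds) (auto simp: xy algebra_simps)
    then show ?thesis
      unfolding es_def by (induction cs) (auto simp: algebra_simps)
  qed
  then show "(\<lambda>x\<in>X \<times> Y. f x * h x) \<in> tensor_funs X A Y B"
    by (intro restrict_cong_mem[OF _ tensor_funs_mem[OF es]]) (auto simp: cs(2) ds(2))
qed

lemma tensor_funs_fst:
  assumes "fun_algebra Y B" "a \<in> A"
  shows "(\<lambda>z\<in>X \<times> Y. a (fst z)) \<in> tensor_funs X A Y B"
  by (rule restrict_cong_mem[OF _ tensor_funs_mem[of "[(a, \<lambda>y\<in>Y. 1)]"]])
    (use assms in \<open>auto intro: fun_algebraD\<close>)

lemma tensor_funs_snd:
  assumes "fun_algebra X A" "b \<in> B"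
  shows "(\<lambda>z\<in>X \<times> Y. b (snd z)) \<in> tensor_funs X A Y B"
  by (rule restrict_cong_mem[OF _ tensor_funs_mem[of "[(\<lambda>x\<in>X. 1, b)]"]])
    (use assms in \<open>auto intro: fun_algebraD\<close>)

text \<open>The universal property of the product of two varieties.\<close>

lemma tensor_funs_pullback:
  assumes C: "fun_algebra Z C" and pq: "\<And>z. z \<in> Z \<Longrightarrow> p z \<in> X \<and> q z \<in> Y"
    and p: "\<And>a. a \<in> A \<Longrightarrow> (\<lambda>z\<in>Z. a (p z)) \<in> C" and q: "\<And>b. b \<in> B \<Longrightarrow> (\<lambda>z\<in>Z. b (q z)) \<in> C"
    and f: "f \<in> tensor_funs X A Y B"
  shows "(\<lambda>z\<in>Z. f (p z, q z)) \<in> C"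
proof -
  obtain cs where cs: "set cs \<subseteq> A \<times> B" "f = (\<lambda>z\<in>X \<times> Y. \<Sum>(a, b)\<leftarrow>cs. a (fst z) * b (snd z))"
    using tensor_funsE[OF f] .
  have "(\<lambda>z\<in>Z. \<Sum>c\<leftarrow>cs. (\<lambda>c z. case c of (a, b) \<Rightarrow> a (p z) * b (q z)) c z) \<in> C"
    using cs(1) by (intro fun_algebra_sum_list[OF C]) (auto intro!: fun_algebraD(4)[OF C] p q)
  then show ?thesis
    by (rule restrict_cong_mem[rotated]) (use pq cs in auto)
qed

lemma tensor_fun_alg:
  "tensor_funs X (fun_alg X F) Y (fun_alg Y F') = fun_alg (X \<times> Y) ((\<lambda>f z. f (fst z)) ` F \<union> (\<lambda>f z. f (snd z)) ` F')"
    (is "?T = fun_alg ?Z ?F")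
proof
  show "fun_alg ?Z ?F \<subseteq> ?T"
  proof (rule fun_alg_least[OF fun_algebra_tensor[OF fun_algebra_fun_alg fun_algebra_fun_alg]])
    fix f assume "f \<in> ?F"
    then consider g where "g \<in> F" "f = (\<lambda>z. g (fst z))" | g where "g \<in> F'" "f = (\<lambda>z. g (snd z))" by auto
    then show "restrict f ?Z \<in> ?T"
    proof cases
      case 1
      have "(\<lambda>z\<in>?Z. (restrict g X) (fst z)) \<in> ?T"
        by (rule tensor_funs_fst[OF fun_algebra_fun_alg fun_alg.gen[OF 1(1)]])
      then show ?thesis
        by (rule restrict_cong_mem[rotated]) (use 1 in auto)
    next
      case 2
      have "(\<lambda>z\<in>?Z. (restrict g Y) (snd z)) \<in> ?T"
        by (rule tensor_funs_snd[OF fun_algebra_fun_alg fun_alg.gen[OF 2(1)]])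
      then show ?thesis
        by (rule restrict_cong_mem[rotated]) (use 2 in auto)
    qed
  qed
  show "?T \<subseteq> fun_alg ?Z ?F"
  proof
    fix f assume f: "f \<in> ?T"
    have "(\<lambda>z\<in>?Z. f (fst z, snd z)) \<in> fun_alg ?Z ?F"
    proof (rule tensor_funs_pullback[OF fun_algebra_fun_alg _ _ _ f])
      show "(\<lambda>z\<in>X \<times> Y. a (fst z)) \<in> fun_alg ?Z ?F" if "a \<in> fun_alg X F" for a
      proof (rule fun_alg_pullback[OF fun_algebra_fun_alg _ _ that])
        show "(\<lambda>x\<in>X \<times> Y. h (fst x)) \<in> fun_alg ?Z ?F" if "h \<in> F" for h
          using fun_alg.gen[of "\<lambda>z. h (fst z)" ?F ?Z] that by auto
      qed auto
      show "(\<lambda>z\<in>X \<times> Y. b (snd z)) \<in> fun_alg ?Z ?F" if "b \<in> fun_alg Y F'" for b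
      proof (rule fun_alg_pullback[OF fun_algebra_fun_alg _ _ that])
        show "(\<lambda>x\<in>X \<times> Y. h (snd x)) \<in> fun_alg ?Z ?F" if "h \<in> F'" for h
          using fun_alg.gen[of "\<lambda>z. h (snd z)" ?F ?Z] that by auto
      qed auto
    qed auto
    moreover have "f \<in> extensional ?Z" using tensor_funsE[OF f] by auto
    ultimately show "f \<in> fun_alg ?Z ?F" using extensional_restrict[of f ?Z] by simp
  qed
qed

section \<open>Characters of function algebras\<close>

definition algchar :: "'a set \<Rightarrow> ('a \<Rightarrow> 'k::field) set \<Rightarrow> (('a \<Rightarrow> 'k) \<Rightarrow> 'k) \<Rightarrow> bool" where
  "algchar X A \<chi> \<longleftrightarrow> \<chi> (\<lambda>x\<in>X. 1) = 1 \<and>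
    (\<forall>f\<in>A. \<forall>h\<in>A. \<chi> (\<lambda>x\<in>X. f x + h x) = \<chi> f + \<chi> h \<and> \<chi> (\<lambda>x\<in>X. f x * h x) = \<chi> f * \<chi> h) \<and>
    (\<forall>c. \<forall>f\<in>A. \<chi> (\<lambda>x\<in>X. c * f x) = c * \<chi> f)"

lemma algcharD:
  assumes A: "fun_algebra X A" and \<chi>: "algchar X A \<chi>"
  shows "\<chi> (\<lambda>x\<in>X. c) = c"
    "(\<lambda>x\<in>X. f x) \<in> A \<Longrightarrow> (\<lambda>x\<in>X. h x) \<in> A \<Longrightarrow> \<chi> (\<lambda>x\<in>X. f x + h x) = \<chi> (\<lambda>x\<in>X. f x) + \<chi> (\<lambda>x\<in>X. h x)"
    "(\<lambda>x\<in>X. f x) \<in> A \<Longrightarrow> (\<lambda>x\<in>X. h x) \<in> A \<Longrightarrow> \<chi> (\<lambda>x\<in>X. f x * h x) = \<chi> (\<lambda>x\<in>X. f x) * \<chi> (\<lambda>x\<in>X. h x)"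
    "(\<lambda>x\<in>X. f x) \<in> A \<Longrightarrow> \<chi> (\<lambda>x\<in>X. c * f x) = c * \<chi> (\<lambda>x\<in>X. f x)"
proof -
  have eq: "(\<lambda>x\<in>X. (\<lambda>x\<in>X. f x) x + (\<lambda>x\<in>X. h x) x) = (\<lambda>x\<in>X. f x + h x)"
    "(\<lambda>x\<in>X. (\<lambda>x\<in>X. f x) x * (\<lambda>x\<in>X. h x) x) = (\<lambda>x\<in>X. f x * h x)"
    "(\<lambda>x\<in>X. c * (\<lambda>x\<in>X. f x) x) = (\<lambda>x\<in>X. c * f x)" for f h :: "'a \<Rightarrow> 'b" and c
    by (auto simp: restrict_def)
  show "(\<lambda>x\<in>X. f x) \<in> A \<Longrightarrow> (\<lambda>x\<in>X. h x) \<in> A \<Longrightarrow> \<chi> (\<lambda>x\<in>X. f x + h x) = \<chi> (\<lambda>x\<in>X. f x) + \<chi> (\<lambda>x\<in>X. h x)"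
    "(\<lambda>x\<in>X. f x) \<in> A \<Longrightarrow> (\<lambda>x\<in>X. h x) \<in> A \<Longrightarrow> \<chi> (\<lambda>x\<in>X. f x * h x) = \<chi> (\<lambda>x\<in>X. f x) * \<chi> (\<lambda>x\<in>X. h x)"
    and sc: "(\<lambda>x\<in>X. f x) \<in> A \<Longrightarrow> \<chi> (\<lambda>x\<in>X. c * f x) = c * \<chi> (\<lambda>x\<in>X. f x)" for f h c
    using \<chi> eq(1)[of f h] eq(2)[of f h] eq(3)[of c f] unfolding algchar_def by metis+
  show "\<chi> (\<lambda>x\<in>X. c) = c"
    using sc[of "\<lambda>_. 1" c] fun_algebraD(2)[OF A, of 1] \<chi> by (simp add: algchar_def)
qed

lemma algchar_eval: "x \<in> X \<Longrightarrow> algchar X A (\<lambda>f. f x)"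
  by (simp add: algchar_def)

lemma algchar_sum:
  assumes A: "fun_algebra X A" and \<chi>: "algchar X A \<chi>" and "\<And>i. i \<in> S \<Longrightarrow> (\<lambda>x\<in>X. f i x) \<in> A"
  shows "\<chi> (\<lambda>x\<in>X. \<Sum>i\<in>S. f i x) = (\<Sum>i\<in>S. \<chi> (\<lambda>x\<in>X. f i x))"
  using assms(3)
proof (induction S rule: infinite_finite_induct)
  case (insert i S)
  then show ?case using algcharD(2)[OF A \<chi>, of "f i" "\<lambda>x. \<Sum>i\<in>S. f i x"] fun_algebra_sum[OF A, of S f]
    by (simp del: restrict_apply)
qed (use algcharD(1)[OF A \<chi>, of 0] in simp_all)

lemma algchar_prod:
  assumes A: "fun_algebra X A" and \<chi>: "algchar X A \<chi>" and "\<And>i. i \<in> S \<Longrightarrow> (\<lambda>x\<in>X. f i x) \<in> A"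
  shows "\<chi> (\<lambda>x\<in>X. \<Prod>i\<in>S. f i x) = (\<Prod>i\<in>S. \<chi> (\<lambda>x\<in>X. f i x))"
  using assms(3)
proof (induction S rule: infinite_finite_induct)
  case (insert i S)
  then show ?case using algcharD(3)[OF A \<chi>, of "f i" "\<lambda>x. \<Prod>i\<in>S. f i x"] fun_algebra_prod[OF A, of S f]
    by (simp del: restrict_apply)
qed (use algcharD(1)[OF A \<chi>, of 1] in simp_all)

text \<open>A character is determined by its values on generators.\<close>

lemma algchar_fun_alg_eval:
  assumes \<chi>: "algchar X (fun_alg X F) \<chi>" and y: "y \<in> X"
    and gen: "\<And>f. f \<in> F \<Longrightarrow> \<chi> (restrict f X) = f y" and f: "f \<in> fun_alg X F"
  shows "\<chi> f = f y"
  using f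
proof induction
  note D = algcharD[OF fun_algebra_fun_alg \<chi>] and M = fun_algebraD(6)[OF fun_algebra_fun_alg]
  have ext: "f \<in> fun_alg X F \<Longrightarrow> restrict f X = f" for f
    using extensional_restrict[OF fun_algebraD(1)[OF fun_algebra_fun_alg]] .
  case (const c) then show ?case using D(1)[of c] y by (simp del: restrict_apply) simp
next
  case (gen f)
  have "\<chi> (restrict f X) = restrict f X y" using assms(3)[OF gen] y by simp
  then show ?case .
next
  case (add f h)
  have "\<chi> (\<lambda>x\<in>X. f x + h x) = f y + h y" using \<chi> add unfolding algchar_def by metis
  moreover have "(\<lambda>x\<in>X. f x + h x) y = f y + h y" using y by simp
  ultimately show ?case by (rule trans[OF _ sym])
next
  case (mult f h)
  have "\<chi> (\<lambda>x\<in>X. f x * h x) = f y * h y" using \<chi> mult unfolding algchar_def by metis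
  moreover have "(\<lambda>x\<in>X. f x * h x) y = f y * h y" using y by simp
  ultimately show ?case by (rule trans[OF _ sym])
qed

lemma algchar_pullback:
  fixes \<chi> :: "('a \<Rightarrow> 'k::field) \<Rightarrow> 'k" and Y :: "'b set"
  assumes A: "fun_algebra X A" and \<chi>: "algchar X A \<chi>" and \<phi>: "\<And>x. x \<in> X \<Longrightarrow> \<phi> x \<in> Y"
    and pull: "\<And>f. f \<in> B \<Longrightarrow> (\<lambda>x\<in>X. f (\<phi> x)) \<in> A"
  shows "algchar Y B (\<lambda>f. \<chi> (\<lambda>x\<in>X. f (\<phi> x)))"
proof -
  have eq: "(\<lambda>x\<in>X. (\<lambda>y\<in>Y. f y) (\<phi> x)) = (\<lambda>x\<in>X. f (\<phi> x))" for f :: "'b \<Rightarrow> 'k"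
    using \<phi> by (auto simp: restrict_def)
  show ?thesis
    unfolding algchar_def eq using algcharD[OF A \<chi>] pull by auto
qed

lemma unital_subring_compose:
  fixes \<psi> :: "'x \<Rightarrow> 'z" and F :: "('z \<Rightarrow> 'k::field) set"
  assumes \<psi>: "\<And>x. \<psi> x \<in> Z"
  shows "unital_subring ((\<lambda>f x. f (\<psi> x)) ` fun_alg Z F)"
proof -
  let ?C = "(\<lambda>f x. f (\<psi> x)) ` fun_alg Z F"
  note D = fun_algebraD[OF fun_algebra_fun_alg[of Z F]]
  have const: "(\<lambda>_. c) \<in> ?C" for c
    by (rule image_eqI[of _ _ "\<lambda>x\<in>Z. c"]) (use \<psi> D(2) in auto)
  have closed: "x + y \<in> ?C \<and> x * y \<in> ?C" if xy: "x \<in> ?C" "y \<in> ?C" for x y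
  proof -
    obtain f h where f: "f \<in> fun_alg Z F" "x = (\<lambda>x. f (\<psi> x))" and h: "h \<in> fun_alg Z F" "y = (\<lambda>x. h (\<psi> x))"
      using xy by auto
    have "x + y \<in> ?C"
      by (rule image_eqI[of _ _ "\<lambda>x\<in>Z. f x + h x"]) (use \<psi> f h in \<open>auto simp: fun_eq_iff intro: fun_alg.intros\<close>)
    moreover have "x * y \<in> ?C"
      by (rule image_eqI[of _ _ "\<lambda>x\<in>Z. f x * h x"]) (use \<psi> f h in \<open>auto simp: fun_eq_iff intro: fun_alg.intros\<close>)
    ultimately show ?thesis by blast
  qed
  have "- x \<in> ?C" if "x \<in> ?C" for x
    using closed[OF const[of "-1"] that] by (simp add: fun_eq_iff times_fun_def fun_Compl_def)
  then show ?thesis using closed const[of 1] by (auto simp: unital_subring_def one_fun_def)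
qed

lemma fun_alg_compose_least:
  fixes \<psi> :: "'x \<Rightarrow> 'z" and F :: "('z \<Rightarrow> 'k::field) set"
  assumes \<psi>: "\<And>x. \<psi> x \<in> Z" and C: "unital_subring C" "\<And>c. (\<lambda>_. c) \<in> C"
    and gen: "\<And>f. f \<in> F \<Longrightarrow> (\<lambda>x. f (\<psi> x)) \<in> C"
  shows "(\<lambda>f x. f (\<psi> x)) ` fun_alg Z F \<subseteq> C"
proof -
  have "(\<lambda>x. f (\<psi> x)) \<in> C" if "f \<in> fun_alg Z F" for f
    using that
  proof induction
    case (add f h)
    then show ?case using unital_subringD(4)[OF C(1) add.IH] \<psi> by (simp add: plus_fun_def)
  next
    case (mult f h)
    then show ?case using unital_subringD(5)[OF C(1) mult.IH] \<psi> by (simp add: times_fun_def)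
  qed (use \<psi> C gen in auto)
  then show ?thesis by auto
qed

text \<open>The ring in which the generic extension of characters takes place is the ring of all functions on the ambient type,
  with pointwise operations; it is reduced, and its constants form a field. Functions on \<open>Y\<close> are pulled back to \<open>X\<close> along
  \<open>\<Phi>\<close>. This is the theorem of Chevalley on images of morphisms, in the form that the image of a morphism contains
  a nonempty open subset of its closure.\<close>

lemma algchar_lifts_generically:
  fixes \<Phi> :: "'x \<Rightarrow> 'y" and F :: "('y \<Rightarrow> 'k::alg_closed_field) set" and F' :: "('x \<Rightarrow> 'k) set"
  assumes fin: "finite F" "finite F'" and ne: "X \<noteq> {}" and surj: "\<Phi> ` X = Y"
    and pull: "\<And>f. f \<in> F \<Longrightarrow> (\<lambda>x\<in>X. f (\<Phi> x)) \<in> fun_alg X F'"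
  shows "\<exists>a\<in>fun_alg Y F. (\<exists>y\<in>Y. a y \<noteq> 0) \<and>
    (\<forall>\<chi>. algchar Y (fun_alg Y F) \<chi> \<and> \<chi> a \<noteq> 0 \<longrightarrow>
      (\<exists>\<chi>'. algchar X (fun_alg X F') \<chi>' \<and> (\<forall>f\<in>fun_alg Y F. \<chi> f = \<chi>' (\<lambda>x\<in>X. f (\<Phi> x)))))"
proof -
  obtain x0 where x0: "x0 \<in> X" using ne by blast
  \<comment> \<open>Functions on \<open>X\<close> are extended to the whole type by their value at \<open>x0\<close>, to avoid conditions outside \<open>X\<close>.\<close>
  define \<rho> where "\<rho> x = (if x \<in> X then x else x0)" for x
  have \<rho>: "\<rho> x \<in> X" "x \<in> X \<Longrightarrow> \<rho> x = x" for x using x0 by (auto simp: \<rho>_def)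
  have \<Phi>\<rho>: "\<Phi> (\<rho> x) \<in> Y" for x using \<rho>(1) surj by blast
  define K :: "('x \<Rightarrow> 'k) set" where "K = range (\<lambda>c _. c)"
  have K: "unital_subring K"
    by (auto simp: unital_subring_def K_def one_fun_def plus_fun_def times_fun_def fun_Compl_def)
  have K1: "prime_at K 1"
    by (auto simp: prime_at_def K_def fun_eq_iff)
  obtain fl gl where fl: "set fl = F" and gl: "set gl = F'" using fin finite_list by metis
  define as where "as = map (\<lambda>f x. f (\<Phi> (\<rho> x))) fl"
  define bs where "bs = map (\<lambda>f x. f (\<rho> x)) gl"
  define A where "A = adjoin_list K as"
  define B where "B = adjoin_list A bs"
  have sA: "unital_subring A" unfolding A_def by (rule unital_subring_adjoin_list[OF K])
  have sB: "unital_subring B" unfolding B_def by (rule unital_subring_adjoin_list[OF sA])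
  have KA: "(\<lambda>_. c) \<in> A" for c using subset_adjoin_list[OF K, of as] by (auto simp: A_def K_def)
  have AB: "A \<subseteq> B" unfolding B_def by (rule subset_adjoin_list[OF sA])
  have A_eq: "A = (\<lambda>f x. f (\<Phi> (\<rho> x))) ` fun_alg Y F"
  proof
    show "A \<subseteq> (\<lambda>f x. f (\<Phi> (\<rho> x))) ` fun_alg Y F"
      unfolding A_def
    proof (rule adjoin_list_least[OF unital_subring_compose[OF \<Phi>\<rho>]])
      show "K \<subseteq> (\<lambda>f x. f (\<Phi> (\<rho> x))) ` fun_alg Y F"
      proof
        fix k assume "k \<in> K"
        then obtain c where "k = (\<lambda>_. c)" by (auto simp: K_def)
        then show "k \<in> (\<lambda>f x. f (\<Phi> (\<rho> x))) ` fun_alg Y F"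
          by (intro image_eqI[of _ _ "\<lambda>x\<in>Y. c"]) (use \<Phi>\<rho> fun_alg.const in auto)
      qed
      show "set as \<subseteq> (\<lambda>f x. f (\<Phi> (\<rho> x))) ` fun_alg Y F"
      proof
        fix k assume "k \<in> set as"
        then obtain f where "f \<in> F" "k = (\<lambda>x. f (\<Phi> (\<rho> x)))" by (auto simp: as_def fl)
        then show "k \<in> (\<lambda>f x. f (\<Phi> (\<rho> x))) ` fun_alg Y F"
          by (intro image_eqI[of _ _ "restrict f Y"]) (use \<Phi>\<rho> fun_alg.gen in auto)
      qed
    qed
    show "(\<lambda>f x. f (\<Phi> (\<rho> x))) ` fun_alg Y F \<subseteq> A"
    proof (rule fun_alg_compose_least[OF \<Phi>\<rho> sA KA])
      fix f assume "f \<in> F"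
      then have "(\<lambda>x. f (\<Phi> (\<rho> x))) \<in> set as" by (auto simp: as_def fl)
      then show "(\<lambda>x. f (\<Phi> (\<rho> x))) \<in> A" using generators_in_adjoin_list[OF K] unfolding A_def by blast
    qed
  qed
  have B_sup: "(\<lambda>f x. f (\<rho> x)) ` fun_alg X F' \<subseteq> B"
  proof (rule fun_alg_compose_least[OF \<rho>(1) sB])
    show "(\<lambda>_. c) \<in> B" for c using KA AB by blast
    fix f assume "f \<in> F'"
    then have "(\<lambda>x. f (\<rho> x)) \<in> set bs" by (auto simp: bs_def gl)
    then show "(\<lambda>x. f (\<rho> x)) \<in> B" using generators_in_adjoin_list[OF sA] unfolding B_def by blast
  qed
  from char_extends_generically[OF _ K K1, of as bs, folded A_def, folded B_def]
  obtain t where t: "t \<in> A" "t \<noteq> 0" and ext: "\<And>\<chi> :: ('x \<Rightarrow> 'k) \<Rightarrow> 'k. char_on A 1 \<chi> \<Longrightarrow> \<chi> t \<noteq> 0 \<Longrightarrow>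
    \<exists>\<chi>'. char_on B 1 \<chi>' \<and> (\<forall>x\<in>A. \<chi>' x = \<chi> x)"
    by (auto simp: fun_eq_iff)
  obtain a where a: "a \<in> fun_alg Y F" "t = (\<lambda>x. a (\<Phi> (\<rho> x)))" using t(1) A_eq by auto
  \<comment> \<open>A section of \<open>\<Phi>\<close> identifies the pulled back functions with functions on \<open>Y\<close> again.\<close>
  define \<sigma> where "\<sigma> y = (SOME x. x \<in> X \<and> \<Phi> x = y)" for y
  have \<sigma>: "\<sigma> y \<in> X" "\<Phi> (\<sigma> y) = y" if "y \<in> Y" for y
    using someI_ex[of "\<lambda>x. x \<in> X \<and> \<Phi> x = y"] that surj unfolding \<sigma>_def by auto
  define bar where "bar t = (\<lambda>y\<in>Y. t (\<sigma> y))" for t :: "'x \<Rightarrow> 'k"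
  have bar: "bar (\<lambda>x. f (\<Phi> (\<rho> x))) = f" if "f \<in> fun_alg Y F" for f
  proof -
    have "bar (\<lambda>x. f (\<Phi> (\<rho> x))) = restrict f Y" unfolding bar_def by (auto simp: \<sigma> \<rho>(2))
    then show ?thesis using extensional_restrict[OF fun_algebraD(1)[OF fun_algebra_fun_alg that]] by simp
  qed
  have bar_mem: "bar t \<in> fun_alg Y F" if "t \<in> A" for t using that bar A_eq by auto
  show ?thesis
  proof (intro bexI[of _ a] conjI allI impI)
    show "\<exists>y\<in>Y. a y \<noteq> 0" using t(2) a(2) \<Phi>\<rho> by (auto simp: fun_eq_iff)
    show "a \<in> fun_alg Y F" by (rule a(1))
    fix \<chi> assume "algchar Y (fun_alg Y F) \<chi> \<and> \<chi> a \<noteq> 0"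
    then have \<chi>: "algchar Y (fun_alg Y F) \<chi>" and nz: "\<chi> a \<noteq> 0" by auto
    have eqs: "bar (x + y) = (\<lambda>z\<in>Y. bar x z + bar y z)" "bar (x * y) = (\<lambda>z\<in>Y. bar x z * bar y z)" for x y
      by (auto simp: bar_def)
    have "char_on A 1 (\<lambda>t. \<chi> (bar t))"
      unfolding char_on_def
    proof (intro conjI ballI impI)
      show "\<chi> (bar 1) = 1" using \<chi> by (simp add: bar_def algchar_def)
      fix x assume x: "x \<in> A"
      have "bar 0 = (\<lambda>y\<in>Y. 0)" by (simp add: bar_def)
      then show "\<chi> (bar x) = 0" if "1 * x = 0" using that algcharD(1)[OF fun_algebra_fun_alg \<chi>, of 0] by simp
      fix y assume y: "y \<in> A"
      show "\<chi> (bar (x + y)) = \<chi> (bar x) + \<chi> (bar y)" "\<chi> (bar (x * y)) = \<chi> (bar x) * \<chi> (bar y)"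
        unfolding eqs using \<chi> bar_mem[OF x] bar_mem[OF y] by (auto simp: algchar_def)
    qed
    moreover have "\<chi> (bar t) \<noteq> 0" using nz bar[OF a(1)] a(2) by simp
    ultimately obtain \<chi>2 where \<chi>2: "char_on B 1 \<chi>2" "\<forall>x\<in>A. \<chi>2 x = \<chi> (bar x)" using ext by blast
    note D2 = char_onD[OF sB \<chi>2(1)]
    have "algchar X (fun_alg X F') (\<lambda>f. \<chi>2 (\<lambda>x. f (\<rho> x)))"
      unfolding algchar_def
    proof (intro conjI ballI allI)
      have "(\<lambda>x. (\<lambda>x\<in>X. 1) (\<rho> x)) = 1" using \<rho>(1) by (auto simp: fun_eq_iff)
      then show "\<chi>2 (\<lambda>x. (\<lambda>x\<in>X. 1) (\<rho> x)) = 1" by (rule trans[OF arg_cong[where f = \<chi>2] D2(1)])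
      fix f assume f: "f \<in> fun_alg X F'"
      then have fB: "(\<lambda>x. f (\<rho> x)) \<in> B" using B_sup by blast
      show "\<chi>2 (\<lambda>x. (\<lambda>x\<in>X. c * f x) (\<rho> x)) = c * \<chi>2 (\<lambda>x. f (\<rho> x))" for c
      proof -
        have "bar (\<lambda>_. c) = (\<lambda>y\<in>Y. c)" by (auto simp: bar_def)
        then have "\<chi>2 (\<lambda>_. c) = c" using \<chi>2(2) KA algcharD(1)[OF fun_algebra_fun_alg \<chi>, of c] by auto
        moreover have "(\<lambda>x. (\<lambda>x\<in>X. c * f x) (\<rho> x)) = (\<lambda>_. c) * (\<lambda>x. f (\<rho> x))"
          using \<rho>(1) by (auto simp: fun_eq_iff)
        moreover have "(\<lambda>_. c) \<in> B" using KA AB by blast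
        ultimately show ?thesis using D2(4)[OF _ fB, of "\<lambda>_. c"] by simp
      qed
      fix h assume h: "h \<in> fun_alg X F'"
      then have hB: "(\<lambda>x. h (\<rho> x)) \<in> B" using B_sup by blast
      have "(\<lambda>x. (\<lambda>x\<in>X. f x + h x) (\<rho> x)) = (\<lambda>x. f (\<rho> x)) + (\<lambda>x. h (\<rho> x))"
        "(\<lambda>x. (\<lambda>x\<in>X. f x * h x) (\<rho> x)) = (\<lambda>x. f (\<rho> x)) * (\<lambda>x. h (\<rho> x))"
        using \<rho>(1) by (auto simp: fun_eq_iff)
      then show "\<chi>2 (\<lambda>x. (\<lambda>x\<in>X. f x + h x) (\<rho> x)) = \<chi>2 (\<lambda>x. f (\<rho> x)) + \<chi>2 (\<lambda>x. h (\<rho> x))"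
        "\<chi>2 (\<lambda>x. (\<lambda>x\<in>X. f x * h x) (\<rho> x)) = \<chi>2 (\<lambda>x. f (\<rho> x)) * \<chi>2 (\<lambda>x. h (\<rho> x))"
        using D2(3,4)[OF fB hB] by simp_all
    qed
    moreover have "\<chi> f = \<chi>2 (\<lambda>x. (\<lambda>x\<in>X. f (\<Phi> x)) (\<rho> x))" if f: "f \<in> fun_alg Y F" for f
    proof -
      have "(\<lambda>x. (\<lambda>x\<in>X. f (\<Phi> x)) (\<rho> x)) = (\<lambda>x. f (\<Phi> (\<rho> x)))" using \<rho>(1) by (auto simp: fun_eq_iff)
      then show ?thesis using \<chi>2(2) bar[OF f] A_eq f by (metis image_eqI)
    qed
    ultimately show "\<exists>\<chi>'. algchar X (fun_alg X F') \<chi>' \<and> (\<forall>f\<in>fun_alg Y F. \<chi> f = \<chi>' (\<lambda>x\<in>X. f (\<Phi> x)))"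
      by (intro exI[of _ "\<lambda>f. \<chi>2 (\<lambda>x. f (\<rho> x))"]) blast
  qed
qed

section \<open>Affine algebraic groups\<close>

lemma points_base_alg:
  assumes "fun_algebra (carrier G) (regular G)"
  shows "\<chi> \<in> points G base_alg \<longleftrightarrow> \<chi> \<in> extensional (regular G) \<and> algchar (carrier G) (regular G) \<chi>"
  by (auto simp: points_def base_alg_def coord_ring_def algchar_def Ring.ring_hom_def simp del: restrict_apply)

lemma algchar_restrict:
  assumes "fun_algebra X A"
  shows "algchar X A (restrict \<chi> A) \<longleftrightarrow> algchar X A \<chi>"
proof -
  have "(\<lambda>x\<in>X. 1) \<in> A" "f \<in> A \<Longrightarrow> (\<lambda>x\<in>X. c * f x) \<in> A" for f c
    using fun_algebraD(2,5,6)[OF assms] by auto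
  then show ?thesis
    using assms unfolding algchar_def fun_algebra_def by (simp cong: ball_cong)
qed

text \<open>The form in which affineness is verified below: in terms of characters of the coordinate algebra rather than of
  points of the group functor.\<close>

lemma affine_alg_groupI:
  fixes G :: "('a, 'k::field) alg_group"
  assumes "group G" and F: "finite F" "regular G = fun_alg (carrier G) F"
    and sep: "\<And>x y. x \<in> carrier G \<Longrightarrow> y \<in> carrier G \<Longrightarrow> (\<And>f. f \<in> regular G \<Longrightarrow> f x = f y) \<Longrightarrow> x = y"
    and pts: "\<And>\<chi>. algchar (carrier G) (regular G) \<chi> \<Longrightarrow> \<exists>x\<in>carrier G. \<forall>f\<in>regular G. \<chi> f = f x"
    and inv: "\<And>f. f \<in> regular G \<Longrightarrow> (\<lambda>x\<in>carrier G. f (inv\<^bsub>G\<^esub> x)) \<in> regular G"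
    and mult: "\<And>f. f \<in> regular G \<Longrightarrow> (\<lambda>z\<in>carrier G \<times> carrier G. f (fst z \<otimes>\<^bsub>G\<^esub> snd z))
        \<in> tensor_funs (carrier G) (regular G) (carrier G) (regular G)"
  shows "affine_alg_group G"
proof -
  have fa: "fun_algebra (carrier G) (regular G)" unfolding F(2) by (rule fun_algebra_fun_alg)
  have "bij_betw (\<lambda>x. \<lambda>f\<in>regular G. f x) (carrier G) (points G base_alg)"
    unfolding bij_betw_def
  proof
    show "inj_on (\<lambda>x. \<lambda>f\<in>regular G. f x) (carrier G)"
    proof (rule inj_onI)
      fix x y assume xy: "x \<in> carrier G" "y \<in> carrier G" "(\<lambda>f\<in>regular G. f x) = (\<lambda>f\<in>regular G. f y)"
      show "x = y" by (rule sep[OF xy(1,2)]) (use fun_cong[OF xy(3)] in \<open>auto dest: meta_spec split: if_splits\<close>, metis restrict_apply')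
    qed
    show "(\<lambda>x. \<lambda>f\<in>regular G. f x) ` carrier G = points G base_alg"
    proof
      show "(\<lambda>x. \<lambda>f\<in>regular G. f x) ` carrier G \<subseteq> points G base_alg"
        using algchar_restrict[OF fa] by (auto simp: points_base_alg[OF fa] algchar_eval)
      show "points G base_alg \<subseteq> (\<lambda>x. \<lambda>f\<in>regular G. f x) ` carrier G"
      proof
        fix \<chi> assume "\<chi> \<in> points G base_alg"
        then have \<chi>: "\<chi> \<in> extensional (regular G)" "algchar (carrier G) (regular G) \<chi>"
          by (auto simp: points_base_alg[OF fa])
        obtain x where x: "x \<in> carrier G" "\<forall>f\<in>regular G. \<chi> f = f x" using pts[OF \<chi>(2)] by blast
        have "\<chi> = (\<lambda>f\<in>regular G. f x)" by (rule extensionalityI[OF \<chi>(1)]) (use x in auto)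
        then show "\<chi> \<in> (\<lambda>x. \<lambda>f\<in>regular G. f x) ` carrier G" using x(1) by blast
      qed
    qed
  qed
  moreover have "(\<lambda>(x, y)\<in>carrier G \<times> carrier G. f (x \<otimes>\<^bsub>G\<^esub> y))
        \<in> tensor_funs (carrier G) (regular G) (carrier G) (regular G)" if "f \<in> regular G" for f
    using mult[OF that] by (simp add: case_prod_unfold)
  ultimately show ?thesis using assms(1) F inv unfolding affine_alg_group_def by blast
qed

lemma affine_alg_groupD:
  fixes G :: "('a, 'k::field) alg_group"
  assumes G: "affine_alg_group G"
  shows "group G" "\<exists>F. finite F \<and> regular G = fun_alg (carrier G) F"
    "fun_algebra (carrier G) (regular G)"
    "x \<in> carrier G \<Longrightarrow> y \<in> carrier G \<Longrightarrow> (\<And>f. f \<in> regular G \<Longrightarrow> f x = f y) \<Longrightarrow> x = y"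
    "algchar (carrier G) (regular G) \<chi> \<Longrightarrow> \<exists>x\<in>carrier G. \<forall>f\<in>regular G. \<chi> f = f x"
    "f \<in> regular G \<Longrightarrow> (\<lambda>x\<in>carrier G. f (inv\<^bsub>G\<^esub> x)) \<in> regular G"
    "f \<in> regular G \<Longrightarrow> (\<lambda>z\<in>carrier G \<times> carrier G. f (fst z \<otimes>\<^bsub>G\<^esub> snd z))
        \<in> tensor_funs (carrier G) (regular G) (carrier G) (regular G)"
proof -
  show "group G" "f \<in> regular G \<Longrightarrow> (\<lambda>x\<in>carrier G. f (inv\<^bsub>G\<^esub> x)) \<in> regular G"
    and F: "\<exists>F. finite F \<and> regular G = fun_alg (carrier G) F"
    using G by (auto simp: affine_alg_group_def)
  show "f \<in> regular G \<Longrightarrow> (\<lambda>z\<in>carrier G \<times> carrier G. f (fst z \<otimes>\<^bsub>G\<^esub> snd z))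
        \<in> tensor_funs (carrier G) (regular G) (carrier G) (regular G)"
    using G by (auto simp: affine_alg_group_def case_prod_unfold)
  show fa: "fun_algebra (carrier G) (regular G)" using F fun_algebra_fun_alg by metis
  have bij: "bij_betw (\<lambda>x. \<lambda>f\<in>regular G. f x) (carrier G) (points G base_alg)"
    using G by (auto simp: affine_alg_group_def)
  show "x = y" if "x \<in> carrier G" "y \<in> carrier G" "\<And>f. f \<in> regular G \<Longrightarrow> f x = f y"
  proof -
    have "(\<lambda>f\<in>regular G. f x) = (\<lambda>f\<in>regular G. f y)" using that(3) by (auto simp: restrict_def)
    then show ?thesis using bij that(1,2) by (auto simp: bij_betw_def dest: inj_onD)
  qed
  show "\<exists>x\<in>carrier G. \<forall>f\<in>regular G. \<chi> f = f x" if "algchar (carrier G) (regular G) \<chi>"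
  proof -
    have "restrict \<chi> (regular G) \<in> points G base_alg"
      using that algchar_restrict[OF fa] by (simp add: points_base_alg[OF fa])
    then obtain x where "x \<in> carrier G" "restrict \<chi> (regular G) = (\<lambda>f\<in>regular G. f x)"
      using bij by (auto simp: bij_betw_def)
    then show ?thesis by (metis restrict_apply')
  qed
qed

section \<open>The general linear group\<close>

definition GL_gens :: "nat \<Rightarrow> ('k::field mat \<Rightarrow> 'k) set" where
  "GL_gens n = {(\<lambda>X. X $$ (i, j)) | i j. i < n \<and> j < n} \<union> {\<lambda>X. 1 / det X}"

lemma finite_GL_gens: "finite (GL_gens n)"
proof -
  have f: "finite ((\<lambda>(i, j) (X :: 'k::field mat). X $$ (i, j)) ` ({..<n} \<times> {..<n}))" by (intro finite_imageI) simp
  show ?thesis unfolding GL_gens_def by (rule finite_UnI[OF finite_subset[OF _ f]]) auto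
qed

lemma GL_carrier: "X \<in> carrier (GL n) \<longleftrightarrow> X \<in> carrier_mat n n \<and> det X \<noteq> 0"
proof -
  have "det X \<noteq> 0" if X: "X \<in> carrier_mat n n" "invertible_mat X"
  proof -
    obtain B where B: "X * B = 1\<^sub>m n" "B * X = 1\<^sub>m (dim_row B)"
      using X by (auto simp: invertible_mat_def inverts_mat_def)
    have "B \<in> carrier_mat n n" using B that(1) by (metis carrier_matD carrier_matI index_mult_mat(2,3) index_one_mat(2,3))
    then have "det X * det B = 1" using B(1) det_mult[OF that(1), of B] by simp
    then show ?thesis by auto
  qed
  moreover have "invertible_mat X" if X: "X \<in> carrier_mat n n" "det X \<noteq> 0"
  proof -
    let ?B = "(1 / det X) \<cdot>\<^sub>m adj_mat X"
    have "X * ?B = 1\<^sub>m n" "?B * X = 1\<^sub>m n"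
      using adj_mat[OF X(1)] X by (auto simp: mult_smult_distrib[OF X(1)] mult_smult_assoc_mat[OF adj_mat(1)[OF X(1)] X(1)])
    then show ?thesis using X adj_mat(1)[OF X(1)]
      by (auto simp: invertible_mat_def inverts_mat_def intro!: exI[of _ ?B])
  qed
  ultimately show ?thesis by (auto simp: GL_def)
qed

lemma GL_simps: "monoid.mult (GL n) = (*)" "one (GL n) = 1\<^sub>m n" "regular (GL n) = fun_alg (carrier (GL n)) (GL_gens n)"
  by (simp_all add: GL_def GL_gens_def)

lemma GL_memD: "X \<in> carrier (GL n) \<Longrightarrow> X \<in> carrier_mat n n"
  by (simp add: GL_carrier)

text \<open>Cramer's rule, which is also the reason why inversion is regular.\<close>

lemma GL_inv_adj:
  assumes "X \<in> carrier_mat n n" "det X \<noteq> 0"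
  shows "X * ((1 / det X) \<cdot>\<^sub>m adj_mat X) = 1\<^sub>m n" "((1 / det X) \<cdot>\<^sub>m adj_mat X) * X = 1\<^sub>m n"
    "(1 / det X) \<cdot>\<^sub>m adj_mat X \<in> carrier (GL n)"
proof -
  let ?B = "(1 / det X) \<cdot>\<^sub>m adj_mat X"
  show 1: "X * ?B = 1\<^sub>m n" "?B * X = 1\<^sub>m n"
    using adj_mat[OF assms(1)] assms by (auto simp: mult_smult_distrib[OF assms(1)] mult_smult_assoc_mat[OF adj_mat(1)[OF assms(1)] assms(1)])
  have B: "?B \<in> carrier_mat n n" using adj_mat(1)[OF assms(1)] by simp
  have "det X * det ?B = 1" using det_mult[OF assms(1) B] unfolding 1(1) det_one by (rule sym)
  then have "det ?B \<noteq> 0" by (metis mult_zero_right zero_neq_one)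
  then show "?B \<in> carrier (GL n)" using B unfolding GL_carrier by blast
qed

lemma group_GL: "group (GL n :: ('k::field mat, 'k) alg_group)"
proof -
  have 1: "x * y \<in> carrier (GL n)" if "x \<in> carrier (GL n)" "y \<in> carrier (GL n)" for x y :: "'k mat"
  proof -
    have xy: "x \<in> carrier_mat n n" "y \<in> carrier_mat n n" "det x \<noteq> 0" "det y \<noteq> 0" using that unfolding GL_carrier by blast+
    have "det (x * y) \<noteq> 0" unfolding det_mult[OF xy(1,2)] by (rule no_zero_divisors[OF xy(3,4)])
    then show ?thesis using mult_carrier_mat[OF xy(1,2)] unfolding GL_carrier by blast
  qed
  have 2: "x * y * z = x * (y * z)"
    if "x \<in> carrier (GL n)" "y \<in> carrier (GL n)" "z \<in> carrier (GL n)" for x y z :: "'k mat"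
    using that unfolding GL_carrier by (intro assoc_mult_mat[of _ n n _ n _ n]) auto
  have 3: "1\<^sub>m n * x = x" if "x \<in> carrier (GL n)" for x :: "'k mat"
    using that unfolding GL_carrier by (intro left_mult_one_mat) blast
  have 4: "\<exists>y\<in>carrier (GL n). y * x = 1\<^sub>m n" if "x \<in> carrier (GL n)" for x :: "'k mat"
  proof -
    have x: "x \<in> carrier_mat n n" "det x \<noteq> 0" using that unfolding GL_carrier by blast+
    show ?thesis by (intro bexI[of _ "(1 / det x) \<cdot>\<^sub>m adj_mat x"] GL_inv_adj(2,3)[OF x])
  qed
  have 5: "1\<^sub>m n \<in> carrier (GL n :: ('k mat, 'k) alg_group)" by (simp add: GL_carrier)
  show ?thesis
    by (rule Group.groupI) (simp_all only: GL_simps 1 2 3 4 5)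
qed

lemma GL_mult: "X \<in> carrier (GL n) \<Longrightarrow> Y \<in> carrier (GL n) \<Longrightarrow> X * Y \<in> carrier (GL n)"
  using monoid.m_closed[OF group.is_monoid[OF group_GL, of n], of X Y] by (simp add: GL_simps)

lemma GL_one: "1\<^sub>m n \<in> carrier (GL n)"
  using monoid.one_closed[OF group.is_monoid[OF group_GL, of n]] by (simp add: GL_simps)

lemma GL_inv:
  assumes "X \<in> carrier (GL n)"
  shows "inv\<^bsub>GL n\<^esub> X \<in> carrier (GL n)" "X * inv\<^bsub>GL n\<^esub> X = 1\<^sub>m n" "inv\<^bsub>GL n\<^esub> X * X = 1\<^sub>m n"
    "inv\<^bsub>GL n\<^esub> X \<in> carrier_mat n n"
  using group.inv_closed[OF group_GL assms] group.r_inv[OF group_GL assms] group.l_inv[OF group_GL assms]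
  by (auto simp: GL_simps GL_carrier)

lemma GL_inv_unique:
  assumes "X \<in> carrier (GL n)" "Y \<in> carrier_mat n n" "Y * X = 1\<^sub>m n"
  shows "inv\<^bsub>GL n\<^esub> X = Y"
proof -
  have "Y = Y * (X * inv\<^bsub>GL n\<^esub> X)" using assms(2) GL_inv(2)[OF assms(1)] by simp
  also have "\<dots> = Y * X * inv\<^bsub>GL n\<^esub> X"
    using assms GL_inv(4)[OF assms(1)] by (intro assoc_mult_mat[symmetric]) (auto simp: GL_carrier)
  also have "\<dots> = inv\<^bsub>GL n\<^esub> X" unfolding assms(3) by (rule left_mult_one_mat[OF GL_inv(4)[OF assms(1)]])
  finally show ?thesis by simp
qed

lemma GL_inv_eq: "X \<in> carrier (GL n) \<Longrightarrow> inv\<^bsub>GL n\<^esub> X = (1 / det X) \<cdot>\<^sub>m adj_mat X"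
  using GL_inv_adj[of X n] by (intro GL_inv_unique) (auto simp: GL_carrier)

section \<open>Regular matrix-valued maps\<close>

definition mat_regular :: "'a set \<Rightarrow> ('a \<Rightarrow> 'k::field) set \<Rightarrow> nat \<Rightarrow> ('a \<Rightarrow> 'k mat) \<Rightarrow> bool" where
  "mat_regular X A n \<phi> \<longleftrightarrow> (\<forall>x\<in>X. \<phi> x \<in> carrier_mat n n) \<and>
    (\<forall>i<n. \<forall>j<n. (\<lambda>x\<in>X. \<phi> x $$ (i, j)) \<in> A)"

definition gl_regular :: "'a set \<Rightarrow> ('a \<Rightarrow> 'k::field) set \<Rightarrow> nat \<Rightarrow> ('a \<Rightarrow> 'k mat) \<Rightarrow> bool" where
  "gl_regular X A n \<phi> \<longleftrightarrow> (\<forall>x\<in>X. \<phi> x \<in> carrier (GL n)) \<and>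
    (\<forall>f\<in>regular (GL n). (\<lambda>x\<in>X. f (\<phi> x)) \<in> A)"

lemma mat_regularD:
  assumes "mat_regular X A n \<phi>"
  shows "x \<in> X \<Longrightarrow> \<phi> x \<in> carrier_mat n n" "i < n \<Longrightarrow> j < n \<Longrightarrow> (\<lambda>x\<in>X. \<phi> x $$ (i, j)) \<in> A"
    "x \<in> X \<Longrightarrow> dim_row (\<phi> x) = n" "x \<in> X \<Longrightarrow> dim_col (\<phi> x) = n"
  using assms by (auto simp: mat_regular_def)

lemma mat_regular_cong:
  assumes "\<And>x. x \<in> X \<Longrightarrow> \<phi> x = \<psi> x" "mat_regular X A n \<phi>"
  shows "mat_regular X A n \<psi>"
  using assms(2) unfolding mat_regular_def
  by (auto simp: assms(1) intro: restrict_cong_mem[of X "\<lambda>x. \<phi> x $$ ij" "\<lambda>x. \<psi> x $$ ij" for ij])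

lemma mat_regularI:
  assumes "\<And>x. x \<in> X \<Longrightarrow> \<phi> x \<in> carrier_mat n n"
    and "\<And>i j. i < n \<Longrightarrow> j < n \<Longrightarrow> (\<lambda>x\<in>X. f i j x) \<in> A"
    and "\<And>x i j. x \<in> X \<Longrightarrow> i < n \<Longrightarrow> j < n \<Longrightarrow> f i j x = \<phi> x $$ (i, j)"
  shows "mat_regular X A n \<phi>"
  unfolding mat_regular_def
proof (intro conjI ballI allI impI)
  fix i j assume "i < n" "j < n"
  then show "(\<lambda>x\<in>X. \<phi> x $$ (i, j)) \<in> A"
    by (intro restrict_cong_mem[OF _ assms(2)[of i j]]) (simp_all add: assms(3))
qed (rule assms(1))

lemma mat_regular_const: "fun_algebra X A \<Longrightarrow> M \<in> carrier_mat n n \<Longrightarrow> mat_regular X A n (\<lambda>_. M)"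
  by (simp add: mat_regular_def fun_algebraD(2))

lemma mat_regular_add:
  assumes A: "fun_algebra X A" and "mat_regular X A n \<phi>" "mat_regular X A n \<psi>"
  shows "mat_regular X A n (\<lambda>x. \<phi> x + \<psi> x)"
  using mat_regularD[OF assms(2)] mat_regularD[OF assms(3)]
  by (intro mat_regularI[where f = "\<lambda>i j x. \<phi> x $$ (i, j) + \<psi> x $$ (i, j)"] fun_algebraD(3)[OF A]) (auto simp del: restrict_apply)

lemma mat_regular_mult:
  assumes A: "fun_algebra X A" and "mat_regular X A n \<phi>" "mat_regular X A n \<psi>"
  shows "mat_regular X A n (\<lambda>x. \<phi> x * \<psi> x)"
  using mat_regularD[OF assms(2)] mat_regularD[OF assms(3)]
  by (intro mat_regularI[where f = "\<lambda>i j x. \<Sum>l\<in>{0..<n}. \<phi> x $$ (i, l) * \<psi> x $$ (l, j)"] fun_algebra_sum[OF A] fun_algebraD(4)[OF A])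
    (auto simp: scalar_prod_def simp del: restrict_apply)

lemma mat_regular_smult:
  assumes A: "fun_algebra X A" and "(\<lambda>x\<in>X. c x) \<in> A" "mat_regular X A n \<phi>"
  shows "mat_regular X A n (\<lambda>x. c x \<cdot>\<^sub>m \<phi> x)"
  using mat_regularD[OF assms(3)] assms(2)
  by (intro mat_regularI[where f = "\<lambda>i j x. c x * \<phi> x $$ (i, j)"] fun_algebraD(4)[OF A]) (auto simp del: restrict_apply)

lemma regular_det:
  assumes A: "fun_algebra X A" and "mat_regular X A n \<phi>"
  shows "(\<lambda>x\<in>X. det (\<phi> x)) \<in> A"
proof -
  have "(\<lambda>x\<in>X. \<Sum>p\<in>{p. p permutes {0..<n}}. signof p * (\<Prod>i = 0..<n. \<phi> x $$ (i, p i))) \<in> A"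
    using permutes_in_image mat_regularD(2)[OF assms(2)]
    by (intro fun_algebra_sum[OF A] fun_algebraD(5)[OF A] fun_algebra_prod[OF A]) fastforce
  then show ?thesis
    by (rule restrict_cong_mem[rotated]) (simp add: det_def'[OF mat_regularD(1)[OF assms(2)]])
qed

lemma mat_regular_adj:
  assumes A: "fun_algebra X A" and \<phi>: "mat_regular X A n \<phi>"
  shows "mat_regular X A n (\<lambda>x. adj_mat (\<phi> x))"
proof (rule mat_regularI[where f = "\<lambda>i j x. (- 1) ^ (j + i) * det (mat_delete (\<phi> x) j i)"])
  show "adj_mat (\<phi> x) \<in> carrier_mat n n" if "x \<in> X" for x using adj_mat(1) mat_regularD(1)[OF \<phi> that] .
  show "(- 1) ^ (j + i) * det (mat_delete (\<phi> x) j i) = adj_mat (\<phi> x) $$ (i, j)"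
    if "x \<in> X" "i < n" "j < n" for x i j
    using that mat_regularD(3,4)[OF \<phi> that(1)] by (simp add: adj_mat_def cofactor_def)
  fix i j assume ij: "i < n" "j < n"
  have "mat_regular X A (n - 1) (\<lambda>x. mat_delete (\<phi> x) j i)"
  proof (rule mat_regularI[where f = "\<lambda>a b x. \<phi> x $$ (if a < j then a else Suc a, if b < i then b else Suc b)"])
    show "mat_delete (\<phi> x) j i \<in> carrier_mat (n - 1) (n - 1)" if "x \<in> X" for x
      using mat_regularD(3,4)[OF \<phi> that] by (intro carrier_matI) auto
    show "(\<lambda>x\<in>X. \<phi> x $$ (if a < j then a else Suc a, if b < i then b else Suc b)) \<in> A"
      if "a < n - 1" "b < n - 1" for a b
      using that by (intro mat_regularD(2)[OF \<phi>]) auto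
    show "\<phi> x $$ (if a < j then a else Suc a, if b < i then b else Suc b) = mat_delete (\<phi> x) j i $$ (a, b)"
      if "x \<in> X" "a < n - 1" "b < n - 1" for a b x
      using that mat_regularD(3,4)[OF \<phi> that(1)] by (simp add: mat_delete_def)
  qed
  then show "(\<lambda>x\<in>X. (- 1) ^ (j + i) * det (mat_delete (\<phi> x) j i)) \<in> A"
    by (intro fun_algebraD(5)[OF A] regular_det[OF A])
qed

lemma gl_regularD:
  assumes "gl_regular X A n \<phi>"
  shows "x \<in> X \<Longrightarrow> \<phi> x \<in> carrier (GL n)" "x \<in> X \<Longrightarrow> \<phi> x \<in> carrier_mat n n"
    "f \<in> regular (GL n) \<Longrightarrow> (\<lambda>x\<in>X. f (\<phi> x)) \<in> A"
  using assms by (auto simp: gl_regular_def GL_carrier)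

lemma regular_GL_entry:
  assumes "i < n" "j < n"
  shows "(\<lambda>X\<in>carrier (GL n). X $$ (i, j)) \<in> regular (GL n)"
  unfolding GL_simps by (rule fun_alg.gen) (use assms in \<open>auto simp: GL_gens_def\<close>)

lemma regular_GL_det: "(\<lambda>X\<in>carrier (GL n). 1 / det X) \<in> regular (GL n)"
  unfolding GL_simps by (rule fun_alg.gen) (auto simp: GL_gens_def)

lemma gl_regular_mat:
  assumes "gl_regular X A n \<phi>"
  shows "mat_regular X A n \<phi>" "(\<lambda>x\<in>X. 1 / det (\<phi> x)) \<in> A"
proof -
  show "mat_regular X A n \<phi>"
    unfolding mat_regular_def
  proof (intro conjI ballI allI impI)
    fix i j assume "i < n" "j < n"
    then show "(\<lambda>x\<in>X. \<phi> x $$ (i, j)) \<in> A"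
      by (intro restrict_cong_mem[OF _ gl_regularD(3)[OF assms regular_GL_entry[of i n j]]]) (simp_all add: gl_regularD(1)[OF assms])
  qed (rule gl_regularD(2)[OF assms])
  show "(\<lambda>x\<in>X. 1 / det (\<phi> x)) \<in> A"
    by (rule restrict_cong_mem[OF _ gl_regularD(3)[OF assms regular_GL_det]]) (simp_all add: gl_regularD(1)[OF assms])
qed

lemma gl_regularI:
  assumes A: "fun_algebra X A" and \<phi>: "mat_regular X A n \<phi>"
    and d: "\<And>x. x \<in> X \<Longrightarrow> det (\<phi> x) \<noteq> 0" "(\<lambda>x\<in>X. 1 / det (\<phi> x)) \<in> A"
  shows "gl_regular X A n \<phi>"
proof -
  have 1: "\<phi> x \<in> carrier (GL n)" if "x \<in> X" for x
    using that d(1) mat_regularD(1)[OF \<phi>] by (simp add: GL_carrier)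
  have "(\<lambda>x\<in>X. f (\<phi> x)) \<in> A" if "f \<in> regular (GL n)" for f
    by (rule fun_alg_pullback[OF A 1 _ that[unfolded GL_simps]])
      (auto simp: GL_gens_def d(2) mat_regularD(2)[OF \<phi>] simp del: restrict_apply)
  then show ?thesis using 1 by (simp add: gl_regular_def)
qed

lemma gl_regular_cong:
  assumes "\<And>x. x \<in> X \<Longrightarrow> \<phi> x = \<psi> x" "gl_regular X A n \<phi>"
  shows "gl_regular X A n \<psi>"
  using assms(2) unfolding gl_regular_def
  by (auto simp: assms(1) intro: restrict_cong_mem[of X "\<lambda>x. f (\<phi> x)" "\<lambda>x. f (\<psi> x)" for f])

lemma gl_regular_mult:
  assumes A: "fun_algebra X A" and \<phi>: "gl_regular X A n \<phi>" and \<psi>: "gl_regular X A n \<psi>"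
  shows "gl_regular X A n (\<lambda>x. \<phi> x * \<psi> x)"
proof (rule gl_regularI[OF A mat_regular_mult[OF A gl_regular_mat(1)[OF \<phi>] gl_regular_mat(1)[OF \<psi>]]])
  show "det (\<phi> x * \<psi> x) \<noteq> 0" if "x \<in> X" for x
    using GL_mult[OF gl_regularD(1)[OF \<phi> that] gl_regularD(1)[OF \<psi> that]] by (simp add: GL_carrier)
  show "(\<lambda>x\<in>X. 1 / det (\<phi> x * \<psi> x)) \<in> A"
    by (rule restrict_cong_mem[OF _ fun_algebraD(4)[OF A gl_regular_mat(2)[OF \<phi>] gl_regular_mat(2)[OF \<psi>]]])
      (simp add: det_mult[OF gl_regularD(2)[OF \<phi>] gl_regularD(2)[OF \<psi>]])
qed

lemma gl_regular_inv:
  assumes A: "fun_algebra X A" and \<phi>: "gl_regular X A n \<phi>"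
  shows "gl_regular X A n (\<lambda>x. inv\<^bsub>GL n\<^esub> (\<phi> x))"
proof (rule gl_regularI[OF A])
  show "mat_regular X A n (\<lambda>x. inv\<^bsub>GL n\<^esub> (\<phi> x))"
    by (rule mat_regular_cong[OF _ mat_regular_smult[OF A gl_regular_mat(2)[OF \<phi>] mat_regular_adj[OF A gl_regular_mat(1)[OF \<phi>]]]])
      (simp add: GL_inv_eq[OF gl_regularD(1)[OF \<phi>]])
  show "det (inv\<^bsub>GL n\<^esub> (\<phi> x)) \<noteq> 0" if "x \<in> X" for x
    using GL_inv(1)[OF gl_regularD(1)[OF \<phi> that]] by (simp add: GL_carrier)
  have "det (\<phi> x) = 1 / det (inv\<^bsub>GL n\<^esub> (\<phi> x))" if "x \<in> X" for x
  proof -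
    note g = gl_regularD(1,2)[OF \<phi> that]
    have "det (\<phi> x) * det (inv\<^bsub>GL n\<^esub> (\<phi> x)) = 1"
      using det_mult[OF g(2) GL_inv(4)[OF g(1)]] GL_inv(2)[OF g(1)] by simp
    then show ?thesis by (metis mult_zero_right nonzero_eq_divide_eq zero_neq_one)
  qed
  then show "(\<lambda>x\<in>X. 1 / det (inv\<^bsub>GL n\<^esub> (\<phi> x))) \<in> A"
    by (rule restrict_cong_mem[OF _ regular_det[OF A gl_regular_mat(1)[OF \<phi>]]])
qed

lemma gl_regular_const: "fun_algebra X A \<Longrightarrow> M \<in> carrier (GL n) \<Longrightarrow> gl_regular X A n (\<lambda>_. M)"
  by (simp add: gl_regular_def fun_algebraD(2))

lemma gl_regular_compose:
  fixes \<phi> :: "'b \<Rightarrow> 'k::field mat" and p :: "'a \<Rightarrow> 'b"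
  assumes \<phi>: "gl_regular Y B n \<phi>" and "\<And>x. x \<in> X \<Longrightarrow> p x \<in> Y" "\<And>b. b \<in> B \<Longrightarrow> (\<lambda>x\<in>X. b (p x)) \<in> A"
  shows "gl_regular X A n (\<lambda>x. \<phi> (p x))"
  unfolding gl_regular_def
proof (intro conjI ballI)
  fix f :: "'k mat \<Rightarrow> 'k" assume f: "f \<in> regular (GL n)"
  show "(\<lambda>x\<in>X. f (\<phi> (p x))) \<in> A"
    by (rule restrict_cong_mem[OF _ assms(3)[OF gl_regularD(3)[OF \<phi> f]]]) (simp add: assms(2))
qed (simp add: gl_regularD(1)[OF \<phi>] assms(2))

lemma fun_algebra_GL: "fun_algebra (carrier (GL n)) (regular (GL n))"
  unfolding GL_simps by (rule fun_algebra_fun_alg)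

lemma gl_regular_id: "gl_regular (carrier (GL n)) (regular (GL n)) n (\<lambda>X. X)"
  using fun_algebraD(6)[OF fun_algebra_GL] by (auto simp: gl_regular_def simp del: restrict_apply)

section \<open>Zariski closed subgroups of the general linear group\<close>

definition gl_closed :: "nat \<Rightarrow> 'k::field mat set \<Rightarrow> bool" where
  "gl_closed n \<Gamma> \<longleftrightarrow> \<Gamma> \<subseteq> carrier (GL n) \<and> (\<forall>M\<in>carrier (GL n).
     (\<forall>f\<in>regular (GL n). (\<forall>X\<in>\<Gamma>. f X = 0) \<longrightarrow> f M = 0) \<longrightarrow> M \<in> \<Gamma>)"

lemma restrict_fun_alg:
  assumes "Y \<subseteq> X"
  shows "(\<lambda>f. restrict f Y) ` fun_alg X F = fun_alg Y F"
proof
  show "(\<lambda>f. restrict f Y) ` fun_alg X F \<subseteq> fun_alg Y F"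
  proof
    fix g assume "g \<in> (\<lambda>f. restrict f Y) ` fun_alg X F"
    then obtain f where f: "f \<in> fun_alg X F" "g = restrict f Y" by auto
    show "g \<in> fun_alg Y F" unfolding f(2)
      by (rule fun_alg_pullback[OF fun_algebra_fun_alg _ fun_alg.gen f(1)]) (use assms in auto)
  qed
  have eq: "(\<lambda>x\<in>Y. g x) = restrict (restrict g X) Y" for g :: "'a \<Rightarrow> 'b"
    using subsetD[OF assms] by (intro ext) auto
  have eq2: "(\<lambda>x\<in>Y. restrict f Y x + restrict h Y x) = restrict (\<lambda>x\<in>X. f x + h x) Y"
    "(\<lambda>x\<in>Y. restrict f Y x * restrict h Y x) = restrict (\<lambda>x\<in>X. f x * h x) Y" for f h :: "'a \<Rightarrow> 'b"
    using subsetD[OF assms] by (auto intro!: ext)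
  show "fun_alg Y F \<subseteq> (\<lambda>f. restrict f Y) ` fun_alg X F"
  proof
    fix g assume "g \<in> fun_alg Y F"
    then show "g \<in> (\<lambda>f. restrict f Y) ` fun_alg X F"
    proof induction
      case (const c)
      show ?case by (rule image_eqI[where x = "\<lambda>x\<in>X. c"], rule eq, rule fun_alg.const)
    next
      case (gen f)
      show ?case by (rule image_eqI[where x = "restrict f X"], rule eq, rule fun_alg.gen[OF gen])
    next
      case (add f h)
      obtain f' h' where fh: "f' \<in> fun_alg X F" "f = restrict f' Y" "h' \<in> fun_alg X F" "h = restrict h' Y"
        using add.IH by blast
      show ?case unfolding fh(2,4) by (rule image_eqI[where x = "\<lambda>x\<in>X. f' x + h' x"], rule eq2, rule fun_alg.add[OF fh(1,3)])
    next
      case (mult f h)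
      obtain f' h' where fh: "f' \<in> fun_alg X F" "f = restrict f' Y" "h' \<in> fun_alg X F" "h = restrict h' Y"
        using mult.IH by blast
      show ?case unfolding fh(2,4) by (rule image_eqI[where x = "\<lambda>x\<in>X. f' x * h' x"], rule eq2, rule fun_alg.mult[OF fh(1,3)])
    qed
  qed
qed

lemma regular_sub_GL:
  assumes "\<Gamma> \<subseteq> carrier (GL n)"
  shows "regular (sub_alg_group (GL n) \<Gamma>) = fun_alg \<Gamma> (GL_gens n)"
  by (simp add: sub_alg_group_def GL_simps restrict_fun_alg[OF assms])

text \<open>The matrix \<open>M\<close> has as entries the values of \<open>\<chi>\<close> on the coordinate functions. It is invertible because \<open>\<chi>\<close> respects
  the polynomial \<open>det\<close> and the relation \<open>det X * (1 / det X) = 1\<close>.\<close>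

lemma algchar_sub_GL:
  fixes \<chi> :: "('k::field mat \<Rightarrow> 'k) \<Rightarrow> 'k"
  assumes \<Gamma>: "\<Gamma> \<subseteq> carrier (GL n)" and \<chi>: "algchar \<Gamma> (fun_alg \<Gamma> (GL_gens n)) \<chi>"
  shows "\<exists>M\<in>carrier (GL n). \<forall>f\<in>regular (GL n). \<chi> (restrict f \<Gamma>) = f M"
proof -
  let ?A = "fun_alg \<Gamma> (GL_gens n)"
  note A = fun_algebra_fun_alg[of \<Gamma> "GL_gens n"]
  have pull: "(\<lambda>x\<in>\<Gamma>. f x) \<in> ?A" if "f \<in> regular (GL n)" for f
    using that restrict_fun_alg[OF \<Gamma>, of "GL_gens n"] unfolding GL_simps by blast
  have id: "gl_regular \<Gamma> ?A n (\<lambda>X. X)" using \<Gamma> pull by (auto simp: gl_regular_def simp del: restrict_apply)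
  note idm = gl_regular_mat[OF id]
  define M where "M = mat n n (\<lambda>ij. \<chi> (\<lambda>X\<in>\<Gamma>. X $$ ij))"
  have M: "M \<in> carrier_mat n n" by (simp add: M_def)
  have "\<chi> (\<lambda>X\<in>\<Gamma>. det X) = \<chi> (\<lambda>X\<in>\<Gamma>. \<Sum>p\<in>{p. p permutes {0..<n}}. signof p * (\<Prod>i = 0..<n. X $$ (i, p i)))"
    by (rule arg_cong[where f = \<chi>], rule restrict_ext) (use \<Gamma> GL_memD in \<open>auto intro!: det_def'\<close>)
  also have "\<dots> = (\<Sum>p\<in>{p. p permutes {0..<n}}. \<chi> (\<lambda>X\<in>\<Gamma>. signof p * (\<Prod>i = 0..<n. X $$ (i, p i))))"
    using permutes_in_image mat_regularD(2)[OF idm(1)]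
    by (intro algchar_sum[OF A \<chi>] fun_algebraD(5)[OF A] fun_algebra_prod[OF A]) fastforce
  also have "\<dots> = (\<Sum>p\<in>{p. p permutes {0..<n}}. signof p * (\<Prod>i = 0..<n. M $$ (i, p i)))"
  proof (rule sum.cong[OF refl])
    fix p assume "p \<in> {p. p permutes {0..<n}}"
    then have p: "p i < n" if "i < n" for i using that permutes_in_image by fastforce
    have e: "(\<lambda>X\<in>\<Gamma>. X $$ (i, p i)) \<in> ?A" if "i \<in> {0..<n}" for i using p that mat_regularD(2)[OF idm(1)] by auto
    have "\<chi> (\<lambda>X\<in>\<Gamma>. signof p * (\<Prod>i = 0..<n. X $$ (i, p i))) = signof p * \<chi> (\<lambda>X\<in>\<Gamma>. \<Prod>i = 0..<n. X $$ (i, p i))"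
      by (rule algcharD(4)[OF A \<chi> fun_algebra_prod[OF A e]])
    also have "\<chi> (\<lambda>X\<in>\<Gamma>. \<Prod>i = 0..<n. X $$ (i, p i)) = (\<Prod>i = 0..<n. \<chi> (\<lambda>X\<in>\<Gamma>. X $$ (i, p i)))"
      by (rule algchar_prod[OF A \<chi> e])
    also have "\<dots> = (\<Prod>i = 0..<n. M $$ (i, p i))" by (rule prod.cong) (auto simp: M_def p)
    finally show "\<chi> (\<lambda>X\<in>\<Gamma>. signof p * (\<Prod>i = 0..<n. X $$ (i, p i))) = signof p * (\<Prod>i = 0..<n. M $$ (i, p i))" .
  qed
  also have "\<dots> = det M" by (rule det_def'[OF M, symmetric])
  finally have detM: "\<chi> (\<lambda>X\<in>\<Gamma>. det X) = det M" .
  have "\<chi> (\<lambda>X\<in>\<Gamma>. det X) * \<chi> (\<lambda>X\<in>\<Gamma>. 1 / det X) = \<chi> (\<lambda>X\<in>\<Gamma>. det X * (1 / det X))"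
    by (rule algcharD(3)[OF A \<chi> regular_det[OF A idm(1)] idm(2), symmetric])
  also have "(\<lambda>X\<in>\<Gamma>. det X * (1 / det X)) = (\<lambda>X\<in>\<Gamma>. 1)" using \<Gamma> by (intro restrict_ext) (auto simp: GL_carrier)
  also have "\<chi> \<dots> = 1" by (rule algcharD(1)[OF A \<chi>])
  finally have dd: "det M * \<chi> (\<lambda>X\<in>\<Gamma>. 1 / det X) = 1" unfolding detM .
  then have MG: "M \<in> carrier (GL n)" using M by (auto simp: GL_carrier)
  have c: "algchar (carrier (GL n)) (regular (GL n)) (\<lambda>f. \<chi> (\<lambda>x\<in>\<Gamma>. f x))"
    by (rule algchar_pullback[OF A \<chi>]) (use \<Gamma> pull in auto)
  have "\<chi> (\<lambda>x\<in>\<Gamma>. f x) = f M" if "f \<in> regular (GL n)" for f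
  proof (rule algchar_fun_alg_eval[OF c[unfolded GL_simps] MG _ that[unfolded GL_simps]])
    fix f :: "'k mat \<Rightarrow> 'k" assume f: "f \<in> GL_gens n"
    have "(\<lambda>x\<in>\<Gamma>. restrict f (carrier (GL n)) x) = (\<lambda>x\<in>\<Gamma>. f x)" using \<Gamma> by (intro restrict_ext) auto
    moreover have "\<chi> (\<lambda>x\<in>\<Gamma>. f x) = f M"
    proof -
      from f consider i j where "i < n" "j < n" "f = (\<lambda>X. X $$ (i, j))" | "f = (\<lambda>X. 1 / det X)"
        by (auto simp: GL_gens_def)
      then show ?thesis
      proof cases
        case 1
        then show ?thesis by (simp add: M_def del: restrict_apply)
      next
        case 2
        have "\<chi> (\<lambda>X\<in>\<Gamma>. 1 / det X) = 1 / det M" using dd by (metis mult.commute mult_zero_right nonzero_eq_divide_eq zero_neq_one)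
        then show ?thesis using 2 by simp
      qed
    qed
    ultimately show "\<chi> (\<lambda>x\<in>\<Gamma>. restrict f (carrier (GL n)) x) = f M" by simp
  qed
  then show ?thesis using MG by blast
qed

lemma algchar_gl_closed:
  fixes \<chi> :: "('k::field mat \<Rightarrow> 'k) \<Rightarrow> 'k"
  assumes \<Gamma>: "gl_closed n \<Gamma>" and \<chi>: "algchar \<Gamma> (fun_alg \<Gamma> (GL_gens n)) \<chi>"
  shows "\<exists>M\<in>\<Gamma>. \<forall>f\<in>fun_alg \<Gamma> (GL_gens n). \<chi> f = f M"
proof -
  have sub: "\<Gamma> \<subseteq> carrier (GL n)" using \<Gamma> by (simp add: gl_closed_def)
  obtain M where M: "M \<in> carrier (GL n)" "\<forall>f\<in>regular (GL n). \<chi> (restrict f \<Gamma>) = f M"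
    using algchar_sub_GL[OF sub \<chi>] by blast
  have "f M = 0" if "f \<in> regular (GL n)" "\<forall>X\<in>\<Gamma>. f X = 0" for f
  proof -
    have "restrict f \<Gamma> = (\<lambda>x\<in>\<Gamma>. 0)" using that(2) by (intro restrict_ext) auto
    then show ?thesis using M(2) that(1) algcharD(1)[OF fun_algebra_fun_alg \<chi>, of 0] by metis
  qed
  then have MG: "M \<in> \<Gamma>" using \<Gamma> M(1) by (auto simp: gl_closed_def)
  have "\<chi> f = f M" if "f \<in> fun_alg \<Gamma> (GL_gens n)" for f
  proof -
    have "f \<in> (\<lambda>f. restrict f \<Gamma>) ` regular (GL n)"
      using that unfolding GL_simps restrict_fun_alg[OF sub] .
    then obtain f' where f': "f' \<in> regular (GL n)" "f = restrict f' \<Gamma>" by blast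
    then show ?thesis using M(2) MG by simp
  qed
  then show ?thesis using MG by blast
qed

text \<open>A point of the closure of \<open>\<Gamma>\<close> evaluates functions on \<open>\<Gamma>\<close>, although it need not belong to \<open>\<Gamma>\<close>.\<close>

lemma algchar_comp_well_defined:
  fixes \<Gamma> :: "'k::field mat set"
  assumes \<Gamma>: "\<Gamma> \<subseteq> carrier (GL n)" and M: "M \<in> carrier (GL n)"
    and cl: "\<forall>f\<in>regular (GL n). (\<forall>X\<in>\<Gamma>. f X = 0) \<longrightarrow> f M = 0"
  shows "\<exists>\<chi>. algchar \<Gamma> (fun_alg \<Gamma> (GL_gens n)) \<chi> \<and> (\<forall>f\<in>regular (GL n). \<chi> (restrict f \<Gamma>) = f M)"
proof -
  note A = fun_algebra_GL[of n, where ?'a = 'k]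
  define \<chi> where "\<chi> g = (SOME f. f \<in> regular (GL n) \<and> restrict f \<Gamma> = g) M" for g
  have val: "\<chi> (restrict f \<Gamma>) = f M" if f: "f \<in> regular (GL n)" for f
  proof -
    define f' where "f' = (SOME f'. f' \<in> regular (GL n) \<and> restrict f' \<Gamma> = restrict f \<Gamma>)"
    have f': "f' \<in> regular (GL n) \<and> restrict f' \<Gamma> = restrict f \<Gamma>"
      unfolding f'_def by (rule someI[of _ f]) (use f in simp)
    let ?d = "\<lambda>X\<in>carrier (GL n). f' X + (- 1) * f X"
    have "?d \<in> regular (GL n)"
      using f f' by (intro fun_algebraD(3,5)[OF A] fun_algebraD(6)[OF A]) auto
    moreover have "?d X = 0" if "X \<in> \<Gamma>" for X
    proof -
      have "f' X = f X" using f' that by (metis restrict_apply')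
      then show ?thesis using that \<Gamma> by auto
    qed
    ultimately have "?d M = 0" using cl by blast
    then have "f' M = f M" using M by simp
    then show ?thesis unfolding \<chi>_def f'_def .
  qed
  have lift: "\<exists>f'\<in>regular (GL n). f = restrict f' \<Gamma>" if "f \<in> fun_alg \<Gamma> (GL_gens n)" for f
    using that unfolding restrict_fun_alg[OF \<Gamma>, symmetric] GL_simps by blast
  have "algchar \<Gamma> (fun_alg \<Gamma> (GL_gens n)) \<chi>"
    unfolding algchar_def
  proof (intro conjI ballI allI)
    have r: "restrict (\<lambda>X\<in>carrier (GL n). g X) \<Gamma> = restrict g \<Gamma>" for g :: "'k mat \<Rightarrow> 'k"
      using \<Gamma> by (intro restrict_ext) auto
    have val': "\<chi> (restrict g \<Gamma>) = g M" if "(\<lambda>X\<in>carrier (GL n). g X) \<in> regular (GL n)" for g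
      using val[OF that] M unfolding r by simp
    show "\<chi> (\<lambda>x\<in>\<Gamma>. 1) = 1" by (rule val'[OF fun_algebraD(2)[OF A]])
    fix f assume "f \<in> fun_alg \<Gamma> (GL_gens n)"
    then obtain f' where f': "f' \<in> regular (GL n)" "f = restrict f' \<Gamma>" using lift by blast
    note m = fun_algebraD(6)[OF A f'(1)]
    have e: "(\<lambda>x\<in>\<Gamma>. c * restrict f' \<Gamma> x) = (\<lambda>x\<in>\<Gamma>. c * f' x)" for c by (intro restrict_ext) simp
    show "\<chi> (\<lambda>x\<in>\<Gamma>. c * f x) = c * \<chi> f" for c
      unfolding f'(2) e val[OF f'(1)] by (rule val'[OF fun_algebraD(5)[OF A m]])
    fix h assume "h \<in> fun_alg \<Gamma> (GL_gens n)"
    then obtain h' where h': "h' \<in> regular (GL n)" "h = restrict h' \<Gamma>" using lift by blast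
    note mh = fun_algebraD(6)[OF A h'(1)]
    have e2: "(\<lambda>x\<in>\<Gamma>. restrict f' \<Gamma> x + restrict h' \<Gamma> x) = (\<lambda>x\<in>\<Gamma>. f' x + h' x)"
      "(\<lambda>x\<in>\<Gamma>. restrict f' \<Gamma> x * restrict h' \<Gamma> x) = (\<lambda>x\<in>\<Gamma>. f' x * h' x)" by (intro restrict_ext; simp)+
    show "\<chi> (\<lambda>x\<in>\<Gamma>. f x + h x) = \<chi> f + \<chi> h"
      unfolding f'(2) h'(2) e2 val[OF f'(1)] val[OF h'(1)] by (rule val'[OF fun_algebraD(3)[OF A m mh]])
    show "\<chi> (\<lambda>x\<in>\<Gamma>. f x * h x) = \<chi> f * \<chi> h"
      unfolding f'(2) h'(2) e2 val[OF f'(1)] val[OF h'(1)] by (rule val'[OF fun_algebraD(4)[OF A m mh]])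
  qed
  then show ?thesis using val by blast
qed

lemma GL_eqI:
  assumes "X \<in> carrier (GL n)" "Y \<in> carrier (GL n)" "\<And>f. f \<in> regular (GL n) \<Longrightarrow> f X = f Y"
  shows "X = Y"
proof (rule eq_matI)
  have d: "X \<in> carrier_mat n n" "Y \<in> carrier_mat n n" using assms(1,2) by (auto simp: GL_carrier)
  show "dim_row X = dim_row Y" "dim_col X = dim_col Y" using d by auto
  fix i j assume "i < dim_row Y" "j < dim_col Y"
  then have "i < n" "j < n" using d by auto
  from assms(3)[OF regular_GL_entry[OF this]] show "X $$ (i, j) = Y $$ (i, j)" using assms(1,2) by simp
qed

lemma regular_GL_translate:
  assumes f: "f \<in> regular (GL n)" and M: "M \<in> carrier (GL n)"
  shows "(\<lambda>X\<in>carrier (GL n). f (M * X)) \<in> regular (GL n)" "(\<lambda>X\<in>carrier (GL n). f (X * M)) \<in> regular (GL n)"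
    "(\<lambda>X\<in>carrier (GL n). f (inv\<^bsub>GL n\<^esub> X)) \<in> regular (GL n)"
proof -
  note A = fun_algebra_GL[of n, where ?'a = 'a]
  show "(\<lambda>X\<in>carrier (GL n). f (M * X)) \<in> regular (GL n)"
    by (rule gl_regularD(3)[OF gl_regular_mult[OF A gl_regular_const[OF A M] gl_regular_id] f])
  show "(\<lambda>X\<in>carrier (GL n). f (X * M)) \<in> regular (GL n)"
    by (rule gl_regularD(3)[OF gl_regular_mult[OF A gl_regular_id gl_regular_const[OF A M]] f])
  show "(\<lambda>X\<in>carrier (GL n). f (inv\<^bsub>GL n\<^esub> X)) \<in> regular (GL n)"
    by (rule gl_regularD(3)[OF gl_regular_inv[OF A gl_regular_id] f])
qed

text \<open>Let \<open>M\<close> be in the closure of \<open>Y = \<Phi>(X)\<close>. The points of the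
  closure where some function \<open>a\<close>, not identically zero on \<open>Y\<close>, does not vanish come from points of \<open>X\<close>, because their
  evaluation characters lift. Translating by a suitable \<open>z \<in> Y\<close> brings \<open>M\<close> to such a point \<open>M z\<close>, so \<open>M z\<close> and hence \<open>M\<close> lie in \<open>Y\<close>.\<close>

lemma gl_closed_image:
  fixes \<Phi> :: "'x \<Rightarrow> 'k::alg_closed_field mat"
  assumes fin: "finite F'" and aff: "\<And>\<chi>. algchar X (fun_alg X F') \<chi> \<Longrightarrow> \<exists>x\<in>X. \<forall>f\<in>fun_alg X F'. \<chi> f = f x"
    and \<Phi>: "gl_regular X (fun_alg X F') n \<Phi>" and sub: "subgroup (\<Phi> ` X) (GL n)"
  shows "gl_closed n (\<Phi> ` X)"
  unfolding gl_closed_def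
proof (intro conjI ballI impI)
  let ?Y = "\<Phi> ` X" and ?R = "regular (GL n :: ('k mat, 'k) alg_group)"
  show YG: "?Y \<subseteq> carrier (GL n)" by (rule subgroup.subset[OF sub])
  have Ym: "x * y \<in> ?Y" if "x \<in> ?Y" "y \<in> ?Y" for x y
    using subgroup.m_closed[OF sub that] by (simp add: GL_simps)
  have Yi: "inv\<^bsub>GL n\<^esub> x \<in> ?Y" if "x \<in> ?Y" for x
    by (rule subgroup.m_inv_closed[OF sub that])
  have ne: "X \<noteq> {}" using subgroup.one_closed[OF sub] by auto
  fix M assume M: "M \<in> carrier (GL n)" and "\<forall>f\<in>?R. (\<forall>X\<in>?Y. f X = 0) \<longrightarrow> f M = 0"
  then have cl: "f M = 0" if "f \<in> ?R" "\<And>x. x \<in> ?Y \<Longrightarrow> f x = 0" for f using that by blast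
  have pull: "(\<lambda>x\<in>X. f (\<Phi> x)) \<in> fun_alg X F'" if "f \<in> GL_gens n" for f
  proof -
    have "restrict f (carrier (GL n)) \<in> ?R" unfolding GL_simps by (rule fun_alg.gen[OF that])
    from gl_regularD(3)[OF \<Phi> this] show ?thesis
      by (rule restrict_cong_mem[rotated]) (simp add: gl_regularD(1)[OF \<Phi>])
  qed
  obtain a where a: "a \<in> fun_alg ?Y (GL_gens n)" "\<exists>y\<in>?Y. a y \<noteq> 0"
    and lift: "\<And>\<chi>. algchar ?Y (fun_alg ?Y (GL_gens n)) \<chi> \<Longrightarrow> \<chi> a \<noteq> 0 \<Longrightarrow>
      \<exists>\<chi>'. algchar X (fun_alg X F') \<chi>' \<and> (\<forall>f\<in>fun_alg ?Y (GL_gens n). \<chi> f = \<chi>' (\<lambda>x\<in>X. f (\<Phi> x)))"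
    using algchar_lifts_generically[where Y = ?Y and \<Phi> = \<Phi> and F = "GL_gens n" and F' = F', OF finite_GL_gens fin ne refl, OF pull]
    by blast
  obtain a' where a': "a' \<in> ?R" "a = restrict a' ?Y"
    using a(1) unfolding restrict_fun_alg[OF YG, symmetric] GL_simps by blast
  obtain y0 where y0: "y0 \<in> ?Y" "a' y0 \<noteq> 0" using a(2) a'(2) by auto
  \<comment> \<open>Otherwise \<open>a'(M z y0)\<close> vanishes for all \<open>z \<in> Y\<close>, hence also for \<open>z\<close> in the closure of \<open>Y\<close>. The closure contains the
    inverse of \<open>M\<close>, for which the value is \<open>a' y0 \<noteq> 0\<close>.\<close>
  have "\<exists>z\<in>?Y. a' (M * z) \<noteq> 0"
  proof (rule ccontr)
    assume "\<not> ?thesis"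
    then have z: "a' (M * z) = 0" if "z \<in> ?Y" for z using that by blast
    have clinv: "f (inv\<^bsub>GL n\<^esub> M) = 0" if "f \<in> ?R" "\<And>x. x \<in> ?Y \<Longrightarrow> f x = 0" for f
    proof -
      have "(\<lambda>X\<in>carrier (GL n). f (inv\<^bsub>GL n\<^esub> X)) M = 0"
        by (rule cl[OF regular_GL_translate(3)[OF that(1) M]]) (use that(2) Yi YG in auto)
      then show ?thesis using M by simp
    qed
    have y0G: "y0 \<in> carrier (GL n)" using y0 YG by blast
    let ?f = "\<lambda>X\<in>carrier (GL n). (\<lambda>X\<in>carrier (GL n). a' (M * X)) (X * y0)"
    have "?f (inv\<^bsub>GL n\<^esub> M) = 0"
    proof (rule clinv[OF regular_GL_translate(2)[OF regular_GL_translate(1)[OF a'(1) M] y0G]])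
      fix x assume x: "x \<in> ?Y"
      then have "x \<in> carrier (GL n)" "x * y0 \<in> carrier (GL n)" using YG Ym[OF x y0(1)] by blast+
      then show "?f x = 0" using z[OF Ym[OF x y0(1)]] by simp
    qed
    then have "a' (M * (inv\<^bsub>GL n\<^esub> M * y0)) = 0"
      using GL_inv(1)[OF M] GL_mult[OF GL_inv(1)[OF M] y0G] by simp
    moreover have "M * (inv\<^bsub>GL n\<^esub> M * y0) = M * inv\<^bsub>GL n\<^esub> M * y0"
      by (rule assoc_mult_mat[OF GL_memD[OF M] GL_inv(4)[OF M] GL_memD[OF y0G], symmetric])
    moreover have "M * inv\<^bsub>GL n\<^esub> M * y0 = y0"
      unfolding GL_inv(2)[OF M] by (rule left_mult_one_mat[OF GL_memD[OF y0G]])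
    ultimately show False using y0(2) by simp
  qed
  then obtain z where z: "z \<in> ?Y" "a' (M * z) \<noteq> 0" by blast
  have zG: "z \<in> carrier (GL n)" using z YG by blast
  have MzG: "M * z \<in> carrier (GL n)" by (rule GL_mult[OF M zG])
  have "f (M * z) = 0" if "f \<in> ?R" "\<forall>x\<in>?Y. f x = 0" for f
  proof -
    have "(\<lambda>X\<in>carrier (GL n). f (X * z)) M = 0"
    proof (rule cl[OF regular_GL_translate(2)[OF that(1) zG]])
      fix x assume x: "x \<in> ?Y"
      then have "f (x * z) = 0" "x \<in> carrier (GL n)" using that(2) Ym[OF x z(1)] YG by blast+
      then show "(\<lambda>X\<in>carrier (GL n). f (X * z)) x = 0" by simp
    qed
    then show ?thesis using M by simp
  qed
  then have "\<forall>f\<in>?R. (\<forall>x\<in>?Y. f x = 0) \<longrightarrow> f (M * z) = 0" by blast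
  from algchar_comp_well_defined[OF YG MzG this]
  obtain \<chi> where \<chi>: "algchar ?Y (fun_alg ?Y (GL_gens n)) \<chi>" "\<forall>f\<in>?R. \<chi> (restrict f ?Y) = f (M * z)"
    by blast
  have "\<chi> a \<noteq> 0" using \<chi>(2) a' z(2) by simp
  from lift[OF \<chi>(1) this] obtain \<chi>' where \<chi>': "algchar X (fun_alg X F') \<chi>'"
    "\<forall>f\<in>fun_alg ?Y (GL_gens n). \<chi> f = \<chi>' (\<lambda>x\<in>X. f (\<Phi> x))" by blast
  obtain x where x: "x \<in> X" "\<forall>f\<in>fun_alg X F'. \<chi>' f = f x" using aff[OF \<chi>'(1)] by blast
  have "M * z = \<Phi> x"
  proof (rule GL_eqI[OF MzG])
    show "\<Phi> x \<in> carrier (GL n)" by (rule gl_regularD(1)[OF \<Phi> x(1)])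
    fix f assume f: "f \<in> ?R"
    have fY: "restrict f ?Y \<in> fun_alg ?Y (GL_gens n)"
      using f unfolding restrict_fun_alg[OF YG, symmetric] GL_simps by blast
    have "f (M * z) = \<chi>' (\<lambda>x\<in>X. restrict f ?Y (\<Phi> x))" using \<chi>(2) \<chi>'(2) f fY by auto
    also have "(\<lambda>x\<in>X. restrict f ?Y (\<Phi> x)) = (\<lambda>x\<in>X. f (\<Phi> x))" by (intro restrict_ext) auto
    also have "\<chi>' \<dots> = f (\<Phi> x)" using x gl_regularD(3)[OF \<Phi> f] by simp
    finally show "f (M * z) = f (\<Phi> x)" .
  qed
  then have "M * z \<in> ?Y" using x(1) by blast
  then have "M * z * inv\<^bsub>GL n\<^esub> z \<in> ?Y" by (rule Ym[OF _ Yi[OF z(1)]])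
  moreover have "M * z * inv\<^bsub>GL n\<^esub> z = M * (z * inv\<^bsub>GL n\<^esub> z)"
    by (rule assoc_mult_mat[OF GL_memD[OF M] GL_memD[OF zG] GL_inv(4)[OF zG]])
  ultimately show "M \<in> ?Y" unfolding GL_inv(2)[OF zG] using GL_memD[OF M] by simp
qed

lemma affine_sub_GL:
  fixes \<Gamma> :: "'k::field mat set"
  assumes cl: "gl_closed n \<Gamma>" and sub: "subgroup \<Gamma> (GL n)"
  shows "affine_alg_group (sub_alg_group (GL n) \<Gamma>)"
proof -
  let ?S = "sub_alg_group (GL n) \<Gamma>" and ?A = "fun_alg \<Gamma> (GL_gens n)"
  note \<Gamma>G = subgroup.subset[OF sub]
  note A = fun_algebra_fun_alg[of \<Gamma> "GL_gens n"]
  have car: "carrier ?S = \<Gamma>" and mul: "x \<otimes>\<^bsub>?S\<^esub> y = x * y" and one: "\<one>\<^bsub>?S\<^esub> = 1\<^sub>m n" for x y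
    by (simp_all add: sub_alg_group_def GL_simps)
  note reg = regular_sub_GL[OF \<Gamma>G]
  have id: "gl_regular \<Gamma> ?A n (\<lambda>X. X)"
    using \<Gamma>G restrict_fun_alg[OF \<Gamma>G, of "GL_gens n"] unfolding gl_regular_def GL_simps by blast
  have grp: "group ?S"
  proof -
    have "group ((GL n)\<lparr>carrier := \<Gamma>\<rparr>)" by (rule group.subgroup_imp_group[OF group_GL sub])
    then show ?thesis
      unfolding group_def monoid_def group_axioms_def Units_def by (simp add: sub_alg_group_def)
  qed
  have inv: "inv\<^bsub>?S\<^esub> x = inv\<^bsub>GL n\<^esub> x" if "x \<in> \<Gamma>" for x
  proof (rule group.inv_equality[OF grp])
    show "inv\<^bsub>GL n\<^esub> x \<otimes>\<^bsub>?S\<^esub> x = \<one>\<^bsub>?S\<^esub>" using that \<Gamma>G GL_inv(3) unfolding mul one by blast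
    show "x \<in> carrier ?S" "inv\<^bsub>GL n\<^esub> x \<in> carrier ?S"
      unfolding car using that subgroup.m_inv_closed[OF sub that] by auto
  qed
  have lift: "\<exists>f'\<in>regular (GL n). f = restrict f' \<Gamma>" if "f \<in> ?A" for f
    using that unfolding restrict_fun_alg[OF \<Gamma>G, symmetric] GL_simps by blast
  show ?thesis
  proof (rule affine_alg_groupI[OF grp finite_GL_gens[of n]]; (unfold car reg)?)
    show "?A = ?A" ..
    show "\<exists>x\<in>\<Gamma>. \<forall>f\<in>?A. \<chi> f = f x" if "algchar \<Gamma> ?A \<chi>" for \<chi> by (rule algchar_gl_closed[OF cl that])
    show "x = y" if xy: "x \<in> \<Gamma>" "y \<in> \<Gamma>" "\<And>f. f \<in> ?A \<Longrightarrow> f x = f y" for x y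
    proof (rule GL_eqI)
      show "x \<in> carrier (GL n)" "y \<in> carrier (GL n)" using xy \<Gamma>G by auto
      fix f :: "'k mat \<Rightarrow> 'k" assume "f \<in> regular (GL n)"
      then have "restrict f \<Gamma> \<in> ?A" unfolding restrict_fun_alg[OF \<Gamma>G, symmetric] GL_simps by blast
      from xy(3)[OF this] show "f x = f y" using xy(1,2) by simp
    qed
    fix f assume f: "f \<in> ?A"
    obtain f' where f': "f' \<in> regular (GL n)" "f = restrict f' \<Gamma>" using lift[OF f] by blast
    show "(\<lambda>x\<in>\<Gamma>. f (inv\<^bsub>?S\<^esub> x)) \<in> ?A"
      by (rule restrict_cong_mem[OF _ gl_regularD(3)[OF gl_regular_inv[OF A id] f'(1)]])
        (simp add: f'(2) inv subgroup.m_inv_closed[OF sub])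
    let ?T = "tensor_funs \<Gamma> ?A \<Gamma> ?A"
    note T = fun_algebra_tensor[OF A A]
    have "gl_regular (\<Gamma> \<times> \<Gamma>) ?T n (\<lambda>z. fst z * snd z)"
      by (intro gl_regular_mult[OF T] gl_regular_compose[OF id, where p = fst] gl_regular_compose[OF id, where p = snd]
          tensor_funs_fst[OF A] tensor_funs_snd[OF A]) auto
    from gl_regularD(3)[OF this f'(1)]
    show "(\<lambda>z\<in>\<Gamma> \<times> \<Gamma>. f (fst z \<otimes>\<^bsub>?S\<^esub> snd z)) \<in> ?T"
      by (rule restrict_cong_mem[rotated]) (use subgroup.m_closed[OF sub] in \<open>auto simp: f'(2) mul GL_simps\<close>)
  qed
qed

section \<open>Linear algebra\<close>

text \<open>A linear map has a linear generalized inverse, with values in a prescribed subspace \<open>V\<close>: choose a right inverse of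
  its restriction to \<open>V\<close> and extend it. Both projections needed below are obtained from it.\<close>

lemma generalized_inverse:
  fixes T :: "('x \<Rightarrow> 'k::field) \<Rightarrow> ('y \<Rightarrow> 'k)"
  assumes add: "\<And>f g. T (\<lambda>x. f x + g x) = (\<lambda>y. T f y + T g y)"
    and scale: "\<And>c f. T (\<lambda>x. c * f x) = (\<lambda>y. c * T f y)"
    and V: "(\<lambda>_. 0) \<in> V" "\<And>f g. f \<in> V \<Longrightarrow> g \<in> V \<Longrightarrow> (\<lambda>x. f x + g x) \<in> V" "\<And>c f. f \<in> V \<Longrightarrow> (\<lambda>x. c * f x) \<in> V"
  obtains S where "\<And>f g. S (\<lambda>y. f y + g y) = (\<lambda>x. S f x + S g x)"
    "\<And>c f. S (\<lambda>y. c * f y) = (\<lambda>x. c * S f x)" "\<And>w. S w \<in> V" "\<And>v. v \<in> V \<Longrightarrow> T (S (T v)) = T v"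
proof -
  let ?s = "\<lambda>(c::'k) (f::'x \<Rightarrow> 'k) x. c * f x" and ?t = "\<lambda>(c::'k) (f::'y \<Rightarrow> 'k) x. c * f x"
  have 1: "vector_space ?s" and 2: "vector_space ?t"
    by (unfold_locales; simp add: fun_eq_iff algebra_simps)+
  interpret vector_space_pair ?s ?t by (simp add: vector_space_pair_def 1 2)
  have "Vector_Spaces.linear ?s ?t T"
    unfolding Vector_Spaces.linear_iff using 1 2 add scale by (simp add: plus_fun_def)
  moreover have "vs1.subspace V"
    using V by (auto simp: vs1.subspace_def plus_fun_def zero_fun_def)
  ultimately obtain S where S: "S ` UNIV \<subseteq> V" "Vector_Spaces.linear ?t ?s S" "\<forall>v\<in>T ` V. T (S v) = v"
    using linear_exists_right_inverse_on by blast
  show thesis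
  proof (rule that)
    show "S (\<lambda>y. f y + g y) = (\<lambda>x. S f x + S g x)" for f g
      using S(2) unfolding Vector_Spaces.linear_iff plus_fun_def by blast
    show "S (\<lambda>y. c * f y) = (\<lambda>x. c * S f x)" for c f using S(2) unfolding Vector_Spaces.linear_iff by blast
  qed (use S in auto)
qed

lemma linear_on_sum:
  fixes T :: "('x \<Rightarrow> 'k::field) \<Rightarrow> ('y \<Rightarrow> 'k)"
  assumes add: "\<And>f g. T (\<lambda>x. f x + g x) = (\<lambda>y. T f y + T g y)"
    and scale: "\<And>c f. T (\<lambda>x. c * f x) = (\<lambda>y. c * T f y)"
    and S: "finite S"
  shows "T (\<lambda>x. \<Sum>s\<in>S. c s * e s x) = (\<lambda>y. \<Sum>s\<in>S. c s * T (e s) y)"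
  using S
proof induction
  case empty
  show ?case using scale[of 0 "\<lambda>_. 0"] by simp
next
  case (insert s S)
  then show ?case using add[of "\<lambda>x. c s * e s x" "\<lambda>x. \<Sum>s\<in>S. c s * e s x"] scale[of "c s" "e s"] by simp
qed

definition vec_subspace :: "nat \<Rightarrow> 'k::field vec set \<Rightarrow> bool" where
  "vec_subspace n K \<longleftrightarrow> K \<subseteq> carrier_vec n \<and> 0\<^sub>v n \<in> K \<and> (\<forall>u\<in>K. \<forall>v\<in>K. u + v \<in> K) \<and> (\<forall>c. \<forall>v\<in>K. c \<cdot>\<^sub>v v \<in> K)"

definition mat_subspace :: "nat \<Rightarrow> 'k::field mat set \<Rightarrow> bool" where
  "mat_subspace n I \<longleftrightarrow> I \<subseteq> carrier_mat n n \<and> 0\<^sub>m n n \<in> I \<and> (\<forall>u\<in>I. \<forall>v\<in>I. u + v \<in> I) \<and> (\<forall>c. \<forall>v\<in>I. c \<cdot>\<^sub>m v \<in> I)"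

text \<open>A matrix \<open>E\<close> that projects onto \<open>L / (K \<inter> L)\<close> when everything is read modulo \<open>K\<close>.\<close>

lemma subquotient_projection:
  fixes K L :: "'k::field vec set"
  assumes K: "vec_subspace n K" and L: "vec_subspace n L"
  shows "\<exists>E\<in>carrier_mat n n. (\<forall>q\<in>carrier_vec n. E *\<^sub>v q \<in> L) \<and> (\<forall>q\<in>K. E *\<^sub>v q = 0\<^sub>v n) \<and>
    (\<forall>q\<in>L. \<exists>k\<in>K. E *\<^sub>v q = q + k)"
proof -
  define co where "co q = (\<lambda>i. if i < n then q $ i else 0)" for q :: "'k vec"
  have co_vec: "vec n (co q) = q" if "q \<in> carrier_vec n" for q
    using that by (intro eq_vecI) (auto simp: co_def)
  have sub: "(\<lambda>_. 0) \<in> co ` W" "f \<in> co ` W \<Longrightarrow> g \<in> co ` W \<Longrightarrow> (\<lambda>x. f x + g x) \<in> co ` W"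
    "f \<in> co ` W \<Longrightarrow> (\<lambda>x. c * f x) \<in> co ` W" if W: "vec_subspace n W" for W f g c
  proof -
    show "(\<lambda>_. 0) \<in> co ` W" using W by (intro image_eqI[of _ _ "0\<^sub>v n"]) (auto simp: co_def vec_subspace_def)
    have WC: "w \<in> carrier_vec n" if "w \<in> W" for w using W that by (auto simp: vec_subspace_def)
    show "(\<lambda>x. f x + g x) \<in> co ` W" if "f \<in> co ` W" "g \<in> co ` W"
    proof -
      obtain u v where uv: "u \<in> W" "f = co u" "v \<in> W" "g = co v" using \<open>f \<in> co ` W\<close> \<open>g \<in> co ` W\<close> by blast
      show ?thesis
        using W WC[OF uv(1)] WC[OF uv(3)] uv by (intro image_eqI[of _ _ "u + v"]) (auto simp: co_def vec_subspace_def)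
    qed
    show "(\<lambda>x. c * f x) \<in> co ` W" if "f \<in> co ` W"
    proof -
      obtain u where u: "u \<in> W" "f = co u" using \<open>f \<in> co ` W\<close> by blast
      show ?thesis
        using W WC[OF u(1)] u by (intro image_eqI[of _ _ "c \<cdot>\<^sub>v u"]) (auto simp: co_def vec_subspace_def)
    qed
  qed
  obtain P where P: "\<And>f g. P (\<lambda>y. f y + g y) = (\<lambda>x. P f x + P g x)"
    "\<And>c f. P (\<lambda>y. c * f y) = (\<lambda>x. c * P f x)" "\<And>w. P w \<in> co ` K" "\<And>v. v \<in> co ` K \<Longrightarrow> P v = v"
    using generalized_inverse[of "\<lambda>f. f" "co ` K", OF refl refl sub[OF K]] by blast
  define T where "T f = (\<lambda>x. f x + (- 1) * P f x)" for f
  have Tadd: "T (\<lambda>x. f x + g x) = (\<lambda>y. T f y + T g y)" for f g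
    unfolding T_def P(1) by (simp add: fun_eq_iff algebra_simps)
  have Tsc: "T (\<lambda>x. c * f x) = (\<lambda>y. c * T f y)" for c f
    unfolding T_def P(2) by (simp add: fun_eq_iff algebra_simps)
  obtain S where S: "\<And>f g. S (\<lambda>y. f y + g y) = (\<lambda>x. S f x + S g x)"
    "\<And>c f. S (\<lambda>y. c * f y) = (\<lambda>x. c * S f x)" "\<And>w. S w \<in> co ` L" "\<And>v. v \<in> co ` L \<Longrightarrow> T (S (T v)) = T v"
    using generalized_inverse[of T "co ` L", OF Tadd Tsc sub[OF L]] by blast
  let ?F = "\<lambda>f. S (T f)"
  have Fadd: "?F (\<lambda>x. f x + g x) = (\<lambda>y. ?F f y + ?F g y)" for f g unfolding Tadd S(1) ..
  have Fsc: "?F (\<lambda>x. c * f x) = (\<lambda>y. c * ?F f y)" for c f unfolding Tsc S(2) ..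
  define E where "E = mat n n (\<lambda>(i, j). ?F (\<lambda>l. if l = j then 1 else 0) i)"
  have E: "E *\<^sub>v q = vec n (?F (co q))" if q: "q \<in> carrier_vec n" for q
  proof -
    have "co q = (\<lambda>l. \<Sum>j\<in>{0..<n}. q $ j * (if l = j then 1 else 0))"
    proof
      fix l
      have "(\<Sum>j\<in>{0..<n}. q $ j * (if l = j then 1 else 0)) = (\<Sum>j\<in>{0..<n}. if j = l then q $ j else 0)"
        by (rule sum.cong) auto
      then show "co q l = (\<Sum>j\<in>{0..<n}. q $ j * (if l = j then 1 else 0))"
        by (simp add: co_def)
    qed
    then have "?F (co q) = (\<lambda>i. \<Sum>j\<in>{0..<n}. q $ j * ?F (\<lambda>l. if l = j then 1 else 0) i)"
      by (simp only: linear_on_sum[of ?F, OF Fadd Fsc finite_atLeastLessThan])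
    then show ?thesis
      using q by (intro eq_vecI) (auto simp: E_def scalar_prod_def mult.commute intro!: sum.cong)
  qed
  have KC: "K \<subseteq> carrier_vec n" and LC: "L \<subseteq> carrier_vec n" using K L by (auto simp: vec_subspace_def)
  show ?thesis
  proof (intro bexI[of _ E] conjI ballI)
    fix q :: "'k vec" assume q: "q \<in> carrier_vec n"
    obtain l where l: "l \<in> L" "?F (co q) = co l" using S(3) by blast
    then show "E *\<^sub>v q \<in> L" using E[OF q] co_vec LC by auto
  next
    fix q assume q: "q \<in> K"
    then have "T (co q) = (\<lambda>_. 0)" by (auto simp: T_def P(4))
    then have "?F (co q) = (\<lambda>_. 0)" using S(2)[of 0 "\<lambda>_. 0"] by simp
    moreover have "E *\<^sub>v q = vec n (?F (co q))" using E q KC by blast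
    ultimately show "E *\<^sub>v q = 0\<^sub>v n" by (simp add: zero_vec_def)
  next
    fix q assume q: "q \<in> L"
    obtain l where l: "l \<in> L" "?F (co q) = co l" using S(3) by blast
    have qC: "q \<in> carrier_vec n" and lC: "l \<in> carrier_vec n" using q l(1) LC by blast+
    have El: "E *\<^sub>v q = l" using E[OF qC] l(2) co_vec[OF lC] by simp
    define d where "d = (\<lambda>i. co l i + (- 1) * co q i)"
    have "T d = (\<lambda>i. T (co l) i + (- 1) * T (co q) i)" unfolding d_def Tadd Tsc ..
    also have "\<dots> = (\<lambda>_. 0)" using S(4)[of "co q"] q l(2) by auto
    finally have Pd: "P d = d" by (simp add: T_def fun_eq_iff)
    have "P d \<in> co ` K" by (rule P(3))
    then obtain k where k: "k \<in> K" "d = co k" unfolding Pd by blast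
    have "l = q + k"
    proof (rule eq_vecI)
      have dims: "dim_vec l = n" "dim_vec q = n" "dim_vec k = n" using qC lC k(1) KC by auto
      then show "dim_vec l = dim_vec (q + k)" by simp
      fix i assume "i < dim_vec (q + k)"
      then have i: "i < n" using dims by simp
      have "d i = k $ i" unfolding k(2) using i by (simp add: co_def)
      moreover have "d i = l $ i - q $ i" unfolding d_def using i by (simp add: co_def)
      ultimately have "k $ i = l $ i - q $ i" by simp
      then show "l $ i = (q + k) $ i" using i dims by simp
    qed
    then show "\<exists>k\<in>K. E *\<^sub>v q = q + k" using El k by blast
  qed (simp add: E_def)
qed

text \<open>The general linear endomorphism of the space of matrices, given by its structure constants, so that its regularity
  is evident.\<close>

definition mat_lin :: "nat \<Rightarrow> (nat \<Rightarrow> nat \<Rightarrow> nat \<Rightarrow> nat \<Rightarrow> 'k::field) \<Rightarrow> 'k mat \<Rightarrow> 'k mat" where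
  "mat_lin n c M = mat n n (\<lambda>(i, j). \<Sum>a\<in>{0..<n}. \<Sum>b\<in>{0..<n}. c i j a b * M $$ (a, b))"

lemma mat_lin_carrier: "mat_lin n c M \<in> carrier_mat n n"
  by (simp add: mat_lin_def)

lemma mat_lin_add:
  "A \<in> carrier_mat n n \<Longrightarrow> B \<in> carrier_mat n n \<Longrightarrow> mat_lin n c (A + B) = mat_lin n c A + mat_lin n c B"
  by (intro eq_matI) (auto simp: mat_lin_def algebra_simps sum.distrib)

lemma mat_lin_regular:
  assumes A: "fun_algebra X A" and \<phi>: "mat_regular X A n \<phi>"
  shows "mat_regular X A n (\<lambda>x. mat_lin n c (\<phi> x))"
  using mat_regularD(2)[OF \<phi>]
  by (intro mat_regularI[where f = "\<lambda>i j x. \<Sum>a\<in>{0..<n}. \<Sum>b\<in>{0..<n}. c i j a b * \<phi> x $$ (a, b)"]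
      fun_algebra_sum[OF A] fun_algebraD(5)[OF A]) (auto simp: mat_lin_def simp del: restrict_apply)

text \<open>Right multiplication by \<open>E\<close> is a linear map on \<open>I\<close>; \<open>mat_lin n c\<close> is a generalized inverse of it with values in \<open>I\<close>. It
  recovers an element \<open>j\<close> of \<open>I\<close> from \<open>j * E\<close>, up to its action off the image of \<open>E\<close>. For \<open>E = 1\<close> it is a projection onto \<open>I\<close>.\<close>

lemma mat_projection:
  fixes I :: "'k::field mat set"
  assumes I: "mat_subspace n I" and E: "E \<in> carrier_mat n n"
  shows "\<exists>c. (\<forall>M\<in>carrier_mat n n. mat_lin n c M \<in> I) \<and> (\<forall>j\<in>I. mat_lin n c (j * E) * E = j * E)"
proof -
  define co where "co M = (\<lambda>(i, j). if i < n \<and> j < n then M $$ (i, j) else 0)" for M :: "'k mat"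
  have co_mat: "mat n n (co M) = M" if "M \<in> carrier_mat n n" for M
    using that by (intro eq_matI) (auto simp: co_def)
  have IC: "w \<in> carrier_mat n n" if "w \<in> I" for w using I that by (auto simp: mat_subspace_def)
  define T where "T f = co (mat n n f * E)" for f
  have Tadd: "T (\<lambda>x. f x + g x) = (\<lambda>y. T f y + T g y)" for f g
  proof -
    have "mat n n (\<lambda>x. f x + g x) = mat n n f + mat n n g" by (intro eq_matI) auto
    moreover have "(mat n n f + mat n n g) * E = mat n n f * E + mat n n g * E"
      by (rule add_mult_distrib_mat) (use E in auto)
    ultimately show ?thesis using E unfolding T_def by (auto simp: co_def fun_eq_iff)
  qed
  have Tsc: "T (\<lambda>x. c * f x) = (\<lambda>y. c * T f y)" for c f
  proof -
    have "mat n n (\<lambda>x. c * f x) = c \<cdot>\<^sub>m mat n n f" by (intro eq_matI) auto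
    moreover have "(c \<cdot>\<^sub>m mat n n f) * E = c \<cdot>\<^sub>m (mat n n f * E)"
      by (rule mult_smult_assoc_mat) (use E in auto)
    ultimately show ?thesis using E unfolding T_def by (auto simp: co_def fun_eq_iff)
  qed
  have sub0: "(\<lambda>_. 0) \<in> co ` I" using I by (intro image_eqI[of _ _ "0\<^sub>m n n"]) (auto simp: co_def mat_subspace_def)
  have sub1: "(\<lambda>x. f x + g x) \<in> co ` I" if fg: "f \<in> co ` I" "g \<in> co ` I" for f g
  proof -
    obtain u v where uv: "u \<in> I" "f = co u" "v \<in> I" "g = co v" using fg by blast
    show ?thesis
      using I IC[OF uv(1)] IC[OF uv(3)] uv by (intro image_eqI[of _ _ "u + v"]) (auto simp: co_def mat_subspace_def)
  qed
  have sub2: "(\<lambda>x. c * f x) \<in> co ` I" if f: "f \<in> co ` I" for c f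
  proof -
    obtain u where u: "u \<in> I" "f = co u" using f by blast
    show ?thesis
      using I IC[OF u(1)] u by (intro image_eqI[of _ _ "c \<cdot>\<^sub>m u"]) (auto simp: co_def mat_subspace_def)
  qed
  obtain S where S: "\<And>f g. S (\<lambda>y. f y + g y) = (\<lambda>x. S f x + S g x)"
    "\<And>c f. S (\<lambda>y. c * f y) = (\<lambda>x. c * S f x)" "\<And>w. S w \<in> co ` I" "\<And>v. v \<in> co ` I \<Longrightarrow> T (S (T v)) = T v"
    using generalized_inverse[of T "co ` I", OF Tadd Tsc sub0 sub1 sub2] by blast
  define e :: "nat \<times> nat \<Rightarrow> nat \<times> nat \<Rightarrow> 'k" where "e p = (\<lambda>l. if l = p then 1 else 0)" for p
  define c where "c i j a b = S (e (a, b)) (i, j)" for i j a b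
  have lin: "mat_lin n c M = mat n n (S (co M))" if M: "M \<in> carrier_mat n n" for M
  proof -
    have "co M = (\<lambda>l. \<Sum>p\<in>{0..<n} \<times> {0..<n}. M $$ p * e p l)"
    proof
      fix l
      have "(\<Sum>p\<in>{0..<n} \<times> {0..<n}. M $$ p * e p l) = (\<Sum>p\<in>{0..<n} \<times> {0..<n}. if p = l then M $$ p else 0)"
        by (rule sum.cong) (auto simp: e_def)
      then show "co M l = (\<Sum>p\<in>{0..<n} \<times> {0..<n}. M $$ p * e p l)"
        by (cases l) (auto simp: co_def)
    qed
    then have "S (co M) = (\<lambda>l. \<Sum>p\<in>{0..<n} \<times> {0..<n}. M $$ p * S (e p) l)"
      by (simp only: linear_on_sum[of S, OF S(1,2) finite_cartesian_product[OF finite_atLeastLessThan finite_atLeastLessThan]])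
    then show ?thesis
      by (intro eq_matI) (auto simp: mat_lin_def c_def sum.cartesian_product case_prod_unfold mult.commute intro!: sum.cong)
  qed
  show ?thesis
  proof (intro exI[of _ c] conjI ballI)
    fix M :: "'k mat" assume M: "M \<in> carrier_mat n n"
    obtain w where "w \<in> I" "S (co M) = co w" using S(3) by blast
    then show "mat_lin n c M \<in> I" using lin[OF M] co_mat IC by simp
  next
    fix j assume j: "j \<in> I"
    have jE: "j * E \<in> carrier_mat n n" using IC[OF j] E by simp
    have Tj: "T (co j) = co (j * E)" unfolding T_def co_mat[OF IC[OF j]] ..
    have "T (S (T (co j))) = T (co j)" using S(4) j by blast
    then have "T (S (co (j * E))) = co (j * E)" unfolding Tj .
    moreover have "T (S (co (j * E))) = co (mat_lin n c (j * E) * E)" unfolding T_def lin[OF jE] ..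
    ultimately have "co (mat_lin n c (j * E) * E) = co (j * E)" by simp
    moreover have "mat_lin n c (j * E) * E \<in> carrier_mat n n" by (rule mult_carrier_mat[OF mat_lin_carrier E])
    ultimately show "mat_lin n c (j * E) * E = j * E" using co_mat jE by metis
  qed
qed

lemma mat_eq_vecI:
  fixes A B :: "'k::field mat"
  assumes A: "A \<in> carrier_mat n n" "B \<in> carrier_mat n n"
    and eq: "\<And>q. q \<in> carrier_vec n \<Longrightarrow> A *\<^sub>v q = B *\<^sub>v q"
  shows "A = B"
proof (rule eq_matI)
  show "dim_row A = dim_row B" "dim_col A = dim_col B" using A by auto
  fix i j assume "i < dim_row B" "j < dim_col B"
  then have ij: "i < n" "j < n" using A by auto
  have u: "(C *\<^sub>v unit_vec n j) $ i = C $$ (i, j)" if "C \<in> carrier_mat n n" for C :: "'k mat"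
    using that ij by (simp add: scalar_prod_right_unit)
  show "A $$ (i, j) = B $$ (i, j)" using eq[OF unit_vec_carrier[of n j]] u[OF A(1)] u[OF A(2)] by simp
qed

lemma mat_add_cancel: "A \<in> carrier_mat n n \<Longrightarrow> B \<in> carrier_mat n n \<Longrightarrow> A + (- 1) \<cdot>\<^sub>m B + B = (A :: 'k::field mat)"
  by (intro eq_matI) auto

lemma mat_diff_zero:
  fixes A B :: "'k::field mat"
  assumes "A \<in> carrier_mat n n" "B \<in> carrier_mat n n" "A + (- 1) \<cdot>\<^sub>m B = 0\<^sub>m n n"
  shows "A = B"
proof -
  have "A = A + (- 1) \<cdot>\<^sub>m B + B" using mat_add_cancel[OF assms(1,2)] by simp
  also have "\<dots> = B" unfolding assms(3) by (rule left_add_zero_mat[OF assms(2)])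
  finally show ?thesis .
qed

lemma zero_mult_vec: "q \<in> carrier_vec n \<Longrightarrow> 0\<^sub>m n n *\<^sub>v q = (0\<^sub>v n :: 'k::field vec)"
  by (intro eq_vecI) auto

section \<open>Unipotent groups of the form 1 + J\<close>

text \<open>The vectors killed by all products of \<open>a\<close> elements of \<open>J\<close>.\<close>

primrec ker_flag :: "nat \<Rightarrow> 'k::field mat set \<Rightarrow> nat \<Rightarrow> 'k vec set" where
  "ker_flag n J 0 = {0\<^sub>v n}"
| "ker_flag n J (Suc a) = {q \<in> carrier_vec n. \<forall>j\<in>J. j *\<^sub>v q \<in> ker_flag n J a}"

text \<open>The partial sums of the geometric series for the inverse of \<open>1 - i\<close>.\<close>

primrec neumann :: "nat \<Rightarrow> 'k::field mat \<Rightarrow> nat \<Rightarrow> 'k mat" where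
  "neumann n i 0 = 1\<^sub>m n"
| "neumann n i (Suc t) = 1\<^sub>m n + i * neumann n i t"

lemma mat_subspaceD:
  assumes "mat_subspace n I"
  shows "v \<in> I \<Longrightarrow> v \<in> carrier_mat n n" "0\<^sub>m n n \<in> I" "u \<in> I \<Longrightarrow> v \<in> I \<Longrightarrow> u + v \<in> I" "v \<in> I \<Longrightarrow> c \<cdot>\<^sub>m v \<in> I"
  using assms by (auto simp: mat_subspace_def)

lemma vec_subspaceD:
  assumes "vec_subspace n I"
  shows "v \<in> I \<Longrightarrow> v \<in> carrier_vec n" "0\<^sub>v n \<in> I" "u \<in> I \<Longrightarrow> v \<in> I \<Longrightarrow> u + v \<in> I" "v \<in> I \<Longrightarrow> c \<cdot>\<^sub>v v \<in> I"
  using assms by (auto simp: vec_subspace_def)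

lemma mult_zero_vec: "A \<in> carrier_mat n n \<Longrightarrow> A *\<^sub>v 0\<^sub>v n = (0\<^sub>v n :: 'k::field vec)"
  by (intro eq_vecI) auto

lemma smult_mat_vec: "A \<in> carrier_mat n n \<Longrightarrow> q \<in> carrier_vec n \<Longrightarrow> (c \<cdot>\<^sub>m A) *\<^sub>v q = c \<cdot>\<^sub>v (A *\<^sub>v (q :: 'k::field vec))"
  by (intro eq_vecI) (auto simp: scalar_prod_def sum_distrib_left mult.assoc)

lemma one_plus_mult_vec:
  "j \<in> carrier_mat n n \<Longrightarrow> q \<in> carrier_vec n \<Longrightarrow> (1\<^sub>m n + j) *\<^sub>v q = q + j *\<^sub>v (q :: 'k::field vec)"
  by (simp add: add_mult_distrib_mat_vec[of _ n n])

text \<open>Nilpotency of \<open>J\<close> is expressed by the flag of kernels exhausting the space. Its steps \<open>K a\<close> are preserved by every matrix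
  that normalizes \<open>J\<close> (the predicate \<open>stab\<close>), and the annihilators \<open>I a\<close> of the steps filter \<open>J\<close>, from \<open>I 0 = J\<close> down to zero.\<close>

locale nil_algebra =
  fixes n :: nat and J :: "'k::field mat set"
  assumes J: "mat_subspace n J" and J_mult: "i \<in> J \<Longrightarrow> j \<in> J \<Longrightarrow> i * j \<in> J"
    and nil: "\<exists>m. carrier_vec n \<subseteq> ker_flag n J m"
begin

abbreviation K where "K \<equiv> ker_flag n J"
abbreviation C where "C \<equiv> carrier_mat n n :: 'k mat set"
definition U where "U = (\<lambda>X. 1\<^sub>m n + X) ` J"
definition I where "I a = {j \<in> J. \<forall>q\<in>K a. j *\<^sub>v q = 0\<^sub>v n}"
definition stab where "stab X \<longleftrightarrow> X \<in> carrier (GL n) \<and> (\<forall>j\<in>J. X * j * inv\<^bsub>GL n\<^esub> X \<in> J \<and> inv\<^bsub>GL n\<^esub> X * j * X \<in> J)"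

lemmas JD = mat_subspaceD[OF J]

lemma K_sub: "vec_subspace n (K a)"
proof (induction a)
  case 0
  then show ?case by (auto simp: vec_subspace_def)
next
  case (Suc a)
  note D = vec_subspaceD[OF Suc]
  show ?case unfolding vec_subspace_def
  proof (intro conjI ballI allI)
    show "0\<^sub>v n \<in> K (Suc a)" using D(2) JD(1) by (auto simp: mult_zero_vec)
    fix u v assume uv: "u \<in> K (Suc a)" "v \<in> K (Suc a)"
    have "j *\<^sub>v (u + v) \<in> K a" if "j \<in> J" for j
      using mult_add_distrib_mat_vec[OF JD(1)[OF that], of u v] D(3) uv that by auto
    then show "u + v \<in> K (Suc a)" using uv by auto
  next
    fix c v assume v: "v \<in> K (Suc a)"
    have "j *\<^sub>v (c \<cdot>\<^sub>v v) \<in> K a" if "j \<in> J" for j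
      using mult_mat_vec[OF JD(1)[OF that], of v c] D(4) v that by auto
    then show "c \<cdot>\<^sub>v v \<in> K (Suc a)" using v by auto
  qed auto
qed

lemmas KD = vec_subspaceD[OF K_sub]

lemma K_mono: "K a \<subseteq> K (Suc a)"
proof (induction a)
  case 0
  then show ?case using JD(1) by (auto simp: mult_zero_vec)
next
  case (Suc a)
  then show ?case by auto
qed

lemma J_K: "j \<in> J \<Longrightarrow> q \<in> K (Suc a) \<Longrightarrow> j *\<^sub>v q \<in> K a" "j \<in> J \<Longrightarrow> q \<in> K a \<Longrightarrow> j *\<^sub>v q \<in> K a"
  using K_mono[of a] by auto

lemma neumann_mem: "i \<in> J \<Longrightarrow> \<exists>s\<in>J. neumann n i t = 1\<^sub>m n + s"
proof (induction t)
  case 0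
  then show ?case using JD(2) by (intro bexI[of _ "0\<^sub>m n n"]) auto
next
  case (Suc t)
  then obtain s where s: "s \<in> J" "neumann n i t = 1\<^sub>m n + s" by blast
  have "i * (1\<^sub>m n + s) = i + i * s"
    using JD(1)[OF Suc.prems] JD(1)[OF s(1)] by (simp add: mult_add_distrib_mat[of _ n n _ n])
  then have "neumann n i (Suc t) = 1\<^sub>m n + (i + i * s)" using s by simp
  then show ?case using JD(3)[OF Suc.prems J_mult[OF Suc.prems s(1)]] by blast
qed

text \<open>Consecutive partial sums differ by a power of \<open>i\<close>, which lowers the flag of kernels by that many steps.\<close>

lemma neumann_fix:
  assumes i: "i \<in> J" and m: "carrier_vec n \<subseteq> K m"
  shows "neumann n i (Suc m) = neumann n i m"
proof -
  have iC: "i \<in> C" by (rule JD(1)[OF i])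
  have NC: "neumann n i t \<in> C" for t using neumann_mem[OF i, of t] JD(1) by auto
  have step: "\<exists>P\<in>C. neumann n i (Suc t) = neumann n i t + P \<and> (\<forall>a. \<forall>q\<in>K (a + t). P *\<^sub>v q \<in> K a)" for t
  proof (induction t)
    case 0
    show ?case
      by (rule bexI[of _ i]) (use iC J_K(2)[OF i] in auto)
  next
    case (Suc t)
    then obtain P where P: "P \<in> C" "neumann n i (Suc t) = neumann n i t + P" "\<forall>a. \<forall>q\<in>K (a + t). P *\<^sub>v q \<in> K a" by blast
    have "neumann n i (Suc (Suc t)) = 1\<^sub>m n + i * (neumann n i t + P)" using P(2) by simp
    also have "i * (neumann n i t + P) = i * neumann n i t + i * P"
      by (rule mult_add_distrib_mat[OF iC NC P(1)])
    also have "1\<^sub>m n + (i * neumann n i t + i * P) = neumann n i (Suc t) + i * P"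
      using iC NC[of t] P(1) by (simp add: assoc_add_mat[of _ n n])
    finally have "neumann n i (Suc (Suc t)) = neumann n i (Suc t) + i * P" .
    moreover have "(i * P) *\<^sub>v q \<in> K a" if q: "q \<in> K (a + Suc t)" for a q
    proof -
      have "P *\<^sub>v q \<in> K (Suc a)" using P(3) q by (metis add_Suc_shift)
      then have "i *\<^sub>v (P *\<^sub>v q) \<in> K a" using J_K(1)[OF i] by blast
      then show ?thesis using assoc_mult_mat_vec[OF iC P(1) KD(1)[OF q]] by simp
    qed
    ultimately show ?case using iC P(1) by (intro bexI[of _ "i * P"]) auto
  qed
  obtain P where P: "P \<in> C" "neumann n i (Suc m) = neumann n i m + P" "\<forall>a. \<forall>q\<in>K (a + m). P *\<^sub>v q \<in> K a"
    using step[of m] by blast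
  have "P = 0\<^sub>m n n"
  proof (rule mat_eq_vecI[OF P(1)])
    fix q :: "'k vec" assume "q \<in> carrier_vec n"
    then have "P *\<^sub>v q \<in> K 0" using P(3)[rule_format, of q 0] m by auto
    then show "P *\<^sub>v q = 0\<^sub>m n n *\<^sub>v q" using zero_mult_vec[OF \<open>q \<in> carrier_vec n\<close>] by simp
  qed simp
  then show ?thesis using P(2) NC[of m] by simp
qed

lemma one_plus_inverse:
  assumes j: "j \<in> J" and m: "carrier_vec n \<subseteq> K m"
  defines "N \<equiv> neumann n ((- 1) \<cdot>\<^sub>m j) m"
  shows "(1\<^sub>m n + j) * N = 1\<^sub>m n" "N * (1\<^sub>m n + j) = 1\<^sub>m n" "\<exists>s\<in>J. N = 1\<^sub>m n + s"
proof -
  have i: "(- 1) \<cdot>\<^sub>m j \<in> J" using JD(4) j .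
  show s: "\<exists>s\<in>J. N = 1\<^sub>m n + s" unfolding N_def by (rule neumann_mem[OF i])
  have NC: "N \<in> C" using s JD(1) by auto
  have jC: "j \<in> C" by (rule JD(1)[OF j])
  have fx: "1\<^sub>m n + ((- 1) \<cdot>\<^sub>m j) * N = N" using neumann_fix[OF i m] unfolding N_def by simp
  have "(1\<^sub>m n + j) * N = N + j * N" using jC NC by (simp add: add_mult_distrib_mat[of _ n n _ _ n])
  also have "\<dots> = (1\<^sub>m n + ((- 1) \<cdot>\<^sub>m j) * N) + j * N" by (simp only: fx)
  also have "((- 1) \<cdot>\<^sub>m j) * N = (- 1) \<cdot>\<^sub>m (j * N)" by (rule mult_smult_assoc_mat[OF jC NC])
  also have "1\<^sub>m n + (- 1) \<cdot>\<^sub>m (j * N) + j * N = 1\<^sub>m n" by (rule mat_add_cancel[OF one_carrier_mat mult_carrier_mat[OF jC NC]])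
  finally show 1: "(1\<^sub>m n + j) * N = 1\<^sub>m n" .
  show "N * (1\<^sub>m n + j) = 1\<^sub>m n" by (rule mat_mult_left_right_inverse[OF _ NC 1]) (use jC in simp)
qed

lemma mat_inverse_GL:
  fixes A B :: "'k mat"
  assumes "A \<in> C" "B \<in> C" "A * B = 1\<^sub>m n"
  shows "A \<in> carrier (GL n)" "1 / det A = det B"
proof -
  have d: "det A * det B = 1" using det_mult[OF assms(1,2)] unfolding assms(3) det_one by simp
  then have "det A \<noteq> 0" by (metis mult_zero_left zero_neq_one)
  then show "A \<in> carrier (GL n)" using assms(1) unfolding GL_carrier by blast
  show "1 / det A = det B" using d \<open>det A \<noteq> 0\<close> by (simp add: field_simps)
qed

lemma one_plus_GL:
  assumes j: "j \<in> J"
  shows "1\<^sub>m n + j \<in> carrier (GL n)" "\<exists>s\<in>J. inv\<^bsub>GL n\<^esub> (1\<^sub>m n + j) = 1\<^sub>m n + s"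
proof -
  obtain m where m: "carrier_vec n \<subseteq> K m" using nil by blast
  note N = one_plus_inverse[OF j m]
  have NC: "neumann n ((- 1) \<cdot>\<^sub>m j) m \<in> C" using N(3) JD(1) by auto
  have jC: "1\<^sub>m n + j \<in> C" using JD(1)[OF j] by simp
  show G: "1\<^sub>m n + j \<in> carrier (GL n)" by (rule mat_inverse_GL(1)[OF jC NC N(1)])
  show "\<exists>s\<in>J. inv\<^bsub>GL n\<^esub> (1\<^sub>m n + j) = 1\<^sub>m n + s" using GL_inv_unique[OF G NC N(2)] N(3) by simp
qed

text \<open>The only issue is the function \<open>1 / det\<close>: it is the determinant of the inverse, which is a polynomial in \<open>p x\<close> by the
  geometric series.\<close>

lemma one_plus_regular:
  assumes A: "fun_algebra X A" and p: "mat_regular X A n p" "\<And>x. x \<in> X \<Longrightarrow> p x \<in> J"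
  shows "gl_regular X A n (\<lambda>x. 1\<^sub>m n + p x)"
proof -
  obtain m where m: "carrier_vec n \<subseteq> K m" using nil by blast
  let ?N = "\<lambda>x. neumann n ((- 1) \<cdot>\<^sub>m p x) m"
  note c = mat_regular_const[OF A one_carrier_mat]
  have np: "mat_regular X A n (\<lambda>x. (- 1) \<cdot>\<^sub>m p x)"
    by (rule mat_regular_smult[OF A fun_algebraD(2)[OF A] p(1)])
  have "mat_regular X A n (\<lambda>x. neumann n ((- 1) \<cdot>\<^sub>m p x) t)" for t
    by (induction t) (simp_all add: c mat_regular_add[OF A c] mat_regular_mult[OF A np])
  then have N: "mat_regular X A n ?N" .
  have pC: "1\<^sub>m n + p x \<in> C" if "x \<in> X" for x using JD(1)[OF p(2)[OF that]] by simp
  note inv = mat_inverse_GL[OF pC mat_regularD(1)[OF N] one_plus_inverse(1)[OF p(2) m]]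
  show ?thesis
  proof (rule gl_regularI[OF A mat_regular_add[OF A c p(1)]])
    show "det (1\<^sub>m n + p x) \<noteq> 0" if "x \<in> X" for x using inv(1)[OF that that that] unfolding GL_carrier by blast
    show "(\<lambda>x\<in>X. 1 / det (1\<^sub>m n + p x)) \<in> A"
      by (rule restrict_cong_mem[OF _ regular_det[OF A N]]) (use inv(2) in simp)
  qed
qed

lemma UI: "j \<in> J \<Longrightarrow> 1\<^sub>m n + j \<in> U"
  by (simp add: U_def)

lemma UE: assumes "u \<in> U" obtains j where "j \<in> J" "u = 1\<^sub>m n + j"
  using assms by (auto simp: U_def)

lemma U_GL: "U \<subseteq> carrier (GL n)"
  using one_plus_GL(1) by (auto simp: U_def)

lemma U_inv: "u \<in> U \<Longrightarrow> inv\<^bsub>GL n\<^esub> u \<in> U"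
  using one_plus_GL(2) by (auto simp: U_def)

lemma U_mult:
  assumes "u \<in> U" "v \<in> U"
  shows "u * v \<in> U"
proof -
  obtain i j where ij: "i \<in> J" "u = 1\<^sub>m n + i" "j \<in> J" "v = 1\<^sub>m n + j" using assms by (auto simp: U_def)
  have c: "i \<in> C" "j \<in> C" using JD(1) ij by auto
  have "u * v = (1\<^sub>m n + i) * 1\<^sub>m n + (1\<^sub>m n + i) * j" unfolding ij using c by (intro mult_add_distrib_mat) auto
  also have "(1\<^sub>m n + i) * j = 1\<^sub>m n * j + i * j" using c by (intro add_mult_distrib_mat) auto
  also have "(1\<^sub>m n + i) * 1\<^sub>m n + (1\<^sub>m n * j + i * j) = 1\<^sub>m n + (i + (j + i * j))"
    using c by (simp add: assoc_add_mat[of _ n n])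
  finally show ?thesis using UI[OF JD(3)[OF ij(1) JD(3)[OF ij(3) J_mult[OF ij(1,3)]]]] by simp
qed

lemma U_one: "1\<^sub>m n \<in> U"
proof -
  have "1\<^sub>m n + 0\<^sub>m n n = (1\<^sub>m n :: 'k mat)" by (rule right_add_zero_mat[OF one_carrier_mat])
  then show ?thesis using UI[OF JD(2)] by metis
qed

text \<open>The projection of matrices onto the subspace \<open>J\<close> turns membership in \<open>1 + J\<close> into polynomial equations.\<close>

lemma U_closed: "gl_closed n U"
  unfolding gl_closed_def
proof (intro conjI ballI impI)
  show "U \<subseteq> carrier (GL n)" by (rule U_GL)
  fix M assume M: "M \<in> carrier (GL n)" and cl: "\<forall>f\<in>regular (GL n). (\<forall>X\<in>U. f X = 0) \<longrightarrow> f M = 0"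
  obtain c where c: "\<And>M. M \<in> C \<Longrightarrow> mat_lin n c M \<in> J" "\<And>j. j \<in> J \<Longrightarrow> mat_lin n c (j * 1\<^sub>m n) * 1\<^sub>m n = j * 1\<^sub>m n"
    using mat_projection[OF J one_carrier_mat] by blast
  have c2: "mat_lin n c j = j" if "j \<in> J" for j using c(2)[OF that] JD(1)[OF that] by (simp add: mat_lin_def)
  define D where "D X = X + (- 1) \<cdot>\<^sub>m 1\<^sub>m n" for X :: "'k mat"
  define F where "F X = D X + (- 1) \<cdot>\<^sub>m mat_lin n c (D X)" for X
  note A = fun_algebra_GL[of n, where ?'a = 'k]
  have D: "mat_regular (carrier (GL n)) (regular (GL n)) n D"
    unfolding D_def
    by (intro mat_regular_add[OF A] gl_regular_mat(1)[OF gl_regular_id] mat_regular_const[OF A]) simp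
  have F: "mat_regular (carrier (GL n)) (regular (GL n)) n F"
    unfolding F_def
    by (intro mat_regular_add[OF A D] mat_regular_smult[OF A] fun_algebraD(2)[OF A] mat_lin_regular[OF A D])
  have DC: "D X \<in> C" if "X \<in> carrier (GL n)" for X using mat_regularD(1)[OF D that] .
  have FU: "F X = 0\<^sub>m n n" if X: "X \<in> U" for X
  proof -
    obtain j where j: "j \<in> J" "X = 1\<^sub>m n + j" using X by (rule UE)
    have "D X = j" using JD(1)[OF j(1)] unfolding D_def j by (intro eq_matI) auto
    then show ?thesis unfolding F_def using c2[OF j(1)] JD(1)[OF j(1)] by (intro eq_matI) auto
  qed
  have "F M = 0\<^sub>m n n"
  proof (rule eq_matI)
    fix i j assume "i < dim_row (0\<^sub>m n n)" "j < dim_col (0\<^sub>m n n)"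
    then have ij: "i < n" "j < n" by auto
    have "(\<lambda>X\<in>carrier (GL n). F X $$ (i, j)) M = 0"
      by (rule cl[rule_format, OF mat_regularD(2)[OF F ij]]) (use FU U_GL ij in auto)
    then show "F M $$ (i, j) = 0\<^sub>m n n $$ (i, j)" using M ij by simp
  qed (use mat_regularD(1)[OF F M] in auto)
  then have "D M = mat_lin n c (D M)"
    unfolding F_def by (rule mat_diff_zero[OF DC[OF M] mat_lin_carrier])
  then have "D M \<in> J" using c(1)[OF DC[OF M]] by simp
  moreover have "M = 1\<^sub>m n + D M" using GL_memD[OF M] unfolding D_def by (intro eq_matI) auto
  ultimately show "M \<in> U" using UI by metis
qed

section \<open>Regular coset representatives modulo 1 + J\<close>

lemmas sq_simps = assoc_mult_mat_vec[of _ n n _ n] mult_carrier_mat[of _ n n _ n] mult_mat_vec_carrier[of _ n n]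
  assoc_mult_mat[of _ n n _ n _ n]

lemma I_sub: "mat_subspace n (I a)"
  unfolding mat_subspace_def
proof (intro conjI ballI allI)
  show "I a \<subseteq> C" using JD(1) by (auto simp: I_def)
  show "0\<^sub>m n n \<in> I a" using JD(2) KD(1) zero_mult_vec by (auto simp: I_def)
  fix u v assume uv: "u \<in> I a" "v \<in> I a"
  have "(u + v) *\<^sub>v q = 0\<^sub>v n" if "q \<in> K a" for q
    using add_mult_distrib_mat_vec[of u n n v q] uv that JD(1) KD(1) by (auto simp: I_def)
  then show "u + v \<in> I a" using uv JD(3) by (auto simp: I_def)
next
  fix c v assume v: "v \<in> I a"
  have "(c \<cdot>\<^sub>m v) *\<^sub>v q = 0\<^sub>v n" if q: "q \<in> K a" for q
  proof -
    have "(c \<cdot>\<^sub>m v) *\<^sub>v q = c \<cdot>\<^sub>v (v *\<^sub>v q)" using smult_mat_vec[of v n q c] v q JD(1) KD(1) by (auto simp: I_def)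
    also have "v *\<^sub>v q = 0\<^sub>v n" using v q by (simp add: I_def)
    also have "c \<cdot>\<^sub>v 0\<^sub>v n = 0\<^sub>v n" by (intro eq_vecI) auto
    finally show ?thesis .
  qed
  then show "c \<cdot>\<^sub>m v \<in> I a" using v JD(4) by (auto simp: I_def)
qed

lemmas ID = mat_subspaceD[OF I_sub]

lemma I_J: "i \<in> I a \<Longrightarrow> i \<in> J" by (simp add: I_def)

lemma I_zero: "I 0 = J"
  using mult_zero_vec JD(1) by (auto simp: I_def)

lemma I_mult_right: "i \<in> I a \<Longrightarrow> j \<in> J \<Longrightarrow> i * j \<in> I (Suc a)"
proof -
  assume i: "i \<in> I a" and j: "j \<in> J"
  have "(i * j) *\<^sub>v q = 0\<^sub>v n" if q: "q \<in> K (Suc a)" for q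
  proof -
    have "(i * j) *\<^sub>v q = i *\<^sub>v (j *\<^sub>v q)" by (rule assoc_mult_mat_vec[OF ID(1)[OF i] JD(1)[OF j] KD(1)[OF q]])
    then show ?thesis using J_K(1)[OF j q] i by (simp add: I_def)
  qed
  then show "i * j \<in> I (Suc a)" using J_mult[OF I_J[OF i] j] by (simp add: I_def)
qed

lemma I_mult_left: "j \<in> J \<Longrightarrow> i \<in> I a \<Longrightarrow> j * i \<in> I a"
proof -
  assume j: "j \<in> J" and i: "i \<in> I a"
  have "(j * i) *\<^sub>v q = 0\<^sub>v n" if q: "q \<in> K a" for q
  proof -
    have "(j * i) *\<^sub>v q = j *\<^sub>v (i *\<^sub>v q)" by (rule assoc_mult_mat_vec[OF JD(1)[OF j] ID(1)[OF i] KD(1)[OF q]])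
    then show ?thesis using i q mult_zero_vec[OF JD(1)[OF j]] by (simp add: I_def)
  qed
  then show "j * i \<in> I a" using J_mult[OF j I_J[OF i]] by (simp add: I_def)
qed

lemma I_top:
  assumes "carrier_vec n \<subseteq> K m"
  shows "I m = {0\<^sub>m n n}"
proof -
  have "i = 0\<^sub>m n n" if i: "i \<in> I m" for i
  proof (rule mat_eq_vecI[OF ID(1)[OF i]])
    fix q :: "'k vec" assume q: "q \<in> carrier_vec n"
    then show "i *\<^sub>v q = 0\<^sub>m n n *\<^sub>v q" using i assms zero_mult_vec[OF q] by (auto simp: I_def)
  qed simp
  then show ?thesis using ID(2) by auto
qed

lemma stabD:
  assumes "stab X"
  shows "X \<in> carrier (GL n)" "j \<in> J \<Longrightarrow> X * j * inv\<^bsub>GL n\<^esub> X \<in> J" "j \<in> J \<Longrightarrow> inv\<^bsub>GL n\<^esub> X * j * X \<in> J"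
    "X \<in> C" "inv\<^bsub>GL n\<^esub> X \<in> C" "X * inv\<^bsub>GL n\<^esub> X = 1\<^sub>m n" "inv\<^bsub>GL n\<^esub> X * X = 1\<^sub>m n"
  using assms GL_inv GL_memD unfolding stab_def by blast+

lemma inv_mult_vec:
  assumes "stab X" "q \<in> carrier_vec n"
  shows "X *\<^sub>v (inv\<^bsub>GL n\<^esub> X *\<^sub>v q) = q" "inv\<^bsub>GL n\<^esub> X *\<^sub>v (X *\<^sub>v q) = q"
  using assoc_mult_mat_vec[OF stabD(4,5)[OF assms(1)] assms(2)] assoc_mult_mat_vec[OF stabD(5,4)[OF assms(1)] assms(2)]
    assms by (simp_all add: stabD(6,7))

lemma stab_K:
  assumes X: "stab X"
  shows "q \<in> K a \<Longrightarrow> X *\<^sub>v q \<in> K a" "q \<in> K a \<Longrightarrow> inv\<^bsub>GL n\<^esub> X *\<^sub>v q \<in> K a"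
proof -
  note S = stabD[OF X]
  have "\<forall>q\<in>K a. X *\<^sub>v q \<in> K a \<and> inv\<^bsub>GL n\<^esub> X *\<^sub>v q \<in> K a"
  proof (induction a)
    case 0
    then show ?case using mult_zero_vec S(4,5) by auto
  next
    case (Suc a)
    show ?case
    proof
      fix q assume q: "q \<in> K (Suc a)"
      note qC = KD(1)[OF q]
      have "j *\<^sub>v (X *\<^sub>v q) \<in> K a" if j: "j \<in> J" for j
      proof -
        note jC = JD(1)[OF j]
        have "(inv\<^bsub>GL n\<^esub> X * j * X) *\<^sub>v q \<in> K a" by (rule J_K(1)[OF S(3)[OF j] q])
        then have "X *\<^sub>v ((inv\<^bsub>GL n\<^esub> X * j * X) *\<^sub>v q) \<in> K a" using Suc by blast
        moreover have "(inv\<^bsub>GL n\<^esub> X * j * X) *\<^sub>v q = inv\<^bsub>GL n\<^esub> X *\<^sub>v (j *\<^sub>v (X *\<^sub>v q))"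
          using jC qC S(4,5) by (simp add: sq_simps)
        ultimately show ?thesis using inv_mult_vec(1)[OF X, of "j *\<^sub>v (X *\<^sub>v q)"] jC qC S(4) by (simp add: sq_simps)
      qed
      moreover have "j *\<^sub>v (inv\<^bsub>GL n\<^esub> X *\<^sub>v q) \<in> K a" if j: "j \<in> J" for j
      proof -
        note jC = JD(1)[OF j]
        have "(X * j * inv\<^bsub>GL n\<^esub> X) *\<^sub>v q \<in> K a" by (rule J_K(1)[OF S(2)[OF j] q])
        then have "inv\<^bsub>GL n\<^esub> X *\<^sub>v ((X * j * inv\<^bsub>GL n\<^esub> X) *\<^sub>v q) \<in> K a" using Suc by blast
        moreover have "(X * j * inv\<^bsub>GL n\<^esub> X) *\<^sub>v q = X *\<^sub>v (j *\<^sub>v (inv\<^bsub>GL n\<^esub> X *\<^sub>v q))"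
          using jC qC S(4,5) by (simp add: sq_simps)
        ultimately show ?thesis using inv_mult_vec(2)[OF X, of "j *\<^sub>v (inv\<^bsub>GL n\<^esub> X *\<^sub>v q)"] jC qC S(5) by (simp add: sq_simps)
      qed
      ultimately show "X *\<^sub>v q \<in> K (Suc a) \<and> inv\<^bsub>GL n\<^esub> X *\<^sub>v q \<in> K (Suc a)"
        using S(4,5) qC by simp
    qed
  qed
  then show "q \<in> K a \<Longrightarrow> X *\<^sub>v q \<in> K a" "q \<in> K a \<Longrightarrow> inv\<^bsub>GL n\<^esub> X *\<^sub>v q \<in> K a" by blast+
qed

lemma GL_inv_mult:
  assumes "X \<in> carrier (GL n)" "Y \<in> carrier (GL n)"
  shows "inv\<^bsub>GL n\<^esub> (X * Y) = inv\<^bsub>GL n\<^esub> Y * inv\<^bsub>GL n\<^esub> (X :: 'k mat)"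
  using group.inv_mult_group[OF group_GL assms] by (simp add: GL_simps)

lemma stab_mult:
  assumes X: "stab X" and Y: "stab Y"
  shows "stab (X * Y)"
proof -
  note S = stabD[OF X] and T = stabD[OF Y]
  have "X * Y * j * inv\<^bsub>GL n\<^esub> (X * Y) \<in> J" if j: "j \<in> J" for j
  proof -
    have "X * Y * j * inv\<^bsub>GL n\<^esub> (X * Y) = X * (Y * j * inv\<^bsub>GL n\<^esub> Y) * inv\<^bsub>GL n\<^esub> X"
      unfolding GL_inv_mult[OF S(1) T(1)] using S(4,5) T(4,5) JD(1)[OF j]
      by (simp add: sq_simps)
    then show ?thesis using S(2)[OF T(2)[OF j]] by simp
  qed
  moreover have "inv\<^bsub>GL n\<^esub> (X * Y) * j * (X * Y) \<in> J" if j: "j \<in> J" for j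
  proof -
    have "inv\<^bsub>GL n\<^esub> (X * Y) * j * (X * Y) = inv\<^bsub>GL n\<^esub> Y * (inv\<^bsub>GL n\<^esub> X * j * X) * Y"
      unfolding GL_inv_mult[OF S(1) T(1)] using S(4,5) T(4,5) JD(1)[OF j]
      by (simp add: sq_simps)
    then show ?thesis using T(3)[OF S(3)[OF j]] by simp
  qed
  ultimately show ?thesis using GL_mult[OF S(1) T(1)] by (simp add: stab_def)
qed

lemma J_one_plus: "j \<in> J \<Longrightarrow> s \<in> J \<Longrightarrow> (1\<^sub>m n + s) * j \<in> J" "j \<in> J \<Longrightarrow> s \<in> J \<Longrightarrow> j * (1\<^sub>m n + s) \<in> J"
proof -
  assume j: "j \<in> J" and s: "s \<in> J"
  have "(1\<^sub>m n + s) * j = j + s * j" "j * (1\<^sub>m n + s) = j + j * s"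
    using JD(1)[OF j] JD(1)[OF s] by (simp_all add: add_mult_distrib_mat[of _ n n _ _ n] mult_add_distrib_mat[of _ n n _ n])
  then show "(1\<^sub>m n + s) * j \<in> J" "j * (1\<^sub>m n + s) \<in> J" using JD(3) J_mult j s by auto
qed

lemma stab_U:
  assumes "u \<in> U"
  shows "stab u"
proof -
  obtain j where j: "j \<in> J" "u = 1\<^sub>m n + j" using assms by (rule UE)
  obtain s where s: "s \<in> J" "inv\<^bsub>GL n\<^esub> u = 1\<^sub>m n + s" using one_plus_GL(2)[OF j(1)] j(2) by blast
  have "u * i * inv\<^bsub>GL n\<^esub> u \<in> J \<and> inv\<^bsub>GL n\<^esub> u * i * u \<in> J" if "i \<in> J" for i
    unfolding s(2) unfolding j(2) using J_one_plus that j(1) s(1) by blast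
  then show ?thesis using U_GL assms by (auto simp: stab_def)
qed

text \<open>\<open>E\<close> projects onto the layer \<open>K (Suc a) / K a\<close> of the flag, and \<open>c\<close> describes a projection onto \<open>I a\<close> that is compatible with
  the restriction to this layer.\<close>

definition layer_ok where
  "layer_ok a E c \<longleftrightarrow> E \<in> C \<and> (\<forall>q\<in>carrier_vec n. E *\<^sub>v q \<in> K (Suc a)) \<and> (\<forall>q\<in>K a. E *\<^sub>v q = 0\<^sub>v n) \<and>
    (\<forall>q\<in>K (Suc a). \<exists>k\<in>K a. E *\<^sub>v q = q + k) \<and>
    (\<forall>M\<in>C. mat_lin n c M \<in> I a) \<and> (\<forall>j\<in>I a. mat_lin n c (j * E) * E = j * E)"

lemma layer_exists: "\<exists>E c. layer_ok a E c"
proof -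
  obtain E where E: "E \<in> C" "\<forall>q\<in>carrier_vec n. E *\<^sub>v q \<in> K (Suc a)" "\<forall>q\<in>K a. E *\<^sub>v q = 0\<^sub>v n"
    "\<forall>q\<in>K (Suc a). \<exists>k\<in>K a. E *\<^sub>v q = q + k"
    using subquotient_projection[OF K_sub[of a] K_sub[of "Suc a"]] by blast
  obtain c where c: "\<forall>M\<in>C. mat_lin n c M \<in> I a" "\<forall>j\<in>I a. mat_lin n c (j * E) * E = j * E"
    using mat_projection[OF I_sub E(1), of a] by blast
  show ?thesis unfolding layer_ok_def using E c by blast
qed

text \<open>The function \<open>f\<close> measures the position of \<open>X\<close> in the layer \<open>I a / I (Suc a)\<close>. It is regular, and left multiplication
  by \<open>1 + j\<close> with \<open>j \<in> I a\<close> shifts it by \<open>j\<close> modulo \<open>I (Suc a)\<close>: the conjugate \<open>X E X\<^sup>-\<^sup>1\<close> is again the identity on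
  \<open>K (Suc a)\<close> modulo \<open>K a\<close>, and \<open>j\<close> kills \<open>K a\<close>, so that \<open>X E X\<^sup>-\<^sup>1 E\<close> changes by exactly \<open>j E\<close>.\<close>

lemma layer_shift:
  assumes ok: "layer_ok a E c" and X: "stab X" and j: "j \<in> I a"
  defines "f \<equiv> \<lambda>X. mat_lin n c (X * E * inv\<^bsub>GL n\<^esub> X * E)"
  shows "\<exists>d\<in>I a. f ((1\<^sub>m n + j) * X) = f X + d \<and> j + (- 1) \<cdot>\<^sub>m d \<in> I (Suc a)"
proof -
  have E: "E \<in> C" "\<And>q. q \<in> carrier_vec n \<Longrightarrow> E *\<^sub>v q \<in> K (Suc a)" "\<And>q. q \<in> K a \<Longrightarrow> E *\<^sub>v q = 0\<^sub>v n"
    "\<And>q. q \<in> K (Suc a) \<Longrightarrow> \<exists>k\<in>K a. E *\<^sub>v q = q + k"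
    "\<And>M. M \<in> C \<Longrightarrow> mat_lin n c M \<in> I a" "\<And>j. j \<in> I a \<Longrightarrow> mat_lin n c (j * E) * E = j * E"
    using ok unfolding layer_ok_def by blast+
  note S = stabD[OF X] and jC = ID(1)[OF j] and jJ = I_J[OF j]
  obtain s where s: "s \<in> J" "inv\<^bsub>GL n\<^esub> (1\<^sub>m n + j) = 1\<^sub>m n + s" using one_plus_GL(2)[OF jJ] by blast
  have sC: "s \<in> C" by (rule JD(1)[OF s(1)])
  have inv': "inv\<^bsub>GL n\<^esub> ((1\<^sub>m n + j) * X) = inv\<^bsub>GL n\<^esub> X * (1\<^sub>m n + s)"
    unfolding GL_inv_mult[OF one_plus_GL(1)[OF jJ] S(1)] s(2) ..
  have key: "((1\<^sub>m n + j) * X) * E * (inv\<^bsub>GL n\<^esub> X * (1\<^sub>m n + s)) * E = X * E * inv\<^bsub>GL n\<^esub> X * E + j * E"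
  proof (rule mat_eq_vecI[of _ n])
    show "((1\<^sub>m n + j) * X) * E * (inv\<^bsub>GL n\<^esub> X * (1\<^sub>m n + s)) * E \<in> C" "X * E * inv\<^bsub>GL n\<^esub> X * E + j * E \<in> C"
      using S(4,5) E(1) jC sC by (simp_all add: sq_simps)
    fix q :: "'k vec" assume q: "q \<in> carrier_vec n"
    define r where "r = E *\<^sub>v q"
    have r: "r \<in> K (Suc a)" "r \<in> carrier_vec n" using E(2)[OF q] KD(1) unfolding r_def by blast+
    define x where "x = inv\<^bsub>GL n\<^esub> X *\<^sub>v r"
    have x: "x \<in> K (Suc a)" using stab_K(2)[OF X r(1)] by (simp add: x_def)
    define y where "y = inv\<^bsub>GL n\<^esub> X *\<^sub>v (s *\<^sub>v r)"
    have y: "y \<in> K a" using stab_K(2)[OF X J_K(1)[OF s(1) r(1)]] by (simp add: y_def)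
    note xC = KD(1)[OF x] and yC = KD(1)[OF y]
    obtain k where k: "k \<in> K a" "E *\<^sub>v x = x + k" using E(4)[OF x] by blast
    note kC = KD(1)[OF k(1)]
    have Ex: "E *\<^sub>v x \<in> carrier_vec n" using E(1) xC by simp
    have srC: "s *\<^sub>v r \<in> carrier_vec n" using sC r(2) by simp
    have "(((1\<^sub>m n + j) * X) * E * (inv\<^bsub>GL n\<^esub> X * (1\<^sub>m n + s)) * E) *\<^sub>v q =
      (1\<^sub>m n + j) *\<^sub>v (X *\<^sub>v (E *\<^sub>v (inv\<^bsub>GL n\<^esub> X *\<^sub>v ((1\<^sub>m n + s) *\<^sub>v r))))"
      using S(4,5) E(1) jC sC q r(2) by (simp add: r_def sq_simps)
    also have "(1\<^sub>m n + s) *\<^sub>v r = r + s *\<^sub>v r" by (rule one_plus_mult_vec[OF sC r(2)])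
    also have "inv\<^bsub>GL n\<^esub> X *\<^sub>v (r + s *\<^sub>v r) = x + y"
      unfolding x_def y_def by (rule mult_add_distrib_mat_vec[OF S(5) r(2) srC])
    also have "E *\<^sub>v (x + y) = E *\<^sub>v x + E *\<^sub>v y" by (rule mult_add_distrib_mat_vec[OF E(1) xC yC])
    also have "E *\<^sub>v y = 0\<^sub>v n" by (rule E(3)[OF y])
    also have "E *\<^sub>v x + 0\<^sub>v n = E *\<^sub>v x" using Ex by simp
    also have "(1\<^sub>m n + j) *\<^sub>v (X *\<^sub>v (E *\<^sub>v x)) = X *\<^sub>v (E *\<^sub>v x) + j *\<^sub>v (X *\<^sub>v (E *\<^sub>v x))"
      by (rule one_plus_mult_vec[OF jC]) (use S(4) Ex in \<open>simp add: sq_simps\<close>)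
    also have "j *\<^sub>v (X *\<^sub>v (E *\<^sub>v x)) = j *\<^sub>v r"
    proof -
      have "X *\<^sub>v (E *\<^sub>v x) = X *\<^sub>v x + X *\<^sub>v k" unfolding k(2) by (rule mult_add_distrib_mat_vec[OF S(4) xC kC])
      also have "X *\<^sub>v x = r" unfolding x_def by (rule inv_mult_vec(1)[OF X r(2)])
      finally have e: "X *\<^sub>v (E *\<^sub>v x) = r + X *\<^sub>v k" .
      have Xk: "X *\<^sub>v k \<in> K a" by (rule stab_K(1)[OF X k(1)])
      have "j *\<^sub>v (r + X *\<^sub>v k) = j *\<^sub>v r + j *\<^sub>v (X *\<^sub>v k)" by (rule mult_add_distrib_mat_vec[OF jC r(2) KD(1)[OF Xk]])
      also have "j *\<^sub>v (X *\<^sub>v k) = 0\<^sub>v n" using j Xk by (simp add: I_def)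
      finally show ?thesis unfolding e using jC r(2) by simp
    qed
    also have "X *\<^sub>v (E *\<^sub>v x) + j *\<^sub>v r = (X * E * inv\<^bsub>GL n\<^esub> X * E + j * E) *\<^sub>v q"
      using S(4,5) E(1) jC q by (simp add: x_def r_def sq_simps add_mult_distrib_mat_vec[of _ n n])
    finally show "(((1\<^sub>m n + j) * X) * E * (inv\<^bsub>GL n\<^esub> X * (1\<^sub>m n + s)) * E) *\<^sub>v q = (X * E * inv\<^bsub>GL n\<^esub> X * E + j * E) *\<^sub>v q" .
  qed
  define d where "d = mat_lin n c (j * E)"
  have jE: "j * E \<in> C" using jC E(1) by simp
  have d: "d \<in> I a" unfolding d_def by (rule E(5)[OF jE])
  have "f ((1\<^sub>m n + j) * X) = f X + d"
    unfolding f_def inv' key d_def by (rule mat_lin_add[OF _ jE]) (use S(4,5) E(1) in \<open>simp add: sq_simps\<close>)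
  moreover have "j + (- 1) \<cdot>\<^sub>m d \<in> I (Suc a)"
  proof -
    have jd: "j + (- 1) \<cdot>\<^sub>m d \<in> I a" by (intro ID(3)[OF j] ID(4)[OF d])
    have "(j + (- 1) \<cdot>\<^sub>m d) *\<^sub>v q = 0\<^sub>v n" if q: "q \<in> K (Suc a)" for q
    proof -
      note qC = KD(1)[OF q]
      obtain k where k: "k \<in> K a" "E *\<^sub>v q = q + k" using E(4)[OF q] by blast
      have v: "M *\<^sub>v q = (M * E) *\<^sub>v q" if M: "M \<in> I a" for M
      proof -
        note MC = ID(1)[OF M]
        have "(M * E) *\<^sub>v q = M *\<^sub>v (q + k)" using assoc_mult_mat_vec[OF MC E(1) qC] k(2) by simp
        also have "\<dots> = M *\<^sub>v q + M *\<^sub>v k" by (rule mult_add_distrib_mat_vec[OF MC qC KD(1)[OF k(1)]])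
        also have "M *\<^sub>v k = 0\<^sub>v n" using M k(1) by (simp add: I_def)
        finally show ?thesis using MC qC by simp
      qed
      have "d *\<^sub>v q = j *\<^sub>v q" unfolding v[OF d] v[OF j] unfolding d_def E(6)[OF j] ..
      moreover have "(j + (- 1) \<cdot>\<^sub>m d) *\<^sub>v q = j *\<^sub>v q + (- 1) \<cdot>\<^sub>v (d *\<^sub>v q)"
        using add_mult_distrib_mat_vec[OF jC, of "(- 1) \<cdot>\<^sub>m d" q] smult_mat_vec[OF ID(1)[OF d] qC] ID(1)[OF d] qC by simp
      ultimately show ?thesis using jC qC by (intro eq_vecI) auto
    qed
    then show ?thesis using I_J[OF jd] by (simp add: I_def)
  qed
  ultimately show ?thesis using d by blast
qed

text \<open>A regular choice of representatives for the cosets \<open>U X\<close>. Starting from \<open>X\<close>, one divides at the step \<open>a\<close> by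
  \<open>1 + f a X\<close>, where \<open>f a\<close> measures the position in the \<open>a\<close>-th layer. After that step, two elements of the same coset have
  results that differ by a factor in \<open>1 + I (Suc a)\<close>, and these groups shrink to the identity.\<close>

lemma unipotent_retraction:
  fixes A :: "('k mat \<Rightarrow> 'k) set"
  assumes A: "fun_algebra \<Gamma> A" and id: "gl_regular \<Gamma> A n (\<lambda>X. X)"
    and st: "\<And>X. X \<in> \<Gamma> \<Longrightarrow> stab X"
  shows "\<exists>R. gl_regular \<Gamma> A n R \<and> (\<forall>X\<in>\<Gamma>. \<exists>u\<in>U. R X = u * X) \<and> (\<forall>u\<in>U. \<forall>X\<in>\<Gamma>. R (u * X) = R X)"
proof -
  obtain E c where ok: "\<And>a. layer_ok a (E a) (c a)" using layer_exists by metis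
  define f where "f a X = mat_lin n (c a) (X * E a * inv\<^bsub>GL n\<^esub> X * E a)" for a X
  define Xs where "Xs = rec_nat (\<lambda>X. X) (\<lambda>a F X. inv\<^bsub>GL n\<^esub> (1\<^sub>m n + f a (F X)) * F X)"
  have Xs0: "Xs 0 X = X" and XsS: "Xs (Suc a) X = inv\<^bsub>GL n\<^esub> (1\<^sub>m n + f a (Xs a X)) * Xs a X" for a X
    by (simp_all add: Xs_def)
  have EC: "E a \<in> C" for a using ok[of a] by (simp add: layer_ok_def)
  have fI: "f a Y \<in> I a" if "stab Y" for a Y
  proof -
    have "Y * E a * inv\<^bsub>GL n\<^esub> Y * E a \<in> C" using EC[of a] stabD(4,5)[OF that] by (simp add: sq_simps)
    then show ?thesis using ok[of a] by (simp add: layer_ok_def f_def)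
  qed
  have fU: "1\<^sub>m n + f a Y \<in> U" if "stab Y" for a Y by (rule UI[OF I_J[OF fI[OF that]]])
  have 1: "\<exists>u\<in>U. Xs a X = u * X" if X: "stab X" for a X
  proof (induction a)
    case 0
    show ?case using U_one stabD(4)[OF X] by (intro bexI[of _ "1\<^sub>m n"]) (auto simp: Xs0)
  next
    case (Suc a)
    then obtain u where u: "u \<in> U" "Xs a X = u * X" by blast
    have w: "inv\<^bsub>GL n\<^esub> (1\<^sub>m n + f a (Xs a X)) \<in> U"
      unfolding u(2) by (rule U_inv[OF fU[OF stab_mult[OF stab_U[OF u(1)] X]]])
    have "Xs (Suc a) X = inv\<^bsub>GL n\<^esub> (1\<^sub>m n + f a (Xs a X)) * u * X"
      unfolding XsS u(2) using w[unfolded u(2)] u(1) U_GL GL_memD stabD(4)[OF X]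
      by (intro assoc_mult_mat[symmetric]) blast+
    then show ?case using U_mult[OF w u(1)] by blast
  qed
  have stXs: "stab (Xs a X)" if "stab X" for a X
    using 1[OF that, of a] stab_mult[OF stab_U that] by metis
  have reg: "gl_regular \<Gamma> A n (Xs a)" for a
  proof (induction a)
    case 0
    show ?case using id by (simp add: Xs_def)
  next
    case (Suc a)
    have f: "mat_regular \<Gamma> A n (\<lambda>X. f a (Xs a X))"
      unfolding f_def
      by (intro mat_lin_regular[OF A] mat_regular_mult[OF A] mat_regular_const[OF A EC] gl_regular_mat(1)[OF gl_regular_inv[OF A Suc]]
          gl_regular_mat(1)[OF Suc])
    have "gl_regular \<Gamma> A n (\<lambda>X. 1\<^sub>m n + f a (Xs a X))"
      by (rule one_plus_regular[OF A f I_J[OF fI[OF stXs[OF st]]]])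
    from gl_regular_mult[OF A gl_regular_inv[OF A this] Suc]
    show ?case by (simp add: Xs_def)
  qed
  have 2: "\<exists>i\<in>I a. Xs a (u * X) = (1\<^sub>m n + i) * Xs a X" if u: "u \<in> U" and X: "stab X" for a u X
  proof (induction a)
    case 0
    obtain j where "j \<in> J" "u = 1\<^sub>m n + j" using u by (rule UE)
    then show ?case unfolding Xs0 I_zero by blast
  next
    case (Suc a)
    then obtain i where i: "i \<in> I a" "Xs a (u * X) = (1\<^sub>m n + i) * Xs a X" by blast
    define Y where "Y = Xs a X"
    have Y: "stab Y" unfolding Y_def by (rule stXs[OF X])
    note YC = stabD(4)[OF Y]
    define p where "p = f a Y"
    have p: "p \<in> I a" unfolding p_def by (rule fI[OF Y])
    obtain d where d: "d \<in> I a" "f a ((1\<^sub>m n + i) * Y) = p + d" "i + (- 1) \<cdot>\<^sub>m d \<in> I (Suc a)"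
      using layer_shift[OF ok Y i(1)] unfolding p_def f_def by blast
    have iC: "i \<in> C" and pC: "p \<in> C" and dC: "d \<in> C" using ID(1) i p d by auto
    have pJ: "p \<in> J" and pdJ: "p + d \<in> J" using I_J p ID(3)[OF p d(1)] by blast+
    define W where "W = inv\<^bsub>GL n\<^esub> (1\<^sub>m n + p)"
    define W' where "W' = inv\<^bsub>GL n\<^esub> (1\<^sub>m n + (p + d))"
    note G = one_plus_GL(1)[OF pJ] and G' = one_plus_GL(1)[OF pdJ]
    note inv1 = GL_inv(2,3,4)[OF G, folded W_def] and inv2 = GL_inv(2,3,4)[OF G', folded W'_def]
    have XsX: "Xs (Suc a) X = W * Y" unfolding XsS Y_def W_def p_def ..
    have XsU: "Xs (Suc a) (u * X) = W' * ((1\<^sub>m n + i) * Y)"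
      unfolding XsS i(2) Y_def[symmetric] d(2) W'_def ..
    define e where "e = (i + (- 1) \<cdot>\<^sub>m d) + i * p"
    have e: "e \<in> I (Suc a)" unfolding e_def by (rule ID(3)[OF d(3) I_mult_right[OF i(1) pJ]])
    have eC: "e \<in> C" by (rule ID(1)[OF e])
    have ipC: "i * p \<in> C" using iC pC by simp
    \<comment> \<open>The factor \<open>1 + i\<close> passes through the division: \<open>(1 + i)(1 + p)\<close> agrees with \<open>1 + p + d\<close> up to \<open>e \<in> I (Suc a)\<close>,
      as \<open>i - d\<close> and \<open>i p\<close> both lie in \<open>I (Suc a)\<close>.\<close>
    have "(1\<^sub>m n + i) * (1\<^sub>m n + p) = (1\<^sub>m n + i) * 1\<^sub>m n + (1\<^sub>m n + i) * p"
      using iC pC by (intro mult_add_distrib_mat) auto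
    also have "(1\<^sub>m n + i) * p = 1\<^sub>m n * p + i * p" using iC pC by (intro add_mult_distrib_mat) auto
    also have "(1\<^sub>m n + i) * 1\<^sub>m n + (1\<^sub>m n * p + i * p) = (1\<^sub>m n + i) + (p + i * p)" using iC pC by simp
    also have "\<dots> = (1\<^sub>m n + (p + d)) + e"
      unfolding e_def using iC pC dC carrier_matD[OF ipC] by (intro eq_matI) (auto simp del: index_mult_mat)
    finally have ab: "(1\<^sub>m n + i) * (1\<^sub>m n + p) = (1\<^sub>m n + (p + d)) + e" .
    have WY: "W * Y \<in> C" using inv1(3) YC by simp
    have ppC: "1\<^sub>m n + p \<in> C" and piC: "1\<^sub>m n + i \<in> C" using pC iC by simp_all
    have "(1\<^sub>m n + p) * (W * Y) = (1\<^sub>m n + p) * W * Y"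
      by (rule assoc_mult_mat[OF ppC inv1(3) YC, symmetric])
    also have "\<dots> = Y" unfolding inv1(1) by (rule left_mult_one_mat[OF YC])
    finally have Yeq: "(1\<^sub>m n + p) * (W * Y) = Y" .
    have "(1\<^sub>m n + i) * Y = (1\<^sub>m n + i) * ((1\<^sub>m n + p) * (W * Y))" unfolding Yeq ..
    also have "\<dots> = (1\<^sub>m n + i) * (1\<^sub>m n + p) * (W * Y)"
      by (rule assoc_mult_mat[OF piC ppC WY, symmetric])
    finally have "(1\<^sub>m n + i) * Y = ((1\<^sub>m n + (p + d)) + e) * (W * Y)" unfolding ab .
    then have "Xs (Suc a) (u * X) = W' * (((1\<^sub>m n + (p + d)) + e) * (W * Y))" using XsU by simp
    also have "\<dots> = W' * ((1\<^sub>m n + (p + d)) + e) * (W * Y)"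
      by (rule assoc_mult_mat[OF inv2(3) _ WY, symmetric]) (use pC dC eC in auto)
    also have "W' * ((1\<^sub>m n + (p + d)) + e) = W' * (1\<^sub>m n + (p + d)) + W' * e"
      by (rule mult_add_distrib_mat[OF inv2(3)]) (use pC dC eC in auto)
    also have "W' * (1\<^sub>m n + (p + d)) = 1\<^sub>m n" by (rule inv2(2))
    finally have fin: "Xs (Suc a) (u * X) = (1\<^sub>m n + W' * e) * Xs (Suc a) X" unfolding XsX .
    obtain s where s: "s \<in> J" "W' = 1\<^sub>m n + s" using one_plus_GL(2)[OF pdJ] unfolding W'_def by blast
    have "W' * e = e + s * e" unfolding s(2) using JD(1)[OF s(1)] eC by (simp add: add_mult_distrib_mat[of _ n n _ _ n])
    then have "W' * e \<in> I (Suc a)" using ID(3)[OF e I_mult_left[OF s(1) e]] by simp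
    then show ?case using fin by blast
  qed
  obtain m where m: "carrier_vec n \<subseteq> K m" using nil by blast
  have "Xs m (u * X) = Xs m X" if "u \<in> U" "X \<in> \<Gamma>" for u X
  proof -
    have "Xs m (u * X) = (1\<^sub>m n + 0\<^sub>m n n) * Xs m X" using 2[OF that(1) st[OF that(2)], of m] I_top[OF m] by auto
    then show ?thesis using left_mult_one_mat[OF stabD(4)[OF stXs[OF st[OF that(2)], of m]]] by simp
  qed
  then show ?thesis using reg[of m] 1[OF st] by blast
qed

end

section \<open>The extension and its image\<close>

locale diamond = nil_algebra n "J_ideal G Id n \<rho> V"
  for n :: nat and G :: "('a, 'k::alg_closed_field) alg_group" and Id :: "('a \<Rightarrow> 'k) set"
    and \<rho> :: "'a \<Rightarrow> 'k mat" and V :: "'k vec set" +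
  assumes G: "affine_alg_group G"
begin

abbreviation "J \<equiv> J_ideal G Id n \<rho> V"
abbreviation "D \<equiv> G_diamond G Id n \<rho> V"
abbreviation "S \<equiv> G_star G Id n \<rho> V"
abbreviation "Qt \<equiv> G_star_mod_U G Id n \<rho> V"
abbreviation "q \<equiv> quot_map G Id n \<rho> V"
abbreviation "ginv \<equiv> \<lambda>X::'k mat. inv\<^bsub>GL n\<^esub> X"

text \<open>What the construction of the extension and the pull-back square uses of an affording morphism: it is a regular map into
  the normalizer of \<open>J\<close>, preserves the identity, and is a homomorphism modulo \<open>U\<close>.\<close>

definition hom_mod_U :: "('a \<Rightarrow> 'k mat) \<Rightarrow> bool" where
  "hom_mod_U \<alpha> \<longleftrightarrow> variety_morphism G (GL n) \<alpha> \<and> \<alpha> \<one>\<^bsub>G\<^esub> = 1\<^sub>m n \<and> (\<forall>g\<in>carrier G. stab (\<alpha> g)) \<and>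
    (\<forall>g\<in>carrier G. \<forall>h\<in>carrier G. \<alpha> g * \<alpha> h * ginv (\<alpha> (g \<otimes>\<^bsub>G\<^esub> h)) \<in> U)"

definition \<Gamma> where "\<Gamma> \<alpha> = rho_diamond \<alpha> ` (U \<times> carrier G)"
abbreviation "RU \<equiv> fun_alg U (GL_gens n)"
abbreviation "T \<equiv> tensor_funs U RU (carrier G) (regular G)"

lemma U_eq: "U_group G Id n \<rho> V = U"
  by (simp add: U_group_def U_def)

lemma D_simps: "carrier (D \<alpha>) = U \<times> carrier G" "\<one>\<^bsub>D \<alpha>\<^esub> = (1\<^sub>m n, \<one>\<^bsub>G\<^esub>)" "regular (D \<alpha>) = T"
  "(x, g) \<otimes>\<^bsub>D \<alpha>\<^esub> (y, h) = (x * (\<alpha> g * y * ginv (\<alpha> g)) * (\<alpha> g * \<alpha> h * ginv (\<alpha> (g \<otimes>\<^bsub>G\<^esub> h))), g \<otimes>\<^bsub>G\<^esub> h)"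
  using regular_sub_GL[OF U_GL] by (simp_all add: G_diamond_def U_eq gamma_def)

lemma S_eq: "S \<alpha> = sub_alg_group (GL n) (\<Gamma> \<alpha>)"
  by (simp add: G_star_def D_simps \<Gamma>_def)

lemma S_simps: "carrier (S \<alpha>) = \<Gamma> \<alpha>" "x \<otimes>\<^bsub>S \<alpha>\<^esub> y = x * y" "\<one>\<^bsub>S \<alpha>\<^esub> = 1\<^sub>m n"
  by (simp_all add: S_eq sub_alg_group_def GL_simps)

lemma groupG: "group G" using affine_alg_groupD(1)[OF G] .
lemmas algG = affine_alg_groupD(3)[OF G]
lemmas G_closed = group.is_monoid[OF groupG, THEN monoid.m_closed] group.is_monoid[OF groupG, THEN monoid.one_closed]
  group.inv_closed[OF groupG]

lemma U_C: "u \<in> U \<Longrightarrow> u \<in> C" using U_GL GL_memD by blast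

lemma T_alg: "fun_algebra (U \<times> carrier G) T"
  by (rule fun_algebra_tensor[OF fun_algebra_fun_alg algG])

lemma hom_mod_UD:
  assumes "hom_mod_U \<alpha>"
  shows "gl_regular (carrier G) (regular G) n \<alpha>" "\<alpha> \<one>\<^bsub>G\<^esub> = 1\<^sub>m n" "g \<in> carrier G \<Longrightarrow> stab (\<alpha> g)"
    "g \<in> carrier G \<Longrightarrow> h \<in> carrier G \<Longrightarrow> \<alpha> g * \<alpha> h * ginv (\<alpha> (g \<otimes>\<^bsub>G\<^esub> h)) \<in> U"
    "g \<in> carrier G \<Longrightarrow> \<alpha> g \<in> carrier (GL n)" "g \<in> carrier G \<Longrightarrow> \<alpha> g \<in> C"
proof -
  show "gl_regular (carrier G) (regular G) n \<alpha>"
    using assms by (auto simp: hom_mod_U_def variety_morphism_def gl_regular_def simp del: restrict_apply)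
  show "\<alpha> \<one>\<^bsub>G\<^esub> = 1\<^sub>m n" "g \<in> carrier G \<Longrightarrow> stab (\<alpha> g)"
    "g \<in> carrier G \<Longrightarrow> h \<in> carrier G \<Longrightarrow> \<alpha> g * \<alpha> h * ginv (\<alpha> (g \<otimes>\<^bsub>G\<^esub> h)) \<in> U"
    "g \<in> carrier G \<Longrightarrow> \<alpha> g \<in> carrier (GL n)" "g \<in> carrier G \<Longrightarrow> \<alpha> g \<in> C"
    using assms stabD(1,4) by (auto simp: hom_mod_U_def)
qed

lemma stab_conj_U:
  assumes X: "stab X" and u: "u \<in> U"
  shows "X * u * ginv X \<in> U" "ginv X * u * X \<in> U"
proof -
  note St = stabD[OF X]
  obtain j where j: "j \<in> J" "u = 1\<^sub>m n + j" using u by (rule UE)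
  note jC = JD(1)[OF j(1)]
  have "X * u = X + X * j" "ginv X * u = ginv X + ginv X * j"
    unfolding j(2) using St(4,5) jC by (simp_all add: mult_add_distrib_mat[of _ n n _ n])
  then have "X * u * ginv X = 1\<^sub>m n + X * j * ginv X" "ginv X * u * X = 1\<^sub>m n + ginv X * j * X"
    using St(4-7) jC by (simp_all add: add_mult_distrib_mat[of _ n n _ _ n] del: assoc_mult_mat)
  then show "X * u * ginv X \<in> U" "ginv X * u * X \<in> U" using UI[OF St(2)[OF j(1)]] UI[OF St(3)[OF j(1)]] by simp_all
qed

lemma ginv_cancel:
  assumes "X \<in> carrier (GL n)" "Y \<in> C"
  shows "X * (ginv X * Y) = Y" "ginv X * (X * Y) = Y" "Y * X * ginv X = Y" "Y * ginv X * X = Y"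
proof -
  note i = GL_inv[OF assms(1)] and XC = GL_memD[OF assms(1)]
  show "X * (ginv X * Y) = Y" using assoc_mult_mat[OF XC i(4) assms(2)] i(2) assms(2) by simp
  show "ginv X * (X * Y) = Y" using assoc_mult_mat[OF i(4) XC assms(2)] i(3) assms(2) by simp
  show "Y * X * ginv X = Y" using assoc_mult_mat[OF assms(2) XC i(4)] i(2) assms(2) by simp
  show "Y * ginv X * X = Y" using assoc_mult_mat[OF assms(2) i(4) XC] i(3) assms(2) by simp
qed

context
  fixes \<alpha> assumes good: "hom_mod_U \<alpha>"
begin

lemmas good_facts = hom_mod_UD[OF good]

text \<open>The factors \<open>\<alpha> g\<close> and their inverses in the twisted multiplication are there precisely to cancel after multiplication
  by \<open>\<alpha> (g h)\<close>.\<close>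

lemma rho_mult:
  assumes "z \<in> U \<times> carrier G" "w \<in> U \<times> carrier G"
  shows "rho_diamond \<alpha> (z \<otimes>\<^bsub>D \<alpha>\<^esub> w) = rho_diamond \<alpha> z * rho_diamond \<alpha> w" "snd (z \<otimes>\<^bsub>D \<alpha>\<^esub> w) = snd z \<otimes>\<^bsub>G\<^esub> snd w"
    "z \<otimes>\<^bsub>D \<alpha>\<^esub> w \<in> U \<times> carrier G"
proof -
  obtain x g y h where zw: "z = (x, g)" "w = (y, h)" "x \<in> U" "y \<in> U" "g \<in> carrier G" "h \<in> carrier G"
    using assms by auto
  have gh: "g \<otimes>\<^bsub>G\<^esub> h \<in> carrier G" using G_closed zw by blast
  note a = good_facts(5)[OF zw(5)] good_facts(5)[OF zw(6)] good_facts(5)[OF gh]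
  note c = U_C[OF zw(3)] U_C[OF zw(4)] good_facts(6)[OF zw(5)] good_facts(6)[OF zw(6)] good_facts(6)[OF gh] GL_inv(4)[OF a(1)] GL_inv(4)[OF a(2)] GL_inv(4)[OF a(3)]
  have "x * (\<alpha> g * y * ginv (\<alpha> g)) * (\<alpha> g * \<alpha> h * ginv (\<alpha> (g \<otimes>\<^bsub>G\<^esub> h))) * \<alpha> (g \<otimes>\<^bsub>G\<^esub> h) =
    x * (\<alpha> g * (y * (ginv (\<alpha> g) * (\<alpha> g * (\<alpha> h * (ginv (\<alpha> (g \<otimes>\<^bsub>G\<^esub> h)) * \<alpha> (g \<otimes>\<^bsub>G\<^esub> h)))))))"
    using c by (simp add: sq_simps)
  also have "ginv (\<alpha> (g \<otimes>\<^bsub>G\<^esub> h)) * \<alpha> (g \<otimes>\<^bsub>G\<^esub> h) = 1\<^sub>m n" by (rule GL_inv(3)[OF a(3)])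
  also have "\<alpha> h * 1\<^sub>m n = \<alpha> h" using c by simp
  also have "ginv (\<alpha> g) * (\<alpha> g * \<alpha> h) = \<alpha> h" by (rule ginv_cancel(2)[OF a(1) c(4)])
  also have "x * (\<alpha> g * (y * \<alpha> h)) = x * \<alpha> g * (y * \<alpha> h)" using c by (simp add: sq_simps)
  finally show "rho_diamond \<alpha> (z \<otimes>\<^bsub>D \<alpha>\<^esub> w) = rho_diamond \<alpha> z * rho_diamond \<alpha> w"
    by (simp only: zw(1,2) D_simps rho_diamond_def case_prod_conv)
  show "snd (z \<otimes>\<^bsub>D \<alpha>\<^esub> w) = snd z \<otimes>\<^bsub>G\<^esub> snd w" by (simp add: zw D_simps)
  show "z \<otimes>\<^bsub>D \<alpha>\<^esub> w \<in> U \<times> carrier G"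
    unfolding zw(1,2) D_simps
    using U_mult[OF U_mult[OF zw(3) stab_conj_U(1)[OF good_facts(3)[OF zw(5)] zw(4)]] good_facts(4)[OF zw(5,6)]] gh by simp
qed

lemma rho_GL: "z \<in> U \<times> carrier G \<Longrightarrow> rho_diamond \<alpha> z \<in> carrier (GL n)"
  using GL_mult[OF subsetD[OF U_GL] good_facts(5)] by (auto simp: rho_diamond_def)

lemma rho_stab: "z \<in> U \<times> carrier G \<Longrightarrow> stab (rho_diamond \<alpha> z)"
  using stab_mult[OF stab_U good_facts(3)] by (auto simp: rho_diamond_def)

lemma fst_of_rho: "z \<in> U \<times> carrier G \<Longrightarrow> fst z = rho_diamond \<alpha> z * ginv (\<alpha> (snd z))"
  using ginv_cancel(3)[OF good_facts(5) U_C] by (auto simp: rho_diamond_def)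

text \<open>The maps \<open>\<rho>\<^sup>\<diamond>\<close> and \<open>snd\<close> embed the extension into the product of \<open>GL n\<close> and \<open>G\<close>. All group axioms, and later all
  equations between maps into the extension, are checked after this embedding.\<close>

lemma rho_inj:
  assumes "z \<in> U \<times> carrier G" "w \<in> U \<times> carrier G" "rho_diamond \<alpha> z = rho_diamond \<alpha> w" "snd z = snd w"
  shows "z = w"
  using fst_of_rho[OF assms(1)] fst_of_rho[OF assms(2)] assms(3,4) by (metis prod.collapse)

lemma rho_one: "rho_diamond \<alpha> (1\<^sub>m n, \<one>\<^bsub>G\<^esub>) = 1\<^sub>m n" "(1\<^sub>m n, \<one>\<^bsub>G\<^esub>) \<in> U \<times> carrier G"
  using U_one G_closed by (simp_all add: rho_diamond_def good_facts(2))

lemma D_inverse: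
  assumes z: "z \<in> U \<times> carrier G"
  defines "w \<equiv> (ginv (rho_diamond \<alpha> z) * ginv (\<alpha> (inv\<^bsub>G\<^esub> (snd z))), inv\<^bsub>G\<^esub> (snd z))"
  shows "w \<in> U \<times> carrier G" "rho_diamond \<alpha> w = ginv (rho_diamond \<alpha> z)" "w \<otimes>\<^bsub>D \<alpha>\<^esub> z = (1\<^sub>m n, \<one>\<^bsub>G\<^esub>)"
proof -
  obtain u g where ug: "z = (u, g)" "u \<in> U" "g \<in> carrier G" using z by auto
  have gi: "inv\<^bsub>G\<^esub> g \<in> carrier G" using G_closed ug by blast
  define a where "a = \<alpha> g"
  define b where "b = \<alpha> (inv\<^bsub>G\<^esub> g)"
  have aG: "a \<in> carrier (GL n)" and bG: "b \<in> carrier (GL n)" using good_facts(5) ug gi by (auto simp: a_def b_def)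
  have uG: "u \<in> carrier (GL n)" using U_GL ug by blast
  have rz: "rho_diamond \<alpha> z = u * a" by (simp add: ug rho_diamond_def a_def)
  note c = GL_memD[OF uG] GL_memD[OF aG] GL_memD[OF bG] GL_inv(4)[OF aG] GL_inv(4)[OF bG] GL_inv(4)[OF uG]
  have "b * a * ginv (\<alpha> (inv\<^bsub>G\<^esub> g \<otimes>\<^bsub>G\<^esub> g)) \<in> U" unfolding a_def b_def by (rule good_facts(4)[OF gi ug(3)])
  moreover have "inv\<^bsub>G\<^esub> g \<otimes>\<^bsub>G\<^esub> g = \<one>\<^bsub>G\<^esub>" by (rule group.l_inv[OF groupG ug(3)])
  moreover have "ginv (1\<^sub>m n) = (1\<^sub>m n :: 'k mat)" by (rule GL_inv_unique[OF GL_one]) auto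
  ultimately have "b * a \<in> U" using c by (simp add: good_facts(2))
  then have "(b * u * ginv b) * (b * a) \<in> U"
    using stab_conj_U(1)[OF good_facts(3)[OF gi] ug(2)] U_mult unfolding b_def by blast
  also have "(b * u * ginv b) * (b * a) = b * u * (ginv b * (b * a))" using c by (simp add: sq_simps)
  also have "ginv b * (b * a) = a" by (rule ginv_cancel(2)[OF bG c(2)])
  finally have "ginv (b * u * a) \<in> U" by (rule U_inv)
  also have "b * u * a = b * (u * a)" using c by (simp add: sq_simps)
  also have "ginv (b * (u * a)) = ginv (u * a) * ginv b" by (rule GL_inv_mult[OF bG GL_mult[OF uG aG]])
  finally have f: "ginv (u * a) * ginv b \<in> U" .
  have w: "w = (ginv (u * a) * ginv b, inv\<^bsub>G\<^esub> g)" unfolding w_def rz by (simp add: ug b_def)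
  show 1: "w \<in> U \<times> carrier G" using f gi by (simp add: w)
  have "ginv (u * a) * ginv b * b = ginv (u * a)" by (rule ginv_cancel(4)[OF bG GL_inv(4)[OF GL_mult[OF uG aG]]])
  then show 2: "rho_diamond \<alpha> w = ginv (rho_diamond \<alpha> z)" unfolding rz by (simp add: w rho_diamond_def b_def)
  show "w \<otimes>\<^bsub>D \<alpha>\<^esub> z = (1\<^sub>m n, \<one>\<^bsub>G\<^esub>)"
  proof (rule rho_inj[OF rho_mult(3)[OF 1 z] rho_one(2)])
    show "rho_diamond \<alpha> (w \<otimes>\<^bsub>D \<alpha>\<^esub> z) = rho_diamond \<alpha> (1\<^sub>m n, \<one>\<^bsub>G\<^esub>)"
      unfolding rho_mult(1)[OF 1 z] rho_one 2 by (rule GL_inv(3)[OF rho_GL[OF z]])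
    show "snd (w \<otimes>\<^bsub>D \<alpha>\<^esub> z) = snd (1\<^sub>m n :: 'k mat, \<one>\<^bsub>G\<^esub>)"
      unfolding rho_mult(2)[OF 1 z] using group.l_inv[OF groupG ug(3)] by (simp add: w ug)
  qed
qed

lemma group_D: "group (D \<alpha>)"
proof (rule Group.groupI; (unfold D_simps(1,2))?)
  show "z \<otimes>\<^bsub>D \<alpha>\<^esub> w \<in> U \<times> carrier G" if "z \<in> U \<times> carrier G" "w \<in> U \<times> carrier G" for z w
    by (rule rho_mult(3)[OF that])
  show "(1\<^sub>m n, \<one>\<^bsub>G\<^esub>) \<in> U \<times> carrier G" by (rule rho_one(2))
  show "x \<otimes>\<^bsub>D \<alpha>\<^esub> y \<otimes>\<^bsub>D \<alpha>\<^esub> z = x \<otimes>\<^bsub>D \<alpha>\<^esub> (y \<otimes>\<^bsub>D \<alpha>\<^esub> z)"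
    if x: "x \<in> U \<times> carrier G" and y: "y \<in> U \<times> carrier G" and z: "z \<in> U \<times> carrier G" for x y z
  proof (rule rho_inj)
    note xy = rho_mult(3)[OF x y] and yz = rho_mult(3)[OF y z]
    show "x \<otimes>\<^bsub>D \<alpha>\<^esub> y \<otimes>\<^bsub>D \<alpha>\<^esub> z \<in> U \<times> carrier G" "x \<otimes>\<^bsub>D \<alpha>\<^esub> (y \<otimes>\<^bsub>D \<alpha>\<^esub> z) \<in> U \<times> carrier G"
      by (rule rho_mult(3)[OF xy z], rule rho_mult(3)[OF x yz])
    show "rho_diamond \<alpha> (x \<otimes>\<^bsub>D \<alpha>\<^esub> y \<otimes>\<^bsub>D \<alpha>\<^esub> z) = rho_diamond \<alpha> (x \<otimes>\<^bsub>D \<alpha>\<^esub> (y \<otimes>\<^bsub>D \<alpha>\<^esub> z))"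
      unfolding rho_mult(1)[OF xy z] rho_mult(1)[OF x y] rho_mult(1)[OF x yz] rho_mult(1)[OF y z]
      by (rule assoc_mult_mat[OF GL_memD[OF rho_GL[OF x]] GL_memD[OF rho_GL[OF y]] GL_memD[OF rho_GL[OF z]]])
    show "snd (x \<otimes>\<^bsub>D \<alpha>\<^esub> y \<otimes>\<^bsub>D \<alpha>\<^esub> z) = snd (x \<otimes>\<^bsub>D \<alpha>\<^esub> (y \<otimes>\<^bsub>D \<alpha>\<^esub> z))"
      unfolding rho_mult(2)[OF xy z] rho_mult(2)[OF x y] rho_mult(2)[OF x yz] rho_mult(2)[OF y z]
      using x y z by (intro monoid.m_assoc[OF group.is_monoid[OF groupG]]) auto
  qed
  show "(1\<^sub>m n, \<one>\<^bsub>G\<^esub>) \<otimes>\<^bsub>D \<alpha>\<^esub> x = x" if x: "x \<in> U \<times> carrier G" for x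
  proof (rule rho_inj[OF rho_mult(3)[OF rho_one(2) x] x])
    show "rho_diamond \<alpha> ((1\<^sub>m n, \<one>\<^bsub>G\<^esub>) \<otimes>\<^bsub>D \<alpha>\<^esub> x) = rho_diamond \<alpha> x"
      unfolding rho_mult(1)[OF rho_one(2) x] rho_one(1) by (rule left_mult_one_mat[OF GL_memD[OF rho_GL[OF x]]])
    show "snd ((1\<^sub>m n, \<one>\<^bsub>G\<^esub>) \<otimes>\<^bsub>D \<alpha>\<^esub> x) = snd x"
      unfolding rho_mult(2)[OF rho_one(2) x] using monoid.l_one[OF group.is_monoid[OF groupG]] x by auto
  qed
  show "\<exists>y\<in>U \<times> carrier G. y \<otimes>\<^bsub>D \<alpha>\<^esub> x = (1\<^sub>m n, \<one>\<^bsub>G\<^esub>)" if x: "x \<in> U \<times> carrier G" for x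
    using D_inverse(1,3)[OF x] by blast
qed

lemma D_inv:
  assumes "z \<in> U \<times> carrier G"
  shows "inv\<^bsub>D \<alpha>\<^esub> z = (ginv (rho_diamond \<alpha> z) * ginv (\<alpha> (inv\<^bsub>G\<^esub> (snd z))), inv\<^bsub>G\<^esub> (snd z))"
  by (rule group.inv_equality[OF group_D]) (use assms D_inverse[OF assms] in \<open>auto simp: D_simps(1,2)\<close>)

lemma \<Gamma>_subgroup: "subgroup (\<Gamma> \<alpha>) (GL n)"
proof (rule group.subgroupI[OF group_GL])
  show "\<Gamma> \<alpha> \<subseteq> carrier (GL n)" using rho_GL by (auto simp: \<Gamma>_def)
  show "\<Gamma> \<alpha> \<noteq> {}" using rho_one(2) by (auto simp: \<Gamma>_def)
  show "ginv x \<in> \<Gamma> \<alpha>" if x: "x \<in> \<Gamma> \<alpha>" for x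
  proof -
    obtain z where z: "z \<in> U \<times> carrier G" "x = rho_diamond \<alpha> z" using x unfolding \<Gamma>_def by blast
    show ?thesis unfolding \<Gamma>_def z(2) using D_inverse(1,2)[OF z(1)] by (metis image_eqI)
  qed
  show "x \<otimes>\<^bsub>GL n\<^esub> y \<in> \<Gamma> \<alpha>" if xy: "x \<in> \<Gamma> \<alpha>" "y \<in> \<Gamma> \<alpha>" for x y
  proof -
    obtain z w where zw: "z \<in> U \<times> carrier G" "x = rho_diamond \<alpha> z" "w \<in> U \<times> carrier G" "y = rho_diamond \<alpha> w"
      using xy unfolding \<Gamma>_def by blast
    show ?thesis unfolding \<Gamma>_def zw(2,4) GL_simps
      using rho_mult(1,3)[OF zw(1,3)] by (metis image_eqI)
  qed
qed

lemma U_gl_regular: "gl_regular U RU n (\<lambda>X. X)"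
  using U_GL restrict_fun_alg[OF U_GL, of "GL_gens n"] unfolding gl_regular_def GL_simps by blast

lemma T_fst: "gl_regular (U \<times> carrier G) T n fst"
  by (rule gl_regular_compose[OF U_gl_regular]) (auto intro: tensor_funs_fst[OF algG])

lemma T_snd: "f \<in> regular G \<Longrightarrow> (\<lambda>z\<in>U \<times> carrier G. f (snd z)) \<in> T"
  by (rule tensor_funs_snd[OF fun_algebra_fun_alg])

lemma T_alpha: "gl_regular (U \<times> carrier G) T n (\<lambda>z. \<alpha> (snd z))"
  by (rule gl_regular_compose[OF good_facts(1)]) (auto intro: T_snd)

lemma T_rho: "gl_regular (U \<times> carrier G) T n (rho_diamond \<alpha>)"
  using gl_regular_mult[OF T_alg T_fst T_alpha] by (simp add: rho_diamond_def case_prod_unfold)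

text \<open>The component in \<open>U\<close> is \<open>\<rho>\<^sup>\<diamond> z \<alpha>(g)\<^sup>-\<^sup>1\<close>, so it is regular once the two composites are. Regularity of the group operations,
  of the comparison isomorphism and of the map from the universal property all follow from this.\<close>

lemma into_D:
  assumes Z: "fun_algebra Z R" and \<phi>: "\<And>z. z \<in> Z \<Longrightarrow> \<phi> z \<in> U \<times> carrier G"
    and 1: "gl_regular Z R n (\<lambda>z. rho_diamond \<alpha> (\<phi> z))"
    and 2: "\<And>f. f \<in> regular G \<Longrightarrow> (\<lambda>z\<in>Z. f (snd (\<phi> z))) \<in> R"
    and f: "f \<in> T"
  shows "(\<lambda>z\<in>Z. f (\<phi> z)) \<in> R"
proof -
  have "gl_regular Z R n (\<lambda>z. \<alpha> (snd (\<phi> z)))"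
    by (rule gl_regular_compose[OF good_facts(1) _ 2]) (use \<phi> in \<open>auto simp: mem_Times_iff\<close>)
  then have "gl_regular Z R n (\<lambda>z. rho_diamond \<alpha> (\<phi> z) * ginv (\<alpha> (snd (\<phi> z))))"
    by (intro gl_regular_mult[OF Z 1] gl_regular_inv[OF Z])
  then have 3: "gl_regular Z R n (\<lambda>z. fst (\<phi> z))"
    by (rule gl_regular_cong[rotated]) (simp add: fst_of_rho[OF \<phi>])
  have "(\<lambda>z\<in>Z. f (fst (\<phi> z), snd (\<phi> z))) \<in> R"
  proof (rule tensor_funs_pullback[OF Z _ _ 2 f])
    show "fst (\<phi> z) \<in> U \<and> snd (\<phi> z) \<in> carrier G" if "z \<in> Z" for z using \<phi>[OF that] by (auto simp: mem_Times_iff)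
    fix a assume "a \<in> RU"
    then have "a \<in> (\<lambda>f. restrict f U) ` regular (GL n)" unfolding GL_simps restrict_fun_alg[OF U_GL] .
    then obtain a' where a': "a' \<in> regular (GL n)" "a = restrict a' U" by blast
    show "(\<lambda>z\<in>Z. a (fst (\<phi> z))) \<in> R"
      by (rule restrict_cong_mem[OF _ gl_regularD(3)[OF 3 a'(1)]]) (use \<phi> in \<open>auto simp: a'(2) mem_Times_iff\<close>)
  qed
  then show ?thesis by simp
qed

lemma T_gens: "\<exists>F. finite F \<and> T = fun_alg (U \<times> carrier G) F"
proof -
  obtain F where F: "finite F" "regular G = fun_alg (carrier G) F" using affine_alg_groupD(2)[OF G] by blast
  have "finite ((\<lambda>(f :: 'k mat \<Rightarrow> 'k) (z :: 'k mat \<times> 'a). f (fst z)) ` GL_gens n \<union> (\<lambda>f z. f (snd z)) ` F)"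
    by (intro finite_UnI finite_imageI F(1) finite_GL_gens)
  then show ?thesis unfolding F(2) tensor_fun_alg by blast
qed

lemma T_points:
  assumes \<chi>: "algchar (U \<times> carrier G) T \<chi>"
  shows "\<exists>z\<in>U \<times> carrier G. \<forall>f\<in>T. \<chi> f = f z"
proof -
  obtain F where F: "finite F" "regular G = fun_alg (carrier G) F" using affine_alg_groupD(2)[OF G] by blast
  have "algchar U RU (\<lambda>f. \<chi> (\<lambda>z\<in>U \<times> carrier G. f (fst z)))"
    by (rule algchar_pullback[OF T_alg \<chi>]) (auto intro: tensor_funs_fst[OF algG])
  from algchar_gl_closed[OF U_closed this] obtain u where u: "u \<in> U"
    "\<forall>f\<in>RU. \<chi> (\<lambda>z\<in>U \<times> carrier G. f (fst z)) = f u" by blast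
  have "algchar (carrier G) (regular G) (\<lambda>f. \<chi> (\<lambda>z\<in>U \<times> carrier G. f (snd z)))"
    by (rule algchar_pullback[OF T_alg \<chi>]) (auto intro: T_snd)
  from affine_alg_groupD(5)[OF G this] obtain g where g: "g \<in> carrier G"
    "\<forall>f\<in>regular G. \<chi> (\<lambda>z\<in>U \<times> carrier G. f (snd z)) = f g" by blast
  let ?Z = "U \<times> carrier G" and ?F = "(\<lambda>f z. f (fst z)) ` GL_gens n \<union> (\<lambda>f z. f (snd z)) ` F"
  have T: "T = fun_alg ?Z ?F" unfolding F(2) tensor_fun_alg ..
  have "\<chi> f = f (u, g)" if "f \<in> T" for f
  proof (rule algchar_fun_alg_eval[OF \<chi>[unfolded T] _ _ that[unfolded T]])
    show "(u, g) \<in> ?Z" using u g by simp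
    fix f assume "f \<in> ?F"
    then consider a where "a \<in> GL_gens n" "f = (\<lambda>z. a (fst z))" | b where "b \<in> F" "f = (\<lambda>z. b (snd z))" by blast
    then show "\<chi> (restrict f ?Z) = f (u, g)"
    proof cases
      case 1
      have "restrict f ?Z = (\<lambda>z\<in>?Z. restrict a U (fst z))" unfolding 1(2) by (intro restrict_ext) auto
      then show ?thesis using bspec[OF u(2) fun_alg.gen[OF 1(1)]] u(1) 1(2) by simp
    next
      case 2
      have "restrict f ?Z = (\<lambda>z\<in>?Z. restrict b (carrier G) (snd z))" unfolding 2(2) by (intro restrict_ext) auto
      moreover have "restrict b (carrier G) \<in> regular G" unfolding F(2) by (rule fun_alg.gen[OF 2(1)])
      ultimately show ?thesis using bspec[OF g(2)] g(1) 2(2) by force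
    qed
  qed
  then show ?thesis using u(1) g(1) by blast
qed

lemma affine_D: "affine_alg_group (D \<alpha>)"
proof -
  obtain F where F: "finite F" "T = fun_alg (U \<times> carrier G) F" using T_gens by blast
  let ?Z = "U \<times> carrier G"
  note TT = fun_algebra_tensor[OF T_alg T_alg]
  show ?thesis
  proof (rule affine_alg_groupI[OF group_D F(1)]; (unfold D_simps(1,3))?)
    show "T = fun_alg ?Z F" by (rule F(2))
    show "\<exists>z\<in>?Z. \<forall>f\<in>T. \<chi> f = f z" if "algchar ?Z T \<chi>" for \<chi> by (rule T_points[OF that])
    show "z = w" if zw: "z \<in> ?Z" "w \<in> ?Z" and eq: "\<And>f. f \<in> T \<Longrightarrow> f z = f w" for z w
    proof (rule rho_inj[OF zw])
      show "rho_diamond \<alpha> z = rho_diamond \<alpha> w"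
      proof (rule GL_eqI[OF rho_GL[OF zw(1)] rho_GL[OF zw(2)]])
        fix f :: "'k mat \<Rightarrow> 'k" assume "f \<in> regular (GL n)"
        from eq[OF gl_regularD(3)[OF T_rho this]] show "f (rho_diamond \<alpha> z) = f (rho_diamond \<alpha> w)" using zw by simp
      qed
      show "snd z = snd w"
      proof (rule affine_alg_groupD(4)[OF G])
        show "snd z \<in> carrier G" "snd w \<in> carrier G" using zw by auto
        fix f assume "f \<in> regular G"
        from eq[OF T_snd[OF this]] show "f (snd z) = f (snd w)" using zw by simp
      qed
    qed
    fix f assume f: "f \<in> T"
    show "(\<lambda>z\<in>?Z. f (inv\<^bsub>D \<alpha>\<^esub> z)) \<in> T"
    proof (rule into_D[OF T_alg _ _ _ f])
      show "inv\<^bsub>D \<alpha>\<^esub> z \<in> ?Z" if "z \<in> ?Z" for z using D_inverse(1)[OF that] D_inv[OF that] by simp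
      show "gl_regular ?Z T n (\<lambda>z. rho_diamond \<alpha> (inv\<^bsub>D \<alpha>\<^esub> z))"
        by (rule gl_regular_cong[OF _ gl_regular_inv[OF T_alg T_rho]]) (simp only: D_inv D_inverse(2))
      show "(\<lambda>z\<in>?Z. h (snd (inv\<^bsub>D \<alpha>\<^esub> z))) \<in> T" if "h \<in> regular G" for h
        by (rule restrict_cong_mem[OF _ T_snd[OF affine_alg_groupD(6)[OF G that]]]) (auto simp only: D_inv snd_conv mem_Times_iff restrict_apply')
    qed
    have p1: "gl_regular (?Z \<times> ?Z) (tensor_funs ?Z T ?Z T) n (\<lambda>p. rho_diamond \<alpha> (fst p))"
      by (rule gl_regular_compose[OF T_rho]) (auto intro: tensor_funs_fst[OF T_alg])
    have p2: "gl_regular (?Z \<times> ?Z) (tensor_funs ?Z T ?Z T) n (\<lambda>p. rho_diamond \<alpha> (snd p))"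
      by (rule gl_regular_compose[OF T_rho]) (auto intro: tensor_funs_snd[OF T_alg])
    show "(\<lambda>z\<in>?Z \<times> ?Z. f (fst z \<otimes>\<^bsub>D \<alpha>\<^esub> snd z)) \<in> tensor_funs ?Z T ?Z T"
    proof (rule into_D[OF TT _ _ _ f])
      show "fst z \<otimes>\<^bsub>D \<alpha>\<^esub> snd z \<in> ?Z" if "z \<in> ?Z \<times> ?Z" for z using that rho_mult(3) by (auto simp: mem_Times_iff)
      show "gl_regular (?Z \<times> ?Z) (tensor_funs ?Z T ?Z T) n (\<lambda>z. rho_diamond \<alpha> (fst z \<otimes>\<^bsub>D \<alpha>\<^esub> snd z))"
        by (rule gl_regular_cong[OF _ gl_regular_mult[OF TT p1 p2]]) (metis rho_mult(1) mem_Times_iff)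
      show "(\<lambda>z\<in>?Z \<times> ?Z. h (snd (fst z \<otimes>\<^bsub>D \<alpha>\<^esub> snd z))) \<in> tensor_funs ?Z T ?Z T" if h: "h \<in> regular G" for h
      proof -
        have m: "(\<lambda>w\<in>?Z \<times> ?Z. (\<lambda>z\<in>carrier G \<times> carrier G. h (fst z \<otimes>\<^bsub>G\<^esub> snd z)) (snd (fst w), snd (snd w))) \<in> tensor_funs ?Z T ?Z T"
        proof (rule tensor_funs_pullback[OF TT _ _ _ affine_alg_groupD(7)[OF G h]])
          show "(\<lambda>w\<in>?Z \<times> ?Z. a (snd (fst w))) \<in> tensor_funs ?Z T ?Z T" if "a \<in> regular G" for a
            by (rule restrict_cong_mem[OF _ tensor_funs_fst[OF T_alg T_snd[OF that]]]) auto
          show "(\<lambda>w\<in>?Z \<times> ?Z. a (snd (snd w))) \<in> tensor_funs ?Z T ?Z T" if "a \<in> regular G" for a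
            by (rule restrict_cong_mem[OF _ tensor_funs_snd[OF T_alg T_snd[OF that]]]) auto
        qed auto
        show ?thesis
        proof (rule restrict_cong_mem[OF _ m])
          fix w assume w: "w \<in> ?Z \<times> ?Z"
          then have "snd (fst w \<otimes>\<^bsub>D \<alpha>\<^esub> snd w) = snd (fst w) \<otimes>\<^bsub>G\<^esub> snd (snd w)"
            by (intro rho_mult(2)) (auto simp: mem_Times_iff)
          then show "(\<lambda>z\<in>carrier G \<times> carrier G. h (fst z \<otimes>\<^bsub>G\<^esub> snd z)) (snd (fst w), snd (snd w)) = h (snd (fst w \<otimes>\<^bsub>D \<alpha>\<^esub> snd w))"
            using w by auto
        qed
      qed
    qed
  qed
qed

lemma \<Gamma>_closed: "gl_closed n (\<Gamma> \<alpha>)"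
proof -
  obtain F where F: "finite F" "T = fun_alg (U \<times> carrier G) F" using T_gens by blast
  show ?thesis unfolding \<Gamma>_def
    by (rule gl_closed_image[OF F(1) _ T_rho[unfolded F(2)] \<Gamma>_subgroup[unfolded \<Gamma>_def]]) (use T_points F(2) in auto)
qed

lemma affine_S: "affine_alg_group (S \<alpha>)"
  unfolding S_eq by (rule affine_sub_GL[OF \<Gamma>_closed \<Gamma>_subgroup])

end

end

section \<open>Quotients admitting a regular choice of representatives\<close>

lemma quot_simps: "carrier (quot_alg_group S N) = carrier (S Mod N)"
  "x \<otimes>\<^bsub>quot_alg_group S N\<^esub> y = x \<otimes>\<^bsub>S Mod N\<^esub> y" "\<one>\<^bsub>quot_alg_group S N\<^esub> = \<one>\<^bsub>S Mod N\<^esub>"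
  by (simp_all add: quot_alg_group_def)

lemma quot_carrier: "carrier (quot_alg_group S N) = (\<lambda>x. N #>\<^bsub>S\<^esub> x) ` carrier S"
  by (auto simp: quot_simps FactGroup_def RCOSETS_def)

lemma quot_mult:
  assumes "N \<lhd> S" "x \<in> carrier S" "y \<in> carrier S"
  shows "(N #>\<^bsub>S\<^esub> x) \<otimes>\<^bsub>quot_alg_group S N\<^esub> (N #>\<^bsub>S\<^esub> y) = N #>\<^bsub>S\<^esub> (x \<otimes>\<^bsub>S\<^esub> y)"
  using normal.rcos_sum[OF assms] by (simp add: quot_simps FactGroup_def)

lemma group_quot:
  assumes "N \<lhd> S"
  shows "group (quot_alg_group S N)"
proof -
  have "group (S Mod N)" by (rule normal.factorgroup_is_group[OF assms])
  then show ?thesis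
    unfolding group_def monoid_def group_axioms_def Units_def quot_simps .
qed

lemma quot_inv:
  assumes N: "N \<lhd> S" and x: "x \<in> carrier S"
  shows "inv\<^bsub>quot_alg_group S N\<^esub> (N #>\<^bsub>S\<^esub> x) = N #>\<^bsub>S\<^esub> (inv\<^bsub>S\<^esub> x)"
proof (rule group.inv_equality[OF group_quot[OF N]])
  have S: "group S" using N by (simp add: normal_def)
  have ix: "inv\<^bsub>S\<^esub> x \<in> carrier S" by (rule group.inv_closed[OF S x])
  show "(N #>\<^bsub>S\<^esub> inv\<^bsub>S\<^esub> x) \<otimes>\<^bsub>quot_alg_group S N\<^esub> (N #>\<^bsub>S\<^esub> x) = \<one>\<^bsub>quot_alg_group S N\<^esub>"
    unfolding quot_mult[OF N ix x] group.l_inv[OF S x]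
    using group.coset_mult_one[OF S normal_imp_subgroup[OF N, THEN subgroup.subset]]
    by (simp add: quot_simps FactGroup_def)
  show "N #>\<^bsub>S\<^esub> x \<in> carrier (quot_alg_group S N)" "N #>\<^bsub>S\<^esub> inv\<^bsub>S\<^esub> x \<in> carrier (quot_alg_group S N)"
    unfolding quot_carrier using x ix by blast+
qed

lemma quot_hom:
  fixes S :: "('b, 'k::field) alg_group"
  assumes N: "N \<lhd> S"
  shows "alg_group_hom S (quot_alg_group S N) (\<lambda>x. N #>\<^bsub>S\<^esub> x)"
  unfolding alg_group_hom_def variety_morphism_def
proof (intro conjI ballI)
  show "(\<lambda>x. N #>\<^bsub>S\<^esub> x) \<in> hom S (quot_alg_group S N)"
    by (rule homI) (auto simp: quot_carrier quot_mult[OF N])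
  show "(\<lambda>x. N #>\<^bsub>S\<^esub> x) \<in> carrier S \<rightarrow> carrier (quot_alg_group S N)" by (auto simp: quot_carrier)
  show "(\<lambda>x\<in>carrier S. f (N #>\<^bsub>S\<^esub> x)) \<in> regular S" if "f \<in> regular (quot_alg_group S N)" for f
    using that by (simp add: quot_alg_group_def)
qed

text \<open>If \<open>R\<close> is a regular choice of representatives, constant on the cosets, then the functions \<open>h \<circ> R\<close> are the regular functions of
  the quotient. So the quotient inherits a finite set of generators from \<open>S\<close>, its points are separated by the
  representatives, and a character \<open>\<chi>\<close> of the quotient gives the character \<open>h \<mapsto> \<chi>(h \<circ> R)\<close> of \<open>S\<close>, that is a point of \<open>S\<close>.\<close>

lemma affine_quotient:
  fixes S :: "('b, 'k::field) alg_group"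
  assumes S: "affine_alg_group S" and N: "N \<lhd> S"
    and R: "\<And>x. x \<in> carrier S \<Longrightarrow> R x \<in> carrier S" "\<And>x. x \<in> carrier S \<Longrightarrow> R x \<in> N #>\<^bsub>S\<^esub> x"
      "\<And>u x. u \<in> N \<Longrightarrow> x \<in> carrier S \<Longrightarrow> R (u \<otimes>\<^bsub>S\<^esub> x) = R x"
      "\<And>h. h \<in> regular S \<Longrightarrow> (\<lambda>x\<in>carrier S. h (R x)) \<in> regular S"
  shows "affine_alg_group (quot_alg_group S N)"
proof -
  let ?Q = "quot_alg_group S N" and ?c = "\<lambda>x. N #>\<^bsub>S\<^esub> x"
  have gS: "group S" by (rule affine_alg_groupD(1)[OF S])
  have subN: "subgroup N S" by (rule normal_imp_subgroup[OF N])
  note aS = affine_alg_groupD(3)[OF S]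
  obtain F where F: "finite F" "regular S = fun_alg (carrier S) F" using affine_alg_groupD(2)[OF S] by blast
  \<comment> \<open>\<open>R\<close> as a function of the coset.\<close>
  define \<sigma> where "\<sigma> K = R (SOME x. x \<in> carrier S \<and> K = ?c x)" for K
  have cR: "?c (R x) = ?c x" if "x \<in> carrier S" for x
    by (rule group.repr_independence[OF gS R(2)[OF that] that subN, symmetric])
  have \<sigma>c: "\<sigma> (?c x) = R x" if x: "x \<in> carrier S" for x
  proof -
    define y where "y = (SOME y. y \<in> carrier S \<and> ?c x = ?c y)"
    have y: "y \<in> carrier S \<and> ?c x = ?c y" unfolding y_def by (rule someI[of _ x]) (use x in simp)
    then have "y \<in> ?c x" using subgroup.one_closed[OF subN] group.is_monoid[OF gS]
      by (auto simp: r_coset_def intro!: bexI[of _ "\<one>\<^bsub>S\<^esub>"] monoid.l_one[symmetric])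
    then obtain u where "u \<in> N" "y = u \<otimes>\<^bsub>S\<^esub> x" by (auto simp: r_coset_def)
    then have "R y = R x" using R(3) x by blast
    then show ?thesis unfolding \<sigma>_def y_def .
  qed
  have \<sigma>: "\<sigma> K \<in> carrier S" "?c (\<sigma> K) = K" if "K \<in> carrier ?Q" for K
    using that \<sigma>c R(1) cR by (auto simp: quot_carrier)
  have regQ: "f \<in> regular ?Q \<longleftrightarrow> f \<in> extensional (carrier ?Q) \<and> (\<lambda>x\<in>carrier S. f (?c x)) \<in> regular S" for f
    by (simp add: quot_alg_group_def)
  have down: "(\<lambda>K\<in>carrier ?Q. h (\<sigma> K)) \<in> regular ?Q" if h: "h \<in> regular S" for h
    unfolding regQ
  proof
    show "(\<lambda>x\<in>carrier S. (\<lambda>K\<in>carrier ?Q. h (\<sigma> K)) (?c x)) \<in> regular S"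
      by (rule restrict_cong_mem[OF _ R(4)[OF h]]) (auto simp: \<sigma>c quot_carrier)
  qed simp
  have up: "f = (\<lambda>K\<in>carrier ?Q. (\<lambda>x\<in>carrier S. f (?c x)) (\<sigma> K))" "(\<lambda>x\<in>carrier S. f (?c x)) \<in> regular S"
    if f: "f \<in> regular ?Q" for f
  proof -
    show "(\<lambda>x\<in>carrier S. f (?c x)) \<in> regular S" using f regQ by blast
    have "f \<in> extensional (carrier ?Q)" using f regQ by blast
    then show "f = (\<lambda>K\<in>carrier ?Q. (\<lambda>x\<in>carrier S. f (?c x)) (\<sigma> K))"
      by (rule extensionalityI) (auto simp: \<sigma>)
  qed
  have aQ: "fun_algebra (carrier ?Q) (regular ?Q)"
    unfolding fun_algebra_def
  proof (intro conjI allI ballI)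
    show "regular ?Q \<subseteq> extensional (carrier ?Q)" using regQ by blast
    show "(\<lambda>x\<in>carrier ?Q. c) \<in> regular ?Q" for c
      by (rule restrict_cong_mem[OF _ down[OF fun_algebraD(2)[OF aS, of c]]]) (use \<sigma> in auto)
    fix f h assume f: "f \<in> regular ?Q" and h: "h \<in> regular ?Q"
    note fh = up(2)[OF f] up(2)[OF h]
    show "(\<lambda>x\<in>carrier ?Q. f x + h x) \<in> regular ?Q"
      by (rule restrict_cong_mem[OF _ down[OF fun_algebraD(3)[OF aS fh]]]) (use \<sigma> in auto)
    show "(\<lambda>x\<in>carrier ?Q. f x * h x) \<in> regular ?Q"
      by (rule restrict_cong_mem[OF _ down[OF fun_algebraD(4)[OF aS fh]]]) (use \<sigma> in auto)
  qed
  define F' where "F' = (\<lambda>f K. f (\<sigma> K)) ` F"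
  have finF': "finite F'" using F(1) by (simp add: F'_def)
  have rQ: "regular ?Q = fun_alg (carrier ?Q) F'"
  proof
    show "fun_alg (carrier ?Q) F' \<subseteq> regular ?Q"
    proof (rule fun_alg_least[OF aQ])
      fix f' assume "f' \<in> F'"
      then obtain f where f: "f \<in> F" "f' = (\<lambda>K. f (\<sigma> K))" by (auto simp: F'_def)
      have "restrict f (carrier S) \<in> regular S" unfolding F(2) by (rule fun_alg.gen[OF f(1)])
      from down[OF this] show "restrict f' (carrier ?Q) \<in> regular ?Q"
        by (rule restrict_cong_mem[rotated]) (simp add: f(2) \<sigma>)
    qed
    show "regular ?Q \<subseteq> fun_alg (carrier ?Q) F'"
    proof
      fix f assume f: "f \<in> regular ?Q"
      have "(\<lambda>K\<in>carrier ?Q. (\<lambda>x\<in>carrier S. f (?c x)) (\<sigma> K)) \<in> fun_alg (carrier ?Q) F'"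
      proof (rule fun_alg_pullback[OF fun_algebra_fun_alg \<sigma>(1) _ up(2)[OF f, unfolded F(2)]])
        fix h assume "h \<in> F"
        then have "(\<lambda>K. h (\<sigma> K)) \<in> F'" by (simp add: F'_def)
        then show "(\<lambda>K\<in>carrier ?Q. h (\<sigma> K)) \<in> fun_alg (carrier ?Q) F'" by (rule fun_alg.gen)
      qed
      then show "f \<in> fun_alg (carrier ?Q) F'" unfolding up(1)[OF f, symmetric] .
    qed
  qed
  show ?thesis
  proof (rule affine_alg_groupI[OF group_quot[OF N] finF' rQ])
    fix K L assume KL: "K \<in> carrier ?Q" "L \<in> carrier ?Q" "\<And>f. f \<in> regular ?Q \<Longrightarrow> f K = f L"
    have "\<sigma> K = \<sigma> L"
    proof (rule affine_alg_groupD(4)[OF S \<sigma>(1)[OF KL(1)] \<sigma>(1)[OF KL(2)]])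
      fix h assume "h \<in> regular S"
      from KL(3)[OF down[OF this]] show "h (\<sigma> K) = h (\<sigma> L)" using KL(1,2) by simp
    qed
    then show "K = L" using \<sigma>(2)[OF KL(1)] \<sigma>(2)[OF KL(2)] by metis
  next
    fix \<chi> assume \<chi>: "algchar (carrier ?Q) (regular ?Q) \<chi>"
    have "algchar (carrier S) (regular S) (\<lambda>h. \<chi> (\<lambda>K\<in>carrier ?Q. h (\<sigma> K)))"
      by (rule algchar_pullback[where \<phi> = \<sigma>, OF aQ \<chi> \<sigma>(1)]) (auto intro: down)
    from affine_alg_groupD(5)[OF S this] obtain x where x: "x \<in> carrier S"
      "\<forall>h\<in>regular S. \<chi> (\<lambda>K\<in>carrier ?Q. h (\<sigma> K)) = h x" by blast
    have "\<chi> f = f (?c x)" if f: "f \<in> regular ?Q" for f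
      using bspec[OF x(2) up(2)[OF f]] x(1) unfolding up(1)[OF f, symmetric] by simp
    then show "\<exists>K\<in>carrier ?Q. \<forall>f\<in>regular ?Q. \<chi> f = f K" using x(1) unfolding quot_carrier by blast
  next
    fix f assume f: "f \<in> regular ?Q"
    define h where "h = (\<lambda>x\<in>carrier S. f (?c x))"
    have h: "h \<in> regular S" unfolding h_def by (rule up(2)[OF f])
    have hx: "h x = f (?c x)" if "x \<in> carrier S" for x using that by (simp add: h_def)
    show "(\<lambda>K\<in>carrier ?Q. f (inv\<^bsub>?Q\<^esub> K)) \<in> regular ?Q"
    proof (rule restrict_cong_mem[OF _ down[OF affine_alg_groupD(6)[OF S h]]])
      fix K assume K: "K \<in> carrier ?Q"
      show "(\<lambda>x\<in>carrier S. h (inv\<^bsub>S\<^esub> x)) (\<sigma> K) = f (inv\<^bsub>?Q\<^esub> K)"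
        using quot_inv[OF N \<sigma>(1)[OF K]] \<sigma>[OF K] group.inv_closed[OF gS] by (simp add: hx)
    qed
    let ?T = "tensor_funs (carrier ?Q) (regular ?Q) (carrier ?Q) (regular ?Q)"
    have "(\<lambda>z\<in>carrier ?Q \<times> carrier ?Q. (\<lambda>z\<in>carrier S \<times> carrier S. h (fst z \<otimes>\<^bsub>S\<^esub> snd z)) (\<sigma> (fst z), \<sigma> (snd z))) \<in> ?T"
    proof (rule tensor_funs_pullback[OF fun_algebra_tensor[OF aQ aQ] _ _ _ affine_alg_groupD(7)[OF S h]])
      show "\<sigma> (fst z) \<in> carrier S \<and> \<sigma> (snd z) \<in> carrier S" if "z \<in> carrier ?Q \<times> carrier ?Q" for z using that \<sigma> by auto
      show "(\<lambda>z\<in>carrier ?Q \<times> carrier ?Q. a (\<sigma> (fst z))) \<in> ?T" if "a \<in> regular S" for a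
        by (rule restrict_cong_mem[OF _ tensor_funs_fst[OF aQ down[OF that]]]) auto
      show "(\<lambda>z\<in>carrier ?Q \<times> carrier ?Q. a (\<sigma> (snd z))) \<in> ?T" if "a \<in> regular S" for a
        by (rule restrict_cong_mem[OF _ tensor_funs_snd[OF aQ down[OF that]]]) auto
    qed
    then show "(\<lambda>z\<in>carrier ?Q \<times> carrier ?Q. f (fst z \<otimes>\<^bsub>?Q\<^esub> snd z)) \<in> ?T"
    proof (rule restrict_cong_mem[rotated])
      fix z assume z: "z \<in> carrier ?Q \<times> carrier ?Q"
      then have s: "\<sigma> (fst z) \<in> carrier S" "\<sigma> (snd z) \<in> carrier S" "?c (\<sigma> (fst z)) = fst z" "?c (\<sigma> (snd z)) = snd z"
        using \<sigma> by auto
      have "f (fst z \<otimes>\<^bsub>?Q\<^esub> snd z) = f (?c (\<sigma> (fst z) \<otimes>\<^bsub>S\<^esub> \<sigma> (snd z)))"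
        using quot_mult[OF N s(1,2)] s(3,4) by simp
      also have "\<dots> = h (\<sigma> (fst z) \<otimes>\<^bsub>S\<^esub> \<sigma> (snd z))"
        using hx monoid.m_closed[OF group.is_monoid[OF gS] s(1,2)] by simp
      finally show "(\<lambda>z\<in>carrier S \<times> carrier S. h (fst z \<otimes>\<^bsub>S\<^esub> snd z)) (\<sigma> (fst z), \<sigma> (snd z)) = f (fst z \<otimes>\<^bsub>?Q\<^esub> snd z)"
        using s(1,2) by simp
    qed
  qed
qed

section \<open>The pull-back square\<close>

context diamond
begin

lemma Qt_eq: "Qt \<alpha> = quot_alg_group (S \<alpha>) U"
  by (simp add: G_star_mod_U_def U_eq)

lemma q_eq: "q \<alpha> X = U #>\<^bsub>S \<alpha>\<^esub> X"
  by (simp add: quot_map_def U_eq)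

lemma q_mem: "Y \<in> q \<alpha> X \<longleftrightarrow> (\<exists>u\<in>U. Y = u * X)"
  by (auto simp: q_eq r_coset_def S_simps)

lemma q_self: "X \<in> C \<Longrightarrow> X \<in> q \<alpha> X"
  unfolding q_mem using U_one by (intro bexI[of _ "1\<^sub>m n"]) auto

lemma induced_eq: "induced_map G Id n \<rho> V \<alpha> g = q \<alpha> (\<alpha> g)"
  by (simp add: induced_map_def)

context
  fixes \<alpha> assumes good: "hom_mod_U \<alpha>"
begin

lemmas good_facts' = hom_mod_UD[OF good]

lemma \<Gamma>_GL: "X \<in> \<Gamma> \<alpha> \<Longrightarrow> X \<in> carrier (GL n)"
  using subgroup.subset[OF \<Gamma>_subgroup[OF good]] by blast

lemma \<Gamma>_stab: "X \<in> \<Gamma> \<alpha> \<Longrightarrow> stab X"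
  using rho_stab[OF good] unfolding \<Gamma>_def by blast

lemma U_sub_\<Gamma>: "U \<subseteq> \<Gamma> \<alpha>"
proof
  fix u assume u: "u \<in> U"
  have "rho_diamond \<alpha> (u, \<one>\<^bsub>G\<^esub>) = u" using U_C[OF u] by (simp add: rho_diamond_def good_facts'(2))
  moreover have "(u, \<one>\<^bsub>G\<^esub>) \<in> U \<times> carrier G" using u G_closed by simp
  ultimately show "u \<in> \<Gamma> \<alpha>" unfolding \<Gamma>_def by (metis image_eqI)
qed

lemma alpha_\<Gamma>:
  assumes "g \<in> carrier G"
  shows "\<alpha> g \<in> \<Gamma> \<alpha>"
proof -
  have "rho_diamond \<alpha> (1\<^sub>m n, g) = \<alpha> g" using left_mult_one_mat[OF good_facts'(6)[OF assms]] by (simp add: rho_diamond_def)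
  moreover have "(1\<^sub>m n, g) \<in> U \<times> carrier G" using U_one assms by simp
  ultimately show ?thesis unfolding \<Gamma>_def by (metis image_eqI)
qed

lemma S_inv: "X \<in> \<Gamma> \<alpha> \<Longrightarrow> inv\<^bsub>S \<alpha>\<^esub> X = ginv X"
  using \<Gamma>_GL GL_inv(3) subgroup.m_inv_closed[OF \<Gamma>_subgroup[OF good]]
  by (intro group.inv_equality[OF affine_alg_groupD(1)[OF affine_S[OF good]]]) (auto simp: S_simps)

lemma U_normal: "U \<lhd> S \<alpha>"
proof -
  have gS: "group (S \<alpha>)" by (rule affine_alg_groupD(1)[OF affine_S[OF good]])
  have sub: "subgroup U (S \<alpha>)"
  proof (rule group.subgroupI[OF gS])
    show "U \<subseteq> carrier (S \<alpha>)" using U_sub_\<Gamma> by (simp add: S_simps)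
    show "U \<noteq> {}" using U_one by blast
    show "inv\<^bsub>S \<alpha>\<^esub> u \<in> U" if "u \<in> U" for u using S_inv U_sub_\<Gamma> U_inv that by auto
    show "u \<otimes>\<^bsub>S \<alpha>\<^esub> v \<in> U" if "u \<in> U" "v \<in> U" for u v using U_mult[OF that] by (simp add: S_simps)
  qed
  show ?thesis
    unfolding group.normal_inv_iff[OF gS]
  proof (intro conjI ballI)
    show "subgroup U (S \<alpha>)" by (rule sub)
    fix X u assume "X \<in> carrier (S \<alpha>)" "u \<in> U"
    then show "X \<otimes>\<^bsub>S \<alpha>\<^esub> u \<otimes>\<^bsub>S \<alpha>\<^esub> inv\<^bsub>S \<alpha>\<^esub> X \<in> U"
      using stab_conj_U(1)[OF \<Gamma>_stab] S_inv by (simp add: S_simps)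
  qed
qed

lemma \<Gamma>_lift: "f \<in> regular (S \<alpha>) \<Longrightarrow> \<exists>f'\<in>regular (GL n). f = restrict f' (\<Gamma> \<alpha>)"
  by (auto simp: S_eq sub_alg_group_def)

lemma into_S:
  assumes "gl_regular Z R n \<phi>" "\<And>z. z \<in> Z \<Longrightarrow> \<phi> z \<in> \<Gamma> \<alpha>" "f \<in> regular (S \<alpha>)"
  shows "(\<lambda>z\<in>Z. f (\<phi> z)) \<in> R"
proof -
  obtain f' where f': "f' \<in> regular (GL n)" "f = restrict f' (\<Gamma> \<alpha>)" using \<Gamma>_lift[OF assms(3)] by blast
  show ?thesis
    by (rule restrict_cong_mem[OF _ gl_regularD(3)[OF assms(1) f'(1)]]) (simp add: f'(2) assms(2))
qed

lemma \<Gamma>_id: "gl_regular (\<Gamma> \<alpha>) (regular (S \<alpha>)) n (\<lambda>X. X)"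
  unfolding gl_regular_def
proof (intro conjI ballI)
  fix f :: "'k mat \<Rightarrow> 'k" assume "f \<in> regular (GL n)"
  then show "restrict (\<lambda>X. f X) (\<Gamma> \<alpha>) \<in> regular (S \<alpha>)" unfolding S_eq sub_alg_group_def by auto
qed (rule \<Gamma>_GL)

text \<open>The regular coset representatives modulo \<open>1 + J\<close> are available on all of \<open>\<Gamma> \<alpha>\<close> because it normalizes \<open>J\<close>.\<close>

lemma affine_Qt: "affine_alg_group (Qt \<alpha>)"
proof -
  note aff = affine_S[OF good]
  obtain R where R: "gl_regular (\<Gamma> \<alpha>) (regular (S \<alpha>)) n R" "\<forall>X\<in>\<Gamma> \<alpha>. \<exists>u\<in>U. R X = u * X"
    "\<forall>u\<in>U. \<forall>X\<in>\<Gamma> \<alpha>. R (u * X) = R X"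
    using unipotent_retraction[OF affine_alg_groupD(3)[OF aff, unfolded S_simps] \<Gamma>_id \<Gamma>_stab] by blast
  have R\<Gamma>: "R X \<in> \<Gamma> \<alpha>" if X: "X \<in> \<Gamma> \<alpha>" for X
  proof -
    obtain u where "u \<in> U" "R X = u * X" using R(2) X by blast
    then show ?thesis using subgroup.m_closed[OF \<Gamma>_subgroup[OF good], of u X] U_sub_\<Gamma> X by (auto simp: GL_simps)
  qed
  show ?thesis
    unfolding Qt_eq
  proof (rule affine_quotient[OF aff U_normal, where R = R]; (unfold S_simps)?)
    show "R X \<in> U #>\<^bsub>S \<alpha>\<^esub> X" if "X \<in> \<Gamma> \<alpha>" for X
      using R(2) that by (auto simp: r_coset_def S_simps)
    show "(\<lambda>x\<in>\<Gamma> \<alpha>. h (R x)) \<in> regular (S \<alpha>)" if "h \<in> regular (S \<alpha>)" for h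
      by (rule into_S[OF R(1) R\<Gamma> that])
  qed (use R R\<Gamma> in auto)
qed

lemma q_hom: "alg_group_hom (S \<alpha>) (Qt \<alpha>) (q \<alpha>)"
proof -
  have "q \<alpha> = (\<lambda>X. U #>\<^bsub>S \<alpha>\<^esub> X)" by (rule ext) (rule q_eq)
  then show ?thesis using quot_hom[OF U_normal] by (simp add: Qt_eq)
qed

lemma q_U: "u \<in> U \<Longrightarrow> X \<in> \<Gamma> \<alpha> \<Longrightarrow> q \<alpha> (u * X) = q \<alpha> X"
  unfolding q_eq
  by (rule group.repr_independence[OF affine_alg_groupD(1)[OF affine_S[OF good]] _ _ normal_imp_subgroup[OF U_normal], symmetric])
    (auto simp: r_coset_def S_simps)

text \<open>The failure of \<open>\<alpha>\<close> to be a homomorphism lies in \<open>U\<close> and disappears in the quotient.\<close>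

lemma induced_hom: "alg_group_hom G (Qt \<alpha>) (induced_map G Id n \<rho> V \<alpha>)"
  unfolding alg_group_hom_def variety_morphism_def
proof (intro conjI ballI)
  have qc: "q \<alpha> X \<in> carrier (Qt \<alpha>)" if "X \<in> \<Gamma> \<alpha>" for X
    using q_hom that by (auto simp: alg_group_hom_def variety_morphism_def S_simps)
  show "induced_map G Id n \<rho> V \<alpha> \<in> carrier G \<rightarrow> carrier (Qt \<alpha>)" using qc alpha_\<Gamma> by (simp add: induced_eq)
  show "induced_map G Id n \<rho> V \<alpha> \<in> hom G (Qt \<alpha>)"
  proof (rule homI)
    fix g h assume gh: "g \<in> carrier G" "h \<in> carrier G"
    have c: "g \<otimes>\<^bsub>G\<^esub> h \<in> carrier G" using G_closed gh by blast
    have "q \<alpha> (\<alpha> g) \<otimes>\<^bsub>Qt \<alpha>\<^esub> q \<alpha> (\<alpha> h) = q \<alpha> (\<alpha> g * \<alpha> h)"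
      using quot_mult[OF U_normal, of "\<alpha> g" "\<alpha> h"] alpha_\<Gamma>[OF gh(1)] alpha_\<Gamma>[OF gh(2)] by (simp add: S_simps Qt_eq q_eq)
    also have "\<alpha> g * \<alpha> h = \<alpha> g * \<alpha> h * ginv (\<alpha> (g \<otimes>\<^bsub>G\<^esub> h)) * \<alpha> (g \<otimes>\<^bsub>G\<^esub> h)"
      by (rule ginv_cancel(4)[OF good_facts'(5)[OF c] mult_carrier_mat[OF good_facts'(6)[OF gh(1)] good_facts'(6)[OF gh(2)]], symmetric])
    also have "q \<alpha> \<dots> = q \<alpha> (\<alpha> (g \<otimes>\<^bsub>G\<^esub> h))" by (rule q_U[OF good_facts'(4)[OF gh] alpha_\<Gamma>[OF c]])
    finally show "induced_map G Id n \<rho> V \<alpha> (g \<otimes>\<^bsub>G\<^esub> h) = induced_map G Id n \<rho> V \<alpha> g \<otimes>\<^bsub>Qt \<alpha>\<^esub> induced_map G Id n \<rho> V \<alpha> h"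
      by (simp add: induced_eq)
  qed (simp add: induced_eq qc alpha_\<Gamma>)
  fix f assume "f \<in> regular (Qt \<alpha>)"
  then have f: "(\<lambda>X\<in>\<Gamma> \<alpha>. f (q \<alpha> X)) \<in> regular (S \<alpha>)"
    using q_hom by (auto simp: alg_group_hom_def variety_morphism_def S_simps simp del: restrict_apply)
  show "(\<lambda>g\<in>carrier G. f (induced_map G Id n \<rho> V \<alpha> g)) \<in> regular G"
    by (rule restrict_cong_mem[OF _ into_S[OF good_facts'(1) alpha_\<Gamma> f]]) (simp_all add: induced_eq alpha_\<Gamma>)
qed

lemma snd_hom: "alg_group_hom (D \<alpha>) G snd"
  unfolding alg_group_hom_def variety_morphism_def
proof (intro conjI ballI)
  show "snd \<in> hom (D \<alpha>) G" by (rule homI) (auto simp: D_simps)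
  show "snd \<in> carrier (D \<alpha>) \<rightarrow> carrier G" by (auto simp: D_simps)
  show "(\<lambda>z\<in>carrier (D \<alpha>). f (snd z)) \<in> regular (D \<alpha>)" if "f \<in> regular G" for f
    using T_snd[OF good that] by (simp only: D_simps)
qed

lemma rho_hom: "alg_group_hom (D \<alpha>) (S \<alpha>) (rho_diamond \<alpha>)"
  unfolding alg_group_hom_def variety_morphism_def
proof (intro conjI ballI)
  have m: "rho_diamond \<alpha> z \<in> \<Gamma> \<alpha>" if "z \<in> U \<times> carrier G" for z unfolding \<Gamma>_def using that by (rule imageI)
  show "rho_diamond \<alpha> \<in> hom (D \<alpha>) (S \<alpha>)" by (rule homI) (simp_all only: D_simps(1) S_simps m rho_mult[OF good])
  show "rho_diamond \<alpha> \<in> carrier (D \<alpha>) \<rightarrow> carrier (S \<alpha>)" using m by (simp only: D_simps(1) S_simps Pi_iff) blast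
  show "(\<lambda>z\<in>carrier (D \<alpha>). f (rho_diamond \<alpha> z)) \<in> regular (D \<alpha>)" if "f \<in> regular (S \<alpha>)" for f
    unfolding D_simps(1,3) by (rule into_S[OF T_rho[OF good] m that])
qed

text \<open>Two maps \<open>a\<close> into \<open>G\<close> and \<open>b\<close> into \<open>\<Gamma> \<alpha>\<close> that agree in the quotient satisfy \<open>b t = u \<alpha>(a t)\<close> with \<open>u \<in> U\<close>, so the map to the
  extension can only be, and is, \<open>t \<mapsto> (u, a t)\<close>.\<close>

lemma pullback:
  "is_pullback TYPE('t) (D \<alpha>) G (S \<alpha>) (Qt \<alpha>) snd (rho_diamond \<alpha>) (induced_map G Id n \<rho> V \<alpha>) (q \<alpha>)"
  unfolding is_pullback_def
proof (intro conjI allI impI ballI)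
  show "affine_alg_group (D \<alpha>)" "affine_alg_group G" "affine_alg_group (S \<alpha>)" "affine_alg_group (Qt \<alpha>)"
    by (rule affine_D[OF good] G affine_S[OF good] affine_Qt)+
  show "alg_group_hom (D \<alpha>) G snd" "alg_group_hom (D \<alpha>) (S \<alpha>) (rho_diamond \<alpha>)"
    "alg_group_hom G (Qt \<alpha>) (induced_map G Id n \<rho> V \<alpha>)" "alg_group_hom (S \<alpha>) (Qt \<alpha>) (q \<alpha>)"
    by (rule snd_hom rho_hom induced_hom q_hom)+
  show "induced_map G Id n \<rho> V \<alpha> (snd z) = q \<alpha> (rho_diamond \<alpha> z)" if "z \<in> carrier (D \<alpha>)" for z
    using that q_U alpha_\<Gamma> by (auto simp: D_simps induced_eq rho_diamond_def)
  fix X :: "('t, 'k) alg_group" and a b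
  assume asm: "affine_alg_group X \<and> alg_group_hom X G a \<and> alg_group_hom X (S \<alpha>) b \<and>
    (\<forall>t\<in>carrier X. induced_map G Id n \<rho> V \<alpha> (a t) = q \<alpha> (b t))"
  have a: "a \<in> hom X G" "t \<in> carrier X \<Longrightarrow> a t \<in> carrier G" "f \<in> regular G \<Longrightarrow> (\<lambda>t\<in>carrier X. f (a t)) \<in> regular X"
    and b: "b \<in> hom X (S \<alpha>)" "t \<in> carrier X \<Longrightarrow> b t \<in> \<Gamma> \<alpha>" "h \<in> regular (S \<alpha>) \<Longrightarrow> (\<lambda>t\<in>carrier X. h (b t)) \<in> regular X"
    and ab: "t \<in> carrier X \<Longrightarrow> q \<alpha> (\<alpha> (a t)) = q \<alpha> (b t)" for t f h
    using asm by (auto simp: alg_group_hom_def variety_morphism_def S_simps induced_eq simp del: restrict_apply)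
  have aX: "affine_alg_group X" using asm by blast
  note algX = affine_alg_groupD(3)[OF aX]
  have closedX: "s \<in> carrier X \<Longrightarrow> t \<in> carrier X \<Longrightarrow> s \<otimes>\<^bsub>X\<^esub> t \<in> carrier X" for s t
    by (rule monoid.m_closed[OF group.is_monoid[OF affine_alg_groupD(1)[OF aX]]])
  define c where "c = (\<lambda>t\<in>carrier X. (b t * ginv (\<alpha> (a t)), a t))"
  have c1: "c t = (b t * ginv (\<alpha> (a t)), a t)" "c t \<in> U \<times> carrier G" "rho_diamond \<alpha> (c t) = b t" "snd (c t) = a t"
    if t: "t \<in> carrier X" for t
  proof -
    show e: "c t = (b t * ginv (\<alpha> (a t)), a t)" using t by (simp add: c_def)
    note at = a(2)[OF t]
    have "b t \<in> q \<alpha> (\<alpha> (a t))" unfolding ab[OF t] by (rule q_self[OF GL_memD[OF \<Gamma>_GL[OF b(2)[OF t]]]])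
    then obtain u where u: "u \<in> U" "b t = u * \<alpha> (a t)" unfolding q_mem by blast
    have "b t * ginv (\<alpha> (a t)) = u" unfolding u(2) by (rule ginv_cancel(3)[OF good_facts'(5)[OF at] U_C[OF u(1)]])
    then show "c t \<in> U \<times> carrier G" "rho_diamond \<alpha> (c t) = b t" "snd (c t) = a t"
      using u at e by (simp_all add: rho_diamond_def)
  qed
  show "\<exists>!c. c \<in> extensional (carrier X) \<and> alg_group_hom X (D \<alpha>) c \<and> (\<forall>t\<in>carrier X. snd (c t) = a t \<and> rho_diamond \<alpha> (c t) = b t)"
  proof (rule ex1I[of _ c])
    have hom: "c \<in> hom X (D \<alpha>)"
    proof (rule homI)
      show "c t \<in> carrier (D \<alpha>)" if "t \<in> carrier X" for t unfolding D_simps(1) by (rule c1(2)[OF that])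
      fix s t assume st: "s \<in> carrier X" "t \<in> carrier X"
      note s = c1[OF st(1)] and t = c1[OF st(2)] and stc = c1[OF closedX[OF st]]
      show "c (s \<otimes>\<^bsub>X\<^esub> t) = c s \<otimes>\<^bsub>D \<alpha>\<^esub> c t"
      proof (rule rho_inj[OF good stc(2) rho_mult(3)[OF good s(2) t(2)]])
        show "rho_diamond \<alpha> (c (s \<otimes>\<^bsub>X\<^esub> t)) = rho_diamond \<alpha> (c s \<otimes>\<^bsub>D \<alpha>\<^esub> c t)"
          unfolding rho_mult(1)[OF good s(2) t(2)] stc(3) s(3) t(3) using hom_mult[OF b(1) st] by (simp add: S_simps)
        show "snd (c (s \<otimes>\<^bsub>X\<^esub> t)) = snd (c s \<otimes>\<^bsub>D \<alpha>\<^esub> c t)"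
          unfolding rho_mult(2)[OF good s(2) t(2)] stc(4) s(4) t(4) by (rule hom_mult[OF a(1) st])
      qed
    qed
    have bX: "gl_regular (carrier X) (regular X) n b"
      by (rule gl_regular_compose[OF \<Gamma>_id, where p = b]) (auto intro: b(2,3))
    have "(\<lambda>t\<in>carrier X. f (c t)) \<in> regular X" if f: "f \<in> T" for f
    proof (rule into_D[OF good algX c1(2) _ _ f])
      show "gl_regular (carrier X) (regular X) n (\<lambda>t. rho_diamond \<alpha> (c t))"
        by (rule gl_regular_cong[OF _ bX]) (simp only: c1(3))
      show "(\<lambda>t\<in>carrier X. h (snd (c t))) \<in> regular X" if "h \<in> regular G" for h
        by (rule restrict_cong_mem[OF _ a(3)[OF that]]) (simp only: c1(4))
    qed
    then have "alg_group_hom X (D \<alpha>) c"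
      using hom c1(2) by (auto simp: alg_group_hom_def variety_morphism_def D_simps(1,3) simp del: restrict_apply)
    then show "c \<in> extensional (carrier X) \<and> alg_group_hom X (D \<alpha>) c \<and> (\<forall>t\<in>carrier X. snd (c t) = a t \<and> rho_diamond \<alpha> (c t) = b t)"
      using c1(3,4) by (auto simp: c_def simp del: restrict_apply)
    fix c' assume c': "c' \<in> extensional (carrier X) \<and> alg_group_hom X (D \<alpha>) c' \<and> (\<forall>t\<in>carrier X. snd (c' t) = a t \<and> rho_diamond \<alpha> (c' t) = b t)"
    show "c' = c"
    proof (rule extensionalityI[of _ "carrier X"])
      show "c' \<in> extensional (carrier X)" "c \<in> extensional (carrier X)" using c' by (auto simp: c_def)
      fix t assume t: "t \<in> carrier X"
      have "c' t \<in> U \<times> carrier G" using c' t by (auto simp: alg_group_hom_def variety_morphism_def D_simps(1))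
      then show "c' t = c t" by (rule rho_inj[OF good _ c1(2)[OF t]]) (use c' t c1(3,4) in auto)
    qed
  qed
qed

end

section \<open>Comparison of two affording morphisms\<close>

text \<open>The correction factor is forced by the requirement that \<open>\<theta>\<close> preserve the action on the vectors.\<close>

definition \<theta> :: "('a \<Rightarrow> 'k mat) \<Rightarrow> ('a \<Rightarrow> 'k mat) \<Rightarrow> 'k mat \<times> 'a \<Rightarrow> 'k mat \<times> 'a" where
  "\<theta> \<beta> \<alpha> z = (fst z * (\<beta> (snd z) * ginv (\<alpha> (snd z))), snd z)"

context
  fixes \<alpha> \<beta> assumes good: "hom_mod_U \<alpha>" "hom_mod_U \<beta>" and diff: "\<And>g. g \<in> carrier G \<Longrightarrow> \<beta> g * ginv (\<alpha> g) \<in> U"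
begin

lemma \<theta>:
  assumes z: "z \<in> U \<times> carrier G"
  shows "\<theta> \<beta> \<alpha> z \<in> U \<times> carrier G" "snd (\<theta> \<beta> \<alpha> z) = snd z" "rho_diamond \<alpha> (\<theta> \<beta> \<alpha> z) = rho_diamond \<beta> z"
proof -
  obtain u g where ug: "z = (u, g)" "u \<in> U" "g \<in> carrier G" using z by auto
  show "\<theta> \<beta> \<alpha> z \<in> U \<times> carrier G" using U_mult[OF ug(2) diff[OF ug(3)]] ug by (simp add: \<theta>_def)
  show "snd (\<theta> \<beta> \<alpha> z) = snd z" by (simp add: \<theta>_def)
  note a = hom_mod_UD(5)[OF good(1) ug(3)] and c = U_C[OF ug(2)] hom_mod_UD(6)[OF good(2) ug(3)]
  have "u * (\<beta> g * ginv (\<alpha> g)) * \<alpha> g = u * (\<beta> g * ginv (\<alpha> g) * \<alpha> g)"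
    by (rule assoc_mult_mat[OF c(1) U_C[OF diff[OF ug(3)]] GL_memD[OF a]])
  also have "\<beta> g * ginv (\<alpha> g) * \<alpha> g = \<beta> g" by (rule ginv_cancel(4)[OF a c(2)])
  finally show "rho_diamond \<alpha> (\<theta> \<beta> \<alpha> z) = rho_diamond \<beta> z" by (simp only: \<theta>_def ug rho_diamond_def fst_conv snd_conv case_prod_conv)
qed

lemma \<Gamma>_sub: "\<Gamma> \<beta> \<subseteq> \<Gamma> \<alpha>"
proof
  fix X assume "X \<in> \<Gamma> \<beta>"
  then obtain z where "z \<in> U \<times> carrier G" "X = rho_diamond \<beta> z" unfolding \<Gamma>_def by blast
  then show "X \<in> \<Gamma> \<alpha>" unfolding \<Gamma>_def using \<theta>(1,3) by (metis image_eqI)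
qed

lemma \<theta>_hom: "alg_group_hom (D \<beta>) (D \<alpha>) (\<theta> \<beta> \<alpha>)"
  unfolding alg_group_hom_def variety_morphism_def
proof (intro conjI ballI)
  show "\<theta> \<beta> \<alpha> \<in> carrier (D \<beta>) \<rightarrow> carrier (D \<alpha>)" unfolding D_simps(1) using \<theta>(1) by blast
  show "\<theta> \<beta> \<alpha> \<in> hom (D \<beta>) (D \<alpha>)"
  proof (rule homI; (unfold D_simps(1))?)
    show "\<theta> \<beta> \<alpha> z \<in> U \<times> carrier G" if "z \<in> U \<times> carrier G" for z by (rule \<theta>(1)[OF that])
    fix z w assume z: "z \<in> U \<times> carrier G" and w: "w \<in> U \<times> carrier G"
    note zw = rho_mult[OF good(2) z w] and zw' = rho_mult[OF good(1) \<theta>(1)[OF z] \<theta>(1)[OF w]]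
    show "\<theta> \<beta> \<alpha> (z \<otimes>\<^bsub>D \<beta>\<^esub> w) = \<theta> \<beta> \<alpha> z \<otimes>\<^bsub>D \<alpha>\<^esub> \<theta> \<beta> \<alpha> w"
    proof (rule rho_inj[OF good(1) \<theta>(1)[OF zw(3)] zw'(3)])
      show "rho_diamond \<alpha> (\<theta> \<beta> \<alpha> (z \<otimes>\<^bsub>D \<beta>\<^esub> w)) = rho_diamond \<alpha> (\<theta> \<beta> \<alpha> z \<otimes>\<^bsub>D \<alpha>\<^esub> \<theta> \<beta> \<alpha> w)"
        unfolding zw'(1) \<theta>(3)[OF zw(3)] \<theta>(3)[OF z] \<theta>(3)[OF w] by (rule zw(1))
      show "snd (\<theta> \<beta> \<alpha> (z \<otimes>\<^bsub>D \<beta>\<^esub> w)) = snd (\<theta> \<beta> \<alpha> z \<otimes>\<^bsub>D \<alpha>\<^esub> \<theta> \<beta> \<alpha> w)"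
        unfolding zw'(2) \<theta>(2)[OF zw(3)] \<theta>(2)[OF z] \<theta>(2)[OF w] by (rule zw(2))
    qed
  qed
  fix f assume "f \<in> regular (D \<alpha>)"
  then have f: "f \<in> T" by (simp only: D_simps(3))
  show "(\<lambda>z\<in>carrier (D \<beta>). f (\<theta> \<beta> \<alpha> z)) \<in> regular (D \<beta>)"
    unfolding D_simps(1,3)
  proof (rule into_D[OF good(1) T_alg \<theta>(1) _ _ f])
    show "gl_regular (U \<times> carrier G) T n (\<lambda>z. rho_diamond \<alpha> (\<theta> \<beta> \<alpha> z))"
      by (rule gl_regular_cong[OF _ T_rho[OF good(2)]]) (simp only: \<theta>(3))
    show "(\<lambda>z\<in>U \<times> carrier G. h (snd (\<theta> \<beta> \<alpha> z))) \<in> T" if "h \<in> regular G" for h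
      by (rule restrict_cong_mem[OF _ T_snd[OF good(2) that]]) (simp only: \<theta>(2))
  qed
qed

end

text \<open>Since \<open>\<beta> g\<close> and \<open>\<alpha> g\<close> differ by an element of \<open>U\<close>, they generate the same group together with \<open>U\<close> and have the same
  coset. The inverse of \<open>\<theta> \<beta> \<alpha>\<close> is \<open>\<theta> \<alpha> \<beta>\<close>, as both are determined by their composites with \<open>\<rho>\<^sup>\<diamond>\<close> and \<open>snd\<close>.\<close>

lemma comparison:
  assumes good: "hom_mod_U \<alpha>" "hom_mod_U \<beta>" and diff: "\<And>g. g \<in> carrier G \<Longrightarrow> \<beta> g * ginv (\<alpha> g) \<in> U"
  shows "S \<beta> = S \<alpha>" "g \<in> carrier G \<Longrightarrow> induced_map G Id n \<rho> V \<beta> g = induced_map G Id n \<rho> V \<alpha> g"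
    "alg_group_iso (D \<beta>) (D \<alpha>) (\<theta> \<beta> \<alpha>)"
    "z \<in> carrier (D \<beta>) \<Longrightarrow> rho_diamond \<alpha> (\<theta> \<beta> \<alpha> z) = rho_diamond \<beta> z"
proof -
  have diff': "\<alpha> g * ginv (\<beta> g) \<in> U" if g: "g \<in> carrier G" for g
  proof -
    note a = hom_mod_UD(5)[OF good(1) g] and b = hom_mod_UD(5)[OF good(2) g]
    have "ginv (ginv (\<alpha> g)) = \<alpha> g" by (rule GL_inv_unique[OF GL_inv(1)[OF a] GL_memD[OF a] GL_inv(2)[OF a]])
    then show ?thesis using U_inv[OF diff[OF g]] unfolding GL_inv_mult[OF b GL_inv(1)[OF a]] by simp
  qed
  have \<Gamma>: "\<Gamma> \<beta> = \<Gamma> \<alpha>" using \<Gamma>_sub[OF good diff] \<Gamma>_sub[OF good(2,1) diff'] by blast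
  show Seq: "S \<beta> = S \<alpha>" by (simp add: S_eq \<Gamma>)
  show "induced_map G Id n \<rho> V \<beta> g = induced_map G Id n \<rho> V \<alpha> g" if g: "g \<in> carrier G"
  proof -
    have "\<beta> g * ginv (\<alpha> g) * \<alpha> g = \<beta> g" by (rule ginv_cancel(4)[OF hom_mod_UD(5)[OF good(1) g] hom_mod_UD(6)[OF good(2) g]])
    then have "q \<alpha> (\<beta> g) = q \<alpha> (\<alpha> g)" using q_U[OF good(1) diff[OF g] alpha_\<Gamma>[OF good(1) g]] by simp
    then show ?thesis by (simp add: induced_eq q_eq Seq)
  qed
  show "rho_diamond \<alpha> (\<theta> \<beta> \<alpha> z) = rho_diamond \<beta> z" if "z \<in> carrier (D \<beta>)"
    using \<theta>(3)[OF good diff] that unfolding D_simps(1) by blast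
  have inv1: "\<theta> \<alpha> \<beta> (\<theta> \<beta> \<alpha> z) = z" if z: "z \<in> U \<times> carrier G" for z
  proof -
    note t = \<theta>[OF good diff z] and t' = \<theta>[OF good(2,1) diff' \<theta>(1)[OF good diff z]]
    show ?thesis by (rule rho_inj[OF good(2) t'(1) z]) (simp_all only: t(2,3) t'(2,3))
  qed
  have inv2: "\<theta> \<beta> \<alpha> (\<theta> \<alpha> \<beta> z) = z" if z: "z \<in> U \<times> carrier G" for z
  proof -
    note t = \<theta>[OF good(2,1) diff' z] and t' = \<theta>[OF good diff \<theta>(1)[OF good(2,1) diff' z]]
    show ?thesis by (rule rho_inj[OF good(1) t'(1) z]) (simp_all only: t(2,3) t'(2,3))
  qed
  have bij: "bij_betw (\<theta> \<beta> \<alpha>) (U \<times> carrier G) (U \<times> carrier G)"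
    by (rule bij_betw_byWitness[where f' = "\<theta> \<alpha> \<beta>"])
      (use inv1 inv2 \<theta>(1)[OF good diff] \<theta>(1)[OF good(2,1) diff'] in blast)+
  have ii: "inv_into (U \<times> carrier G) (\<theta> \<beta> \<alpha>) z = \<theta> \<alpha> \<beta> z" if z: "z \<in> U \<times> carrier G" for z
    using inv_into_f_f[OF bij_betw_imp_inj_on[OF bij] \<theta>(1)[OF good(2,1) diff' z]] inv2[OF z] by simp
  have h': "alg_group_hom (D \<alpha>) (D \<beta>) (\<theta> \<alpha> \<beta>)" by (rule \<theta>_hom[OF good(2,1) diff'])
  have "alg_group_hom (D \<alpha>) (D \<beta>) (inv_into (U \<times> carrier G) (\<theta> \<beta> \<alpha>))"
    unfolding alg_group_hom_def variety_morphism_def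
  proof (intro conjI ballI)
    show "inv_into (U \<times> carrier G) (\<theta> \<beta> \<alpha>) \<in> hom (D \<alpha>) (D \<beta>)"
    proof (rule homI; (unfold D_simps(1))?)
      fix z w assume z: "z \<in> U \<times> carrier G" and w: "w \<in> U \<times> carrier G"
      show "inv_into (U \<times> carrier G) (\<theta> \<beta> \<alpha>) z \<in> U \<times> carrier G" unfolding ii[OF z] by (rule \<theta>(1)[OF good(2,1) diff' z])
      have "\<theta> \<alpha> \<beta> (z \<otimes>\<^bsub>D \<alpha>\<^esub> w) = \<theta> \<alpha> \<beta> z \<otimes>\<^bsub>D \<beta>\<^esub> \<theta> \<alpha> \<beta> w"
        using h' z w hom_mult[of "\<theta> \<alpha> \<beta>" "D \<alpha>" "D \<beta>" z w] unfolding alg_group_hom_def D_simps(1) by blast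
      then show "inv_into (U \<times> carrier G) (\<theta> \<beta> \<alpha>) (z \<otimes>\<^bsub>D \<alpha>\<^esub> w) =
        inv_into (U \<times> carrier G) (\<theta> \<beta> \<alpha>) z \<otimes>\<^bsub>D \<beta>\<^esub> inv_into (U \<times> carrier G) (\<theta> \<beta> \<alpha>) w"
        unfolding ii[OF z] ii[OF w] ii[OF rho_mult(3)[OF good(1) z w]] .
    qed
    show "inv_into (U \<times> carrier G) (\<theta> \<beta> \<alpha>) \<in> carrier (D \<alpha>) \<rightarrow> carrier (D \<beta>)"
      unfolding D_simps(1) using ii \<theta>(1)[OF good(2,1) diff'] by auto
    fix f assume "f \<in> regular (D \<beta>)"
    then have "(\<lambda>x\<in>carrier (D \<alpha>). f (\<theta> \<alpha> \<beta> x)) \<in> regular (D \<alpha>)"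
      using h' unfolding alg_group_hom_def variety_morphism_def by blast
    then show "(\<lambda>x\<in>carrier (D \<alpha>). f (inv_into (U \<times> carrier G) (\<theta> \<beta> \<alpha>) x)) \<in> regular (D \<alpha>)"
      by (rule restrict_cong_mem[rotated]) (simp only: D_simps(1) ii)
  qed
  then show "alg_group_iso (D \<beta>) (D \<alpha>) (\<theta> \<beta> \<alpha>)"
    unfolding alg_group_iso_def using bij \<theta>_hom[OF good diff] unfolding D_simps(1) by blast
qed

end

section \<open>Matrices over commutative algebras\<close>

lemma pair_list_nth: "set cs \<subseteq> A \<times> B \<Longrightarrow> j < length cs \<Longrightarrow> fst (cs ! j) \<in> A \<and> snd (cs ! j) \<in> B"
proof -
  assume "set cs \<subseteq> A \<times> B" "j < length cs"
  then have "cs ! j \<in> A \<times> B" using nth_mem by blast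
  then show "fst (cs ! j) \<in> A \<and> snd (cs ! j) \<in> B" by (simp add: mem_Times_iff)
qed

locale kalg = cring S for S :: "('k::field, 's) module" (structure) +
  assumes alg: "algebra class_ring S"
begin

abbreviation \<iota> where "\<iota> c \<equiv> c \<odot> \<one>"

lemma smult_facts:
  "x \<in> carrier S \<Longrightarrow> c \<odot> x \<in> carrier S" "x \<in> carrier S \<Longrightarrow> (a + b) \<odot> x = a \<odot> x \<oplus> b \<odot> x"
  "x \<in> carrier S \<Longrightarrow> y \<in> carrier S \<Longrightarrow> a \<odot> (x \<oplus> y) = a \<odot> x \<oplus> a \<odot> y"
  "x \<in> carrier S \<Longrightarrow> (a * b) \<odot> x = a \<odot> (b \<odot> x)" "x \<in> carrier S \<Longrightarrow> 1 \<odot> x = x"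
  "x \<in> carrier S \<Longrightarrow> y \<in> carrier S \<Longrightarrow> (a \<odot> x) \<otimes> y = a \<odot> (x \<otimes> y)"
proof -
  have m: "Module.module class_ring S" using alg by (simp add: algebra_def)
  show "x \<in> carrier S \<Longrightarrow> c \<odot> x \<in> carrier S" "x \<in> carrier S \<Longrightarrow> (a + b) \<odot> x = a \<odot> x \<oplus> b \<odot> x"
    "x \<in> carrier S \<Longrightarrow> y \<in> carrier S \<Longrightarrow> a \<odot> (x \<oplus> y) = a \<odot> x \<oplus> a \<odot> y"
    "x \<in> carrier S \<Longrightarrow> (a * b) \<odot> x = a \<odot> (b \<odot> x)" "x \<in> carrier S \<Longrightarrow> 1 \<odot> x = x"
    using Module.module.smult_closed[OF m, of c x] Module.module.smult_l_distr[OF m, of a b x]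
      Module.module.smult_r_distr[OF m, of a x y] Module.module.smult_assoc1[OF m, of a b x]
      Module.module.smult_one[OF m, of x] by simp_all
  show "x \<in> carrier S \<Longrightarrow> y \<in> carrier S \<Longrightarrow> (a \<odot> x) \<otimes> y = a \<odot> (x \<otimes> y)"
    using algebra.smult_assoc2[OF alg, of a x y] by simp
qed

lemma iota: "\<iota> c \<in> carrier S" "\<iota> (a + b) = \<iota> a \<oplus> \<iota> b" "\<iota> (a * b) = \<iota> a \<otimes> \<iota> b" "\<iota> 1 = \<one>" "\<iota> 0 = \<zero>"
  "x \<in> carrier S \<Longrightarrow> c \<odot> x = \<iota> c \<otimes> x"
proof -
  show c: "\<iota> c \<in> carrier S" for c by (simp add: smult_facts)
  show add: "\<iota> (a + b) = \<iota> a \<oplus> \<iota> b" for a b by (simp add: smult_facts)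
  show x: "x \<in> carrier S \<Longrightarrow> c \<odot> x = \<iota> c \<otimes> x" for c x by (simp add: smult_facts)
  show "\<iota> (a * b) = \<iota> a \<otimes> \<iota> b" using x[OF c, of a b] by (simp add: smult_facts)
  show "\<iota> 1 = \<one>" by (simp add: smult_facts)
  have "\<iota> 0 \<oplus> \<iota> 0 = \<iota> 0" using add[of 0 0] by simp
  then show "\<iota> 0 = \<zero>" using add.l_cancel_one[OF c c] by blast
qed

lemma smult_zero: "x \<in> carrier S \<Longrightarrow> 0 \<odot> x = \<zero>"
  using iota(5) iota(6)[of x 0] by simp

lemma iota_sum: "finite A \<Longrightarrow> \<iota> (\<Sum>i\<in>A. f i) = (\<Oplus>i\<in>A. \<iota> (f i))"
proof (induction A rule: finite_induct)
  case empty
  then show ?case by (simp add: iota(5))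
next
  case (insert a A)
  have "(\<Oplus>i\<in>insert a A. \<iota> (f i)) = \<iota> (f a) \<oplus> (\<Oplus>i\<in>A. \<iota> (f i))"
    by (rule finsum_insert) (use insert iota(1) in auto)
  then show ?case using insert iota(2) by simp
qed

lemma finsum_swap:
  assumes "finite A" "finite B" "\<And>a b. a \<in> A \<Longrightarrow> b \<in> B \<Longrightarrow> f a b \<in> carrier S"
  shows "(\<Oplus>a\<in>A. \<Oplus>b\<in>B. f a b) = (\<Oplus>b\<in>B. \<Oplus>a\<in>A. f a b)"
  using assms(1,3)
proof (induction A rule: finite_induct)
  case empty
  then show ?case by simp
next
  case (insert x A)
  have "(\<Oplus>a\<in>insert x A. \<Oplus>b\<in>B. f a b) = (\<Oplus>b\<in>B. f x b) \<oplus> (\<Oplus>a\<in>A. \<Oplus>b\<in>B. f a b)"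
    by (rule finsum_insert) (use insert in \<open>auto intro!: finsum_closed\<close>)
  also have "\<dots> = (\<Oplus>b\<in>B. f x b) \<oplus> (\<Oplus>b\<in>B. \<Oplus>a\<in>A. f a b)" using insert by simp
  also have "\<dots> = (\<Oplus>b\<in>B. f x b \<oplus> (\<Oplus>a\<in>A. f a b))"
    by (rule finsum_addf[symmetric]) (use insert in \<open>auto intro!: finsum_closed\<close>)
  also have "\<dots> = (\<Oplus>b\<in>B. \<Oplus>a\<in>insert x A. f a b)"
    by (rule finsum_cong') (use insert in \<open>auto intro!: finsum_closed finsum_insert[symmetric]\<close>)
  finally show ?case .
qed

text \<open>Associativity of matrix multiplication, entry by entry.\<close>

lemma finsum_assoc:
  assumes "finite A" "finite B" "\<And>a. a \<in> A \<Longrightarrow> x a \<in> carrier S" "\<And>a b. a \<in> A \<Longrightarrow> b \<in> B \<Longrightarrow> y a b \<in> carrier S"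
    "\<And>b. b \<in> B \<Longrightarrow> z b \<in> carrier S"
  shows "(\<Oplus>b\<in>B. (\<Oplus>a\<in>A. x a \<otimes> y a b) \<otimes> z b) = (\<Oplus>a\<in>A. x a \<otimes> (\<Oplus>b\<in>B. y a b \<otimes> z b))"
proof -
  have "(\<Oplus>b\<in>B. (\<Oplus>a\<in>A. x a \<otimes> y a b) \<otimes> z b) = (\<Oplus>b\<in>B. \<Oplus>a\<in>A. x a \<otimes> y a b \<otimes> z b)"
    by (rule finsum_cong') (use assms in \<open>auto intro!: finsum_closed finsum_ldistr\<close>)
  also have "\<dots> = (\<Oplus>a\<in>A. \<Oplus>b\<in>B. x a \<otimes> y a b \<otimes> z b)"
    by (rule finsum_swap) (use assms in auto)
  also have "\<dots> = (\<Oplus>a\<in>A. x a \<otimes> (\<Oplus>b\<in>B. y a b \<otimes> z b))"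
  proof (rule finsum_cong')
    fix a assume a: "a \<in> A"
    have "(\<Oplus>b\<in>B. x a \<otimes> y a b \<otimes> z b) = (\<Oplus>b\<in>B. x a \<otimes> (y a b \<otimes> z b))"
      by (rule finsum_cong') (use assms a in \<open>auto intro!: m_assoc\<close>)
    also have "\<dots> = x a \<otimes> (\<Oplus>b\<in>B. y a b \<otimes> z b)"
      by (rule finsum_rdistr[symmetric]) (use assms a in auto)
    finally show "(\<Oplus>b\<in>B. x a \<otimes> y a b \<otimes> z b) = x a \<otimes> (\<Oplus>b\<in>B. y a b \<otimes> z b)" .
  qed (use assms in \<open>auto intro!: finsum_closed\<close>)
  finally show ?thesis .
qed

definition smat :: "nat \<Rightarrow> 's mat set" where
  "smat n = {X \<in> carrier_mat n n. \<forall>i<n. \<forall>j<n. X $$ (i, j) \<in> carrier S}"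

definition svec :: "nat \<Rightarrow> 's vec set" where
  "svec n = {w \<in> carrier_vec n. \<forall>i<n. w $ i \<in> carrier S}"

lemma smat_eqI:
  "X \<in> carrier_mat n n \<Longrightarrow> Y \<in> carrier_mat n n \<Longrightarrow> (\<And>i j. i < n \<Longrightarrow> j < n \<Longrightarrow> X $$ (i, j) = Y $$ (i, j)) \<Longrightarrow> X = Y"
  by (intro eq_matI) auto

lemma smat_mult: "X \<in> smat n \<Longrightarrow> Y \<in> smat n \<Longrightarrow> mult_mat_alg S n X Y \<in> smat n"
  by (auto simp: smat_def mult_mat_alg_def intro!: finsum_closed)

lemma smat_assoc:
  assumes "X \<in> smat n" "Y \<in> smat n" "Z \<in> smat n"
  shows "mult_mat_alg S n (mult_mat_alg S n X Y) Z = mult_mat_alg S n X (mult_mat_alg S n Y Z)"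
proof (rule smat_eqI)
  fix i j assume ij: "i < n" "j < n"
  have "(\<Oplus>l\<in>{..<n}. mult_mat_alg S n X Y $$ (i, l) \<otimes> Z $$ (l, j)) =
    (\<Oplus>l\<in>{..<n}. (\<Oplus>m\<in>{..<n}. X $$ (i, m) \<otimes> Y $$ (m, l)) \<otimes> Z $$ (l, j))"
    by (rule finsum_cong') (use assms ij in \<open>auto simp: smat_def mult_mat_alg_def intro!: finsum_closed\<close>)
  also have "\<dots> = (\<Oplus>m\<in>{..<n}. X $$ (i, m) \<otimes> (\<Oplus>l\<in>{..<n}. Y $$ (m, l) \<otimes> Z $$ (l, j)))"
    by (rule finsum_assoc) (use assms ij in \<open>auto simp: smat_def\<close>)
  also have "\<dots> = (\<Oplus>m\<in>{..<n}. X $$ (i, m) \<otimes> mult_mat_alg S n Y Z $$ (m, j))"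
    by (rule finsum_cong') (use assms ij in \<open>auto simp: smat_def mult_mat_alg_def intro!: finsum_closed\<close>)
  finally show "mult_mat_alg S n (mult_mat_alg S n X Y) Z $$ (i, j) = mult_mat_alg S n X (mult_mat_alg S n Y Z) $$ (i, j)"
    using ij by (simp add: mult_mat_alg_def)
qed (simp_all add: mult_mat_alg_def)

lemma svec_mult: "X \<in> smat n \<Longrightarrow> w \<in> svec n \<Longrightarrow> mult_vec_alg S n X w \<in> svec n"
  by (auto simp: smat_def svec_def mult_vec_alg_def intro!: finsum_closed)

lemma svec_assoc:
  assumes "X \<in> smat n" "Y \<in> smat n" "w \<in> svec n"
  shows "mult_vec_alg S n (mult_mat_alg S n X Y) w = mult_vec_alg S n X (mult_vec_alg S n Y w)"
proof (rule eq_vecI)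
  fix i assume "i < dim_vec (mult_vec_alg S n X (mult_vec_alg S n Y w))"
  then have i: "i < n" by (simp add: mult_vec_alg_def)
  have "(\<Oplus>l\<in>{..<n}. mult_mat_alg S n X Y $$ (i, l) \<otimes> w $ l) =
    (\<Oplus>l\<in>{..<n}. (\<Oplus>m\<in>{..<n}. X $$ (i, m) \<otimes> Y $$ (m, l)) \<otimes> w $ l)"
    by (rule finsum_cong') (use assms i in \<open>auto simp: smat_def svec_def mult_mat_alg_def intro!: finsum_closed\<close>)
  also have "\<dots> = (\<Oplus>m\<in>{..<n}. X $$ (i, m) \<otimes> (\<Oplus>l\<in>{..<n}. Y $$ (m, l) \<otimes> w $ l))"
    by (rule finsum_assoc) (use assms i in \<open>auto simp: smat_def svec_def\<close>)
  also have "\<dots> = (\<Oplus>m\<in>{..<n}. X $$ (i, m) \<otimes> mult_vec_alg S n Y w $ m)"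
    by (rule finsum_cong') (use assms i in \<open>auto simp: smat_def svec_def mult_vec_alg_def intro!: finsum_closed\<close>)
  finally show "mult_vec_alg S n (mult_mat_alg S n X Y) w $ i = mult_vec_alg S n X (mult_vec_alg S n Y w) $ i"
    using i by (simp add: mult_vec_alg_def)
qed (simp add: mult_vec_alg_def)

lemma bc_smat: "X \<in> carrier_mat n n \<Longrightarrow> base_change_mat S X \<in> smat n"
  by (auto simp: smat_def base_change_mat_def iota(1-5))

lemma bc_mult:
  assumes "X \<in> carrier_mat n n" "Y \<in> carrier_mat n n"
  shows "base_change_mat S (X * Y) = mult_mat_alg S n (base_change_mat S X) (base_change_mat S Y)"
proof (rule smat_eqI[of _ n])
  fix i j assume ij: "i < n" "j < n"
  have "\<iota> ((X * Y) $$ (i, j)) = \<iota> (\<Sum>l\<in>{..<n}. X $$ (i, l) * Y $$ (l, j))"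
    using assms ij by (simp add: scalar_prod_def atLeast0LessThan)
  also have "\<dots> = (\<Oplus>l\<in>{..<n}. \<iota> (X $$ (i, l) * Y $$ (l, j)))" by (rule iota_sum) simp
  also have "\<dots> = (\<Oplus>l\<in>{..<n}. base_change_mat S X $$ (i, l) \<otimes> base_change_mat S Y $$ (l, j))"
    by (rule finsum_cong') (use assms ij in \<open>auto simp: base_change_mat_def iota(1-5)\<close>)
  finally show "base_change_mat S (X * Y) $$ (i, j) = mult_mat_alg S n (base_change_mat S X) (base_change_mat S Y) $$ (i, j)"
    using assms ij by (simp add: base_change_mat_def mult_mat_alg_def)
qed (use assms in \<open>auto simp: base_change_mat_def mult_mat_alg_def\<close>)

lemma finsum_delta:
  fixes i n :: nat
  assumes "i < n" "\<And>l. l < n \<Longrightarrow> f l \<in> carrier S" "\<And>l. l < n \<Longrightarrow> l \<noteq> i \<Longrightarrow> f l = \<zero>"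
  shows "(\<Oplus>l\<in>{..<n}. f l) = f i"
proof -
  have "(\<Oplus>l\<in>{..<n}. f l) = (\<Oplus>l\<in>insert i ({..<n} - {i}). f l)" using assms(1) by (intro arg_cong[where f = "finsum S f"]) auto
  also have "\<dots> = f i \<oplus> (\<Oplus>l\<in>{..<n} - {i}. f l)" by (rule finsum_insert) (use assms in auto)
  also have "(\<Oplus>l\<in>{..<n} - {i}. f l) = (\<Oplus>l\<in>{..<n} - {i}. \<zero>)" by (rule finsum_cong') (use assms in auto)
  finally show ?thesis using assms(1,2) by simp
qed

lemma bc_one:
  assumes "X \<in> smat n"
  shows "mult_mat_alg S n (base_change_mat S (1\<^sub>m n)) X = X" "mult_mat_alg S n X (base_change_mat S (1\<^sub>m n)) = X"
proof -
  have b: "base_change_mat S (1\<^sub>m n) $$ (i, l) = (if i = l then \<one> else \<zero>)" if "i < n" "l < n" for i l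
    using that by (simp add: base_change_mat_def iota(1-5))
  have XC: "X \<in> carrier_mat n n" using assms by (simp add: smat_def)
  show "mult_mat_alg S n (base_change_mat S (1\<^sub>m n)) X = X"
  proof (rule smat_eqI[OF _ XC])
    fix i j assume ij: "i < n" "j < n"
    have "(\<Oplus>l\<in>{..<n}. base_change_mat S (1\<^sub>m n) $$ (i, l) \<otimes> X $$ (l, j)) = base_change_mat S (1\<^sub>m n) $$ (i, i) \<otimes> X $$ (i, j)"
      by (rule finsum_delta) (use assms ij b in \<open>auto simp: smat_def\<close>)
    then show "mult_mat_alg S n (base_change_mat S (1\<^sub>m n)) X $$ (i, j) = X $$ (i, j)"
      using ij b assms by (simp add: mult_mat_alg_def smat_def)
  qed (simp add: mult_mat_alg_def)
  show "mult_mat_alg S n X (base_change_mat S (1\<^sub>m n)) = X"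
  proof (rule smat_eqI[OF _ XC])
    fix i j assume ij: "i < n" "j < n"
    have "(\<Oplus>l\<in>{..<n}. X $$ (i, l) \<otimes> base_change_mat S (1\<^sub>m n) $$ (l, j)) = X $$ (i, j) \<otimes> base_change_mat S (1\<^sub>m n) $$ (j, j)"
      by (rule finsum_delta) (use assms ij b in \<open>auto simp: smat_def\<close>)
    then show "mult_mat_alg S n X (base_change_mat S (1\<^sub>m n)) $$ (i, j) = X $$ (i, j)"
      using ij b assms by (simp add: mult_mat_alg_def smat_def)
  qed (simp add: mult_mat_alg_def)
qed

definition intertwines :: "nat \<Rightarrow> 'k mat \<Rightarrow> 's mat \<Rightarrow> 's mat \<Rightarrow> bool" where
  "intertwines n M P Q \<longleftrightarrow> mult_mat_alg S n (base_change_mat S M) P = mult_mat_alg S n Q (base_change_mat S M)"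

lemma intertwines_mult:
  assumes c: "M \<in> carrier_mat n n" "M' \<in> carrier_mat n n" "P \<in> smat n" "Q \<in> smat n" "Q' \<in> smat n"
    and t: "intertwines n M' P Q" "intertwines n M Q Q'"
  shows "intertwines n (M * M') P Q'"
  using t c unfolding intertwines_def bc_mult[OF c(1,2)] by (metis smat_assoc bc_smat)

lemma intertwines_inv:
  assumes M: "M \<in> carrier (GL n)" and c: "P \<in> smat n" "Q \<in> smat n" and t: "intertwines n M P Q"
  shows "intertwines n (inv\<^bsub>GL n\<^esub> M) Q P"
proof -
  let ?N = "inv\<^bsub>GL n\<^esub> M" and ?m = "mult_mat_alg S n"
  note i = GL_inv[OF M] and MC = GL_memD[OF M]
  define m where "m = base_change_mat S M"
  define k where "k = base_change_mat S ?N"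
  have mk: "m \<in> smat n" "k \<in> smat n" unfolding m_def k_def by (rule bc_smat[OF MC], rule bc_smat[OF i(4)])
  have km: "?m k m = base_change_mat S (1\<^sub>m n)" unfolding k_def m_def bc_mult[OF i(4) MC, symmetric] i(3) ..
  have mk': "?m m k = base_change_mat S (1\<^sub>m n)" unfolding k_def m_def bc_mult[OF MC i(4), symmetric] i(2) ..
  have "?m k Q = ?m (?m k Q) (?m m k)" unfolding mk' by (rule bc_one(2)[OF smat_mult[OF mk(2) c(2)], symmetric])
  also have "\<dots> = ?m k (?m (?m Q m) k)" using mk c by (simp add: smat_assoc smat_mult)
  also have "?m Q m = ?m m P" using t unfolding intertwines_def m_def by simp
  also have "?m k (?m (?m m P) k) = ?m (?m (?m k m) P) k" using mk c by (simp add: smat_assoc smat_mult)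
  also have "\<dots> = ?m P k" unfolding km bc_one(1)[OF c(1)] ..
  finally show ?thesis unfolding intertwines_def k_def .
qed

lemma intertwines_add:
  assumes c: "M \<in> carrier_mat n n" "M' \<in> carrier_mat n n" "P \<in> smat n" "Q \<in> smat n"
    and t: "intertwines n M P Q" "intertwines n M' P Q"
  shows "intertwines n (M + M') P Q"
  unfolding intertwines_def
proof (rule smat_eqI[of _ n])
  let ?m = "mult_mat_alg S n" and ?b = "base_change_mat S"
  fix i j assume ij: "i < n" "j < n"
  have b: "?b (M + M') $$ (a, l) = ?b M $$ (a, l) \<oplus> ?b M' $$ (a, l)" "?b M $$ (a, l) \<in> carrier S" "?b M' $$ (a, l) \<in> carrier S"
    if "a < n" "l < n" for a l using that c by (simp_all add: base_change_mat_def iota(1-5))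
  have PQ: "P $$ (a, l) \<in> carrier S" "Q $$ (a, l) \<in> carrier S" if "a < n" "l < n" for a l using that c by (simp_all add: smat_def)
  have e: "?m A B $$ (i, j) = (\<Oplus>l\<in>{..<n}. A $$ (i, l) \<otimes> B $$ (l, j))" for A B :: "'s mat"
    using ij by (simp add: mult_mat_alg_def)
  have "?m (?b (M + M')) P $$ (i, j) = (\<Oplus>l\<in>{..<n}. ?b M $$ (i, l) \<otimes> P $$ (l, j) \<oplus> ?b M' $$ (i, l) \<otimes> P $$ (l, j))"
    unfolding e by (rule finsum_cong') (use ij in \<open>auto simp: b PQ l_distr\<close>)
  also have "\<dots> = ?m (?b M) P $$ (i, j) \<oplus> ?m (?b M') P $$ (i, j)"
    unfolding e by (rule finsum_addf) (use ij in \<open>auto simp: b PQ\<close>)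
  also have "\<dots> = ?m Q (?b M) $$ (i, j) \<oplus> ?m Q (?b M') $$ (i, j)" using t unfolding intertwines_def by simp
  also have "\<dots> = (\<Oplus>l\<in>{..<n}. Q $$ (i, l) \<otimes> ?b M $$ (l, j) \<oplus> Q $$ (i, l) \<otimes> ?b M' $$ (l, j))"
    unfolding e by (rule finsum_addf[symmetric]) (use ij in \<open>auto simp: b PQ\<close>)
  also have "\<dots> = ?m Q (?b (M + M')) $$ (i, j)"
    unfolding e by (rule finsum_cong') (use ij in \<open>auto simp: b PQ r_distr\<close>)
  finally show "?m (?b (M + M')) P $$ (i, j) = ?m Q (?b (M + M')) $$ (i, j)" .
qed (simp_all add: mult_mat_alg_def)

lemma intertwines_scalar:
  assumes "P \<in> smat n"
  shows "intertwines n (c \<cdot>\<^sub>m 1\<^sub>m n) P P"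
  unfolding intertwines_def
proof (rule smat_eqI[of _ n])
  let ?B = "base_change_mat S (c \<cdot>\<^sub>m 1\<^sub>m n)"
  have b: "?B $$ (i, l) = (if i = l then \<iota> c else \<zero>)" if "i < n" "l < n" for i l
    using that by (simp add: base_change_mat_def iota(1-5))
  fix i j assume ij: "i < n" "j < n"
  have P: "P $$ (a, l) \<in> carrier S" if "a < n" "l < n" for a l using that assms by (simp add: smat_def)
  have "(\<Oplus>l\<in>{..<n}. ?B $$ (i, l) \<otimes> P $$ (l, j)) = ?B $$ (i, i) \<otimes> P $$ (i, j)"
    by (rule finsum_delta) (use ij b P iota(1) in auto)
  moreover have "(\<Oplus>l\<in>{..<n}. P $$ (i, l) \<otimes> ?B $$ (l, j)) = P $$ (i, j) \<otimes> ?B $$ (j, j)"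
    by (rule finsum_delta) (use ij b P iota(1) in auto)
  ultimately show "mult_mat_alg S n ?B P $$ (i, j) = mult_mat_alg S n P ?B $$ (i, j)"
    using ij b P iota(1) by (simp add: mult_mat_alg_def m_comm)
qed (simp_all add: mult_mat_alg_def)

lemma tensor_vec_svec: "set cs \<subseteq> carrier S \<times> W \<Longrightarrow> tensor_vec S n cs \<in> svec n"
  unfolding svec_def tensor_vec_def
  by (auto intro!: finsum_closed smult_facts(1) pair_list_nth[where A = "carrier S" and B = W, THEN conjunct1])

text \<open>Every vector over \<open>S\<close> comes from the tensor product with the full space, so being in a base-changed subspace is a
  condition only for proper subspaces.\<close>

lemma svec_as_tensor:
  assumes "w \<in> svec n"
  shows "w = tensor_vec S n (map (\<lambda>i. (w $ i, unit_vec n i)) [0..<n])"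
proof (rule eq_vecI)
  fix i assume "i < dim_vec (tensor_vec S n (map (\<lambda>i. (w $ i, unit_vec n i)) [0..<n]))"
  then have i: "i < n" by (simp add: tensor_vec_def)
  have W: "w $ l \<in> carrier S" if "l < n" for l using that assms by (simp add: svec_def)
  have "(\<Oplus>j\<in>{..<n}. (unit_vec n j $ i) \<odot> w $ j) = (unit_vec n i $ i) \<odot> w $ i"
    by (rule finsum_delta) (use i W in \<open>auto simp: smult_facts(1) smult_zero\<close>)
  then have e: "(\<Oplus>j\<in>{..<n}. (unit_vec n j $ i) \<odot> w $ j) = w $ i" using i W by (simp add: smult_facts)
  have "tensor_vec S n (map (\<lambda>i. (w $ i, unit_vec n i)) [0..<n]) $ i = (\<Oplus>j\<in>{..<n}. (unit_vec n j $ i) \<odot> w $ j)"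
    using i unfolding tensor_vec_def by (auto intro!: finsum_cong' simp: smult_facts(1) W)
  then show "w $ i = tensor_vec S n (map (\<lambda>i. (w $ i, unit_vec n i)) [0..<n]) $ i" using e by simp
qed (use assms in \<open>simp_all add: tensor_vec_def svec_def\<close>)

lemma tensor_vec_map:
  assumes cs: "set cs \<subseteq> carrier S \<times> carrier_vec n" and p: "p \<in> carrier_mat n n"
  shows "mult_vec_alg S n (base_change_mat S p) (tensor_vec S n cs) = tensor_vec S n (map (\<lambda>(s, v). (s, p *\<^sub>v v)) cs)"
proof (rule eq_vecI)
  fix i assume "i < dim_vec (tensor_vec S n (map (\<lambda>(s, v). (s, p *\<^sub>v v)) cs))"
  then have i: "i < n" by (simp add: tensor_vec_def)
  let ?L = "{..<length cs}"
  have s: "fst (cs ! j) \<in> carrier S" "snd (cs ! j) \<in> carrier_vec n" if "j \<in> ?L" for j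
    using pair_list_nth[OF cs] that by auto
  have tv: "tensor_vec S n cs $ l = (\<Oplus>j\<in>?L. \<iota> (snd (cs ! j) $ l) \<otimes> fst (cs ! j))" if "l < n" for l
  proof -
    have "tensor_vec S n cs $ l = (\<Oplus>j\<in>?L. (snd (cs ! j) $ l) \<odot> fst (cs ! j))" using that by (simp add: tensor_vec_def)
    also have "\<dots> = (\<Oplus>j\<in>?L. \<iota> (snd (cs ! j) $ l) \<otimes> fst (cs ! j))"
      by (rule finsum_cong') (use s iota(1) in \<open>auto intro: iota(6)\<close>)
    finally show ?thesis .
  qed
  have "mult_vec_alg S n (base_change_mat S p) (tensor_vec S n cs) $ i =
    (\<Oplus>l\<in>{..<n}. base_change_mat S p $$ (i, l) \<otimes> tensor_vec S n cs $ l)"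
    using i by (simp add: mult_vec_alg_def)
  also have "\<dots> = (\<Oplus>l\<in>{..<n}. \<iota> (p $$ (i, l)) \<otimes> (\<Oplus>j\<in>?L. \<iota> (snd (cs ! j) $ l) \<otimes> fst (cs ! j)))"
  proof (rule finsum_cong')
    fix l assume "l \<in> {..<n}"
    then show "base_change_mat S p $$ (i, l) \<otimes> tensor_vec S n cs $ l =
      \<iota> (p $$ (i, l)) \<otimes> (\<Oplus>j\<in>?L. \<iota> (snd (cs ! j) $ l) \<otimes> fst (cs ! j))"
      using i p by (simp only: tv lessThan_iff) (simp add: base_change_mat_def)
  qed (use s iota(1) in \<open>auto intro!: finsum_closed\<close>)
  also have "\<dots> = (\<Oplus>j\<in>?L. (\<Oplus>l\<in>{..<n}. \<iota> (p $$ (i, l)) \<otimes> \<iota> (snd (cs ! j) $ l)) \<otimes> fst (cs ! j))"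
    by (rule finsum_assoc[symmetric]) (use s iota(1) in auto)
  also have "\<dots> = (\<Oplus>j\<in>?L. \<iota> ((p *\<^sub>v snd (cs ! j)) $ i) \<otimes> fst (cs ! j))"
  proof (rule finsum_cong')
    fix j assume j: "j \<in> ?L"
    have "(p *\<^sub>v snd (cs ! j)) $ i = (\<Sum>l\<in>{..<n}. p $$ (i, l) * snd (cs ! j) $ l)"
      using i p s(2)[OF j] by (simp add: scalar_prod_def atLeast0LessThan)
    then have "\<iota> ((p *\<^sub>v snd (cs ! j)) $ i) = (\<Oplus>l\<in>{..<n}. \<iota> (p $$ (i, l) * snd (cs ! j) $ l))"
      by (simp add: iota_sum)
    then show "(\<Oplus>l\<in>{..<n}. \<iota> (p $$ (i, l)) \<otimes> \<iota> (snd (cs ! j) $ l)) \<otimes> fst (cs ! j) = \<iota> ((p *\<^sub>v snd (cs ! j)) $ i) \<otimes> fst (cs ! j)"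
      by (simp add: iota(3))
  qed (use s iota(1) in auto)
  also have "\<dots> = (\<Oplus>j\<in>?L. ((p *\<^sub>v snd (cs ! j)) $ i) \<odot> fst (cs ! j))"
    by (rule finsum_cong') (use s in \<open>auto simp: smult_facts(1) intro: iota(6)[symmetric]\<close>)
  also have "\<dots> = (\<Oplus>j\<in>?L. (snd (map (\<lambda>(s, v). (s, p *\<^sub>v v)) cs ! j) $ i) \<odot> fst (map (\<lambda>(s, v). (s, p *\<^sub>v v)) cs ! j))"
    by (rule finsum_cong') (use s in \<open>auto simp: smult_facts(1) case_prod_unfold\<close>)
  also have "\<dots> = tensor_vec S n (map (\<lambda>(s, v). (s, p *\<^sub>v v)) cs) $ i"
    using i by (simp add: tensor_vec_def)
  finally show "mult_vec_alg S n (base_change_mat S p) (tensor_vec S n cs) $ i = tensor_vec S n (map (\<lambda>(s, v). (s, p *\<^sub>v v)) cs) $ i" .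
qed (simp add: mult_vec_alg_def tensor_vec_def)

end

lemma kalgI: "algebra class_ring S \<Longrightarrow> kalg S"
  by (simp add: kalg_def kalg_axioms_def algebra_def)

section \<open>The group functor and its constant points\<close>

lemma comult_spec:
  fixes G :: "('a, 'k::field) alg_group"
  assumes G: "affine_alg_group G" and f: "f \<in> regular G"
  shows "set (comult G f) \<subseteq> regular G \<times> regular G"
    "x \<in> carrier G \<Longrightarrow> y \<in> carrier G \<Longrightarrow> f (x \<otimes>\<^bsub>G\<^esub> y) = (\<Sum>(a, b)\<leftarrow>comult G f. a x * b y)"
proof -
  obtain cs where cs: "set cs \<subseteq> regular G \<times> regular G"
    "(\<lambda>z\<in>carrier G \<times> carrier G. f (fst z \<otimes>\<^bsub>G\<^esub> snd z)) = (\<lambda>z\<in>carrier G \<times> carrier G. \<Sum>(a, b)\<leftarrow>cs. a (fst z) * b (snd z))"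
    using tensor_funsE[OF affine_alg_groupD(7)[OF G f]] .
  have "f (x \<otimes>\<^bsub>G\<^esub> y) = (\<Sum>(a, b)\<leftarrow>cs. a x * b y)" if "x \<in> carrier G" "y \<in> carrier G" for x y
    using fun_cong[OF cs(2), of "(x, y)"] that by simp
  with cs(1) have "\<exists>cs. set cs \<subseteq> regular G \<times> regular G \<and>
     (\<forall>x\<in>carrier G. \<forall>y\<in>carrier G. f (x \<otimes>\<^bsub>G\<^esub> y) = (\<Sum>(a, b)\<leftarrow>cs. a x * b y))" by blast
  from someI_ex[OF this] have s: "set (comult G f) \<subseteq> regular G \<times> regular G \<and>
     (\<forall>x\<in>carrier G. \<forall>y\<in>carrier G. f (x \<otimes>\<^bsub>G\<^esub> y) = (\<Sum>(a, b)\<leftarrow>comult G f. a x * b y))"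
    unfolding comult_def .
  then show "set (comult G f) \<subseteq> regular G \<times> regular G" by blast
  show "x \<in> carrier G \<Longrightarrow> y \<in> carrier G \<Longrightarrow> f (x \<otimes>\<^bsub>G\<^esub> y) = (\<Sum>(a, b)\<leftarrow>comult G f. a x * b y)" using s by blast
qed

context kalg
begin

definition constant_point :: "('a, 'k) alg_group \<Rightarrow> 'a \<Rightarrow> (('a \<Rightarrow> 'k) \<Rightarrow> 's)" where
  "constant_point G g = (\<lambda>f\<in>regular G. \<iota> (f g))"

lemma constant_point_mem:
  assumes G: "affine_alg_group G" and g: "g \<in> carrier G"
  shows "constant_point G g \<in> points G S"
proof -
  have one: "(\<lambda>x\<in>carrier G. 1) \<in> regular G" using fun_algebraD(2)[OF affine_alg_groupD(3)[OF G]] .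
  have cl: "(\<lambda>x\<in>carrier G. f x * h x) \<in> regular G" "(\<lambda>x\<in>carrier G. f x + h x) \<in> regular G" "(\<lambda>x\<in>carrier G. c * f x) \<in> regular G"
    if "f \<in> regular G" "h \<in> regular G" for f h c
    using affine_alg_groupD(3)[OF G] that fun_algebraD(5,6)[OF affine_alg_groupD(3)[OF G]] by (auto simp: fun_algebra_def)
  have "constant_point G g \<in> Ring.ring_hom (coord_ring G) S"
  proof (rule Ring.ring_hom_memI)
    show "constant_point G g x \<in> carrier S" if "x \<in> carrier (coord_ring G)" for x
      using that iota(1) by (simp add: coord_ring_def constant_point_def)
    fix f h assume "f \<in> carrier (coord_ring G)" "h \<in> carrier (coord_ring G)"
    then have fh: "f \<in> regular G" "h \<in> regular G" by (simp_all add: coord_ring_def)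
    have "constant_point G g (\<lambda>x\<in>carrier G. f x * h x) = \<iota> (f g * h g)" using cl(1)[OF fh] g by (simp add: constant_point_def)
    then show "constant_point G g (f \<otimes>\<^bsub>coord_ring G\<^esub> h) = constant_point G g f \<otimes> constant_point G g h"
      using fh iota(3) by (simp add: coord_ring_def constant_point_def)
    have "constant_point G g (\<lambda>x\<in>carrier G. f x + h x) = \<iota> (f g + h g)" using cl(2)[OF fh] g by (simp add: constant_point_def)
    then show "constant_point G g (f \<oplus>\<^bsub>coord_ring G\<^esub> h) = constant_point G g f \<oplus> constant_point G g h"
      using fh iota(2) by (simp add: coord_ring_def constant_point_def)
  next
    show "constant_point G g \<one>\<^bsub>coord_ring G\<^esub> = \<one>" using one g iota(4) by (simp add: coord_ring_def constant_point_def)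
  qed
  moreover have "constant_point G g (c \<odot>\<^bsub>coord_ring G\<^esub> f) = c \<odot> constant_point G g f" if f: "f \<in> regular G" for c f
  proof -
    have "constant_point G g (\<lambda>x\<in>carrier G. c * f x) = \<iota> (c * f g)" using cl(3)[OF f f] g by (simp add: constant_point_def)
    then show ?thesis using f by (simp add: coord_ring_def constant_point_def smult_facts)
  qed
  ultimately show ?thesis by (auto simp: points_def constant_point_def)
qed

lemma constant_point_mult:
  assumes G: "affine_alg_group G" and g: "g \<in> carrier G" "h \<in> carrier G"
  shows "constant_point G g \<otimes>\<^bsub>points_group G S\<^esub> constant_point G h = constant_point G (g \<otimes>\<^bsub>G\<^esub> h)"
proof -
  have "(\<Oplus>i\<in>{..<length (comult G f)}. constant_point G g (fst (comult G f ! i)) \<otimes> constant_point G h (snd (comult G f ! i))) = \<iota> (f (g \<otimes>\<^bsub>G\<^esub> h))"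
    if f: "f \<in> regular G" for f
  proof -
    let ?L = "{..<length (comult G f)}"
    note c = comult_spec[OF G f]
    have m: "fst (comult G f ! i) \<in> regular G" "snd (comult G f ! i) \<in> regular G" if "i \<in> ?L" for i
      using pair_list_nth[OF c(1)] that by auto
    have "(\<Oplus>i\<in>?L. constant_point G g (fst (comult G f ! i)) \<otimes> constant_point G h (snd (comult G f ! i))) =
      (\<Oplus>i\<in>?L. \<iota> (fst (comult G f ! i) g * snd (comult G f ! i) h))"
    proof (rule finsum_cong')
      fix i assume i: "i \<in> ?L"
      show "constant_point G g (fst (comult G f ! i)) \<otimes> constant_point G h (snd (comult G f ! i)) = \<iota> (fst (comult G f ! i) g * snd (comult G f ! i) h)"
        unfolding iota(3) using m[OF i] by (simp add: constant_point_def)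
    qed (use iota(1) in auto)
    also have "\<dots> = \<iota> (\<Sum>i\<in>?L. fst (comult G f ! i) g * snd (comult G f ! i) h)" by (rule iota_sum[symmetric]) simp
    also have "(\<Sum>i\<in>?L. fst (comult G f ! i) g * snd (comult G f ! i) h) = (\<Sum>(a, b)\<leftarrow>comult G f. a g * b h)"
      by (simp add: sum_list_sum_nth atLeast0LessThan case_prod_unfold)
    finally show ?thesis using c(2)[OF g] by simp
  qed
  then show ?thesis unfolding points_group_def constant_point_def by (auto intro!: restrict_ext)
qed

lemma constant_point_one: "\<one>\<^bsub>points_group G S\<^esub> = constant_point G \<one>\<^bsub>G\<^esub>"
  by (simp add: points_group_def constant_point_def)

lemma points_carrier: "carrier (points_group G S) = points G S"
  by (simp add: points_group_def)

lemma mat_at_constant_point: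
  assumes "\<And>i j. i < n \<Longrightarrow> j < n \<Longrightarrow> (\<lambda>g\<in>carrier G. \<phi> g $$ (i, j)) \<in> regular G" "g \<in> carrier G" "\<phi> g \<in> carrier_mat n n"
  shows "mat_at G n \<phi> (constant_point G g) = base_change_mat S (\<phi> g)"
proof (rule eq_matI)
  fix i j assume "i < dim_row (base_change_mat S (\<phi> g))" "j < dim_col (base_change_mat S (\<phi> g))"
  then have ij: "i < n" "j < n" using assms(3) by (auto simp: base_change_mat_def)
  have "constant_point G g (\<lambda>g\<in>carrier G. \<phi> g $$ (i, j)) = \<iota> (\<phi> g $$ (i, j))" using assms(1)[OF ij] assms(2) by (simp add: constant_point_def)
  then show "mat_at G n \<phi> (constant_point G g) $$ (i, j) = base_change_mat S (\<phi> g) $$ (i, j)"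
    using ij assms(3) by (simp add: mat_at_def base_change_mat_def)
qed (use assms(3) in \<open>auto simp: mat_at_def base_change_mat_def\<close>)

lemma mat_at_smat:
  assumes "\<And>i j. i < n \<Longrightarrow> j < n \<Longrightarrow> (\<lambda>g\<in>carrier G. \<phi> g $$ (i, j)) \<in> regular G" "x \<in> points G S"
  shows "mat_at G n \<phi> x \<in> smat n"
proof -
  have "x f \<in> carrier S" if "f \<in> regular G" for f
    using assms(2) that Ring.ring_hom_closed[of x "coord_ring G" S f] by (auto simp: points_def coord_ring_def)
  then show ?thesis using assms(1) by (auto simp: smat_def mat_at_def simp del: restrict_apply)
qed

end

text \<open>The test algebras in the definition of strong stability live on sets of functions, so the base field has to be copied
  there, as singletons of constant functions, before it can be used as a test algebra. Evaluation over it
  recovers ordinary equations between matrices.\<close>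

definition field_alg :: "('a, 'k::field) test_alg" where
  "field_alg = \<lparr>carrier = range (\<lambda>c. {\<lambda>_. c}),
     monoid.mult = (\<lambda>A B. {\<lambda>_. the_elem A undefined * the_elem B undefined}),
     one = {\<lambda>_. 1}, zero = {\<lambda>_. 0},
     add = (\<lambda>A B. {\<lambda>_. the_elem A undefined + the_elem B undefined}),
     smult = (\<lambda>c A. {\<lambda>_. c * the_elem A undefined})\<rparr>"

lemma field_alg: "algebra class_ring (field_alg :: ('a, 'k::field) test_alg)"
proof -
  let ?S = "field_alg :: ('a, 'k) test_alg"
  note d = field_alg_def
  have ag: "abelian_group ?S"
  proof (rule abelian_groupI)
    show "\<exists>y\<in>carrier ?S. y \<oplus>\<^bsub>?S\<^esub> x = \<zero>\<^bsub>?S\<^esub>" if x: "x \<in> carrier ?S" for x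
    proof -
      obtain c where "x = {\<lambda>_. c}" using x by (auto simp: d)
      then show ?thesis by (intro bexI[of _ "{\<lambda>_. - c}"]) (auto simp: d)
    qed
  qed (auto simp: d algebra_simps)
  have cm: "Group.comm_monoid ?S"
    by (rule comm_monoidI) (auto simp: d algebra_simps)
  have cr: "cring ?S"
    by (rule cringI[OF ag cm]) (auto simp: d algebra_simps)
  have cf: "cring (class_ring :: 'k ring)" using class_field unfolding class_field_def
    using class_cring.is_cring by blast
  have m: "Module.module class_ring ?S"
    by (rule Module.moduleI[OF cf ag]) (auto simp: d algebra_simps)
  show ?thesis
    unfolding algebra_def algebra_axioms_def using m cr by (auto simp: d algebra_simps)
qed

section \<open>Strictly increasing chains of subspaces\<close>

text \<open>The positions of leading entries. Their number is the dimension of \<open>W\<close>.\<close>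

definition pivots :: "nat \<Rightarrow> 'k::field vec set \<Rightarrow> nat set" where
  "pivots n W = {i. i < n \<and> (\<exists>w\<in>W. w $ i \<noteq> 0 \<and> (\<forall>l<i. w $ l = 0))}"

lemma pivots_finite: "finite (pivots n W)" "card (pivots n W) \<le> n"
proof -
  have s: "pivots n W \<subseteq> {..<n}" by (auto simp: pivots_def)
  show "finite (pivots n W)" using s finite_subset by blast
  show "card (pivots n W) \<le> n" using card_mono[OF _ s] by simp
qed

lemma pivots_strict:
  fixes W W' :: "'k::field vec set"
  assumes W: "vec_subspace n W" and W': "vec_subspace n W'" and sub: "W \<subset> W'"
  shows "card (pivots n W) < card (pivots n W')"
proof -
  have le: "pivots n W \<subseteq> pivots n W'" using sub by (auto simp: pivots_def)
  have "pivots n W \<noteq> pivots n W'"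
  proof
    assume eq: "pivots n W = pivots n W'"
    \<comment> \<open>Gaussian elimination: a vector of \<open>W'\<close> is reduced by elements of \<open>W\<close> with the same pivot until it is zero.\<close>
    have "\<forall>w\<in>W'. (\<forall>l<k. w $ l = 0) \<longrightarrow> w \<in> W" if "k \<le> n" for k
      using that
    proof (induction rule: inc_induct)
      case base
      show ?case
      proof (intro ballI impI)
        fix w assume "w \<in> W'" "\<forall>l<n. w $ l = 0"
        then have "w = 0\<^sub>v n" using vec_subspaceD(1)[OF W', of w] by (intro eq_vecI) auto
        then show "w \<in> W" using vec_subspaceD(2)[OF W] by simp
      qed
    next
      case (step k)
      show ?case
      proof (intro ballI impI)
        fix w assume w: "w \<in> W'" and z: "\<forall>l<k. w $ l = 0"
        show "w \<in> W"
        proof (cases "w $ k = 0")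
          case True
          then have "\<forall>l<Suc k. w $ l = 0" using z by (auto simp: less_Suc_eq)
          then show ?thesis using step.IH w by blast
        next
          case False
          then have "k \<in> pivots n W'" using w z step.hyps by (auto simp: pivots_def)
          then have "k \<in> pivots n W" using eq by simp
          then obtain u where u: "u \<in> W" "u $ k \<noteq> 0" "\<forall>l<k. u $ l = 0" by (auto simp: pivots_def)
          have uC: "u \<in> carrier_vec n" and wC: "w \<in> carrier_vec n"
            using vec_subspaceD(1)[OF W u(1)] vec_subspaceD(1)[OF W' w] by auto
          define c where "c = w $ k / u $ k"
          define w' where "w' = w + (- c) \<cdot>\<^sub>v u"
          have "w' \<in> W'" unfolding w'_def using vec_subspaceD(3,4)[OF W'] w u(1) sub by blast
          moreover have "\<forall>l<Suc k. w' $ l = 0"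
            using u z wC uC step.hyps by (auto simp: w'_def c_def less_Suc_eq)
          ultimately have "w' \<in> W" using step.IH by blast
          then have "w' + c \<cdot>\<^sub>v u \<in> W" using vec_subspaceD(3,4)[OF W] u(1) by blast
          moreover have "w' + c \<cdot>\<^sub>v u = w" unfolding w'_def using uC wC by (intro eq_vecI) auto
          ultimately show ?thesis by simp
        qed
      qed
    qed
    from this[of 0] show False using sub by auto
  qed
  then show ?thesis using psubset_card_mono[OF pivots_finite(1)] le by blast
qed

lemma subspace_iff:
  "subspace class_ring W (module_vec TYPE('k::field) n) \<longleftrightarrow> vec_subspace n W"
proof
  assume "subspace class_ring W (module_vec TYPE('k) n)"
  then have s: "submodule class_ring W (module_vec TYPE('k) n)" by (simp add: subspace_def)
  show "vec_subspace n W"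
    using submodule.subset[OF s] submodule.m_closed[OF s] submodule.zero_closed[OF s] submodule.smult_closed[OF s]
    by (auto simp: vec_subspace_def module_vec_simps)
next
  assume W: "vec_subspace n W"
  have "submodule class_ring W (module_vec TYPE('k) n)"
    unfolding submodule_def using vec_module W by (auto simp: vec_subspace_def module_vec_simps)
  then show "subspace class_ring W (module_vec TYPE('k) n)" using vec_vs by (simp add: subspace_def)
qed

section \<open>The algebra of N-endomorphisms\<close>

text \<open>The data of the theorem apart from the affording morphism.\<close>

locale scheme_setting =
  fixes G :: "('a, 'k::alg_closed_field) alg_group" and Id :: "('a \<Rightarrow> 'k) set" and n :: nat
    and \<rho> :: "'a \<Rightarrow> 'k mat" and V :: "'k vec set" and act :: "'a \<Rightarrow> 'k vec \<Rightarrow> 'k vec"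
  assumes G: "affine_alg_group G" and N: "normal_subgroup_scheme G Id" and \<rho>: "rational_module G Id n \<rho>"
    and V: "G_submodule G Id n \<rho> V act" and soc: "socle G Id n \<rho> \<subseteq> V"
begin

abbreviation "E \<equiv> End_N G Id n \<rho>"
abbreviation "J \<equiv> J_ideal G Id n \<rho> V"
abbreviation "C \<equiv> carrier_mat n n :: 'k mat set"
abbreviation "R \<equiv> mat_at G n \<rho>"
abbreviation "\<N> \<equiv> sub_points G Id"

lemma rho_smat:
  assumes "kalg S" "x \<in> \<N> S"
  shows "R x \<in> kalg.smat S n"
  by (rule kalg.mat_at_smat[OF assms(1)]) (use \<rho> assms(2) in \<open>auto simp: rational_module_def sub_points_def\<close>)

text \<open>Commuting with the group scheme means intertwining its points over every test algebra. The endomorphisms themselves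
  have entries in the base field, so they can be compared over all algebras at once.\<close>

lemma End_iff:
  "X \<in> E \<longleftrightarrow> X \<in> C \<and> (\<forall>S :: ('a, 'k) test_alg. kalg S \<longrightarrow> (\<forall>x\<in>\<N> S. kalg.intertwines S n X (R x) (R x)))"
proof -
  have e: "algebra class_ring S \<longleftrightarrow> kalg S" for S :: "('a, 'k) test_alg"
    using kalgI kalg.alg by blast
  show ?thesis unfolding End_N_def e by (auto simp: kalg.intertwines_def)
qed

lemma End_C: "X \<in> E \<Longrightarrow> X \<in> C" by (simp add: End_iff)

lemma End_mult:
  assumes "X \<in> E" "Y \<in> E"
  shows "X * Y \<in> E"
  unfolding End_iff
proof (intro conjI allI impI ballI)
  show "X * Y \<in> C" using End_C assms by (blast intro: mult_carrier_mat)
  fix S :: "('a, 'k) test_alg" and x assume S: "kalg S" and x: "x \<in> \<N> S"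
  show "kalg.intertwines S n (X * Y) (R x) (R x)"
    by (rule kalg.intertwines_mult[OF S End_C[OF assms(1)] End_C[OF assms(2)] rho_smat[OF S x] rho_smat[OF S x] rho_smat[OF S x]])
      (use assms S x in \<open>auto simp: End_iff\<close>)
qed

lemma End_add:
  assumes "X \<in> E" "Y \<in> E"
  shows "X + Y \<in> E"
  unfolding End_iff
proof (intro conjI allI impI ballI)
  show "X + Y \<in> C" using End_C assms by (blast intro: add_carrier_mat)
  fix S :: "('a, 'k) test_alg" and x assume S: "kalg S" and x: "x \<in> \<N> S"
  show "kalg.intertwines S n (X + Y) (R x) (R x)"
    by (rule kalg.intertwines_add[OF S End_C[OF assms(1)] End_C[OF assms(2)] rho_smat[OF S x] rho_smat[OF S x]])
      (use assms S x in \<open>auto simp: End_iff\<close>)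
qed

lemma End_scalar: "c \<cdot>\<^sub>m 1\<^sub>m n \<in> E"
  unfolding End_iff
proof (intro conjI allI impI ballI)
  fix S :: "('a, 'k) test_alg" and x assume S: "kalg S" and x: "x \<in> \<N> S"
  show "kalg.intertwines S n (c \<cdot>\<^sub>m 1\<^sub>m n) (R x) (R x)" by (rule kalg.intertwines_scalar[OF S rho_smat[OF S x]])
qed simp

lemma smult_as_mult: "X \<in> C \<Longrightarrow> (c \<cdot>\<^sub>m 1\<^sub>m n) * X = c \<cdot>\<^sub>m X"
  using mult_smult_assoc_mat[OF one_carrier_mat, of X n n c] by simp

lemma End_one: "1\<^sub>m n \<in> E"
proof -
  have "1 \<cdot>\<^sub>m 1\<^sub>m n = (1\<^sub>m n :: 'k mat)" by (intro eq_matI) auto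
  then show ?thesis using End_scalar[of 1] by simp
qed

lemma V_sub: "vec_subspace n V" "N_submodule G Id n \<rho> V"
  using V by (simp_all add: G_submodule_def subspace_iff)

lemmas VD = vec_subspaceD[OF V_sub(1)]

lemma J_iff: "X \<in> J \<longleftrightarrow> X \<in> E \<and> (\<forall>v\<in>V. X *\<^sub>v v = 0\<^sub>v n)"
  by (simp add: J_ideal_def)

lemma J_C: "X \<in> J \<Longrightarrow> X \<in> C" using End_C J_iff by blast

lemma J_End_mult:
  assumes "X \<in> E" "j \<in> J"
  shows "X * j \<in> J"
proof -
  have "(X * j) *\<^sub>v v = 0\<^sub>v n" if v: "v \<in> V" for v
  proof -
    have "(X * j) *\<^sub>v v = X *\<^sub>v (j *\<^sub>v v)" by (rule assoc_mult_mat_vec[OF End_C[OF assms(1)] J_C[OF assms(2)] VD(1)[OF v]])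
    also have "j *\<^sub>v v = 0\<^sub>v n" using assms(2) v J_iff by blast
    finally show ?thesis using mult_zero_vec[OF End_C[OF assms(1)]] by simp
  qed
  then show ?thesis using End_mult assms J_iff by blast
qed

lemma J_sub: "mat_subspace n J"
  unfolding mat_subspace_def
proof (intro conjI ballI allI)
  show "J \<subseteq> C" using J_C by blast
  have z: "0 \<cdot>\<^sub>m 1\<^sub>m n = (0\<^sub>m n n :: 'k mat)" by (intro eq_matI) auto
  show "0\<^sub>m n n \<in> J" unfolding J_iff using End_scalar[of 0] VD(1) zero_mult_vec by (auto simp: z)
  fix X Y assume XY: "X \<in> J" "Y \<in> J"
  have "(X + Y) *\<^sub>v v = 0\<^sub>v n" if v: "v \<in> V" for v
    using add_mult_distrib_mat_vec[OF J_C[OF XY(1)] J_C[OF XY(2)] VD(1)[OF v]] XY v by (simp add: J_iff)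
  then show "X + Y \<in> J" using XY End_add by (auto simp: J_iff)
next
  fix c X assume X: "X \<in> J"
  show "c \<cdot>\<^sub>m X \<in> J" using J_End_mult[OF End_scalar X, of c] smult_as_mult[OF J_C[OF X]] by simp
qed

section \<open>Nilpotency of the annihilator\<close>

lemma N_sub_vec: "N_submodule G Id n \<rho> W \<Longrightarrow> vec_subspace n W"
  by (simp add: N_submodule_def subspace_iff)

lemma simple_sub_V:
  assumes "simple_N_submodule G Id n \<rho> W"
  shows "W \<subseteq> V"
proof -
  have c: "\<Union>{W. simple_N_submodule G Id n \<rho> W} \<subseteq> carrier (module_vec TYPE('k) n)"
  proof
    fix x assume "x \<in> \<Union>{W. simple_N_submodule G Id n \<rho> W}"
    then obtain X where X: "simple_N_submodule G Id n \<rho> X" "x \<in> X" by blast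
    then have "vec_subspace n X" using N_sub_vec by (simp add: simple_N_submodule_def)
    then show "x \<in> carrier (module_vec TYPE('k) n)" using vec_subspaceD(1) X(2) by (simp add: module_vec_simps)
  qed
  have "W \<subseteq> socle G Id n \<rho>"
    unfolding socle_def using LinearCombinations.module.in_own_span[OF vec_module c] assms by blast
  then show ?thesis using soc by blast
qed

text \<open>By descent on the dimension, a nonzero submodule contains a simple one, and this lies in the socle.\<close>

lemma N_sub_meets_V:
  assumes W: "N_submodule G Id n \<rho> W" "W \<noteq> {0\<^sub>v n}"
  shows "\<exists>v\<in>W \<inter> V. v \<noteq> 0\<^sub>v n"
  using W
proof (induction "card (pivots n W)" arbitrary: W rule: less_induct)
  case less
  show ?case
  proof (cases "simple_N_submodule G Id n \<rho> W")
    case True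
    have "0\<^sub>v n \<in> W" using vec_subspaceD(2)[OF N_sub_vec[OF less.prems(1)]] .
    then show ?thesis using simple_sub_V[OF True] less.prems(2) by blast
  next
    case False
    then obtain W' where W': "N_submodule G Id n \<rho> W'" "W' \<subseteq> W" "W' \<noteq> {0\<^sub>v n}" "W' \<noteq> W"
      using less.prems by (auto simp: simple_N_submodule_def)
    have "card (pivots n W') < card (pivots n W)"
      by (rule pivots_strict[OF N_sub_vec[OF W'(1)] N_sub_vec[OF less.prems(1)]]) (use W' in blast)
    from less.hyps[OF this W'(1,3)] show ?thesis using W'(2) by blast
  qed
qed

text \<open>After base change a vector of the image is \<open>p t\<close> for some vector \<open>t\<close> over \<open>S\<close>, and the points of \<open>N\<close> commute with \<open>p\<close>.\<close>

lemma image_N_sub: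
  assumes p: "p \<in> E"
  shows "N_submodule G Id n \<rho> ((\<lambda>v. p *\<^sub>v v) ` carrier_vec n)"
  unfolding N_submodule_def subspace_iff
proof (intro conjI allI impI ballI)
  let ?W = "(\<lambda>v. p *\<^sub>v v) ` carrier_vec n"
  note pC = End_C[OF p]
  show "vec_subspace n ?W"
    unfolding vec_subspace_def
  proof (intro conjI ballI allI)
    show "?W \<subseteq> carrier_vec n" using pC by auto
    show "0\<^sub>v n \<in> ?W" using mult_zero_vec[OF pC] by (intro image_eqI[of _ _ "0\<^sub>v n"]) auto
    fix u v assume "u \<in> ?W" "v \<in> ?W"
    then obtain x y where xy: "x \<in> carrier_vec n" "u = p *\<^sub>v x" "y \<in> carrier_vec n" "v = p *\<^sub>v y" by blast
    show "u + v \<in> ?W" using mult_add_distrib_mat_vec[OF pC xy(1,3)] xy by (intro image_eqI[of _ _ "x + y"]) auto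
  next
    fix c u assume "u \<in> ?W"
    then obtain x where x: "x \<in> carrier_vec n" "u = p *\<^sub>v x" by blast
    show "c \<cdot>\<^sub>v u \<in> ?W" using mult_mat_vec[OF pC x(1)] x by (intro image_eqI[of _ _ "c \<cdot>\<^sub>v x"]) auto
  qed
  fix S :: "('a, 'k) test_alg" and x w
  assume "algebra class_ring S" and x: "x \<in> \<N> S" and w: "w \<in> base_change_space S n ?W"
  then have S: "kalg S" by (intro kalgI)
  interpret kalg S by (rule S)
  note Rx = rho_smat[OF S x] and bp = bc_smat[OF pC]
  obtain cs where cs: "set cs \<subseteq> carrier S \<times> ?W" "w = tensor_vec S n cs" using w by (auto simp: base_change_space_def)
  define pre where "pre v = (SOME y. y \<in> carrier_vec n \<and> p *\<^sub>v y = v)" for v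
  have pre: "pre v \<in> carrier_vec n" "p *\<^sub>v pre v = v" if "v \<in> ?W" for v
    using someI_ex[of "\<lambda>y. y \<in> carrier_vec n \<and> p *\<^sub>v y = v"] that unfolding pre_def by auto
  define ds where "ds = map (\<lambda>(s, v). (s, pre v)) cs"
  have ds: "set ds \<subseteq> carrier S \<times> carrier_vec n" using cs(1) pre(1) unfolding ds_def by fastforce
  have "map (\<lambda>(s, v). (s, p *\<^sub>v v)) ds = cs"
    unfolding ds_def using cs(1) pre(2) by (induction cs) auto
  then have w1: "w = mult_vec_alg S n (base_change_mat S p) (tensor_vec S n ds)"
    using tensor_vec_map[OF ds pC] cs(2) by simp
  define t where "t = tensor_vec S n ds"
  have t: "t \<in> svec n" unfolding t_def by (rule tensor_vec_svec[OF ds])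
  define t' where "t' = mult_vec_alg S n (R x) t"
  have t': "t' \<in> svec n" unfolding t'_def by (rule svec_mult[OF Rx t])
  have "mult_vec_alg S n (R x) w = mult_vec_alg S n (mult_mat_alg S n (R x) (base_change_mat S p)) t"
    unfolding w1 t_def[symmetric] by (rule svec_assoc[OF Rx bp t, symmetric])
  also have "mult_mat_alg S n (R x) (base_change_mat S p) = mult_mat_alg S n (base_change_mat S p) (R x)"
  proof -
    have "intertwines n p (R x) (R x)" using p S x by (simp add: End_iff)
    then show ?thesis unfolding intertwines_def by (rule sym)
  qed
  also have "mult_vec_alg S n (mult_mat_alg S n (base_change_mat S p) (R x)) t = mult_vec_alg S n (base_change_mat S p) t'"
    unfolding t'_def by (rule svec_assoc[OF bp Rx t])
  also have "t' = tensor_vec S n (map (\<lambda>i. (t' $ i, unit_vec n i)) [0..<n])" by (rule svec_as_tensor[OF t'])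
  also have "mult_vec_alg S n (base_change_mat S p) \<dots> =
    tensor_vec S n (map (\<lambda>(s, v). (s, p *\<^sub>v v)) (map (\<lambda>i. (t' $ i, unit_vec n i)) [0..<n]))"
    by (rule tensor_vec_map[OF _ pC]) (use t' in \<open>auto simp: svec_def\<close>)
  finally have e: "mult_vec_alg S n (R x) w =
    tensor_vec S n (map (\<lambda>(s, v). (s, p *\<^sub>v v)) (map (\<lambda>i. (t' $ i, unit_vec n i)) [0..<n]))" .
  show "mult_vec_alg S n (R x) w \<in> base_change_space S n ?W"
    unfolding e base_change_space_def
    by (rule imageI) (use t' in \<open>auto simp: svec_def\<close>)
qed

lemma zero_in_ker_flag: "0\<^sub>v n \<in> ker_flag n J m"
  by (induction m) (auto simp: mult_zero_vec[OF J_C])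

text \<open>The reason why \<open>J\<close> is nilpotent. Let \<open>p\<close> be a product of elements of \<open>J\<close>, or just an \<open>N\<close>-endomorphism, that is nonzero. Its
  image is a nonzero \<open>N\<close>-submodule, so it meets \<open>V\<close>, and any further factor \<open>j \<in> J\<close> kills the intersection: the kernel of \<open>j p\<close>
  is strictly larger than that of \<open>p\<close>. As the kernel cannot exceed dimension \<open>n\<close>, the number of factors is bounded.\<close>

lemma kernel_growth:
  assumes p: "p \<in> E" and v: "v \<in> carrier_vec n" "p *\<^sub>v v \<notin> ker_flag n J m"
  shows "card (pivots n {w \<in> carrier_vec n. p *\<^sub>v w = 0\<^sub>v n}) + m \<le> n"
  using p v
proof (induction m arbitrary: p v)
  case 0
  show ?case using pivots_finite(2) by simp
next
  case (Suc m)
  let ?ker = "\<lambda>p. {w \<in> carrier_vec n. p *\<^sub>v w = 0\<^sub>v n}"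
  note pC = End_C[OF Suc.prems(1)]
  have kersub: "vec_subspace n (?ker p)" if "p \<in> C" for p :: "'k mat"
    unfolding vec_subspace_def
  proof (intro conjI ballI allI)
    show "0\<^sub>v n \<in> ?ker p" using mult_zero_vec[OF that] by simp
    fix u v assume "u \<in> ?ker p" "v \<in> ?ker p"
    then show "u + v \<in> ?ker p" using mult_add_distrib_mat_vec[OF that, of u v] by simp
  next
    fix c v assume "v \<in> ?ker p"
    moreover have "c \<cdot>\<^sub>v 0\<^sub>v n = (0\<^sub>v n :: 'k vec)" by (intro eq_vecI) auto
    ultimately show "c \<cdot>\<^sub>v v \<in> ?ker p" using mult_mat_vec[OF that, of v c] by simp
  qed auto
  have pv: "p *\<^sub>v v \<in> carrier_vec n" using pC Suc.prems(2) by simp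
  then obtain j where j: "j \<in> J" "j *\<^sub>v (p *\<^sub>v v) \<notin> ker_flag n J m" using Suc.prems(3) by auto
  note jC = J_C[OF j(1)]
  have jp: "j * p \<in> E" using End_mult Suc.prems(1) j(1) J_iff by blast
  have e: "(j * p) *\<^sub>v w = j *\<^sub>v (p *\<^sub>v w)" if "w \<in> carrier_vec n" for w by (rule assoc_mult_mat_vec[OF jC pC that])
  have IH: "card (pivots n (?ker (j * p))) + m \<le> n"
    by (rule Suc.IH[OF jp Suc.prems(2)]) (use e[OF Suc.prems(2)] j(2) in simp)
  have "?ker p \<subset> ?ker (j * p)"
  proof
    show "?ker p \<subseteq> ?ker (j * p)" using e mult_zero_vec[OF jC] by auto
    have "p *\<^sub>v v \<noteq> 0\<^sub>v n" using Suc.prems(3) zero_in_ker_flag by metis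
    then have "(\<lambda>v. p *\<^sub>v v) ` carrier_vec n \<noteq> {0\<^sub>v n}" using Suc.prems(2) by blast
    from N_sub_meets_V[OF image_N_sub[OF Suc.prems(1)] this]
    obtain w where w: "w \<in> carrier_vec n" "p *\<^sub>v w \<in> V" "p *\<^sub>v w \<noteq> 0\<^sub>v n" by blast
    then have "w \<in> ?ker (j * p)" using e[OF w(1)] j(1) J_iff by simp
    then show "?ker p \<noteq> ?ker (j * p)" using w by blast
  qed
  from pivots_strict[OF kersub[OF pC] kersub[OF End_C[OF jp]] this] show ?case using IH by simp
qed

lemma nil_algebra_J: "nil_algebra n J"
proof
  show "mat_subspace n J" by (rule J_sub)
  show "i * j \<in> J" if "i \<in> J" "j \<in> J" for i j using J_End_mult that J_iff by blast
  have "v \<in> ker_flag n J (Suc n)" if v: "v \<in> carrier_vec n" for v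
  proof (rule ccontr)
    assume "v \<notin> ker_flag n J (Suc n)"
    then have "1\<^sub>m n *\<^sub>v v \<notin> ker_flag n J (Suc n)" using v by simp
    from kernel_growth[OF End_one v this] show False by simp
  qed
  then show "\<exists>m. carrier_vec n \<subseteq> ker_flag n J m" by blast
qed

sublocale dia: diamond n G Id \<rho> V
  using nil_algebra_J G by (simp add: diamond_def diamond_axioms_def)

end

context scheme_setting
begin

section \<open>Morphisms affording strong stability\<close>

text \<open>Conjugation by a point \<open>g\<close> of \<open>G\<close> with values in the base field, acting on the points of \<open>N\<close> over any algebra. These
  constant points suffice, since the elements of \<open>U\<close> that have to be produced are matrices over the base field.\<close>

definition cnj where
  "cnj S g y = kalg.constant_point S G g \<otimes>\<^bsub>points_group G S\<^esub> y \<otimes>\<^bsub>points_group G S\<^esub> inv\<^bsub>points_group G S\<^esub> (kalg.constant_point S G g)"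

lemma groupG: "group G" by (rule affine_alg_groupD(1)[OF G])

lemma points_normal:
  fixes S :: "('a, 'k) test_alg"
  assumes "kalg S"
  shows "\<N> S \<lhd> points_group G S" "group (points_group G S)"
proof -
  show n: "\<N> S \<lhd> points_group G S" using N kalg.alg[OF assms] by (simp add: normal_subgroup_scheme_def)
  then show "group (points_group G S)" by (simp add: normal_def)
qed

lemma constant_point_carrier:
  fixes S :: "('a, 'k) test_alg"
  assumes "kalg S" "g \<in> carrier G"
  shows "kalg.constant_point S G g \<in> carrier (points_group G S)"
  using kalg.constant_point_mem[OF assms(1) G assms(2)] kalg.points_carrier[OF assms(1)] by blast

lemma cnj_mem:
  fixes S :: "('a, 'k) test_alg"
  assumes "kalg S" "g \<in> carrier G" "y \<in> \<N> S"
  shows "cnj S g y \<in> \<N> S"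
  unfolding cnj_def by (rule normal.inv_op_closed2[OF points_normal(1)[OF assms(1)] constant_point_carrier[OF assms(1,2)] assms(3)])

lemma cnj_mult:
  fixes S :: "('a, 'k) test_alg"
  assumes S: "kalg S" and g: "g \<in> carrier G" "h \<in> carrier G" and y: "y \<in> \<N> S"
  shows "cnj S g (cnj S h y) = cnj S (g \<otimes>\<^bsub>G\<^esub> h) y"
proof -
  let ?P = "points_group G S"
  interpret P: group ?P by (rule points_normal(2)[OF S])
  note c = constant_point_carrier[OF S g(1)] constant_point_carrier[OF S g(2)]
  have yP: "y \<in> carrier ?P" using y points_normal(1)[OF S] by (meson normal_imp_subgroup subgroup.mem_carrier)
  show ?thesis
    unfolding cnj_def kalg.constant_point_mult[OF S G g, symmetric] using c yP by (simp add: P.m_assoc P.inv_mult_group)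
qed

lemma cnj_one:
  fixes S :: "('a, 'k) test_alg"
  assumes S: "kalg S" and y: "y \<in> \<N> S"
  shows "cnj S \<one>\<^bsub>G\<^esub> y = y"
proof -
  let ?P = "points_group G S"
  interpret P: group ?P by (rule points_normal(2)[OF S])
  have yP: "y \<in> carrier ?P" using y points_normal(1)[OF S] by (meson normal_imp_subgroup subgroup.mem_carrier)
  show ?thesis unfolding cnj_def kalg.constant_point_one[OF S, symmetric] using yP by simp
qed

lemma cnj_cancel:
  fixes S :: "('a, 'k) test_alg"
  assumes S: "kalg S" and g: "g \<in> carrier G" and y: "y \<in> \<N> S"
  shows "cnj S g (cnj S (inv\<^bsub>G\<^esub> g) y) = y" "cnj S (inv\<^bsub>G\<^esub> g) (cnj S g y) = y"
proof -
  have ig: "inv\<^bsub>G\<^esub> g \<in> carrier G" by (rule group.inv_closed[OF groupG g])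
  show "cnj S g (cnj S (inv\<^bsub>G\<^esub> g) y) = y"
    unfolding cnj_mult[OF S g ig y] group.r_inv[OF groupG g] by (rule cnj_one[OF S y])
  show "cnj S (inv\<^bsub>G\<^esub> g) (cnj S g y) = y"
    unfolding cnj_mult[OF S ig g y] group.l_inv[OF groupG g] by (rule cnj_one[OF S y])
qed

lemma act_facts:
  "g \<in> carrier G \<Longrightarrow> v \<in> V \<Longrightarrow> act g v \<in> V" "v \<in> V \<Longrightarrow> act \<one>\<^bsub>G\<^esub> v = v"
  "g \<in> carrier G \<Longrightarrow> h \<in> carrier G \<Longrightarrow> v \<in> V \<Longrightarrow> act (g \<otimes>\<^bsub>G\<^esub> h) v = act g (act h v)"
  "v \<in> V \<Longrightarrow> i < n \<Longrightarrow> (\<lambda>g\<in>carrier G. act g v $ i) \<in> regular G"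
  using V by (auto simp: G_submodule_def simp del: restrict_apply)

context
  fixes \<alpha> assumes ss: "strongly_stable G Id n \<rho> V act \<alpha>"
begin

lemma alpha_GL: "g \<in> carrier G \<Longrightarrow> \<alpha> g \<in> carrier (GL n)" "g \<in> carrier G \<Longrightarrow> \<alpha> g \<in> C"
  using ss GL_memD by (auto simp: strongly_stable_def variety_morphism_def)

lemma alpha_regular: "gl_regular (carrier G) (regular G) n \<alpha>"
  using ss by (auto simp: strongly_stable_def variety_morphism_def gl_regular_def simp del: restrict_apply)

lemma alpha_entry: "i < n \<Longrightarrow> j < n \<Longrightarrow> (\<lambda>g\<in>carrier G. \<alpha> g $$ (i, j)) \<in> regular G"
  by (rule mat_regularD(2)[OF gl_regular_mat(1)[OF alpha_regular]])

lemma alpha_constant_point: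
  assumes "kalg S" "g \<in> carrier G"
  shows "mat_at G n \<alpha> (kalg.constant_point S G g) = base_change_mat S (\<alpha> g)"
  by (rule kalg.mat_at_constant_point[OF assms(1) alpha_entry assms(2) alpha_GL(2)[OF assms(2)]])

lemma alpha_tw:
  fixes S :: "('a, 'k) test_alg"
  assumes S: "kalg S" and g: "g \<in> carrier G" and y: "y \<in> \<N> S"
  shows "kalg.intertwines S n (\<alpha> g) (R y) (R (cnj S g y))"
proof -
  have "\<forall>x\<in>points G S. \<forall>y\<in>\<N> S. mult_mat_alg S n (mat_at G n \<alpha> x) (R y) = mult_mat_alg S n
      (R (x \<otimes>\<^bsub>points_group G S\<^esub> y \<otimes>\<^bsub>points_group G S\<^esub> inv\<^bsub>points_group G S\<^esub> x)) (mat_at G n \<alpha> x)"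
    using ss kalg.alg[OF S] unfolding strongly_stable_def by blast
  from this[rule_format, OF kalg.constant_point_mem[OF S G g] y]
  show ?thesis unfolding kalg.intertwines_def[OF S] alpha_constant_point[OF S g] cnj_def .
qed

lemma alpha_tw_inv:
  fixes S :: "('a, 'k) test_alg"
  assumes S: "kalg S" and g: "g \<in> carrier G" and y: "y \<in> \<N> S"
  shows "kalg.intertwines S n (inv\<^bsub>GL n\<^esub> (\<alpha> g)) (R (cnj S g y)) (R y)"
  by (rule kalg.intertwines_inv[OF S alpha_GL(1)[OF g] rho_smat[OF S y] rho_smat[OF S cnj_mem[OF S g y]] alpha_tw[OF S g y]])

lemma alpha_one: "\<alpha> \<one>\<^bsub>G\<^esub> = 1\<^sub>m n"
proof -
  let ?S = "field_alg :: ('a, 'k) test_alg"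
  have S: "kalg ?S" by (rule kalgI[OF field_alg])
  have oneG: "\<one>\<^bsub>G\<^esub> \<in> carrier G" using monoid.one_closed[OF group.is_monoid[OF groupG]] .
  have "mat_at G n \<alpha> \<one>\<^bsub>points_group G ?S\<^esub> = one_mat_alg ?S n"
    using ss field_alg unfolding strongly_stable_def by blast
  then have e: "base_change_mat ?S (\<alpha> \<one>\<^bsub>G\<^esub>) = one_mat_alg ?S n"
    unfolding kalg.constant_point_one[OF S] alpha_constant_point[OF S oneG] .
  show ?thesis
  proof (rule eq_matI)
    note aC = alpha_GL(2)[OF oneG]
    show "dim_row (\<alpha> \<one>\<^bsub>G\<^esub>) = dim_row (1\<^sub>m n)" "dim_col (\<alpha> \<one>\<^bsub>G\<^esub>) = dim_col (1\<^sub>m n)" using aC by auto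
    fix i j assume ij: "i < dim_row (1\<^sub>m n)" "j < dim_col (1\<^sub>m n)"
    have "base_change_mat ?S (\<alpha> \<one>\<^bsub>G\<^esub>) $$ (i, j) = {\<lambda>_. \<alpha> \<one>\<^bsub>G\<^esub> $$ (i, j)}"
      using aC ij by (simp add: base_change_mat_def field_alg_def)
    moreover have "one_mat_alg ?S n $$ (i, j) = {\<lambda>_. 1\<^sub>m n $$ (i, j)}" using ij by (simp add: one_mat_alg_def field_alg_def)
    ultimately show "\<alpha> \<one>\<^bsub>G\<^esub> $$ (i, j) = 1\<^sub>m n $$ (i, j)" unfolding e by (auto simp: fun_eq_iff)
  qed
qed

text \<open>The copy of the base field as test algebra, and the constant point \<open>g\<close>, turn the condition over all algebras into one over
  the field.\<close>

lemma alpha_act: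
  assumes g: "g \<in> carrier G" and v: "v \<in> V"
  shows "\<alpha> g *\<^sub>v v = act g v"
proof -
  let ?S = "field_alg :: ('a, 'k) test_alg"
  have S: "kalg ?S" by (rule kalgI[OF field_alg])
  interpret kalg ?S by (rule S)
  let ?c = "[(\<one>\<^bsub>?S\<^esub>, v)]"
  have vC: "v \<in> carrier_vec n" by (rule VD(1)[OF v])
  note aC = alpha_GL(2)[OF g]
  have "set ?c \<subseteq> carrier ?S \<times> V" using v by simp
  then have "mult_vec_alg ?S n (mat_at G n \<alpha> (constant_point G g)) (tensor_vec ?S n ?c) = act_at G n act ?S (constant_point G g) ?c"
    using ss field_alg constant_point_mem[OF G g] unfolding strongly_stable_def by blast
  moreover have "mult_vec_alg ?S n (mat_at G n \<alpha> (constant_point G g)) (tensor_vec ?S n ?c) = tensor_vec ?S n [(\<one>\<^bsub>?S\<^esub>, \<alpha> g *\<^sub>v v)]"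
    unfolding alpha_constant_point[OF S g] using tensor_vec_map[OF _ aC, of ?c] vC by simp
  ultimately have e: "tensor_vec ?S n [(\<one>\<^bsub>?S\<^esub>, \<alpha> g *\<^sub>v v)] = act_at G n act ?S (constant_point G g) ?c" by simp
  show ?thesis
  proof (rule eq_vecI)
    have aV: "act g v \<in> carrier_vec n" using VD(1)[OF act_facts(1)[OF g v]] .
    show "dim_vec (\<alpha> g *\<^sub>v v) = dim_vec (act g v)" using aC aV by simp
    fix i assume "i < dim_vec (act g v)"
    then have i: "i < n" using aV by simp
    have s: "(\<Oplus>\<^bsub>?S\<^esub>j\<in>{..<1::nat}. f j) = f 0" if "f 0 \<in> carrier ?S" for f
      using finsum_delta[of 0 1 f] that by simp
    have "tensor_vec ?S n [(\<one>\<^bsub>?S\<^esub>, \<alpha> g *\<^sub>v v)] $ i = ((\<alpha> g *\<^sub>v v) $ i) \<odot>\<^bsub>?S\<^esub> \<one>\<^bsub>?S\<^esub>"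
      using i s[of "\<lambda>j. (snd ([(\<one>\<^bsub>?S\<^esub>, \<alpha> g *\<^sub>v v)] ! j) $ i) \<odot>\<^bsub>?S\<^esub> fst ([(\<one>\<^bsub>?S\<^esub>, \<alpha> g *\<^sub>v v)] ! j)"] iota(1)
      unfolding tensor_vec_def by simp
    moreover have "act_at G n act ?S (constant_point G g) ?c $ i = (act g v $ i) \<odot>\<^bsub>?S\<^esub> \<one>\<^bsub>?S\<^esub>"
    proof -
      have c: "constant_point G g (\<lambda>g\<in>carrier G. act g v $ i) = (act g v $ i) \<odot>\<^bsub>?S\<^esub> \<one>\<^bsub>?S\<^esub>"
        using act_facts(4)[OF v i] g by (simp add: constant_point_def)
      have "act_at G n act ?S (constant_point G g) ?c $ i = constant_point G g (\<lambda>g\<in>carrier G. act g v $ i) \<otimes>\<^bsub>?S\<^esub> \<one>\<^bsub>?S\<^esub>"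
        using i s[of "\<lambda>j. constant_point G g (\<lambda>g\<in>carrier G. act g (snd (?c ! j)) $ i) \<otimes>\<^bsub>?S\<^esub> fst (?c ! j)"] c iota(1)
        unfolding act_at_def by (simp del: restrict_apply)
      then show ?thesis unfolding c using iota(1) by simp
    qed
    ultimately have "((\<alpha> g *\<^sub>v v) $ i) \<odot>\<^bsub>?S\<^esub> \<one>\<^bsub>?S\<^esub> = (act g v $ i) \<odot>\<^bsub>?S\<^esub> \<one>\<^bsub>?S\<^esub>" using e by simp
    then show "(\<alpha> g *\<^sub>v v) $ i = act g v $ i" by (simp add: field_alg_def fun_eq_iff)
  qed
qed

lemma alpha_inv_act:
  assumes g: "g \<in> carrier G" and v: "v \<in> V"
  shows "inv\<^bsub>GL n\<^esub> (\<alpha> g) *\<^sub>v v = act (inv\<^bsub>G\<^esub> g) v"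
proof -
  note i = GL_inv[OF alpha_GL(1)[OF g]] and aC = alpha_GL(2)[OF g]
  have ig: "inv\<^bsub>G\<^esub> g \<in> carrier G" by (rule group.inv_closed[OF groupG g])
  have w: "act (inv\<^bsub>G\<^esub> g) v \<in> V" by (rule act_facts(1)[OF ig v])
  have "\<alpha> g *\<^sub>v act (inv\<^bsub>G\<^esub> g) v = v"
    using act_facts(3)[OF g ig v] act_facts(2)[OF v] group.r_inv[OF groupG g] by (simp add: alpha_act[OF g w])
  then have "inv\<^bsub>GL n\<^esub> (\<alpha> g) *\<^sub>v v = inv\<^bsub>GL n\<^esub> (\<alpha> g) *\<^sub>v (\<alpha> g *\<^sub>v act (inv\<^bsub>G\<^esub> g) v)" by simp
  also have "\<dots> = (inv\<^bsub>GL n\<^esub> (\<alpha> g) * \<alpha> g) *\<^sub>v act (inv\<^bsub>G\<^esub> g) v"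
    by (rule assoc_mult_mat_vec[OF i(4) aC VD(1)[OF w], symmetric])
  finally show ?thesis unfolding i(3) using VD(1)[OF w] by simp
qed

end

lemma conj_J:
  assumes ss: "strongly_stable G Id n \<rho> V act \<alpha>" and g: "g \<in> carrier G" and j: "j \<in> J"
  shows "\<alpha> g * j * inv\<^bsub>GL n\<^esub> (\<alpha> g) \<in> J" "inv\<^bsub>GL n\<^esub> (\<alpha> g) * j * \<alpha> g \<in> J"
proof -
  let ?a = "\<alpha> g" and ?b = "inv\<^bsub>GL n\<^esub> (\<alpha> g)"
  note aC = alpha_GL(2)[OF ss g] and bC = GL_inv(4)[OF alpha_GL(1)[OF ss g]] and jC = J_C[OF j]
  have ig: "inv\<^bsub>G\<^esub> g \<in> carrier G" by (rule group.inv_closed[OF groupG g])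
  have jE: "kalg.intertwines S n j (R x) (R x)" if "kalg S" "x \<in> \<N> S" for S :: "('a, 'k) test_alg" and x
    using j that by (auto simp: J_iff End_iff)
  have "?a * j * ?b \<in> E"
    unfolding End_iff
  proof (intro conjI allI impI ballI)
    show "?a * j * ?b \<in> C" by (intro mult_carrier_mat[of _ n n] aC bC jC)
    fix S :: "('a, 'k) test_alg" and x assume S: "kalg S" and x: "x \<in> \<N> S"
    define y where "y = cnj S (inv\<^bsub>G\<^esub> g) x"
    have y: "y \<in> \<N> S" "cnj S g y = x" unfolding y_def by (rule cnj_mem[OF S ig x], rule cnj_cancel(1)[OF S g x])
    note Rx = rho_smat[OF S x] and Ry = rho_smat[OF S y(1)]
    note t1 = alpha_tw_inv[OF ss S g y(1), unfolded y(2)] and t2 = alpha_tw[OF ss S g y(1), unfolded y(2)]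
    show "kalg.intertwines S n (?a * j * ?b) (R x) (R x)"
      by (rule kalg.intertwines_mult[OF S mult_carrier_mat[OF aC jC] bC Rx Ry Rx t1
          kalg.intertwines_mult[OF S aC jC Ry Ry Rx jE[OF S y(1)] t2]])
  qed
  moreover have "(?a * j * ?b) *\<^sub>v v = 0\<^sub>v n" if v: "v \<in> V" for v
  proof -
    note w = act_facts(1)[OF ig v]
    have "(?a * j * ?b) *\<^sub>v v = ?a *\<^sub>v (j *\<^sub>v (?b *\<^sub>v v))"
      using aC bC jC VD(1)[OF v] by (simp add: assoc_mult_mat_vec[of _ n n _ n] mult_carrier_mat[of _ n n _ n])
    also have "j *\<^sub>v (?b *\<^sub>v v) = 0\<^sub>v n" unfolding alpha_inv_act[OF ss g v] using j w by (simp add: J_iff)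
    finally show ?thesis using mult_zero_vec[OF aC] by simp
  qed
  ultimately show "?a * j * ?b \<in> J" by (simp add: J_iff)
  have "?b * j * ?a \<in> E"
    unfolding End_iff
  proof (intro conjI allI impI ballI)
    show "?b * j * ?a \<in> C" by (intro mult_carrier_mat[of _ n n] aC bC jC)
    fix S :: "('a, 'k) test_alg" and x assume S: "kalg S" and x: "x \<in> \<N> S"
    note y = cnj_mem[OF S g x]
    note Rx = rho_smat[OF S x] and Ry = rho_smat[OF S y]
    show "kalg.intertwines S n (?b * j * ?a) (R x) (R x)"
      by (rule kalg.intertwines_mult[OF S mult_carrier_mat[OF bC jC] aC Rx Ry Rx alpha_tw[OF ss S g x]
          kalg.intertwines_mult[OF S bC jC Ry Ry Rx jE[OF S y] alpha_tw_inv[OF ss S g x]]])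
  qed
  moreover have "(?b * j * ?a) *\<^sub>v v = 0\<^sub>v n" if v: "v \<in> V" for v
  proof -
    note w = act_facts(1)[OF g v]
    have "(?b * j * ?a) *\<^sub>v v = ?b *\<^sub>v (j *\<^sub>v (?a *\<^sub>v v))"
      using aC bC jC VD(1)[OF v] by (simp add: assoc_mult_mat_vec[of _ n n _ n] mult_carrier_mat[of _ n n _ n])
    also have "j *\<^sub>v (?a *\<^sub>v v) = 0\<^sub>v n" unfolding alpha_act[OF ss g v] using j w by (simp add: J_iff)
    finally show ?thesis using mult_zero_vec[OF bC] by simp
  qed
  ultimately show "?b * j * ?a \<in> J" by (simp add: J_iff)
qed

text \<open>An \<open>N\<close>-endomorphism that is the identity on \<open>V\<close> differs from the identity by an element of \<open>J\<close>.\<close>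

lemma U_memI:
  assumes X: "X \<in> E" "\<And>v. v \<in> V \<Longrightarrow> X *\<^sub>v v = v"
  shows "X \<in> dia.U"
proof -
  note XC = End_C[OF X(1)]
  define j where "j = X + (- 1) \<cdot>\<^sub>m 1\<^sub>m n"
  have "j \<in> E" unfolding j_def by (intro End_add X(1) End_scalar)
  moreover have "j *\<^sub>v v = 0\<^sub>v n" if v: "v \<in> V" for v
  proof -
    note vC = VD(1)[OF v]
    have "j *\<^sub>v v = X *\<^sub>v v + ((- 1) \<cdot>\<^sub>m 1\<^sub>m n) *\<^sub>v v" unfolding j_def by (rule add_mult_distrib_mat_vec[OF XC _ vC]) simp
    also have "((- 1) \<cdot>\<^sub>m 1\<^sub>m n) *\<^sub>v v = (- 1) \<cdot>\<^sub>v v" using smult_mat_vec[OF one_carrier_mat vC, of "- 1"] vC by simp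
    also have "X *\<^sub>v v = v" by (rule X(2)[OF v])
    also have "v + (- 1) \<cdot>\<^sub>v v = 0\<^sub>v n" using vC by (intro eq_vecI) auto
    finally show ?thesis .
  qed
  ultimately have "j \<in> J" by (simp add: J_iff)
  moreover have "1\<^sub>m n + j = X" unfolding j_def using XC by (intro eq_matI) auto
  ultimately show ?thesis using dia.UI by metis
qed

text \<open>The product \<open>\<alpha> g \<alpha> h \<alpha>(gh)\<^sup>-\<^sup>1\<close> is an \<open>N\<close>-endomorphism because the three twists by conjugation cancel, and it is the
  identity on \<open>V\<close> because \<open>V\<close> is a \<open>G\<close>-module.\<close>

lemma affording_hom_mod_U:
  assumes ss: "strongly_stable G Id n \<rho> V act \<alpha>"
  shows "dia.hom_mod_U \<alpha>"
  unfolding dia.hom_mod_U_def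
proof (intro conjI ballI)
  show "variety_morphism G (GL n) \<alpha>" using ss by (simp add: strongly_stable_def)
  show "\<alpha> \<one>\<^bsub>G\<^esub> = 1\<^sub>m n" by (rule alpha_one[OF ss])
  show "dia.stab (\<alpha> g)" if g: "g \<in> carrier G" for g
    unfolding dia.stab_def using alpha_GL(1)[OF ss g] conj_J[OF ss g] by blast
  fix g h assume g: "g \<in> carrier G" and h: "h \<in> carrier G"
  have gh: "g \<otimes>\<^bsub>G\<^esub> h \<in> carrier G" using monoid.m_closed[OF group.is_monoid[OF groupG] g h] .
  have igh: "inv\<^bsub>G\<^esub> (g \<otimes>\<^bsub>G\<^esub> h) \<in> carrier G" by (rule group.inv_closed[OF groupG gh])
  let ?c = "inv\<^bsub>GL n\<^esub> (\<alpha> (g \<otimes>\<^bsub>G\<^esub> h))"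
  note aC = alpha_GL(2)[OF ss g] and bC = alpha_GL(2)[OF ss h] and cC = GL_inv(4)[OF alpha_GL(1)[OF ss gh]]
  show "\<alpha> g * \<alpha> h * ?c \<in> dia.U"
  proof (rule U_memI)
    show "\<alpha> g * \<alpha> h * ?c \<in> E"
      unfolding End_iff
    proof (intro conjI allI impI ballI)
      show "\<alpha> g * \<alpha> h * ?c \<in> C" by (intro mult_carrier_mat[of _ n n] aC bC cC)
      fix S :: "('a, 'k) test_alg" and x assume S: "kalg S" and x: "x \<in> \<N> S"
      define y where "y = cnj S (inv\<^bsub>G\<^esub> (g \<otimes>\<^bsub>G\<^esub> h)) x"
      have y: "y \<in> \<N> S" "cnj S (g \<otimes>\<^bsub>G\<^esub> h) y = x" unfolding y_def
        by (rule cnj_mem[OF S igh x], rule cnj_cancel(1)[OF S gh x])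
      have z: "cnj S h y \<in> \<N> S" "cnj S g (cnj S h y) = x"
        using cnj_mem[OF S h y(1)] cnj_mult[OF S g h y(1)] y(2) by simp_all
      note Rx = rho_smat[OF S x] and Ry = rho_smat[OF S y(1)] and Rz = rho_smat[OF S z(1)]
      show "kalg.intertwines S n (\<alpha> g * \<alpha> h * ?c) (R x) (R x)"
        by (rule kalg.intertwines_mult[OF S mult_carrier_mat[OF aC bC] cC Rx Ry Rx alpha_tw_inv[OF ss S gh y(1), unfolded y(2)]
            kalg.intertwines_mult[OF S aC bC Ry Rz Rx alpha_tw[OF ss S h y(1)] alpha_tw[OF ss S g z(1), unfolded z(2)]]])
    qed
    fix v assume v: "v \<in> V"
    define w where "w = act (inv\<^bsub>G\<^esub> (g \<otimes>\<^bsub>G\<^esub> h)) v"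
    have w: "w \<in> V" unfolding w_def by (rule act_facts(1)[OF igh v])
    have "(\<alpha> g * \<alpha> h * ?c) *\<^sub>v v = \<alpha> g *\<^sub>v (\<alpha> h *\<^sub>v (?c *\<^sub>v v))"
      using aC bC cC VD(1)[OF v] by (simp add: assoc_mult_mat_vec[of _ n n _ n] mult_carrier_mat[of _ n n _ n])
    also have "?c *\<^sub>v v = w" unfolding w_def by (rule alpha_inv_act[OF ss gh v])
    also have "\<alpha> g *\<^sub>v (\<alpha> h *\<^sub>v w) = act (g \<otimes>\<^bsub>G\<^esub> h) w"
      using alpha_act[OF ss h w] alpha_act[OF ss g act_facts(1)[OF h w]] act_facts(3)[OF g h w] by simp
    also have "\<dots> = v"
      unfolding w_def using act_facts(3)[OF gh igh v] act_facts(2)[OF v] group.r_inv[OF groupG gh] by simp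
    finally show "(\<alpha> g * \<alpha> h * ?c) *\<^sub>v v = v" .
  qed
qed

text \<open>Both morphisms intertwine the action of \<open>N\<close> with the same conjugate of it, and both restrict to the action of \<open>G\<close> on \<open>V\<close>.\<close>

lemma affording_differ_by_U:
  assumes ss: "strongly_stable G Id n \<rho> V act \<alpha>" "strongly_stable G Id n \<rho> V act \<beta>" and g: "g \<in> carrier G"
  shows "\<beta> g * inv\<^bsub>GL n\<^esub> (\<alpha> g) \<in> dia.U"
proof (rule U_memI)
  let ?c = "inv\<^bsub>GL n\<^esub> (\<alpha> g)"
  have ig: "inv\<^bsub>G\<^esub> g \<in> carrier G" by (rule group.inv_closed[OF groupG g])
  note bC = alpha_GL(2)[OF ss(2) g] and cC = GL_inv(4)[OF alpha_GL(1)[OF ss(1) g]]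
  show "\<beta> g * ?c \<in> E"
    unfolding End_iff
  proof (intro conjI allI impI ballI)
    show "\<beta> g * ?c \<in> C" by (intro mult_carrier_mat[of _ n n] bC cC)
    fix S :: "('a, 'k) test_alg" and x assume S: "kalg S" and x: "x \<in> \<N> S"
    define y where "y = cnj S (inv\<^bsub>G\<^esub> g) x"
    have y: "y \<in> \<N> S" "cnj S g y = x" unfolding y_def by (rule cnj_mem[OF S ig x], rule cnj_cancel(1)[OF S g x])
    note Rx = rho_smat[OF S x] and Ry = rho_smat[OF S y(1)]
    show "kalg.intertwines S n (\<beta> g * ?c) (R x) (R x)"
      by (rule kalg.intertwines_mult[OF S bC cC Rx Ry Rx alpha_tw_inv[OF ss(1) S g y(1), unfolded y(2)]
          alpha_tw[OF ss(2) S g y(1), unfolded y(2)]])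
  qed
  fix v assume v: "v \<in> V"
  note w = act_facts(1)[OF ig v]
  have "(\<beta> g * ?c) *\<^sub>v v = \<beta> g *\<^sub>v (?c *\<^sub>v v)" by (rule assoc_mult_mat_vec[OF bC cC VD(1)[OF v]])
  also have "\<dots> = act g (act (inv\<^bsub>G\<^esub> g) v)" unfolding alpha_inv_act[OF ss(1) g v] by (rule alpha_act[OF ss(2) g w])
  also have "\<dots> = v" using act_facts(3)[OF g ig v] act_facts(2)[OF v] group.r_inv[OF groupG g] by simp
  finally show "(\<beta> g * ?c) *\<^sub>v v = v" .
qed

end

theorem theorem3p6:
  fixes G :: "('a, 'k::alg_closed_field) alg_group"
    and I :: "('a \<Rightarrow> 'k) set"
    and n :: nat
    and \<rho> :: "'a \<Rightarrow> 'k mat"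
    and V :: "'k vec set"
    and act :: "'a \<Rightarrow> 'k vec \<Rightarrow> 'k vec"
    and \<alpha> :: "'a \<Rightarrow> 'k mat"
  assumes "affine_alg_group G"
    and "connected_space (zariski G)"
    and "normal_subgroup_scheme G I"
    and "rational_module G I n \<rho>"
    and "G_submodule G I n \<rho> V act"
    and "socle G I n \<rho> \<subseteq> V"
    and "strongly_stable G I n \<rho> V act \<alpha>"
  shows
    "(\<forall>\<beta>. strongly_stable G I n \<rho> V act \<beta> \<longrightarrow>
        G_star G I n \<rho> V \<beta> = G_star G I n \<rho> V \<alpha> \<and>
        (\<forall>g\<in>carrier G. induced_map G I n \<rho> V \<beta> g = induced_map G I n \<rho> V \<alpha> g) \<and>
        (\<exists>\<theta>. alg_group_iso (G_diamond G I n \<rho> V \<beta>) (G_diamond G I n \<rho> V \<alpha>) \<theta> \<and>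
           (\<forall>z\<in>carrier (G_diamond G I n \<rho> V \<beta>). \<forall>q\<in>carrier_vec n.
              rho_diamond \<alpha> (\<theta> z) *\<^sub>v q = rho_diamond \<beta> z *\<^sub>v q))) \<and>
     is_pullback TYPE('t)
       (G_diamond G I n \<rho> V \<alpha>) G (G_star G I n \<rho> V \<alpha>) (G_star_mod_U G I n \<rho> V \<alpha>)
       snd (rho_diamond \<alpha>) (induced_map G I n \<rho> V \<alpha>) (quot_map G I n \<rho> V \<alpha>)"
proof -
  interpret scheme_setting G I n \<rho> V act by (rule scheme_setting.intro[OF assms(1,3-6)])
  note good = affording_hom_mod_U[OF assms(7)]
  have "G_star G I n \<rho> V \<beta> = G_star G I n \<rho> V \<alpha> \<and>
      (\<forall>g\<in>carrier G. induced_map G I n \<rho> V \<beta> g = induced_map G I n \<rho> V \<alpha> g) \<and>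
      (\<exists>\<theta>. alg_group_iso (G_diamond G I n \<rho> V \<beta>) (G_diamond G I n \<rho> V \<alpha>) \<theta> \<and>
         (\<forall>z\<in>carrier (G_diamond G I n \<rho> V \<beta>). \<forall>q\<in>carrier_vec n.
            rho_diamond \<alpha> (\<theta> z) *\<^sub>v q = rho_diamond \<beta> z *\<^sub>v q))"
    if \<beta>: "strongly_stable G I n \<rho> V act \<beta>" for \<beta>
    using dia.comparison[OF good affording_hom_mod_U[OF \<beta>] affording_differ_by_U[OF assms(7) \<beta>]] by metis
  then show ?thesis using dia.pullback[OF good] by blast
qed

end
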